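(* Let $\mathcal I=(-1,1)$ and let $\mathcal B\subset L^2(\mathcal I,\mathbb R^{m+p})$ be a controllable linear differential behavior with McMillan degree $\mathfrak n(\mathcal B)$. Let $s\in\mathbb N\setminus\{0\}$, $k\in\mathbb N$ and $w\in\mathcal B\cap H^{\mathfrak n(\mathcal B)+s+k}(\mathcal I,\mathbb R^{m+p})$. Then for every $N\in\mathbb N$ with $N\ge \mathfrak n(\mathcal B)+s+1$ there is $w^N\in\mathcal B\cap\operatorname{im}P_N$ such that $\Lambda_s(w^N-w)(-1)=0$, and these $w^N$ satisfy $$\|w-w^N\|_{H^{s-1}}=\mathcal O(N^{-k})\qquad(N\to\infty).$$
   Context: $\mathbb N$ includes $0$; $\mathcal I=(-1,1)$, $q=m+p$. $H^k(\mathcal I,\mathbb R^d)$ is the Sobolev space of order $k$ based on $L^2$ ($H^0=L^2$). For $f\in H^{k-1}(\mathcal I,\mathbb R^d)$, $k\ge1$, $\Lambda_k(f)=\operatorname{col}(f,f^{(1)},\dots,f^{(k-1)})\in L^2(\mathcal I,\mathbb R^{kd})$ (vertical stacking), and $\|f\|_{H^{k-1}}=\|\Lambda_k(f)\|_{L^2}$. $\operatorname{im}P_N$ is the space of $\mathbb R^{d}$-valued polynomial functions on $\mathcal I$ of degree at most $N-1$ ($P_N$ is the $L^2$-orthogonal projection onto it; here $d=q$). A linear differential behavior is a set $\mathcal B=\{w\in L^2(\mathcal I,\mathbb R^q)\mid R(\frac{d}{dt})w=0\}$ with $R(s)=R_0+\dots+R_rs^r\in\mathbb R^{g\times q}[s]$,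 where $R(\frac{d}{dt})w=0$ is meant weakly: $\sum_{i=0}^r(-1)^i\int_{\mathcal I}w^\top R_i^\top\phi^{(i)}\,dt=0$ for all $\phi\in C_c^\infty(\mathcal I,\mathbb R^g)$. Trajectories are partitioned as $w=\operatorname{col}(u,y)$ with input $u$ ($m$ components) and output $y$ ($p$ components) such that $\mathcal B$ admits an input-state-output representation: matrices $A\in\mathbb R^{n\times n}$, $B\in\mathbb R^{n\times m}$, $C\in\mathbb R^{p\times n}$, $D\in\mathbb R^{p\times m}$ such that $w=\operatorname{col}(u,y)\in C^\infty(\overline{\mathcal I},\mathbb R^q)$ belongs to $\mathcal B$ if and only if there is $x\in C^\infty(\overline{\mathcal I},\mathbb R^n)$ with $\frac{d}{dt}x=Ax+Bu$, $y=Cx+Du$. The McMillan degree $\mathfrak n(\mathcal B)$ is the minimal state dimension $n$ among all such representations. $\mathcal B$ is controllable if for all $w_0,w_1\in\mathcal B$ there are $t_1\in(0,1)$ and $w\in\mathcal B$ with $w(t)=w_0(t)$ for (a.e.) $t\in(-1,0]$ and $w(t)=w_1(t-t_1)$ for (a.e.) $t\in[t_1,1)$. *)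

theory Defs
  imports
    "HOL-Analysis.Analysis"
    "HOL-Library.Landau_Symbols"
    "Jordan_Normal_Form.Matrix"
begin

unbundle no vec_syntax and no inner_syntax

text \<open>
  Signals with values in R^d are functions into the vectors of dimension d of
  Jordan_Normal_Form; this allows dimensions that are variables, including 0.
  Elements of L2 are represented by functions, identified almost everywhere on the interval;
  values of a signal outside the interval are irrelevant.
\<close>

type_synonym signal = "real \<Rightarrow> real vec"

abbreviation \<I> :: "real set" where
  "\<I> \<equiv> {-1<..<1}"

definition smooth_on :: "real set \<Rightarrow> (real \<Rightarrow> real) \<Rightarrow> bool" where
  "smooth_on S f \<longleftrightarrow>
     (\<exists>g :: nat \<Rightarrow> real \<Rightarrow> real. g 0 = f \<and>
        (\<forall>j. \<forall>t\<in>S. (g j has_real_derivative g (Suc j) t) (at t within S)))"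

text \<open>On the closed interval derivatives at the end points are one-sided.\<close>

definition smooth_closed :: "nat \<Rightarrow> signal set" where
  "smooth_closed d =
     {f. (\<forall>t\<in>{-1..1}. f t \<in> carrier_vec d) \<and> (\<forall>i<d. smooth_on {-1..1} (\<lambda>t. f t $ i))}"

definition test_functions :: "nat \<Rightarrow> signal set" where
  "test_functions d =
     {\<phi>. (\<forall>t. \<phi> t \<in> carrier_vec d) \<and> (\<forall>i<d. smooth_on UNIV (\<lambda>t. \<phi> t $ i)) \<and>
         compact (closure {t. \<phi> t \<noteq> 0\<^sub>v d}) \<and> closure {t. \<phi> t \<noteq> 0\<^sub>v d} \<subseteq> \<I>}"

definition vderiv :: "nat \<Rightarrow> signal \<Rightarrow> real \<Rightarrow> real vec" where
  "vderiv j \<phi> t = vec (dim_vec (\<phi> t)) (\<lambda>i. (deriv ^^ j) (\<lambda>\<tau>. \<phi> \<tau> $ i) t)"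

definition L2 :: "nat \<Rightarrow> signal set" where
  "L2 d =
     {f. (\<forall>t\<in>\<I>. f t \<in> carrier_vec d) \<and>
         (\<forall>i<d. (\<lambda>t. f t $ i) \<in> borel_measurable (lebesgue_on \<I>) \<and>
                integrable (lebesgue_on \<I>) (\<lambda>t. (f t $ i)\<^sup>2))}"

definition L2_norm :: "signal \<Rightarrow> real" where
  "L2_norm f = sqrt (LINT t|lebesgue_on \<I>. f t \<bullet> f t)"

definition is_weak_deriv ::
    "nat \<Rightarrow> nat \<Rightarrow> signal \<Rightarrow> signal \<Rightarrow> bool" where
  "is_weak_deriv d j f g \<longleftrightarrow> g \<in> L2 d \<and>
     (\<forall>\<phi>\<in>test_functions d.
        (LINT t|lebesgue_on \<I>. f t \<bullet> vderiv j \<phi> t) =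
        (-1) ^ j * (LINT t|lebesgue_on \<I>. g t \<bullet> \<phi> t))"

definition Sobolev :: "nat \<Rightarrow> nat \<Rightarrow> signal set" where
  "Sobolev d k = {f \<in> L2 d. \<forall>j\<le>k. \<exists>g. is_weak_deriv d j f g}"

text \<open>The weak derivative is unique only almost everywhere; some representative is chosen.
  In particular \<open>weak_deriv d 0 f\<close> equals \<open>f\<close> almost everywhere on the interval.\<close>

definition weak_deriv :: "nat \<Rightarrow> nat \<Rightarrow> signal \<Rightarrow> real \<Rightarrow> real vec" where
  "weak_deriv d j f = (SOME g. is_weak_deriv d j f g)"

text \<open>\<open>Lam d k f = col (f, f', \<dots>, f\<^sup>(\<^sup>k\<^sup>-\<^sup>1\<^sup>))\<close>, of dimension \<open>k * d\<close>, for \<open>f\<close> with values in R^d.\<close>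

primrec Lam :: "nat \<Rightarrow> nat \<Rightarrow> signal \<Rightarrow> real \<Rightarrow> real vec" where
  "Lam d 0 f t = 0\<^sub>v 0"
| "Lam d (Suc k) f t = Lam d k f t @\<^sub>v weak_deriv d k f t"

definition Sobolev_norm :: "nat \<Rightarrow> nat \<Rightarrow> signal \<Rightarrow> real" where
  "Sobolev_norm d k f = L2_norm (Lam d (k + 1) f)"

text \<open>Point values on the closed interval are those of the continuous representative.\<close>

definition has_value_at :: "nat \<Rightarrow> signal \<Rightarrow> real \<Rightarrow> real vec \<Rightarrow> bool" where
  "has_value_at d f t\<^sub>0 v \<longleftrightarrow>
     (\<exists>g. (\<forall>t\<in>{-1..1}. g t \<in> carrier_vec d) \<and>
          (\<forall>i<d. continuous_on {-1..1} (\<lambda>t. g t $ i)) \<and>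
          (AE t in lebesgue_on \<I>. g t = f t) \<and> g t\<^sub>0 = v)"

text \<open>The range of the projection \<open>P\<^sub>N\<close>; for \<open>N = 0\<close> it is the zero space.\<close>

definition im_P :: "nat \<Rightarrow> nat \<Rightarrow> signal set" where
  "im_P d N =
     {f. \<exists>P :: nat \<Rightarrow> real poly. (\<forall>i<d. P i = 0 \<or> degree (P i) < N) \<and>
           (\<forall>t\<in>\<I>. f t = vec d (\<lambda>i. poly (P i) t))}"

text \<open>Weak solutions of \<open>R(d/dt) w = 0\<close> for \<open>R(s) = R\<^sub>0 + \<dots> + R\<^sub>r s\<^sup>r\<close> with \<open>g\<close> rows and \<open>q\<close> columns.\<close>

definition kernel_behavior ::
    "nat \<Rightarrow> nat \<Rightarrow> nat \<Rightarrow> (nat \<Rightarrow> real mat) \<Rightarrow> signal set" where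
  "kernel_behavior g q r R =
     {w \<in> L2 q. \<forall>\<phi>\<in>test_functions g.
        (\<Sum>i\<le>r. (-1) ^ i *
           (LINT t|lebesgue_on \<I>. w t \<bullet> (transpose_mat (R i) *\<^sub>v vderiv i \<phi> t))) = 0}"

definition is_iso_representation ::
    "nat \<Rightarrow> nat \<Rightarrow> signal set \<Rightarrow> nat \<Rightarrow>
     real mat \<Rightarrow> real mat \<Rightarrow> real mat \<Rightarrow> real mat \<Rightarrow> bool" where
  "is_iso_representation m p \<B> n A B C D \<longleftrightarrow>
     A \<in> carrier_mat n n \<and> B \<in> carrier_mat n m \<and>
     C \<in> carrier_mat p n \<and> D \<in> carrier_mat p m \<and>
     (\<forall>u\<in>smooth_closed m. \<forall>y\<in>smooth_closed p.
        (\<lambda>t. u t @\<^sub>v y t) \<in> \<B> \<longleftrightarrow>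
        (\<exists>x\<in>smooth_closed n. \<forall>t\<in>\<I>.
           (\<forall>i<n. ((\<lambda>\<tau>. x \<tau> $ i) has_real_derivative (A *\<^sub>v x t + B *\<^sub>v u t) $ i) (at t)) \<and>
           y t = C *\<^sub>v x t + D *\<^sub>v u t))"

definition linear_differential_behavior :: "nat \<Rightarrow> nat \<Rightarrow> signal set \<Rightarrow> bool" where
  "linear_differential_behavior m p \<B> \<longleftrightarrow>
     (\<exists>g r R. (\<forall>i\<le>r. R i \<in> carrier_mat g (m + p)) \<and> \<B> = kernel_behavior g (m + p) r R) \<and>
     (\<exists>n A B C D. is_iso_representation m p \<B> n A B C D)"

definition McMillan_degree :: "nat \<Rightarrow> nat \<Rightarrow> signal set \<Rightarrow> nat" where
  "McMillan_degree m p \<B> = (LEAST n. \<exists>A B C D. is_iso_representation m p \<B> n A B C D)"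

definition controllable :: "signal set \<Rightarrow> bool" where
  "controllable \<B> \<longleftrightarrow>
     (\<forall>w\<^sub>0\<in>\<B>. \<forall>w\<^sub>1\<in>\<B>. \<exists>t\<^sub>1\<in>{0<..<1}. \<exists>w\<in>\<B>.
        (AE t in lebesgue_on {-1<..0}. w t = w\<^sub>0 t) \<and>
        (AE t in lebesgue_on {t\<^sub>1..<1}. w t = w\<^sub>1 (t - t\<^sub>1)))"

end

theory Submission
  imports Defs "Jordan_Normal_Form.Determinant"
begin

text \<open>
  The trajectory \<open>w = col(u, y)\<close> has a state \<open>x\<close>, also for \<open>L\<^sup>2\<close> inputs: smooth approximation gives weak
  solutions with input \<open>u\<close>, and the difference to \<open>w\<close> is a zero-input solution, hence smooth because its
  components satisfy scalar equations obtained from the adjugate of the output symbol. The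
  derivatives of \<open>u\<close> and \<open>x\<close> are approximated simultaneously by polynomials matching the jet at \<open>-1\<close>; the
  rate comes from the Legendre equation. Such polynomials solve \<open>x' = Ax + Bu\<close> only up to a small
  residual \<open>h\<close>. In a minimal representation of a controllable behavior the pair \<open>(A, B)\<close> is
  controllable, since otherwise the state could be compressed to the reachable subspace, so
  \<open>[sI - A, -B]\<close> has a polynomial right inverse; applied to \<open>h\<close> it yields a polynomial
  correction, built from fewer than \<open>n\<close> derivatives of \<open>h\<close>, that makes the trajectory exact.
  Approximating \<open>n + s\<close> derivatives therefore leaves \<open>s\<close> of them under control.
\<close>

text \<open>The correction is not found by solving the state equation: variation of constants would
  produce exponentials. A differential operator applied to the polynomial residual gives polynomials
  of no larger degree and keeps the vanishing jet at \<open>-1\<close>. The price is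
  differentiation: forming the residual costs one derivative of the state, and the term with
  \<open>A^j B\<close>, \<open>j < n\<close>, costs \<open>j\<close> more, hence the
  \<open>n\<close> extra orders. The remaining \<open>k\<close> orders of smoothness are spent on
  the rate, and integrating back \<open>n + s\<close> times explains the threshold
  \<open>N > n + s\<close>. A second obstacle is that a representation speaks about smooth
  trajectories only, and that controllability is a property of the behavior, not of
  \<open>(A, B)\<close>. Patching trajectories produces non-smooth signals, so a state must first be
  attached to every square-integrable trajectory. Moreover patching sees states only up to
  unobservable ones: it shows that reachable and unobservable states together fill the state space.
  Removing the unobservable part of an initial state leaves the output unchanged, and this permits
  the compression.\<close>

hide_const (open) Module.smult

section \<open>Square-integrable functions\<close>

abbreviation MI :: "real measure" where "MI \<equiv> lebesgue_on \<I>"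
abbreviation LI :: "(real \<Rightarrow> real) \<Rightarrow> real" where "LI f \<equiv> integral\<^sup>L MI f"

definition sq_int :: "(real \<Rightarrow> real) \<Rightarrow> bool" where
  "sq_int f \<longleftrightarrow> f \<in> borel_measurable MI \<and> integrable MI (\<lambda>t. (f t)\<^sup>2)"

definition nL :: "(real \<Rightarrow> real) \<Rightarrow> real" where "nL f = sqrt (LI (\<lambda>t. (f t)\<^sup>2))"

text \<open>The base point \<open>-1\<close> is the point at which jets are matched, so primitives
  never disturb initial values. \<open>integral\<close> is the Henstock-Kurzweil integral,
  \<open>LI\<close> the Lebesgue integral; \<open>LI_eq_integral\<close> links them.\<close>

definition J :: "(real \<Rightarrow> real) \<Rightarrow> real \<Rightarrow> real" where "J f t = integral {-1..t} f"

interpretation MI: finite_measure MI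
  by (rule finite_measure_lebesgue_on) simp

lemma measure_MI [simp]: "Sigma_Algebra.measure MI \<I> = 2"
  by (simp add: measure_restrict_space)

lemma sq_int_measurable [measurable_dest]: "sq_int f \<Longrightarrow> f \<in> borel_measurable MI"
  by (simp add: sq_int_def)

lemma sq_int_sq: "sq_int f \<Longrightarrow> integrable MI (\<lambda>t. (f t)\<^sup>2)"
  by (simp add: sq_int_def)

lemma sq_int_mult: assumes "sq_int f" "sq_int g" shows "integrable MI (\<lambda>t. f t * g t)"
proof (rule Bochner_Integration.integrable_bound)
  show "integrable MI (\<lambda>t. (f t)\<^sup>2 + (g t)\<^sup>2)" using assms by (simp add: sq_int_def)
  have [measurable]: "f \<in> borel_measurable MI" "g \<in> borel_measurable MI" using assms by (simp_all add: sq_int_def)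
  show "(\<lambda>t. f t * g t) \<in> borel_measurable MI" by measurable
  have "\<bar>a * b\<bar> \<le> \<bar>a\<^sup>2 + b\<^sup>2\<bar>" for a b :: real
  proof -
    have "0 \<le> (\<bar>a\<bar> - \<bar>b\<bar>)\<^sup>2" by simp
    hence "2 * \<bar>a\<bar> * \<bar>b\<bar> \<le> a\<^sup>2 + b\<^sup>2" by (simp add: power2_eq_square algebra_simps)
    moreover have "0 \<le> \<bar>a\<bar> * \<bar>b\<bar>" by simp
    ultimately show ?thesis unfolding abs_mult by linarith
  qed
  thus "AE t in MI. norm (f t * g t) \<le> norm ((f t)\<^sup>2 + (g t)\<^sup>2)" by simp
qed

lemma sq_int_bounded:
  assumes "f \<in> borel_measurable MI" "\<And>t. t \<in> \<I> \<Longrightarrow> \<bar>f t\<bar> \<le> C"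
  shows "sq_int f"
  unfolding sq_int_def
proof
  show "integrable MI (\<lambda>t. (f t)\<^sup>2)"
  proof (rule MI.integrable_const_bound)
    show "AE t in MI. norm ((f t)\<^sup>2) \<le> C\<^sup>2"
      using power_mono[OF assms(2), of _ 2] by (auto simp: power2_abs)
  qed (use assms in measurable)
qed fact

lemma sq_int_cont: assumes "continuous_on {-1..1} f" shows "sq_int f"
proof -
  obtain C where "\<And>t. t \<in> {-1..1} \<Longrightarrow> \<bar>f t\<bar> \<le> C"
    using compact_imp_bounded[OF compact_continuous_image[OF assms compact_Icc]]
    unfolding bounded_iff by (metis image_eqI real_norm_def)
  moreover have "continuous_on \<I> f" by (rule continuous_on_subset[OF assms]) auto
  ultimately show ?thesis
    by (intro sq_int_bounded[of _ C] continuous_imp_measurable_on_sets_lebesgue) auto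
qed

lemma sq_int_const [simp]: "sq_int (\<lambda>t. c)" by (rule sq_int_cont) simp

lemma sq_int_poly [simp]: "sq_int (poly p)"
  by (rule sq_int_cont) (intro continuous_intros)

lemma sq_int_poly' [simp]: "sq_int (\<lambda>t. poly p t)"
  by (rule sq_int_cont) (intro continuous_intros)

lemma sq_int_integrable: "sq_int f \<Longrightarrow> integrable MI f"
  using sq_int_mult[of f "\<lambda>t. 1"] by simp

lemma sq_int_cmult [intro]: "sq_int f \<Longrightarrow> sq_int (\<lambda>t. c * f t)"
  unfolding sq_int_def power_mult_distrib by (intro conjI borel_measurable_times) auto

lemma sq_int_add [intro]: assumes "sq_int f" "sq_int g" shows "sq_int (\<lambda>t. f t + g t)"
proof -
  have "integrable MI (\<lambda>t. (f t)\<^sup>2 + (g t)\<^sup>2 + 2 * (f t * g t))"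
    using assms sq_int_mult[OF assms] by (simp add: sq_int_def)
  moreover have [measurable]: "f \<in> borel_measurable MI" "g \<in> borel_measurable MI" using assms by (simp_all add: sq_int_def)
  have "(\<lambda>t. f t + g t) \<in> borel_measurable MI" by measurable
  ultimately show ?thesis by (simp add: sq_int_def power2_sum algebra_simps)
qed

lemma sq_int_uminus [intro]: "sq_int f \<Longrightarrow> sq_int (\<lambda>t. - f t)"
  using sq_int_cmult[of f "-1"] by simp

lemma sq_int_diff [intro]: "sq_int f \<Longrightarrow> sq_int g \<Longrightarrow> sq_int (\<lambda>t. f t - g t)"
  using sq_int_add[of f "\<lambda>t. - g t"] by auto

lemma sq_int_sum [intro]: "(\<And>i. i \<in> A \<Longrightarrow> sq_int (f i)) \<Longrightarrow> sq_int (\<lambda>t. \<Sum>i\<in>A. f i t)"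
  by (induction A rule: infinite_finite_induct) auto

lemma sq_int_cong_AE: assumes "sq_int f" "AE t in MI. f t = g t" "g \<in> borel_measurable MI"
  shows "sq_int g"
  unfolding sq_int_def
proof
  show "integrable MI (\<lambda>t. (g t)\<^sup>2)"
    by (rule Bochner_Integration.integrable_cong_AE_imp[OF sq_int_sq[OF assms(1)]]) (use assms in auto)
qed fact

text \<open>The quadratic \<open>s \<mapsto> LI ((f - s g)^2)\<close> is nonnegative. Its value at
  the minimiser \<open>b / c\<close> is the inequality; if \<open>c = 0\<close> it is affine in
  \<open>s\<close>, which forces \<open>b = 0\<close>.\<close>

lemma Cauchy_Schwarz_LI: assumes f: "sq_int f" and g: "sq_int g"
  shows "\<bar>LI (\<lambda>t. f t * g t)\<bar> \<le> nL f * nL g"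
proof -
  let ?a = "LI (\<lambda>t. (f t)\<^sup>2)" and ?b = "LI (\<lambda>t. f t * g t)" and ?c = "LI (\<lambda>t. (g t)\<^sup>2)"
  have q: "0 \<le> ?a - 2 * s * ?b + s\<^sup>2 * ?c" for s
  proof -
    have "0 \<le> LI (\<lambda>t. (f t - s * g t)\<^sup>2)" by (rule integral_nonneg_AE) simp
    also have "(\<lambda>t. (f t - s * g t)\<^sup>2) = (\<lambda>t. (f t)\<^sup>2 - 2 * s * (f t * g t) + s\<^sup>2 * (g t)\<^sup>2)"
      by (auto simp: power2_eq_square algebra_simps)
    also have "LI \<dots> = ?a - 2 * s * ?b + s\<^sup>2 * ?c"
      using sq_int_sq[OF f] sq_int_sq[OF g] sq_int_mult[OF f g] by simp
    finally show ?thesis .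
  qed
  have c0: "0 \<le> ?c" "0 \<le> ?a" by (rule integral_nonneg_AE, simp)+
  have "?b\<^sup>2 \<le> ?a * ?c"
  proof (cases "?c = 0")
    case True
    have "?b = 0"
    proof (rule ccontr)
      assume "?b \<noteq> 0"
      \<comment> \<open>For this \<open>s\<close> and \<open>c = 0\<close> the quadratic takes the
        value \<open>-1\<close>.\<close>
      with q[of "(?a + 1) / (2 * ?b)"] True show False by simp
    qed
    thus ?thesis using True by simp
  next
    case False
    with c0 have c: "?c > 0" by linarith
    have "0 \<le> ?a - ?b\<^sup>2 / ?c" using q[of "?b / ?c"] c by (simp add: power2_eq_square field_simps)
    thus ?thesis using c by (simp add: field_simps)
  qed
  hence "sqrt (?b\<^sup>2) \<le> sqrt (?a * ?c)" by (rule real_sqrt_le_mono)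
  thus ?thesis unfolding real_sqrt_abs real_sqrt_mult nL_def .
qed

lemma nL_nonneg [simp]: "0 \<le> nL f" unfolding nL_def by (simp add: integral_nonneg_AE)

lemma nL_sq: "(nL f)\<^sup>2 = LI (\<lambda>t. (f t)\<^sup>2)" unfolding nL_def by (simp add: integral_nonneg_AE)

lemma LI_sq_nonneg [simp]: "0 \<le> LI (\<lambda>t. (f t)\<^sup>2)" by (simp add: integral_nonneg_AE)

lemma nL_triangle: assumes f: "sq_int f" and g: "sq_int g"
  shows "nL (\<lambda>t. f t + g t) \<le> nL f + nL g"
proof (rule power2_le_imp_le)
  have "(nL (\<lambda>t. f t + g t))\<^sup>2 = (nL f)\<^sup>2 + (nL g)\<^sup>2 + 2 * LI (\<lambda>t. f t * g t)"
    using sq_int_sq[OF f] sq_int_sq[OF g] sq_int_mult[OF f g]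
    by (simp add: nL_sq power2_sum mult.assoc)
  also have "\<dots> \<le> (nL f)\<^sup>2 + (nL g)\<^sup>2 + 2 * (nL f * nL g)"
    using Cauchy_Schwarz_LI[OF f g] by linarith
  finally show "(nL (\<lambda>t. f t + g t))\<^sup>2 \<le> (nL f + nL g)\<^sup>2" by (simp add: power2_sum)
qed simp

text \<open>The factor \<open>sqrt 2\<close>, here and in later estimates, is the square root of the
  length of the interval.\<close>

lemma nL_le_sup: assumes "\<And>t. t \<in> \<I> \<Longrightarrow> \<bar>f t\<bar> \<le> C" "sq_int f" shows "nL f \<le> sqrt 2 * \<bar>C\<bar>"
proof -
  have "LI (\<lambda>t. (f t)\<^sup>2) \<le> LI (\<lambda>t. C\<^sup>2)"
    using power_mono[OF assms(1), of _ 2] by (intro integral_mono) (use sq_int_sq[OF assms(2)] in auto)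
  hence "nL f \<le> sqrt (2 * C\<^sup>2)" unfolding nL_def by simp
  thus ?thesis by (simp add: real_sqrt_mult)
qed

lemma sq_int_abs: "sq_int f \<Longrightarrow> sq_int (\<lambda>t. \<bar>f t\<bar>)"
  using borel_measurable_abs[of f MI] by (simp add: sq_int_def)

lemma LI_abs_le: assumes "sq_int f" shows "LI (\<lambda>t. \<bar>f t\<bar>) \<le> sqrt 2 * nL f"
  using Cauchy_Schwarz_LI[OF sq_int_const[of 1] sq_int_abs[OF assms]] 
  by (simp add: nL_def)

lemma LI_cong_AE: assumes "sq_int f" "AE t in MI. f t = g t" "sq_int g" "sq_int h"
  shows "LI (\<lambda>t. f t * h t) = LI (\<lambda>t. g t * h t)"
  by (rule integral_cong_AE) (use assms in auto)

lemma AE_MI: "(AE t in MI. P t) \<longleftrightarrow> (AE t in lebesgue. t \<in> \<I> \<longrightarrow> P t)"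
  by (rule AE_restrict_space_iff) simp

text \<open>The two end points join the null set, so that facts holding almost everywhere on the
  open interval apply to integrals over \<open>{-1..1}\<close>.\<close>

lemma AE_MI_neg: assumes "AE t in MI. P t" obtains N where "negligible N" "\<And>t. t \<in> {-1..1} - N \<Longrightarrow> P t"
proof -
  from assms have "negligible {t. \<not> (t \<in> \<I> \<longrightarrow> P t)}" unfolding AE_MI
    using eventually_ae_filter_negligible by (metis (mono_tags, lifting) mem_Collect_eq negligible_subset subsetI)
  hence "negligible ({t. \<not> (t \<in> \<I> \<longrightarrow> P t)} \<union> {-1,1})" by auto
  thus ?thesis by (rule that) auto
qed

lemma AE_MI_I: "(\<And>t. t \<in> \<I> \<Longrightarrow> P t) \<Longrightarrow> AE t in MI. P t" by (auto intro: AE_I2)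

lemma sq_int_abs_integrable: assumes "sq_int f" shows "f absolutely_integrable_on {-1..1}"
proof -
  have "integrable MI f" using sq_int_integrable[OF assms] .
  hence "f absolutely_integrable_on \<I>" by (simp add: integrable_restrict_space set_integrable_def)
  thus ?thesis by (rule absolutely_integrable_spike_set)
     (rule negligible_subset[of "{-1,1}"], auto)+
qed

lemma LI_eq_integral: assumes "integrable MI f" shows "LI f = integral {-1..1} f"
  using lebesgue_integral_eq_integral[OF assms] by (simp add: integral_open_interval_real)

lemma sq_int_J_int: assumes "sq_int f" "-1 \<le> a" "b \<le> 1"
  shows "f integrable_on {a..b}" "f absolutely_integrable_on {a..b}"
proof -
  have "f absolutely_integrable_on {a..b}"
    by (rule absolutely_integrable_on_subinterval[OF sq_int_abs_integrable[OF assms(1)]]) (use assms in auto)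
  thus "f integrable_on {a..b}" "f absolutely_integrable_on {a..b}"
    by (auto simp: absolutely_integrable_on_def)
qed

section \<open>Primitives from the left end point\<close>

lemma J_left [simp]: "J f (-1) = 0" by (simp add: J_def)

lemma J_1: "sq_int f \<Longrightarrow> J f 1 = LI f"
  by (simp add: J_def LI_eq_integral sq_int_integrable)

lemma J_add: "sq_int f \<Longrightarrow> sq_int g \<Longrightarrow> t \<le> 1 \<Longrightarrow> J (\<lambda>t. f t + g t) t = J f t + J g t"
  unfolding J_def by (rule integral_add) (auto intro: sq_int_J_int)

lemma J_diff: "sq_int f \<Longrightarrow> sq_int g \<Longrightarrow> t \<le> 1 \<Longrightarrow> J (\<lambda>t. f t - g t) t = J f t - J g t"
  unfolding J_def by (rule integral_diff) (auto intro: sq_int_J_int)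

lemma J_cmult: "J (\<lambda>t. c * f t) t = c * J f t"
  unfolding J_def by simp

lemma J_zero [simp]: "J (\<lambda>t. 0) t = 0" by (simp add: J_def)

lemma J_sum: "(\<And>i. i \<in> A \<Longrightarrow> sq_int (f i)) \<Longrightarrow> t \<le> 1 \<Longrightarrow> J (\<lambda>t. \<Sum>i\<in>A. f i t) t = (\<Sum>i\<in>A. J (f i) t)"
proof (induction A rule: infinite_finite_induct)
  case (insert x F) thus ?case by (simp add: J_add sq_int_sum)
qed auto

lemma J_cong_AE: assumes "AE t in MI. f t = g t" "t \<le> 1" shows "J f t = J g t"
proof -
  obtain N where N: "negligible N" "\<And>t. t \<in> {-1..1} - N \<Longrightarrow> f t = g t"
    using AE_MI_neg[OF assms(1)] by auto
  show ?thesis unfolding J_def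
    by (rule integral_spike[OF N(1)]) (use N(2) assms(2) in auto)
qed

lemma J_cong: assumes "\<And>t. t \<in> {-1..1} \<Longrightarrow> f t = g t" "t \<le> 1" shows "J f t = J g t"
  unfolding J_def by (rule integral_cong) (use assms in auto)

lemma J_abs_le: assumes "sq_int f" "t \<in> {-1..1}" shows "\<bar>J f t\<bar> \<le> sqrt 2 * nL f"
proof -
  have "\<bar>J f t\<bar> \<le> integral {-1..t} (\<lambda>t. \<bar>f t\<bar>)"
    unfolding J_def using sq_int_J_int[of f "-1" t] assms absolutely_integrable_on_def[of "{-1..t}" f]
      integral_norm_bound_integral[of f "{-1..t}" "\<lambda>t. \<bar>f t\<bar>"] by auto
  also have "\<dots> \<le> integral {-1..1} (\<lambda>t. \<bar>f t\<bar>)"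
    by (rule integral_subset_le) (use assms sq_int_J_int[OF sq_int_abs] in auto)
  also have "\<dots> = LI (\<lambda>t. \<bar>f t\<bar>)" 
    using LI_eq_integral[OF sq_int_integrable[OF sq_int_abs[OF assms(1)]]] by simp
  also have "\<dots> \<le> sqrt 2 * nL f" by (rule LI_abs_le[OF assms(1)])
  finally show ?thesis .
qed

lemma J_abs_le_sup: assumes "sq_int f" "t \<in> {-1..1}" "\<And>s. s \<in> {-1..t} \<Longrightarrow> \<bar>f s\<bar> \<le> C" "0 \<le> C"
  shows "\<bar>J f t\<bar> \<le> C * (t + 1)"
  unfolding J_def using integral_norm_bound_integral[of f "{-1..t}" "\<lambda>_. C"] sq_int_J_int[of f "-1" t] assms
  by (auto simp: mult.commute)

lemma J_cont: assumes "sq_int f" shows "continuous_on {-1..1} (J f)"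
  using indefinite_integral_continuous_1[of f "-1" 1] sq_int_J_int[OF assms, of "-1" 1]
  by (simp add: J_def [abs_def])

lemma sq_int_J [intro]: "sq_int f \<Longrightarrow> sq_int (J f)" using J_cont sq_int_cont by blast

lemma J_deriv: assumes "continuous_on {-1..1} f" "t \<in> {-1..1}"
  shows "(J f has_real_derivative f t) (at t within {-1..1})"
  using integral_has_real_derivative[OF assms] by (simp add: J_def[abs_def])

lemma J_FTC: assumes "\<And>t. t \<in> {-1..1} \<Longrightarrow> (F has_real_derivative f t) (at t within {-1..1})" "t \<in> {-1..1}"
  shows "J f t = F t - F (-1)"
proof -
  have "(F has_real_derivative f s) (at s within {-1..t})" if "s \<in> {-1..t}" for s
    by (rule DERIV_subset[OF assms(1)]) (use that assms(2) in auto)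
  hence "(f has_integral F t - F (-1)) {-1..t}"
    using assms(2) by (intro fundamental_theorem_of_calculus)
      (auto simp: has_real_derivative_iff_has_vector_derivative[symmetric])
  thus ?thesis unfolding J_def by (rule integral_unique)
qed

section \<open>Density of polynomials among the square-integrable functions\<close>

lemma real_polynomial_function_poly:
  assumes "real_polynomial_function g" obtains p :: "real poly" where "g = poly p"
proof -
  from assms have "\<exists>p. g = poly p"
  proof (induction)
    case (linear f)
    then interpret bounded_linear f .
    have "f x = poly [:0, f 1:] x" for x using scaleR[of x 1] unfolding real_scaleR_def by (metis add_0 mult.right_neutral mult_zero_right add.right_neutral poly_0 poly_pCons)
    hence "f = poly [:0, f 1:]" by (rule ext)
    thus ?case by blast
  next
    case (const c) have "(\<lambda>x::real. c) = poly [:c:]" by (auto simp: fun_eq_iff) thus ?case by blast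
  next
    case (add f g) then obtain p q where "f = poly p" "g = poly q" by blast
    hence "(\<lambda>x. f x + g x) = poly (p + q)" by (auto simp: fun_eq_iff) thus ?case by blast
  next
    case (mult f g) then obtain p q where "f = poly p" "g = poly q" by blast
    hence "(\<lambda>x. f x * g x) = poly (p * q)" by (auto simp: fun_eq_iff) thus ?case by blast
  qed
  thus ?thesis using that by blast
qed

lemma Weierstrass_poly: assumes "continuous_on {-1..1} f" "0 < e"
  obtains p :: "real poly" where "\<And>x. x \<in> {-1..1} \<Longrightarrow> \<bar>f x - poly p x\<bar> < e"
proof -
  obtain g where g: "real_polynomial_function g" "\<And>x. x \<in> {-1..1} \<Longrightarrow> \<bar>f x - g x\<bar> < e"
    using Stone_Weierstrass_real_polynomial_function[OF _ assms(1)] assms(2) compact_Icc by metis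
  obtain p where "g = poly p" using real_polynomial_function_poly[OF g(1)] .
  with g that show ?thesis by blast
qed

text \<open>Reduces density to bounded functions: the squared truncation errors are dominated by
  \<open>f^2\<close> and vanish pointwise as soon as the level exceeds
  \<open>\<bar>f t\<bar>\<close>.\<close>

lemma trunc_dense: assumes f: "sq_int f" and e: "0 < e"
  obtains C where "0 < C" "nL (\<lambda>t. f t - max (-C) (min C (f t))) < e"
proof -
  let ?g = "\<lambda>k t. f t - max (- real k) (min (real k) (f t))"
  have m [measurable]: "f \<in> borel_measurable MI" using f by (rule sq_int_measurable)
  have "(\<lambda>k. LI (\<lambda>t. (?g k t)\<^sup>2)) \<longlonglongrightarrow> LI (\<lambda>t. 0)"
  proof (rule integral_dominated_convergence[where w = "\<lambda>t. (f t)\<^sup>2"])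
    show "AE t in MI. (\<lambda>k. (?g k t)\<^sup>2) \<longlonglongrightarrow> 0"
    proof (rule AE_I2)
      fix t
      have "eventually (\<lambda>k. (?g k t)\<^sup>2 = 0) sequentially"
        unfolding eventually_sequentially
      proof (intro exI allI impI)
        fix n assume "nat \<lceil>\<bar>f t\<bar>\<rceil> \<le> n"
        hence "\<bar>f t\<bar> \<le> real n" by linarith
        thus "(?g n t)\<^sup>2 = 0" by (auto simp: min_def max_def)
      qed
      thus "(\<lambda>k. (?g k t)\<^sup>2) \<longlonglongrightarrow> 0" by (rule tendsto_eventually)
    qed
    show "AE t in MI. norm ((?g k t)\<^sup>2) \<le> (f t)\<^sup>2" for k
    proof (rule AE_I2)
      fix t
      have "\<bar>?g k t\<bar> \<le> \<bar>f t\<bar>" by (auto simp: min_def max_def)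
      hence "\<bar>?g k t\<bar>\<^sup>2 \<le> \<bar>f t\<bar>\<^sup>2" by (rule power_mono) simp
      thus "norm ((?g k t)\<^sup>2) \<le> (f t)\<^sup>2" by simp
    qed
  qed (use sq_int_sq[OF f] in auto)
  hence "eventually (\<lambda>k. LI (\<lambda>t. (?g k t)\<^sup>2) < e\<^sup>2) sequentially"
    by (rule order_tendstoD) (use e in auto)
  then obtain k where "LI (\<lambda>t. (?g k t)\<^sup>2) < e\<^sup>2" "k > 0"
    unfolding eventually_sequentially by (metis gr0I le_refl less_Suc_eq_le nat_le_linear zero_less_Suc)
  thus ?thesis using that[of k] e real_sqrt_less_mono[of "LI (\<lambda>t. (?g k t)\<^sup>2)" "e\<^sup>2"] by (simp add: nL_def)
qed

text \<open>\<open>measurable_on\<close> supplies continuous functions converging off a null set.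
  Clipping them at the bound \<open>C\<close> of \<open>f\<close> does not spoil the limit and makes
  the constant \<open>(2 C)^2\<close> a dominating function.\<close>

lemma cont_dense_bounded: assumes f: "f \<in> borel_measurable MI" "\<And>t. \<bar>f t\<bar> \<le> C" and e: "0 < e"
  obtains g where "continuous_on UNIV g" "nL (\<lambda>t. f t - g t) < e"
proof -
  have C: "0 \<le> C" using f(2)[of 0] by linarith
  have "f measurable_on \<I>" using f(1) measurable_on_iff_borel_measurable[of \<I> f] by simp
  then obtain N g where N: "negligible N" and g: "\<And>n::nat. continuous_on UNIV (g n)"
    and lim: "\<And>x. x \<notin> N \<Longrightarrow> (\<lambda>n. g n x) \<longlonglongrightarrow> (if x \<in> \<I> then f x else 0)"
    unfolding measurable_on_def by blast
  let ?h = "\<lambda>n t. max (- C) (min C (g n t))"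
  have ch: "continuous_on UNIV (?h n)" for n by (intro continuous_intros g)
  have [measurable]: "?h n \<in> borel_measurable MI" for n
    by (rule continuous_imp_measurable_on_sets_lebesgue) (auto intro: continuous_on_subset[OF ch])
  note [measurable] = f(1)
  have "(\<lambda>k. LI (\<lambda>t. (f t - ?h k t)\<^sup>2)) \<longlonglongrightarrow> LI (\<lambda>t. 0)"
  proof (rule integral_dominated_convergence[where w = "\<lambda>t. (2 * C)\<^sup>2"])
    have "AE t in MI. t \<notin> N" unfolding AE_MI
      using N by (metis (mono_tags, lifting) AE_iff_null_sets eventually_mono negligible_iff_null_sets null_setsD2)
    thus "AE t in MI. (\<lambda>k. (f t - ?h k t)\<^sup>2) \<longlonglongrightarrow> 0"
    proof (rule AE_mp, intro AE_I2 impI)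
      fix t assume t: "t \<in> space MI" "t \<notin> N"
      have "(\<lambda>k. g k t) \<longlonglongrightarrow> f t" using lim[OF t(2)] t(1) by simp
      hence "(\<lambda>k. (f t - ?h k t)\<^sup>2) \<longlonglongrightarrow> (f t - max (-C) (min C (f t)))\<^sup>2" by (intro tendsto_intros)
      moreover have "max (-C) (min C (f t)) = f t" using f(2)[of t] by (auto simp: abs_le_iff)
      ultimately show "(\<lambda>k. (f t - ?h k t)\<^sup>2) \<longlonglongrightarrow> 0" by simp
    qed
    show "AE t in MI. norm ((f t - ?h k t)\<^sup>2) \<le> (2 * C)\<^sup>2" for k
    proof (rule AE_I2)
      fix t
      have "\<bar>f t - ?h k t\<bar> \<le> 2 * C" using f(2)[of t] C by (auto simp: min_def max_def abs_le_iff)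
      hence "\<bar>f t - ?h k t\<bar>\<^sup>2 \<le> (2 * C)\<^sup>2" by (rule power_mono) simp
      thus "norm ((f t - ?h k t)\<^sup>2) \<le> (2 * C)\<^sup>2" by simp
    qed
  qed auto
  hence "eventually (\<lambda>k. LI (\<lambda>t. (f t - ?h k t)\<^sup>2) < e\<^sup>2) sequentially"
    by (rule order_tendstoD) (use e in auto)
  then obtain k where "LI (\<lambda>t. (f t - ?h k t)\<^sup>2) < e\<^sup>2"
    unfolding eventually_sequentially by blast
  thus ?thesis using that[OF ch[of k]] e real_sqrt_less_mono[of "LI (\<lambda>t. (f t - ?h k t)\<^sup>2)" "e\<^sup>2"] by (simp add: nL_def)
qed

text \<open>Truncation, continuous approximation and Weierstrass, with errors \<open>e / 4\<close>,
  \<open>e / 4\<close> and \<open>e / 2\<close>. The uniform error \<open>e / 4\<close> of the last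
  one grows to \<open>e / 2\<close> because the passage to the L2 norm costs
  \<open>sqrt 2 \<le> 2\<close>.\<close>

lemma poly_dense: assumes f: "sq_int f" and e: "0 < e"
  obtains p :: "real poly" where "nL (\<lambda>t. f t - poly p t) < e"
proof -
  obtain C where C: "0 < C" "nL (\<lambda>t. f t - max (-C) (min C (f t))) < e / 4"
    using trunc_dense[OF f, of "e / 4"] e by auto
  let ?f = "\<lambda>t. max (-C) (min C (f t))"
  have m: "?f \<in> borel_measurable MI" using sq_int_measurable[OF f] by measurable
  have b: "\<bar>?f t\<bar> \<le> C" for t using C by (auto simp: min_def max_def)
  have sf: "sq_int ?f" by (rule sq_int_bounded[OF m]) (use b in auto)
  obtain g where g: "continuous_on UNIV g" "nL (\<lambda>t. ?f t - g t) < e / 4"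
    using cont_dense_bounded[OF m b, of "e / 4"] e by auto
  have cg: "continuous_on {-1..1} g" using g(1) by (rule continuous_on_subset) simp
  obtain p where p: "\<And>x. x \<in> {-1..1} \<Longrightarrow> \<bar>g x - poly p x\<bar> < e / 4"
    using Weierstrass_poly[OF cg, of "e / 4"] e by auto
  have sg: "sq_int g" by (rule sq_int_cont[OF cg])
  have "sqrt 2 \<le> 2" by (rule real_le_lsqrt) auto
  have "nL (\<lambda>t. g t - poly p t) \<le> sqrt 2 * \<bar>e / 4\<bar>"
    by (rule nL_le_sup) (use p sg in \<open>auto intro!: less_imp_le\<close>)
  also have "\<dots> \<le> 2 * (e / 4)" using \<open>sqrt 2 \<le> 2\<close> e by (intro mult_mono) auto
  finally have 3: "nL (\<lambda>t. g t - poly p t) \<le> e / 2" by simp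
  have "nL (\<lambda>t. (f t - ?f t) + ((?f t - g t) + (g t - poly p t))) \<le>
      nL (\<lambda>t. f t - ?f t) + nL (\<lambda>t. (?f t - g t) + (g t - poly p t))"
    by (rule nL_triangle) (use f sf sg in auto)
  also have "\<dots> \<le> nL (\<lambda>t. f t - ?f t) + (nL (\<lambda>t. ?f t - g t) + nL (\<lambda>t. g t - poly p t))"
    by (intro add_left_mono nL_triangle) (use f sf sg in auto)
  finally have "nL (\<lambda>t. f t - poly p t) < e" using 3 C(2) g(2) by simp
  thus ?thesis by (rule that)
qed

text \<open>Closes density arguments: both sides of an identity change by at most a multiple of
  \<open>e\<close> when a function is replaced by a polynomial at distance \<open>e\<close>.\<close>

lemma LI_tendsto_eqI:
  assumes "\<And>e. 0 < e \<Longrightarrow> \<bar>a - b\<bar> \<le> K * e" shows "a = (b::real)"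
proof (rule ccontr)
  assume "a \<noteq> b"
  hence "0 < \<bar>a - b\<bar> / (2 * (\<bar>K\<bar> + 1))" by simp
  from assms[OF this] have "\<bar>a - b\<bar> \<le> K * (\<bar>a - b\<bar> / (2 * (\<bar>K\<bar> + 1)))" .
  also have "\<dots> \<le> (\<bar>K\<bar> + 1) * (\<bar>a - b\<bar> / (2 * (\<bar>K\<bar> + 1)))" by (intro mult_right_mono) auto
  also have "\<dots> = \<bar>a - b\<bar> / 2" by (simp add: field_simps)
  finally show False using \<open>a \<noteq> b\<close> by simp
qed

text \<open>For polynomial \<open>f\<close> this is the fundamental theorem of calculus applied to a
  product. Every term depends continuously on \<open>f\<close> in L2, so the general case follows by
  density.\<close>

lemma int_by_parts:
  assumes f: "sq_int f" and d: "\<And>t. t \<in> {-1..1} \<Longrightarrow> (\<pi> has_real_derivative \<pi>' t) (at t within {-1..1})"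
    and c: "continuous_on {-1..1} \<pi>'"
  shows "LI (\<lambda>t. (c0 + J f t) * \<pi>' t) = (c0 + J f 1) * \<pi> 1 - c0 * \<pi> (-1) - LI (\<lambda>t. f t * \<pi> t)"
proof -
  have c\<pi>: "continuous_on {-1..1} \<pi>" using d by (metis DERIV_continuous_on)
  note sq = sq_int_cont[OF c] sq_int_cont[OF c\<pi>]
  \<comment> \<open>The summands bound the errors in the integral against \<open>\<pi>'\<close>, in
    the boundary term at 1 and in the integral against \<open>\<pi>\<close>, in this order.\<close>
  let ?K = "sqrt 2 * sqrt 2 * nL \<pi>' + sqrt 2 * \<bar>\<pi> 1\<bar> + nL \<pi>"
  show ?thesis
  proof (rule LI_tendsto_eqI[where K = "?K"])
    fix e :: real assume e: "0 < e"
    obtain p where p: "nL (\<lambda>t. f t - poly p t) < e" using poly_dense[OF f e] .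
    have cp: "continuous_on {-1..1} (poly p)" by (intro continuous_intros)
    let ?r = "\<lambda>t. f t - poly p t"
    have sr: "sq_int ?r" using f by auto
    have fr: "f = (\<lambda>t. ?r t + poly p t)" by simp
    have J: "J f t = J ?r t + J (poly p) t" if "t \<in> {-1..1}" for t
      using J_add[OF sr sq_int_poly[of p], of t] that by simp
    have P: "LI (\<lambda>t. (c0 + J (poly p) t) * \<pi>' t + poly p t * \<pi> t) = (c0 + J (poly p) 1) * \<pi> 1 - c0 * \<pi> (-1)"
    proof -
      have s: "sq_int (\<lambda>t. (c0 + J (poly p) t) * \<pi>' t + poly p t * \<pi> t)"
        by (intro sq_int_cont continuous_intros J_cont c c\<pi> sq_int_poly)
      have "LI (\<lambda>t. (c0 + J (poly p) t) * \<pi>' t + poly p t * \<pi> t) =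
         J (\<lambda>t. (c0 + J (poly p) t) * \<pi>' t + poly p t * \<pi> t) 1" using J_1[OF s] by simp
      also have "\<dots> = (c0 + J (poly p) 1) * \<pi> 1 - (c0 + J (poly p) (-1)) * \<pi> (-1)"
        by (rule J_FTC) (auto intro!: derivative_eq_intros J_deriv cp d)
      finally show ?thesis by simp
    qed
    have 1: "LI (\<lambda>t. (c0 + J f t) * \<pi>' t) = LI (\<lambda>t. (c0 + J (poly p) t) * \<pi>' t + J ?r t * \<pi>' t)"
      by (rule Bochner_Integration.integral_cong) (auto simp: J algebra_simps)
    have 2: "\<dots> = LI (\<lambda>t. (c0 + J (poly p) t) * \<pi>' t) + LI (\<lambda>t. J ?r t * \<pi>' t)"
      by (intro Bochner_Integration.integral_add sq_int_mult sq_int_add sq_int_J sr sq) auto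
    have 3: "LI (\<lambda>t. f t * \<pi> t) = LI (\<lambda>t. poly p t * \<pi> t) + LI (\<lambda>t. ?r t * \<pi> t)"
    proof -
      have "LI (\<lambda>t. f t * \<pi> t) = LI (\<lambda>t. poly p t * \<pi> t + ?r t * \<pi> t)" by (simp add: algebra_simps)
      thus ?thesis using sq_int_mult[OF sr sq(2)] sq_int_mult[OF sq_int_poly' sq(2), of p] by simp
    qed
    have 4: "LI (\<lambda>t. (c0 + J (poly p) t) * \<pi>' t + poly p t * \<pi> t) = LI (\<lambda>t. (c0 + J (poly p) t) * \<pi>' t) + LI (\<lambda>t. poly p t * \<pi> t)"
      by (intro Bochner_Integration.integral_add sq_int_mult sq_int_add sq_int_J sr sq) auto
    have a: "\<bar>LI (\<lambda>t. J ?r t * \<pi>' t)\<bar> \<le> sqrt 2 * sqrt 2 * nL \<pi>' * e"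
    proof -
      have "nL (J ?r) \<le> sqrt 2 * \<bar>sqrt 2 * nL ?r\<bar>"
        by (rule nL_le_sup) (use J_abs_le[OF sr] sr in auto)
      also have "\<dots> \<le> sqrt 2 * (sqrt 2 * e)" using p by simp
      finally have n: "nL (J ?r) \<le> sqrt 2 * (sqrt 2 * e)" .
      have "\<bar>LI (\<lambda>t. J ?r t * \<pi>' t)\<bar> \<le> nL (J ?r) * nL \<pi>'"
        by (rule Cauchy_Schwarz_LI) (use sr sq in auto)
      also have "\<dots> \<le> sqrt 2 * (sqrt 2 * e) * nL \<pi>'" using n by (rule mult_right_mono) simp
      finally show ?thesis by (simp add: ac_simps)
    qed
    have b: "\<bar>LI (\<lambda>t. ?r t * \<pi> t)\<bar> \<le> nL \<pi> * e"
    proof -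
      have "\<bar>LI (\<lambda>t. ?r t * \<pi> t)\<bar> \<le> nL ?r * nL \<pi>"
        by (rule Cauchy_Schwarz_LI) (use sr sq in auto)
      also have "\<dots> \<le> e * nL \<pi>" using p by (intro mult_right_mono) auto
      finally show ?thesis by (simp add: ac_simps)
    qed
    have c: "\<bar>J ?r 1 * \<pi> 1\<bar> \<le> sqrt 2 * \<bar>\<pi> 1\<bar> * e"
    proof -
      have "\<bar>J ?r 1\<bar> \<le> sqrt 2 * e" using J_abs_le[OF sr, of 1] p
        by (meson atLeastAtMost_iff less_imp_le mult_left_mono neg_le_iff_le one_le_numeral order_refl order_trans real_sqrt_ge_0_iff zero_le_numeral zero_le_one neg_le_0_iff_le)
      hence "\<bar>J ?r 1\<bar> * \<bar>\<pi> 1\<bar> \<le> sqrt 2 * e * \<bar>\<pi> 1\<bar>" by (rule mult_right_mono) simp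
      thus ?thesis by (simp add: abs_mult ac_simps)
    qed
    have "LI (\<lambda>t. (c0 + J f t) * \<pi>' t) - ((c0 + J f 1) * \<pi> 1 - c0 * \<pi> (-1) - LI (\<lambda>t. f t * \<pi> t))
      = LI (\<lambda>t. J ?r t * \<pi>' t) - J ?r 1 * \<pi> 1 + LI (\<lambda>t. ?r t * \<pi> t)"
      using 1 2 3 4 P J[of 1] by (simp add: algebra_simps)
    moreover have "\<bar>\<dots>\<bar> \<le> ?K * e" using a b c unfolding distrib_right by linarith
    ultimately show "\<bar>LI (\<lambda>t. (c0 + J f t) * \<pi>' t) - ((c0 + J f 1) * \<pi> 1 - c0 * \<pi> (-1) - LI (\<lambda>t. f t * \<pi> t))\<bar> \<le> ?K * e" by simp
  qed
qed

section \<open>Smooth functions and test functions\<close>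

text \<open>Choosing for every member of \<open>F\<close> a derivative in \<open>F\<close> gives an
  operator whose iterates are the sequence required by \<open>smooth_on\<close>. Most smoothness
  proofs below reduce to finding such a class.\<close>

lemma smooth_on_class:
  assumes "f \<in> F" "\<And>h. h \<in> F \<Longrightarrow> \<exists>h'\<in>F. \<forall>t\<in>S. (h has_real_derivative h' t) (at t within S)"
  shows "smooth_on S f"
proof -
  obtain D where D: "\<And>h. h \<in> F \<Longrightarrow> D h \<in> F" 
      "\<And>h t. h \<in> F \<Longrightarrow> t \<in> S \<Longrightarrow> (h has_real_derivative D h t) (at t within S)"
    using assms(2) by metis
  have "(D ^^ j) f \<in> F" for j by (induction j) (auto simp: assms(1) D)
  thus ?thesis unfolding smooth_on_def using D by (intro exI[of _ "\<lambda>j. (D ^^ j) f"]) auto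
qed

lemma smooth_on_derivE:
  assumes "smooth_on S f"
  obtains f' where "smooth_on S f'" "\<And>t. t \<in> S \<Longrightarrow> (f has_real_derivative f' t) (at t within S)"
proof -
  obtain g where g: "g 0 = f" "\<And>j t. t \<in> S \<Longrightarrow> (g j has_real_derivative g (Suc j) t) (at t within S)"
    using assms unfolding smooth_on_def by blast
  have "smooth_on S (g 1)" unfolding smooth_on_def
    using g by (intro exI[of _ "\<lambda>j. g (Suc j)"]) auto
  thus ?thesis using that g by (metis One_nat_def)
qed

text \<open>Derivatives of products are sums and derivatives of chains are products, so closure
  under differentiation is shown for all these operations together.\<close>

inductive_set smooth_alg :: "real set \<Rightarrow> (real \<Rightarrow> real) set" for S where
  base: "smooth_on S f \<Longrightarrow> f \<in> smooth_alg S"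
| add: "f \<in> smooth_alg S \<Longrightarrow> g \<in> smooth_alg S \<Longrightarrow> (\<lambda>t. f t + g t) \<in> smooth_alg S"
| mult: "f \<in> smooth_alg S \<Longrightarrow> g \<in> smooth_alg S \<Longrightarrow> (\<lambda>t. f t * g t) \<in> smooth_alg S"
| comp: "smooth_on UNIV h \<Longrightarrow> smooth_on S q \<Longrightarrow> (\<lambda>t. h (q t)) \<in> smooth_alg S"

lemma smooth_alg_smooth: assumes "f \<in> smooth_alg S" shows "smooth_on S f"
proof (rule smooth_on_class[OF assms])
  fix h assume "h \<in> smooth_alg S"
  thus "\<exists>h'\<in>smooth_alg S. \<forall>t\<in>S. (h has_real_derivative h' t) (at t within S)"
  proof induction
    case (base f) thus ?case by (metis smooth_on_derivE smooth_alg.base)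
  next
    case (add f g)
    then obtain f' g' where "f' \<in> smooth_alg S" "g' \<in> smooth_alg S"
      "\<forall>t\<in>S. (f has_real_derivative f' t) (at t within S)" "\<forall>t\<in>S. (g has_real_derivative g' t) (at t within S)" by blast
    thus ?case by (intro bexI[of _ "\<lambda>t. f' t + g' t"] smooth_alg.add) (auto intro!: derivative_eq_intros)
  next
    case (mult f g)
    then obtain f' g' where "f' \<in> smooth_alg S" "g' \<in> smooth_alg S"
      "\<forall>t\<in>S. (f has_real_derivative f' t) (at t within S)" "\<forall>t\<in>S. (g has_real_derivative g' t) (at t within S)" by blast
    thus ?case using mult by (intro bexI[of _ "\<lambda>t. f' t * g t + g' t * f t"] smooth_alg.add smooth_alg.mult) (auto intro!: derivative_eq_intros)
  next
    case (comp h q)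
    obtain h' where h': "smooth_on UNIV h'" "\<And>t. (h has_real_derivative h' t) (at t)"
      using smooth_on_derivE[OF comp(1)] by auto
    obtain q' where q': "smooth_on S q'" "\<And>t. t \<in> S \<Longrightarrow> (q has_real_derivative q' t) (at t within S)"
      using smooth_on_derivE[OF comp(2)] by auto
    show ?case
    proof (intro bexI[of _ "\<lambda>t. h' (q t) * q' t"] ballI)
      show "(\<lambda>t. h' (q t) * q' t) \<in> smooth_alg S"
        using smooth_alg.mult[OF smooth_alg.comp[OF h'(1) comp(2)] smooth_alg.base[OF q'(1)]] .
      fix t assume "t \<in> S"
      thus "((\<lambda>t. h (q t)) has_real_derivative h' (q t) * q' t) (at t within S)"
        using DERIV_chain2[OF h'(2) q'(2)] by blast
    qed
  qed
qed

lemma smooth_on_add: "smooth_on S f \<Longrightarrow> smooth_on S g \<Longrightarrow> smooth_on S (\<lambda>t. f t + g t)"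
  by (simp add: smooth_alg.add smooth_alg.base smooth_alg_smooth)

lemma smooth_on_mult: "smooth_on S f \<Longrightarrow> smooth_on S g \<Longrightarrow> smooth_on S (\<lambda>t. f t * g t)"
  by (simp add: smooth_alg.mult smooth_alg.base smooth_alg_smooth)

lemma smooth_on_comp: "smooth_on UNIV f \<Longrightarrow> smooth_on S g \<Longrightarrow> smooth_on S (\<lambda>t. f (g t))"
  by (simp add: smooth_alg.comp smooth_alg_smooth)

lemma smooth_on_poly: "smooth_on S (\<lambda>t. poly p t)"
proof (rule smooth_on_class[where F = "range (\<lambda>p t. poly p t)"])
  fix h :: "real \<Rightarrow> real" assume "h \<in> range (\<lambda>p t. poly p t)"
  then obtain p where "h = (\<lambda>t. poly p t)" by auto
  thus "\<exists>h'\<in>range (\<lambda>p t. poly p t). \<forall>t\<in>S. (h has_real_derivative h' t) (at t within S)"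
    by (auto intro!: exI[of _ "pderiv p"] has_field_derivative_at_within[OF poly_DERIV])
qed auto

lemma smooth_on_const: "smooth_on S (\<lambda>t. c)" using smooth_on_poly[of S "[:c:]"] by simp

lemma smooth_on_cmult: "smooth_on S f \<Longrightarrow> smooth_on S (\<lambda>t. c * f t)"
  by (intro smooth_on_mult smooth_on_const)

lemma smooth_on_sum: "(\<And>i. i \<in> A \<Longrightarrow> smooth_on S (f i)) \<Longrightarrow> smooth_on S (\<lambda>t. \<Sum>i\<in>A. f i t)"
  by (induction A rule: infinite_finite_induct) (auto intro: smooth_on_const smooth_on_add)

lemma smooth_on_continuous: "smooth_on S f \<Longrightarrow> continuous_on S f"
  by (metis smooth_on_derivE DERIV_continuous_on)

lemma smooth_deriv:
  assumes "smooth_on UNIV f"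
  shows "smooth_on UNIV (deriv f)" "(f has_real_derivative deriv f t) (at t)"
proof -
  obtain f' where f': "smooth_on UNIV f'" "\<And>t. (f has_real_derivative f' t) (at t)"
    using smooth_on_derivE[OF assms] by auto
  have "deriv f = f'" using DERIV_imp_deriv[OF f'(2)] by auto
  thus "smooth_on UNIV (deriv f)" "(f has_real_derivative deriv f t) (at t)" using f' by auto
qed

lemma smooth_deriv_iter: "smooth_on UNIV f \<Longrightarrow> smooth_on UNIV ((deriv ^^ j) f)"
  by (induction j) (auto intro: smooth_deriv)

section \<open>Bump functions and scalar test functions\<close>

definition bexp :: "real \<Rightarrow> real" where "bexp x = (if 0 < x then exp (- (1 / x)) else 0)"

lemma poly_exp_at_top: "((\<lambda>y. poly p y * exp (- y)) \<longlongrightarrow> 0) (at_top :: real filter)"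
proof -
  have "((\<lambda>y. \<Sum>i\<le>degree p. coeff p i * (y ^ i / exp y)) \<longlongrightarrow> (\<Sum>i\<le>degree p. coeff p i * 0)) at_top"
    by (intro tendsto_intros tendsto_power_div_exp_0)
  thus ?thesis by (simp add: poly_altdef exp_minus sum_distrib_right divide_inverse mult.assoc)
qed

lemma DERIV_ev_transfer:
  "(g has_real_derivative D) (at t) \<Longrightarrow> eventually (\<lambda>x. f x = g x) (nhds t) \<Longrightarrow> (f has_real_derivative D) (at t)"
  using DERIV_cong_ev[OF refl _ refl, of f g t D] by simp

text \<open>The functions \<open>p(1/x) exp (-1/x)\<close> with polynomial \<open>p\<close>,
  extended by 0 to \<open>x \<le> 0\<close>, form a class closed under differentiation. At 0 the
  difference quotient tends to 0 because the exponential beats every power of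
  \<open>1/x\<close>.\<close>

lemma bexp_smooth: "smooth_on UNIV bexp"
proof (rule smooth_on_class[where F = "range (\<lambda>p x. if 0 < x then poly p (1 / x) * exp (- (1 / x)) else 0)"])
  show "bexp \<in> range (\<lambda>p x. if 0 < x then poly p (1 / x) * exp (- (1 / x)) else 0)"
    by (rule range_eqI[of _ _ 1]) (auto simp: bexp_def)
next
  fix h :: "real \<Rightarrow> real"
  assume "h \<in> range (\<lambda>p x. if 0 < x then poly p (1 / x) * exp (- (1 / x)) else 0)"
  then obtain p where h: "h = (\<lambda>x. if 0 < x then poly p (1 / x) * exp (- (1 / x)) else 0)" by auto
  \<comment> \<open>With \<open>y = 1/x\<close> one has \<open>y' = - y^2\<close>, so
    \<open>p(y) exp (-y)\<close> has the derivative
    \<open>(p(y) - p'(y)) y^2 exp (-y)\<close>.\<close>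
  let ?q = "(p - pderiv p) * [:0,0,1:]"
  let ?h = "\<lambda>x. if 0 < x then poly ?q (1 / x) * exp (- (1 / x)) else 0"
  have "(h has_real_derivative ?h t) (at t)" for t
  proof -
    consider "0 < t" | "t < 0" | "t = 0" by linarith
    thus ?thesis
    proof cases
      case 1
      have "((\<lambda>x. poly p (1 / x) * exp (- (1 / x))) has_real_derivative ?h t) (at t)"
        using 1 by (auto intro!: derivative_eq_intros simp: field_simps power2_eq_square)
      moreover have "eventually (\<lambda>x. x \<in> {0<..}) (nhds t)" using 1 by (intro eventually_nhds_in_open) auto
      hence "eventually (\<lambda>x. h x = poly p (1 / x) * exp (- (1 / x))) (nhds t)"
        by eventually_elim (simp add: h)
      ultimately show ?thesis using DERIV_ev_transfer by blast
    next
      case 2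
      have "eventually (\<lambda>x. x \<in> {..<0}) (nhds t)" using 2 by (intro eventually_nhds_in_open) auto
      hence "eventually (\<lambda>x. h x = 0) (nhds t)" by eventually_elim (simp add: h)
      moreover have "((\<lambda>x. 0) has_real_derivative ?h t) (at t)" using 2 by simp
      ultimately show ?thesis using DERIV_ev_transfer by blast
    next
      case 3
      have "((\<lambda>x. h x / x) \<longlongrightarrow> 0) (at_left 0)"
        by (rule tendsto_eventually) (auto simp: h eventually_at_left_field intro!: exI[of _ "-1"])
      moreover have "((\<lambda>x. h x / x) \<longlongrightarrow> 0) (at_right 0)"
      proof -
        have "((\<lambda>x. poly ([:0,1:] * p) (inverse x) * exp (- inverse x)) \<longlongrightarrow> 0) (at_right 0)"
          by (rule filterlim_compose[OF poly_exp_at_top filterlim_inverse_at_top_right])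
        moreover have "eventually (\<lambda>x. poly ([:0,1:] * p) (inverse x) * exp (- inverse x) = h x / x) (at_right 0)"
          using eventually_at_right_less[of 0] by eventually_elim (simp add: h field_simps)
        ultimately show ?thesis by (rule Lim_transform_eventually)
      qed
      ultimately have "((\<lambda>x. h x / x) \<longlongrightarrow> 0) (at 0)" by (rule filterlim_split_at)
      moreover have "(h (t + x) - h t) / x = h x / x" for x using 3 by (simp add: h)
      moreover have "?h t = 0" using 3 by simp
      ultimately show ?thesis unfolding DERIV_def by presburger
    qed
  qed
  moreover have "?h \<in> range (\<lambda>p x. if 0 < x then poly p (1 / x) * exp (- (1 / x)) else 0)" by (rule rangeI)
  ultimately show "\<exists>h'\<in>range (\<lambda>p x. if 0 < x then poly p (1 / x) * exp (- (1 / x)) else 0). \<forall>t\<in>UNIV. (h has_real_derivative h' t) (at t)"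
    by (intro bexI[of _ ?h] ballI)
qed

text \<open>Vanishing for \<open>a \<le> \<bar>t\<bar>\<close> with some \<open>a < 1\<close> is
  compact support in the open interval, in a form that passes easily to sums and
  derivatives.\<close>

definition tf :: "(real \<Rightarrow> real) \<Rightarrow> bool" where
  "tf \<psi> \<longleftrightarrow> smooth_on UNIV \<psi> \<and> (\<exists>a. 0 < a \<and> a < 1 \<and> (\<forall>t. a \<le> \<bar>t\<bar> \<longrightarrow> \<psi> t = 0))"

lemma tf_smooth: "tf \<psi> \<Longrightarrow> smooth_on UNIV \<psi>" by (simp add: tf_def)

lemma tf_bexp: assumes "0 < a" "a < 1" shows "tf (\<lambda>t. poly p t * bexp (a\<^sup>2 - t\<^sup>2))"
  unfolding tf_def
proof (intro conjI exI[of _ a] allI impI)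
  have "smooth_on UNIV (\<lambda>t. bexp (poly [:a\<^sup>2, 0, -1:] t))"
    by (rule smooth_on_comp[OF bexp_smooth smooth_on_poly])
  hence "smooth_on UNIV (\<lambda>t. bexp (a\<^sup>2 - t\<^sup>2))" by (simp add: power2_eq_square algebra_simps)
  thus "smooth_on UNIV (\<lambda>t. poly p t * bexp (a\<^sup>2 - t\<^sup>2))" by (intro smooth_on_mult smooth_on_poly)
  fix t assume "a \<le> \<bar>t\<bar>"
  hence "a\<^sup>2 \<le> t\<^sup>2" using power_mono[of a "\<bar>t\<bar>" 2] assms by simp
  thus "poly p t * bexp (a\<^sup>2 - t\<^sup>2) = 0" by (simp add: bexp_def)
qed (use assms in auto)

lemma tf_zero: "tf (\<lambda>t. 0)"
  unfolding tf_def by (auto intro: smooth_on_const exI[of _ "1/2"])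

lemma tf_add: assumes "tf \<phi>" "tf \<psi>" shows "tf (\<lambda>t. \<phi> t + \<psi> t)"
proof -
  obtain a b where a: "0 < a" "a < 1" "\<And>t. a \<le> \<bar>t\<bar> \<Longrightarrow> \<phi> t = 0" and b: "0 < b" "b < 1" "\<And>t. b \<le> \<bar>t\<bar> \<Longrightarrow> \<psi> t = 0"
    using assms unfolding tf_def by metis
  show ?thesis unfolding tf_def
    using assms a b by (intro conjI exI[of _ "max a b"] smooth_on_add) (auto simp: tf_def)
qed

lemma tf_cmult: "tf \<psi> \<Longrightarrow> tf (\<lambda>t. c * \<psi> t)"
  unfolding tf_def by (auto intro: smooth_on_cmult)

lemma tf_diff: "tf \<phi> \<Longrightarrow> tf \<psi> \<Longrightarrow> tf (\<lambda>t. \<phi> t - \<psi> t)"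
  using tf_add[of \<phi> "\<lambda>t. (-1) * \<psi> t"] tf_cmult[of \<psi> "-1"] by simp

lemma tf_sum: "(\<And>i. i \<in> A \<Longrightarrow> tf (f i)) \<Longrightarrow> tf (\<lambda>t. \<Sum>i\<in>A. f i t)"
  by (induction A rule: infinite_finite_induct) (auto intro: tf_zero tf_add)

lemma tf_deriv: assumes "tf \<psi>" shows "tf (deriv \<psi>)"
proof -
  obtain a where a: "0 < a" "a < 1" "\<And>t. a \<le> \<bar>t\<bar> \<Longrightarrow> \<psi> t = 0"
    using assms unfolding tf_def by metis
  \<comment> \<open>The radius grows to \<open>(a + 1) / 2\<close>, so that \<open>t\<close> has a
    whole neighbourhood on which \<open>\<psi>\<close> vanishes.\<close>
  have "deriv \<psi> t = 0" if "(a + 1) / 2 \<le> \<bar>t\<bar>" for t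
  proof -
    have "t \<in> {..<-a} \<union> {a<..}" using that a by (auto simp: abs_if field_simps split: if_splits)
    hence "eventually (\<lambda>s. s \<in> {..<-a} \<union> {a<..}) (nhds t)" by (intro eventually_nhds_in_open) auto
    hence "eventually (\<lambda>s. \<psi> s = 0) (nhds t)" by eventually_elim (use a in auto)
    hence "deriv \<psi> t = deriv (\<lambda>s. 0) t" by (intro deriv_cong_ev) auto
    thus ?thesis by simp
  qed
  thus ?thesis unfolding tf_def using a smooth_deriv(1)[of \<psi>] assms
    by (intro conjI exI[of _ "(a + 1) / 2"]) (auto simp: tf_def)
qed

lemma tf_deriv_iter: "tf \<psi> \<Longrightarrow> tf ((deriv ^^ j) \<psi>)" by (induction j) (auto intro: tf_deriv)

lemma tf_cont: "tf \<psi> \<Longrightarrow> continuous_on S \<psi>"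
  using smooth_on_continuous tf_smooth continuous_on_subset by blast

lemma tf_sq_int: "tf \<psi> \<Longrightarrow> sq_int \<psi>" by (intro sq_int_cont tf_cont)

lemma tf_boundary: assumes "tf \<psi>" shows "\<psi> 1 = 0" "\<psi> (-1) = 0"
  using assms unfolding tf_def by (metis abs_1 abs_minus less_imp_le)+

lemma integral_zero: "(\<And>x. x \<in> S \<Longrightarrow> f x = 0) \<Longrightarrow> integral S f = (0::real)"
  using integral_cong[of S f "\<lambda>_. 0"] by simp

text \<open>Integral 0 is exactly what makes the primitive from \<open>-1\<close> vanish again to
  the right of the support.\<close>

lemma tf_antideriv: assumes "tf \<psi>" "LI \<psi> = 0" obtains \<phi> where "tf \<phi>" "deriv \<phi> = \<psi>"
proof -
  obtain a where a: "0 < a" "a < 1" "\<And>t. a \<le> \<bar>t\<bar> \<Longrightarrow> \<psi> t = 0"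
    using assms unfolding tf_def by metis
  define \<phi> where "\<phi> t = integral {-1..t} \<psi>" for t
  have z: "\<phi> t = 0" if "t \<le> -a" for t
    unfolding \<phi>_def by (rule integral_zero) (use a that in auto)
  have i: "\<psi> integrable_on {c..d}" for c d by (intro integrable_continuous_real tf_cont assms)
  have z': "\<phi> t = 0" if "a \<le> t" for t
  proof -
    have "\<phi> t = integral {-1..a} \<psi> + integral {a..t} \<psi>"
      unfolding \<phi>_def by (rule Henstock_Kurzweil_Integration.integral_combine[symmetric]) (use a that i in auto)
    also have "integral {a..t} \<psi> = 0" by (rule integral_zero) (use a in auto)
    finally have 1: "\<phi> t = integral {-1..a} \<psi>" by simp
    have "0 = integral {-1..1} \<psi>" using assms LI_eq_integral[OF sq_int_integrable[OF tf_sq_int]] by simp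
    also have "\<dots> = integral {-1..a} \<psi> + integral {a..1} \<psi>"
      by (rule Henstock_Kurzweil_Integration.integral_combine[symmetric]) (use a i in auto)
    also have "integral {a..1} \<psi> = 0" by (rule integral_zero) (use a in auto)
    finally show ?thesis using 1 by simp
  qed
  have d: "(\<phi> has_real_derivative \<psi> t) (at t)" for t
  proof (cases "-1 < t")
    case True
    have "(\<phi> has_real_derivative \<psi> t) (at t within {-1..t+1})"
      unfolding \<phi>_def [abs_def] by (rule integral_has_real_derivative) (use True assms tf_cont in auto)
    moreover have "at t within {-1..t+1} = at t" by (rule at_within_interior) (use True in auto)
    ultimately show ?thesis by simp
  next
    case False
    hence "eventually (\<lambda>s. s \<in> {..<-a}) (nhds t)" by (intro eventually_nhds_in_open) (use a in auto)
    hence "eventually (\<lambda>s. \<phi> s = 0) (nhds t)" by eventually_elim (auto simp: z)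
    moreover have "((\<lambda>s. 0) has_real_derivative \<psi> t) (at t)" using False a by simp
    ultimately show ?thesis using DERIV_ev_transfer by blast
  qed
  have s: "smooth_on UNIV \<phi>"
  proof -
    obtain g where g: "g 0 = \<psi>" "\<And>j t. (g j has_real_derivative g (Suc j) t) (at t)"
      using tf_smooth[OF assms(1)] unfolding smooth_on_def by auto
    show ?thesis unfolding smooth_on_def
      using g d by (intro exI[of _ "\<lambda>j. case j of 0 \<Rightarrow> \<phi> | Suc i \<Rightarrow> g i"]) (auto split: nat.splits)
  qed
  have "tf \<phi>" unfolding tf_def using s a z z'
    by (intro conjI exI[of _ a]) (auto simp: abs_if split: if_splits)
  moreover have "deriv \<phi> = \<psi>" using DERIV_imp_deriv[OF d] by auto
  ultimately show ?thesis by (rule that)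
qed

lemma bexp_bounds: "0 \<le> bexp x" "bexp x \<le> 1" by (auto simp: bexp_def)

lemma bexp_cont: "continuous_on S bexp"
  using smooth_on_continuous[OF bexp_smooth] continuous_on_subset by blast

lemma sq_int_mult_cont: assumes "sq_int g" "continuous_on {-1..1} h" shows "sq_int (\<lambda>t. g t * h t)"
proof -
  obtain C where C: "\<And>t. t \<in> {-1..1} \<Longrightarrow> \<bar>h t\<bar> \<le> C"
    using compact_imp_bounded[OF compact_continuous_image[OF assms(2) compact_Icc]]
    unfolding bounded_iff by (metis image_eqI real_norm_def)
  have [measurable]: "g \<in> borel_measurable MI" "h \<in> borel_measurable MI"
    using assms sq_int_cont by (auto intro: sq_int_measurable)
  show ?thesis unfolding sq_int_def
  proof
    show "integrable MI (\<lambda>t. (g t * h t)\<^sup>2)"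
    proof (rule Bochner_Integration.integrable_bound)
      show "integrable MI (\<lambda>t. C\<^sup>2 * (g t)\<^sup>2)" using sq_int_sq[OF assms(1)] by simp
      have "\<bar>(g t * h t)\<^sup>2\<bar> \<le> \<bar>C\<^sup>2 * (g t)\<^sup>2\<bar>" if "t \<in> \<I>" for t
        using power_mono[OF C, of t 2] that mult_left_mono[of "(h t)\<^sup>2" "C\<^sup>2" "(g t)\<^sup>2"] by (auto simp: power_mult_distrib mult.commute)
      thus "AE t in MI. norm ((g t * h t)\<^sup>2) \<le> norm (C\<^sup>2 * (g t)\<^sup>2)" by auto
    qed measurable
  qed measurable
qed

text \<open>Orthogonality gives \<open>LI (f^2) = LI (f (f - p))\<close> for every polynomial
  \<open>p\<close>, and \<open>p\<close> can be taken arbitrarily close to \<open>f\<close>.\<close>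

lemma sq_int_AE_0: assumes "sq_int f" "\<And>p. LI (\<lambda>t. f t * poly p t) = 0" shows "AE t in MI. f t = 0"
proof -
  have "LI (\<lambda>t. (f t)\<^sup>2) = 0"
  proof (rule LI_tendsto_eqI[where K = "nL f"])
    fix e :: real assume "0 < e"
    then obtain p where p: "nL (\<lambda>t. f t - poly p t) < e" using poly_dense[OF assms(1)] by blast
    have "LI (\<lambda>t. f t * (f t - poly p t)) = LI (\<lambda>t. (f t)\<^sup>2 - f t * poly p t)"
      by (simp add: power2_eq_square algebra_simps)
    also have "\<dots> = LI (\<lambda>t. (f t)\<^sup>2)" 
      using sq_int_sq[OF assms(1)] sq_int_mult[OF assms(1) sq_int_poly', of p] assms(2) by simp
    finally have "\<bar>LI (\<lambda>t. (f t)\<^sup>2)\<bar> = \<bar>LI (\<lambda>t. f t * (f t - poly p t))\<bar>" by simp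
    also have "\<dots> \<le> nL f * nL (\<lambda>t. f t - poly p t)"
      by (intro Cauchy_Schwarz_LI sq_int_diff sq_int_poly' assms)
    also have "\<dots> \<le> nL f * e" using p by (intro mult_left_mono) auto
    finally show "\<bar>LI (\<lambda>t. (f t)\<^sup>2) - 0\<bar> \<le> nL f * e" by simp
  qed
  hence "AE t in MI. (f t)\<^sup>2 = 0"
    by (subst integral_nonneg_eq_0_iff_AE[symmetric]) (use sq_int_sq[OF assms(1)] in auto)
  thus ?thesis by simp
qed

text \<open>Multiplying by a bump function turns every polynomial into a limit of test functions.\<close>

lemma weak_zero: assumes g: "sq_int g" and w: "\<And>\<psi>. tf \<psi> \<Longrightarrow> LI (\<lambda>t. g t * \<psi> t) = 0"
  shows "AE t in MI. g t = 0"
proof -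
  let ?b = "\<lambda>t. bexp (1 - t\<^sup>2)"
  have cb: "continuous_on {-1..1} (\<lambda>t. bexp (c - t\<^sup>2))" for c
    by (rule continuous_on_compose2[OF bexp_cont[of UNIV]]) (auto intro!: continuous_intros)
  have "AE t in MI. g t * ?b t = 0"
  proof (rule sq_int_AE_0)
    show "sq_int (\<lambda>t. g t * ?b t)" by (intro sq_int_mult_cont g cb)
    fix p :: "real poly"
    \<comment> \<open>The bump of radius 1 is not supported in a compact part of the interval; those
      of radius \<open>?a k < 1\<close> are, and they converge to it.\<close>
    let ?a = "\<lambda>k::nat. 1 - inverse (real (Suc k)) / 2"
    have a: "0 < ?a k" "?a k < 1" for k by (auto simp: field_simps)
    have al: "?a \<longlonglongrightarrow> 1 - 0 / 2" by (intro tendsto_intros LIMSEQ_inverse_real_of_nat) auto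
    let ?f = "\<lambda>k t. g t * (poly p t * bexp ((?a k)\<^sup>2 - t\<^sup>2))"
    have gp: "sq_int (\<lambda>t. g t * poly p t)" by (intro sq_int_mult_cont g continuous_intros)
    have "(\<lambda>k. LI (?f k)) \<longlonglongrightarrow> LI (\<lambda>t. g t * (poly p t * ?b t))"
    proof (rule integral_dominated_convergence[where w = "\<lambda>t. \<bar>g t * poly p t\<bar>"])
      show "(\<lambda>t. g t * (poly p t * ?b t)) \<in> borel_measurable MI"
        by (intro sq_int_measurable sq_int_mult_cont g continuous_on_mult cb continuous_intros)
      show "?f k \<in> borel_measurable MI" for k
        by (intro sq_int_measurable sq_int_mult_cont g continuous_on_mult cb continuous_intros)
      show "integrable MI (\<lambda>t. \<bar>g t * poly p t\<bar>)"
        using sq_int_integrable[OF gp] by auto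
      show "AE t in MI. (\<lambda>k. ?f k t) \<longlonglongrightarrow> g t * (poly p t * ?b t)"
      proof (rule AE_I2)
        fix t
        have "isCont bexp x" for x using bexp_cont[of UNIV] by (simp add: continuous_on_eq_continuous_at)
        moreover have "(\<lambda>k. (?a k)\<^sup>2 - t\<^sup>2) \<longlonglongrightarrow> (1 - 0 / 2)\<^sup>2 - t\<^sup>2" by (intro tendsto_diff tendsto_power tendsto_const al)
        hence "(\<lambda>k. (?a k)\<^sup>2 - t\<^sup>2) \<longlonglongrightarrow> 1 - t\<^sup>2" by simp
        ultimately have "(\<lambda>k. bexp ((?a k)\<^sup>2 - t\<^sup>2)) \<longlonglongrightarrow> ?b t"
          by (rule isCont_tendsto_compose)
        thus "(\<lambda>k. ?f k t) \<longlonglongrightarrow> g t * (poly p t * ?b t)" by (intro tendsto_intros)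
      qed
      show "AE t in MI. norm (?f k t) \<le> \<bar>g t * poly p t\<bar>" for k
      proof (rule AE_I2)
        fix t
        have "\<bar>?f k t\<bar> = \<bar>g t * poly p t\<bar> * \<bar>bexp ((?a k)\<^sup>2 - t\<^sup>2)\<bar>" by (simp add: abs_mult)
        also have "\<dots> \<le> \<bar>g t * poly p t\<bar> * 1"
          using bexp_bounds[of "(?a k)\<^sup>2 - t\<^sup>2"] by (intro mult_left_mono) auto
        finally show "norm (?f k t) \<le> \<bar>g t * poly p t\<bar>" by simp
      qed
    qed
    moreover have "LI (?f k) = 0" for k by (rule w[OF tf_bexp[OF a]])
    ultimately show "LI (\<lambda>t. g t * ?b t * poly p t) = 0"
      by (simp add: LIMSEQ_const_iff mult.assoc mult.commute[of "?b _"])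
  qed
  thus ?thesis
  proof (rule AE_mp, intro AE_I2 impI)
    fix t assume "t \<in> space MI" "g t * ?b t = 0"
    moreover have "t\<^sup>2 < 1" using calculation(1) by (auto simp: abs_square_less_1)
    hence "?b t \<noteq> 0" by (simp add: bexp_def)
    ultimately show "g t = 0" by simp
  qed
qed

section \<open>Weak derivatives\<close>

text \<open>\<open>F 0\<close> lies in \<open>H\<^sup>l\<close> with weak derivatives \<open>F j\<close>, the continuous representative being chosen for \<open>j < l\<close>.\<close>

definition chain :: "nat \<Rightarrow> (nat \<Rightarrow> real \<Rightarrow> real) \<Rightarrow> bool" where
  "chain l F \<longleftrightarrow> (\<forall>j\<le>l. sq_int (F j)) \<and>
     (\<forall>j<l. \<forall>t\<in>{-1..1}. F j t = F j (-1) + J (F (Suc j)) t)"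

lemma chain_sq_int: "chain l F \<Longrightarrow> j \<le> l \<Longrightarrow> sq_int (F j)" unfolding chain_def by blast

lemma chain_J: "chain l F \<Longrightarrow> j < l \<Longrightarrow> t \<in> {-1..1} \<Longrightarrow> F j t = F j (-1) + J (F (Suc j)) t"
  unfolding chain_def by blast

lemma chainI:
  "(\<And>j. j \<le> l \<Longrightarrow> sq_int (F j)) \<Longrightarrow>
   (\<And>j t. j < l \<Longrightarrow> t \<in> {-1..1} \<Longrightarrow> F j t = F j (-1) + J (F (Suc j)) t) \<Longrightarrow> chain l F"
  unfolding chain_def by blast

lemma chain_mono: "chain l F \<Longrightarrow> k \<le> l \<Longrightarrow> chain k F"
  unfolding chain_def by (meson le_trans less_le_trans)

lemma chain_shift: assumes "chain (i + l) F" shows "chain l (\<lambda>j. F (i + j))"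
proof (rule chainI)
  fix j and t :: real assume "j < l" "t \<in> {-1..1}"
  thus "F (i + j) t = F (i + j) (-1) + J (F (i + Suc j)) t" using chain_J[OF assms, of "i + j" t] by simp
qed (rule chain_sq_int[OF assms], simp)

lemma chain_Suc_shift: "chain (Suc l) F \<Longrightarrow> chain l (\<lambda>j. F (Suc j))"
  using chain_shift[of 1 l F] by simp

lemma chain_cont: assumes "chain l F" "j < l" shows "continuous_on {-1..1} (F j)"
proof -
  have "continuous_on {-1..1} (\<lambda>t. F j (-1) + J (F (Suc j)) t)"
    by (intro continuous_intros J_cont chain_sq_int[OF assms(1)]) (use assms in auto)
  thus ?thesis by (rule continuous_on_eq) (rule chain_J[OF assms, symmetric])
qed

lemma chain_lin: assumes "chain l F" "chain l G" shows "chain l (\<lambda>j t. a * F j t + b * G j t)"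
proof (rule chainI)
  fix j and t :: real assume j: "j < l" and t: "t \<in> {-1..1}"
  have s: "sq_int (F (Suc j))" "sq_int (G (Suc j))"
    using chain_sq_int[OF assms(1), of "Suc j"] chain_sq_int[OF assms(2), of "Suc j"] j by auto
  have "J (\<lambda>t. a * F (Suc j) t + b * G (Suc j) t) t = a * J (F (Suc j)) t + b * J (G (Suc j)) t"
    using J_add[OF sq_int_cmult[OF s(1), of a] sq_int_cmult[OF s(2), of b], of t] t by (simp add: J_cmult)
  thus "a * F j t + b * G j t = a * F j (-1) + b * G j (-1) + J (\<lambda>t. a * F (Suc j) t + b * G (Suc j) t) t"
    using arg_cong[OF chain_J[OF assms(1) j t], of "(*) a"] arg_cong[OF chain_J[OF assms(2) j t], of "(*) b"]
    unfolding distrib_left by linarith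
next
  fix j assume "j \<le> l"
  thus "sq_int (\<lambda>t. a * F j t + b * G j t)"
    by (intro sq_int_add sq_int_cmult chain_sq_int[OF assms(1)] chain_sq_int[OF assms(2)])
qed

lemma chain_zero: "chain l (\<lambda>j t. 0)" by (rule chainI) auto

lemma chain_sum: "(\<And>i. i \<in> A \<Longrightarrow> chain l (F i)) \<Longrightarrow> chain l (\<lambda>j t. \<Sum>i\<in>A. c i * F i j t)"
proof (induction A rule: infinite_finite_induct)
  case (insert x A)
  thus ?case using chain_lin[of l "F x" "\<lambda>j t. \<Sum>i\<in>A. c i * F i j t" "c x" 1] by simp
qed (auto intro: chain_zero)

lemma chain_poly: "chain l (\<lambda>j t. poly ((pderiv ^^ j) p) t)"
proof (rule chainI)
  fix j and t :: real assume "t \<in> {-1..1}"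
  thus "poly ((pderiv ^^ j) p) t = poly ((pderiv ^^ j) p) (-1) + J (poly ((pderiv ^^ Suc j) p)) t"
    by (subst J_FTC[where F = "poly ((pderiv ^^ j) p)"]) (auto intro: has_field_derivative_at_within[OF poly_DERIV])
qed auto

lemma chain_deriv: assumes "\<And>j t. j < l \<Longrightarrow> t \<in> {-1..1} \<Longrightarrow> (F j has_real_derivative F (Suc j) t) (at t within {-1..1})"
    "continuous_on {-1..1} (F l)"
  shows "chain l F"
proof (rule chainI)
  fix j assume "j \<le> l"
  thus "sq_int (F j)" using assms(2) DERIV_continuous_on[of "{-1..1}" "F j", OF assms(1)]
    by (cases "j = l") (auto intro!: sq_int_cont)
next
  fix j and t :: real assume "j < l" "t \<in> {-1..1}"
  thus "F j t = F j (-1) + J (F (Suc j)) t" using J_FTC[of "F j" "F (Suc j)" t] assms(1) by auto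
qed

lemma sq_int_J_iter: "sq_int v \<Longrightarrow> sq_int ((J ^^ k) v)" by (induction k) auto

text \<open>A square-integrable function is the \<open>l\<close>-th weak derivative of its
  \<open>l\<close>-fold primitive; this provides the particular solution in
  \<open>weak_deriv_chain\<close> and moves derivatives in \<open>weak_ode_smooth\<close>.\<close>

lemma chain_J_iter: "sq_int v \<Longrightarrow> chain l (\<lambda>j. (J ^^ (l - j)) v)"
  by (rule chainI) (auto simp: Suc_diff_Suc[symmetric] simp del: funpow.simps(2) simp: sq_int_J_iter, simp)

section \<open>Weak derivatives against test functions\<close>

lemma tf_parts: assumes "sq_int f" "tf \<psi>"
  shows "LI (\<lambda>t. (c + J f t) * deriv \<psi> t) = - LI (\<lambda>t. f t * \<psi> t)"
  using int_by_parts[OF assms(1), of \<psi> "deriv \<psi>" c] smooth_deriv(2)[OF tf_smooth[OF assms(2)]]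
    tf_cont[OF tf_deriv[OF assms(2)]] tf_boundary[OF assms(2)]
  by (simp add: has_field_derivative_at_within)

lemma chain_weak: assumes "chain l F" "j \<le> l" "tf \<psi>"
  shows "LI (\<lambda>t. F 0 t * (deriv ^^ j) \<psi> t) = (-1) ^ j * LI (\<lambda>t. F j t * \<psi> t)"
  using assms(2,3)
proof (induction j arbitrary: \<psi>)
  case (Suc j)
  have "LI (\<lambda>t. F 0 t * (deriv ^^ Suc j) \<psi> t) = LI (\<lambda>t. F 0 t * (deriv ^^ j) (deriv \<psi>) t)"
    by (simp add: funpow_swap1)
  also have "\<dots> = (-1) ^ j * LI (\<lambda>t. F j t * deriv \<psi> t)" using Suc by (intro Suc.IH tf_deriv) auto
  also have "LI (\<lambda>t. F j t * deriv \<psi> t) = LI (\<lambda>t. (F j (-1) + J (F (Suc j)) t) * deriv \<psi> t)"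
  proof (rule Bochner_Integration.integral_cong[OF refl])
    fix t assume "t \<in> space MI"
    hence "t \<in> {-1..1}" by auto
    thus "F j t * deriv \<psi> t = (F j (-1) + J (F (Suc j)) t) * deriv \<psi> t"
      using chain_J[OF assms(1), of j t] Suc.prems by simp
  qed
  also have "\<dots> = - LI (\<lambda>t. F (Suc j) t * \<psi> t)"
    using Suc assms(1) by (intro tf_parts) (auto intro: chain_sq_int)
  finally show ?case by simp
qed simp

text \<open>If every test function had integral 0, \<open>weak_zero\<close> would make the constant
  1 vanish. The function obtained serves to subtract mean values.\<close>

lemma exists_tf_integral_1: obtains \<theta> where "tf \<theta>" "LI \<theta> = 1"
proof -
  have "\<exists>\<psi>. tf \<psi> \<and> LI \<psi> \<noteq> 0"
  proof (rule ccontr)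
    assume "\<nexists>\<psi>. tf \<psi> \<and> LI \<psi> \<noteq> 0"
    hence "AE t in MI. (1::real) = 0" by (intro weak_zero) auto
    hence "LI (\<lambda>t. 1) = LI (\<lambda>t. 0)" by (intro integral_cong_AE) auto
    thus False by simp
  qed
  then obtain \<psi> where "tf \<psi>" "LI \<psi> \<noteq> 0" by blast
  thus ?thesis using that[of "\<lambda>t. (1 / LI \<psi>) * \<psi> t"] tf_cmult[of \<psi> "1 / LI \<psi>"] by simp
qed

lemma pderiv_monom_iter: "(pderiv ^^ j) (monom (c::real) j) = [: c * fact j :]"
  by (induction j arbitrary: c) (auto simp: pderiv_monom funpow_swap1 monom_0 algebra_simps simp del: funpow.simps(2) simp: funpow_Suc_right)

lemma deriv_iter_lin: assumes "smooth_on UNIV f" "smooth_on UNIV g"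
  shows "(deriv ^^ j) (\<lambda>t. a * f t + b * g t) = (\<lambda>t. a * (deriv ^^ j) f t + b * (deriv ^^ j) g t)"
proof (induction j)
  case (Suc j)
  have "deriv (\<lambda>t. a * (deriv ^^ j) f t + b * (deriv ^^ j) g t) t = a * deriv ((deriv ^^ j) f) t + b * deriv ((deriv ^^ j) g) t" for t
    by (rule DERIV_imp_deriv) (auto intro!: derivative_eq_intros smooth_deriv smooth_deriv_iter assms)
  thus ?case using Suc by auto
qed simp

text \<open>Induction on the number of derivatives. Subtracting \<open>LI \<psi>\<close> times
  \<open>\<theta>\<close> turns \<open>\<psi>\<close> into the derivative of a test function, so the
  integral of \<open>g\<close> against the \<open>r\<close>-th derivative of \<open>\<psi>\<close>
  depends on \<open>LI \<psi>\<close> only. A monomial with the same dependence is subtracted from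
  \<open>g\<close>.\<close>

lemma du_Bois_Reymond:
  assumes "sq_int g" "\<And>\<psi>. tf \<psi> \<Longrightarrow> LI (\<lambda>t. g t * (deriv ^^ r) \<psi> t) = 0"
  shows "\<exists>q. AE t in MI. g t = poly q t"
  using assms
proof (induction r arbitrary: g)
  case 0
  hence "AE t in MI. g t = poly 0 t" using weak_zero[of g] by simp
  thus ?case by blast
next
  case (Suc r)
  obtain \<theta> where \<theta>: "tf \<theta>" "LI \<theta> = 1" using exists_tf_integral_1 .
  define c where "c = LI (\<lambda>t. g t * (deriv ^^ r) \<theta> t)"
  \<comment> \<open>Chosen so that the \<open>r\<close>-th derivative of \<open>p\<close> is the
    constant \<open>(-1)^r c\<close>; the sign cancels the one from \<open>r\<close> integrations by
    parts.\<close>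
  define p where "p = monom ((-1) ^ r * c / fact r) r"
  have "\<exists>q. AE t in MI. g t - poly p t = poly q t"
  proof (rule Suc.IH)
    show "sq_int (\<lambda>t. g t - poly p t)" using Suc.prems by auto
    fix \<psi> assume \<psi>: "tf \<psi>"
    let ?m = "LI \<psi>"
    have m: "tf (\<lambda>t. \<psi> t - ?m * \<theta> t)" by (intro tf_diff tf_cmult \<psi> \<theta>)
    have "LI (\<lambda>t. \<psi> t - ?m * \<theta> t) = 0"
      using sq_int_integrable[OF tf_sq_int[OF \<psi>]] sq_int_integrable[OF tf_sq_int[OF \<theta>(1)]] \<theta>(2) by simp
    then obtain \<phi> where \<phi>: "tf \<phi>" "deriv \<phi> = (\<lambda>t. \<psi> t - ?m * \<theta> t)" using tf_antideriv[OF m] by blast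
    have e: "(deriv ^^ Suc r) \<phi> = (\<lambda>t. (deriv ^^ r) \<psi> t - ?m * (deriv ^^ r) \<theta> t)"
      using deriv_iter_lin[of \<psi> \<theta> r 1 "- ?m"] tf_smooth[OF \<psi>] tf_smooth[OF \<theta>(1)]
      by (simp add: funpow_swap1 \<phi>(2))
    note s = sq_int_mult[OF Suc.prems(1) tf_sq_int[OF tf_deriv_iter[OF \<psi>, of r]]]
       sq_int_mult[OF Suc.prems(1) tf_sq_int[OF tf_deriv_iter[OF \<theta>(1), of r]]]
    have "0 = LI (\<lambda>t. g t * ((deriv ^^ r) \<psi> t - ?m * (deriv ^^ r) \<theta> t))"
      using Suc.prems(2)[OF \<phi>(1)] e by simp
    also have "\<dots> = LI (\<lambda>t. g t * (deriv ^^ r) \<psi> t - ?m * (g t * (deriv ^^ r) \<theta> t))"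
      by (simp add: algebra_simps)
    also have "\<dots> = LI (\<lambda>t. g t * (deriv ^^ r) \<psi> t) - ?m * c"
      using s by (simp add: c_def)
    finally have 1: "LI (\<lambda>t. g t * (deriv ^^ r) \<psi> t) = ?m * c" by simp
    have "LI (\<lambda>t. poly p t * (deriv ^^ r) \<psi> t) = (-1) ^ r * LI (\<lambda>t. poly ((pderiv ^^ r) p) t * \<psi> t)"
      using chain_weak[OF chain_poly[of r p] order_refl \<psi>] by simp
    also have "\<dots> = c * ?m"
      unfolding p_def pderiv_monom_iter by (simp add: field_simps flip: power_mult_distrib)
    finally have 2: "LI (\<lambda>t. poly p t * (deriv ^^ r) \<psi> t) = c * ?m" .
    have "LI (\<lambda>t. (g t - poly p t) * (deriv ^^ r) \<psi> t) = LI (\<lambda>t. g t * (deriv ^^ r) \<psi> t - poly p t * (deriv ^^ r) \<psi> t)"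
      by (simp add: algebra_simps)
    also have "\<dots> = 0"
      using 1 2 s(1) sq_int_mult[OF sq_int_poly' tf_sq_int[OF tf_deriv_iter[OF \<psi>, of r]], of p] by simp
    finally show "LI (\<lambda>t. (g t - poly p t) * (deriv ^^ r) \<psi> t) = 0" .
  qed
  then obtain q where "AE t in MI. g t - poly p t = poly q t" by blast
  hence "AE t in MI. g t = poly (p + q) t" by eventually_elim simp
  thus ?case by blast
qed

text \<open>The \<open>l\<close>-fold primitive of \<open>g\<close> has the same \<open>l\<close>-th
  weak derivative as \<open>f\<close>. By du Bois-Reymond the two differ by a polynomial, and
  polynomials form chains with their derivatives.\<close>

lemma weak_deriv_chain:
  assumes f: "sq_int f" and g: "sq_int g"
    and w: "\<And>\<psi>. tf \<psi> \<Longrightarrow> LI (\<lambda>t. f t * (deriv ^^ l) \<psi> t) = (-1) ^ l * LI (\<lambda>t. g t * \<psi> t)"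
  obtains F where "chain l F" "AE t in MI. f t = F 0 t"
proof -
  let ?G = "\<lambda>j. (J ^^ (l - j)) g"
  have c: "chain l ?G" by (rule chain_J_iter[OF g])
  have G: "sq_int (?G 0)" using chain_sq_int[OF c, of 0] by simp
  have "\<exists>q. AE t in MI. f t - ?G 0 t = poly q t"
  proof (rule du_Bois_Reymond)
    show "sq_int (\<lambda>t. f t - ?G 0 t)" using f G by (rule sq_int_diff)
    fix \<psi> assume \<psi>: "tf \<psi>"
    note s = tf_sq_int[OF tf_deriv_iter[OF \<psi>, of l]]
    have "LI (\<lambda>t. (f t - ?G 0 t) * (deriv ^^ l) \<psi> t) = LI (\<lambda>t. f t * (deriv ^^ l) \<psi> t) - LI (\<lambda>t. ?G 0 t * (deriv ^^ l) \<psi> t)"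
      using sq_int_mult[OF f s] sq_int_mult[OF G s] by (simp add: left_diff_distrib)
    also have "LI (\<lambda>t. ?G 0 t * (deriv ^^ l) \<psi> t) = (-1) ^ l * LI (\<lambda>t. ?G l t * \<psi> t)"
      by (rule chain_weak[OF c order_refl \<psi>])
    finally show "LI (\<lambda>t. (f t - ?G 0 t) * (deriv ^^ l) \<psi> t) = 0" using w[OF \<psi>] by simp
  qed
  then obtain q where q: "AE t in MI. f t - ?G 0 t = poly q t" by blast
  show ?thesis
  proof (rule that)
    show "chain l (\<lambda>j t. 1 * ?G j t + 1 * poly ((pderiv ^^ j) q) t)" by (rule chain_lin[OF c chain_poly])
    show "AE t in MI. f t = 1 * ?G 0 t + 1 * poly ((pderiv ^^ 0) q) t" using q by eventually_elim simp
  qed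
qed

section \<open>Constant-coefficient operators and scalar weak equations\<close>

definition diff_op :: "real poly \<Rightarrow> (real \<Rightarrow> real) \<Rightarrow> real \<Rightarrow> real" where
  "diff_op p \<psi> t = (\<Sum>j\<le>degree p. coeff p j * (deriv ^^ j) \<psi> t)"

lemma diff_op_sum: "degree p \<le> n \<Longrightarrow> diff_op p \<psi> t = (\<Sum>j\<le>n. coeff p j * (deriv ^^ j) \<psi> t)"
  unfolding diff_op_def by (rule sum.mono_neutral_left) (auto simp: coeff_eq_0)

lemma diff_op_0 [simp]: "diff_op 0 \<psi> t = 0" by (simp add: diff_op_def)

lemma diff_op_add: "diff_op (p + q) \<psi> t = diff_op p \<psi> t + diff_op q \<psi> t"
proof -
  let ?n = "max (degree p) (degree q)"
  have "diff_op (p + q) \<psi> t = (\<Sum>j\<le>?n. coeff (p + q) j * (deriv ^^ j) \<psi> t)"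
    by (rule diff_op_sum) (rule degree_add_le_max)
  thus ?thesis using diff_op_sum[of p ?n] diff_op_sum[of q ?n] by (simp add: sum.distrib distrib_right)
qed

lemma diff_op_smult: "diff_op (smult c p) \<psi> t = c * diff_op p \<psi> t"
  using diff_op_sum[of "smult c p" "degree p"] by (simp add: diff_op_def sum_distrib_left mult.assoc)

lemma diff_op_poly_sum: "diff_op (\<Sum>i\<in>A. p i) \<psi> t = (\<Sum>i\<in>A. diff_op (p i) \<psi> t)"
  by (induction A rule: infinite_finite_induct) (auto simp: diff_op_add)

lemma diff_op_monom: "diff_op (monom c i) \<psi> t = c * (deriv ^^ i) \<psi> t"
  using diff_op_sum[of "monom c i" i] degree_monom_le[of c i]
  by (simp add: if_distrib[of "\<lambda>x. x * _"] sum.delta' cong: if_cong)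

lemma diff_op_pCons: "diff_op (pCons a p) \<psi> t = a * \<psi> t + diff_op p (deriv \<psi>) t"
proof -
  have "diff_op (pCons a p) \<psi> t = (\<Sum>j\<le>Suc (degree p). coeff (pCons a p) j * (deriv ^^ j) \<psi> t)"
    by (rule diff_op_sum) (rule degree_pCons_le)
  thus ?thesis by (simp add: sum.atMost_Suc_shift diff_op_def funpow_swap1 del: sum.atMost_Suc)
qed

lemma tf_diff_op: "tf \<psi> \<Longrightarrow> tf (diff_op p \<psi>)"
  unfolding diff_op_def [abs_def] by (intro tf_sum tf_cmult tf_deriv_iter)

lemma smooth_diff_op: "smooth_on UNIV \<psi> \<Longrightarrow> smooth_on UNIV (diff_op p \<psi>)"
  unfolding diff_op_def [abs_def] by (intro smooth_on_sum smooth_on_cmult smooth_deriv_iter)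

lemma diff_op_lin: assumes "smooth_on UNIV f" "smooth_on UNIV g"
  shows "diff_op p (\<lambda>t. a * f t + b * g t) t = a * diff_op p f t + b * diff_op p g t"
  by (simp add: diff_op_def deriv_iter_lin[OF assms] sum_distrib_left distrib_left sum.distrib ac_simps)

lemma diff_op_fun_sum: "finite A \<Longrightarrow> (\<And>i. i \<in> A \<Longrightarrow> smooth_on UNIV (f i)) \<Longrightarrow>
    diff_op p (\<lambda>t. \<Sum>i\<in>A. c i * f i t) t = (\<Sum>i\<in>A. c i * diff_op p (f i) t)"
proof (induction A rule: finite_induct)
  case empty
  show ?case using diff_op_lin[OF smooth_on_const[of _ 0] smooth_on_const[of _ 0], of p 0 0 t] by simp
next
  case (insert x A)
  thus ?case using diff_op_lin[of "f x" "\<lambda>t. \<Sum>i\<in>A. c i * f i t" p "c x" 1 t]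
    by (simp add: smooth_on_sum smooth_on_cmult)
qed

lemma diff_op_deriv: assumes "smooth_on UNIV \<psi>" shows "deriv (diff_op p \<psi>) = diff_op p (deriv \<psi>)"
proof
  fix t
  have "(diff_op p \<psi> has_real_derivative (\<Sum>j\<le>degree p. coeff p j * deriv ((deriv ^^ j) \<psi>) t)) (at t)"
    unfolding diff_op_def [abs_def]
    by (intro derivative_intros DERIV_cmult smooth_deriv smooth_deriv_iter assms)
  hence "deriv (diff_op p \<psi>) t = (\<Sum>j\<le>degree p. coeff p j * deriv ((deriv ^^ j) \<psi>) t)" by (rule DERIV_imp_deriv)
  thus "deriv (diff_op p \<psi>) t = diff_op p (deriv \<psi>) t" by (simp add: diff_op_def funpow_swap1)
qed

lemma diff_op_mult: "smooth_on UNIV \<psi> \<Longrightarrow> diff_op (p * q) \<psi> t = diff_op p (diff_op q \<psi>) t"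
proof (induction p arbitrary: \<psi> t)
  case (pCons a p)
  have "diff_op (pCons a p * q) \<psi> t = a * diff_op q \<psi> t + diff_op (p * q) (deriv \<psi>) t"
    by (simp add: diff_op_add diff_op_smult diff_op_pCons)
  also have "diff_op (p * q) (deriv \<psi>) t = diff_op p (diff_op q (deriv \<psi>)) t"
    using pCons smooth_deriv(1) by blast
  also have "diff_op q (deriv \<psi>) = deriv (diff_op q \<psi>)" using diff_op_deriv pCons by simp
  finally show ?case by (simp add: diff_op_pCons)
qed simp

text \<open>Integrating the weak equation \<open>degree D\<close> times makes it an equation between
  primitives of \<open>v\<close>, true up to a polynomial by du Bois-Reymond. Solved for
  \<open>v\<close>, it expresses \<open>v\<close> by its own primitives, which bootstraps
  regularity.\<close>

lemma weak_ode_smooth: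
  assumes v: "sq_int v" and D: "D \<noteq> 0" and w: "\<And>\<psi>. tf \<psi> \<Longrightarrow> LI (\<lambda>t. v t * diff_op D \<psi> t) = 0"
  obtains f where "smooth_on {-1..1} f" "AE t in MI. v t = f t"
proof -
  let ?r = "degree D"
  let ?d = "coeff D ?r"
  have d0: "?d \<noteq> 0" using D by simp
  let ?V = "\<lambda>j. (J ^^ (?r - j)) v"
  \<comment> \<open>The term of order \<open>j\<close> is replaced by a \<open>(?r - j)\<close>-fold
    primitive with the corresponding sign, so that all terms are tested against the derivative of
    order \<open>?r\<close> of \<open>\<psi>\<close>.\<close>
  let ?g = "\<lambda>t. \<Sum>j\<le>?r. (coeff D j * (-1) ^ (?r - j)) * ?V j t"
  have ch: "chain (?r - j) (\<lambda>i. (J ^^ (?r - j - i)) v)" for j by (rule chain_J_iter[OF v])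
  have sV: "sq_int (?V j)" for j using chain_sq_int[OF ch[of j], of 0] by simp
  have "\<exists>q. AE t in MI. ?g t = poly q t"
  proof (rule du_Bois_Reymond)
    show "sq_int ?g" by (intro sq_int_sum sq_int_cmult sV)
    fix \<psi> assume \<psi>: "tf \<psi>"
    note s = tf_sq_int[OF tf_deriv_iter[OF \<psi>]]
    have e: "LI (\<lambda>t. ?V j t * (deriv ^^ ?r) \<psi> t) = (-1) ^ (?r - j) * LI (\<lambda>t. v t * (deriv ^^ j) \<psi> t)" if "j \<le> ?r" for j
    proof -
      have "(deriv ^^ ?r) \<psi> = (deriv ^^ (?r - j)) ((deriv ^^ j) \<psi>)"
        using that by (simp add: funpow_add[symmetric, THEN fun_cong, unfolded o_def])
      thus ?thesis using chain_weak[OF ch[of j] order_refl tf_deriv_iter[OF \<psi>, of j]] by simp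
    qed
    have "LI (\<lambda>t. ?g t * (deriv ^^ ?r) \<psi> t) = LI (\<lambda>t. \<Sum>j\<le>?r. (coeff D j * (-1) ^ (?r - j)) * (?V j t * (deriv ^^ ?r) \<psi> t))"
      by (simp add: sum_distrib_right mult.assoc)
    also have "\<dots> = (\<Sum>j\<le>?r. (coeff D j * (-1) ^ (?r - j)) * LI (\<lambda>t. ?V j t * (deriv ^^ ?r) \<psi> t))"
      using sq_int_mult[OF sV s] by simp
    also have "\<dots> = (\<Sum>j\<le>?r. coeff D j * LI (\<lambda>t. v t * (deriv ^^ j) \<psi> t))"
      by (rule sum.cong) (auto simp: e mult.assoc[symmetric] power_mult_distrib[symmetric])
    also have "\<dots> = LI (\<lambda>t. v t * diff_op D \<psi> t)"
    proof -
      have "v t * diff_op D \<psi> t = (\<Sum>j\<le>?r. coeff D j * (v t * (deriv ^^ j) \<psi> t))" for t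
        by (simp add: diff_op_def sum_distrib_left mult.left_commute)
      thus ?thesis using sq_int_mult[OF v s] by simp
    qed
    finally show "LI (\<lambda>t. ?g t * (deriv ^^ ?r) \<psi> t) = 0" using w[OF \<psi>] by simp
  qed
  then obtain q where q: "AE t in MI. ?g t = poly q t" by blast
  define c where "c i = coeff D (?r - i) * (-1) ^ i / ?d" for i
  \<comment> \<open>Division by the leading coefficient solves for \<open>v\<close>. The right-hand
    side contains only a polynomial and primitives of \<open>v\<close>, hence is a continuous
    representative.\<close>
  define f where "f t = poly (smult (1 / ?d) q) t - (\<Sum>i=1..?r. c i * (J ^^ i) v t)" for t
  have g: "?g t = ?d * (v t + (\<Sum>i=1..?r. c i * (J ^^ i) v t))" for t
  proof -
    have "?g t = (\<Sum>i\<le>?r. (coeff D (?r - i) * (-1) ^ i) * (J ^^ i) v t)"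
      by (rule sum.reindex_bij_witness[of _ "\<lambda>i. ?r - i" "\<lambda>i. ?r - i"]) auto
    also have "\<dots> = (\<Sum>i\<le>?r. ?d * (c i * (J ^^ i) v t))" using d0 by (simp add: c_def)
    also have "\<dots> = ?d * (c 0 * v t) + (\<Sum>i=1..?r. ?d * (c i * (J ^^ i) v t))"
      by (simp add: atMost_atLeast0 sum.atLeast_Suc_atMost)
    finally show ?thesis using d0 by (simp add: c_def distrib_left sum_distrib_left mult.assoc)
  qed
  have vf: "AE t in MI. v t = f t" using q
  proof eventually_elim
    case (elim t)
    show ?case using elim d0 unfolding g f_def by (simp add: field_simps)
  qed
  have cf: "continuous_on {-1..1} f"
  proof -
    have "continuous_on {-1..1} ((J ^^ i) v)" if "i \<ge> 1" for i
      using that sq_int_J_iter[OF v] by (cases i) (auto intro: J_cont)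
    thus ?thesis unfolding f_def [abs_def] by (intro continuous_intros) auto
  qed
  \<comment> \<open>Primitives ignore null sets, so \<open>v\<close> may be replaced by
    \<open>f\<close> under every \<open>J\<close>; the equation for \<open>f\<close> then holds at
    every point of \<open>{-1..1}\<close>.\<close>
  have Jf: "(J ^^ i) v t = (J ^^ i) f t" if "1 \<le> i" "t \<in> {-1..1}" for i t
    using that
  proof (induction i arbitrary: t)
    case (Suc i)
    show ?case
    proof (cases "i = 0")
      case True thus ?thesis using J_cong_AE[OF vf] Suc by simp
    next
      case False thus ?thesis using Suc by (auto intro!: J_cong)
    qed
  qed simp
  have f_eq: "f t = poly (smult (1 / ?d) q) t - (\<Sum>i=1..?r. c i * (J ^^ i) f t)" if "t \<in> {-1..1}" for t
    using Jf[OF _ that] by (simp add: f_def)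
  \<comment> \<open>Differentiation lowers the order of each primitive by one. The term with
    \<open>i = 0\<close> contains \<open>f\<close> itself and is differentiated through its
    equation, so the class is closed.\<close>
  let ?K = "{h. \<exists>p b. h = (\<lambda>t. poly p t + (\<Sum>i\<le>?r. b i * (J ^^ i) f t))}"
  have cJ: "continuous_on {-1..1} ((J ^^ i) f)" for i
    by (induction i) (auto intro: cf J_cont sq_int_cont)
  have dJ: "((J ^^ Suc i) f has_real_derivative (J ^^ i) f t) (at t within {-1..1})" if "t \<in> {-1..1}" for i t
    using J_deriv[OF cJ that] by simp
  define df where "df t = poly (pderiv (smult (1 / ?d) q)) t - (\<Sum>i=1..?r. c i * (J ^^ (i - 1)) f t)" for t
  have dfd: "(f has_real_derivative df t) (at t within {-1..1})" if t: "t \<in> {-1..1}" for t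
  proof -
    have "((J ^^ i) f has_real_derivative (J ^^ (i - 1)) f t) (at t within {-1..1})" if "i \<in> {1..?r}" for i
      using dJ[OF t, of "i - 1"] that by (cases i) auto
    hence "((\<lambda>t. poly (smult (1 / ?d) q) t - (\<Sum>i=1..?r. c i * (J ^^ i) f t)) has_real_derivative df t) (at t within {-1..1})"
      unfolding df_def by (intro derivative_intros DERIV_cmult has_field_derivative_at_within[OF poly_DERIV]) auto
    thus ?thesis
    proof (rule has_field_derivative_transform_within)
      show "(0::real) < 1" "t \<in> {-1..1}" using t by simp_all
      fix x :: real assume "x \<in> {-1..1}"
      thus "poly (smult (1 / ?d) q) x - (\<Sum>i=1..?r. c i * (J ^^ i) f x) = f x" by (rule f_eq[symmetric])
    qed
  qed
  have "smooth_on {-1..1} f"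
  proof (rule smooth_on_class[of f ?K])
    show "f \<in> ?K"
      by (auto intro!: exI[of _ 0] exI[of _ "\<lambda>i. if i = 0 then 1 else 0"] simp: fun_eq_iff if_distrib[of "\<lambda>x. x * _"] cong: if_cong)
    fix h assume "h \<in> ?K"
    then obtain p b where h: "h = (\<lambda>t. poly p t + (\<Sum>i\<le>?r. b i * (J ^^ i) f t))" by auto
    define p' where "p' = pderiv p + smult (b 0) (pderiv (smult (1 / ?d) q))"
    define b' where "b' i = (if i < ?r then b (Suc i) - b 0 * c (Suc i) else 0)" for i
    have "(h has_real_derivative poly p' t + (\<Sum>i\<le>?r. b' i * (J ^^ i) f t)) (at t within {-1..1})" if t: "t \<in> {-1..1}" for t
    proof -
      have h': "h = (\<lambda>t. poly p t + (b 0 * f t + (\<Sum>i<?r. b (Suc i) * (J ^^ Suc i) f t)))"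
        unfolding h by (simp add: sum.atMost_shift lessThan_Suc_atMost)
      have "(h has_real_derivative poly (pderiv p) t + (b 0 * df t + (\<Sum>i<?r. b (Suc i) * (J ^^ i) f t))) (at t within {-1..1})"
        unfolding h' by (intro derivative_intros DERIV_cmult dJ dfd t has_field_derivative_at_within[OF poly_DERIV])
      also have "poly (pderiv p) t + (b 0 * df t + (\<Sum>i<?r. b (Suc i) * (J ^^ i) f t)) = poly p' t + (\<Sum>i<?r. b' i * (J ^^ i) f t)"
      proof -
        have "(\<Sum>i=1..?r. c i * (J ^^ (i - 1)) f t) = (\<Sum>i<?r. c (Suc i) * (J ^^ i) f t)"
          by (rule sum.reindex_bij_witness[of _ Suc "\<lambda>i. i - 1"]) auto
        thus ?thesis by (simp add: df_def p'_def b'_def algebra_simps sum_distrib_left sum_subtractf)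
      qed
      also have "(\<Sum>i<?r. b' i * (J ^^ i) f t) = (\<Sum>i\<le>?r. b' i * (J ^^ i) f t)"
        by (rule sum.mono_neutral_left) (auto simp: b'_def)
      finally show ?thesis .
    qed
    thus "\<exists>h'\<in>?K. \<forall>t\<in>{-1..1}. (h has_real_derivative h' t) (at t within {-1..1})"
      by (intro bexI[of _ "\<lambda>t. poly p' t + (\<Sum>i\<le>?r. b' i * (J ^^ i) f t)"]) auto
  qed
  thus ?thesis using vf by (rule that)
qed

section \<open>Linear state equations\<close>

lemma J_mono_bound:
  assumes "sq_int f" "sq_int g" "t \<in> {-1..1}" "\<And>s. s \<in> {-1..t} \<Longrightarrow> \<bar>f s\<bar> \<le> g s"
  shows "\<bar>J f t\<bar> \<le> J g t"
  unfolding J_def using integral_norm_bound_integral[of f "{-1..t}" g] assms sq_int_J_int[of f "-1" t] sq_int_J_int[of g "-1" t]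
  by auto

lemma DERIV_within_transform:
  assumes "(f has_real_derivative D) (at t within S)" "t \<in> S" "\<And>x. x \<in> S \<Longrightarrow> f x = g x"
  shows "(g has_real_derivative D) (at t within S)"
  using has_field_derivative_transform_within[where d = 1 and g = g, OF assms(1) _ assms(2)] assms(3) by simp

lemma J_lin_sum:
  assumes "\<And>j. j \<in> S \<Longrightarrow> sq_int (f j)" "t \<le> 1"
  shows "J (\<lambda>s. \<Sum>j\<in>S. a j * f j s) t = (\<Sum>j\<in>S. a j * J (f j) t)"
proof -
  have "J (\<lambda>s. \<Sum>j\<in>S. a j * f j s) t = (\<Sum>j\<in>S. J (\<lambda>s. a j * f j s) t)"
    by (rule J_sum) (use assms in \<open>auto intro: sq_int_cmult\<close>)
  thus ?thesis by (simp add: J_cmult)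
qed

lemma J_uniform_limit:
  assumes u: "uniform_limit {-1..1} f g sequentially" and s: "\<And>k. sq_int (f k)" "sq_int g" and t: "t \<in> {-1..1}"
  shows "(\<lambda>k. J (f k) t) \<longlonglongrightarrow> J g t"
proof (rule LIMSEQ_I)
  fix r :: real assume r: "0 < r"
  have "eventually (\<lambda>k. \<forall>x\<in>{-1..1}. dist (f k x) (g x) < r / 3) sequentially"
    by (rule uniform_limitD[OF u]) (use r in simp)
  then obtain N where N: "\<And>k x. N \<le> k \<Longrightarrow> x \<in> {-1..1} \<Longrightarrow> \<bar>f k x - g x\<bar> < r / 3"
    unfolding eventually_sequentially dist_real_def by metis
  show "\<exists>no. \<forall>k\<ge>no. norm (J (f k) t - J g t) < r"
  proof (intro exI allI impI)
    fix k assume k: "N \<le> k"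
    have "J (f k) t - J g t = J (\<lambda>s. f k s - g s) t" using J_diff[OF s(1)[of k] s(2), of t] t by simp
    also have "\<bar>\<dots>\<bar> \<le> r / 3 * (t + 1)"
    proof (rule J_abs_le_sup[OF sq_int_diff[OF s] t])
      fix x assume "x \<in> {-1..t}"
      hence "x \<in> {-1..1}" using t by auto
      thus "\<bar>f k x - g x\<bar> \<le> r / 3" using N[OF k] by (meson less_imp_le)
    qed (use r in simp)
    also have "\<dots> \<le> r / 3 * 2" using t r by (intro mult_left_mono) auto
    also have "\<dots> < r" using r by simp
    finally show "norm (J (f k) t - J g t) < r" by simp
  qed
qed

lemma matrix_row_bound:
  fixes A :: "nat \<Rightarrow> nat \<Rightarrow> real"
  assumes "i < n" shows "(\<Sum>j<n. \<bar>A i j\<bar>) \<le> (\<Sum>i<n. \<Sum>j<n. \<bar>A i j\<bar>)"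
  using sum_nonneg_leq_bound[of "{..<n}" "\<lambda>i. \<Sum>j<n. \<bar>A i j\<bar>" _ i] assms
  by (auto intro!: sum_nonneg member_le_sum[of i "{..<n}" "\<lambda>i. \<Sum>j<n. \<bar>A i j\<bar>"])

text \<open>Neumann series of the Volterra operator \<open>x \<mapsto> J (A x)\<close>, with
  \<open>D k\<close> its \<open>k\<close>-th term. \<open>K\<close> bounds all row sums of
  \<open>A\<close>, repeated integration of powers of \<open>s + 1\<close> produces the factorial,
  and \<open>t + 1 \<le> 2\<close> accounts for \<open>exp (2 * K)\<close>.\<close>

lemma volterra_exists:
  fixes A :: "nat \<Rightarrow> nat \<Rightarrow> real" and d :: "nat \<Rightarrow> real \<Rightarrow> real" and n :: nat
  defines "K \<equiv> \<Sum>i<n. \<Sum>j<n. \<bar>A i j\<bar>"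
  assumes dc: "\<And>i. i < n \<Longrightarrow> continuous_on {-1..1} (d i)"
    and dM: "\<And>i t. i < n \<Longrightarrow> t \<in> {-1..1} \<Longrightarrow> \<bar>d i t\<bar> \<le> M" and M: "0 \<le> M"
  obtains x where "\<And>i. i < n \<Longrightarrow> continuous_on {-1..1} (x i)"
    and "\<And>i t. i < n \<Longrightarrow> t \<in> {-1..1} \<Longrightarrow> x i t = d i t + J (\<lambda>s. \<Sum>j<n. A i j * x j s) t"
    and "\<And>i t. i < n \<Longrightarrow> t \<in> {-1..1} \<Longrightarrow> \<bar>x i t\<bar> \<le> M * exp (2 * K)"
proof -
  define D where "D = rec_nat d (\<lambda>_ X i t. J (\<lambda>s. \<Sum>j<n. A i j * X j s) t)"
  have D0: "D 0 = d" and DS: "D (Suc k) i = J (\<lambda>s. \<Sum>j<n. A i j * D k j s)" for k i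
    by (simp_all add: D_def)
  have K: "0 \<le> K" unfolding K_def by (intro sum_nonneg) auto
  have Dc: "continuous_on {-1..1} (D k i)" if "i < n" for k i
    using that
  proof (induction k arbitrary: i)
    case 0 thus ?case by (simp add: D0 dc)
  next
    case (Suc k)
    show ?case unfolding DS by (intro J_cont sq_int_sum sq_int_cmult sq_int_cont Suc.IH) auto
  qed
  have Dsq: "sq_int (D k i)" if "i < n" for k i by (intro sq_int_cont Dc that)
  have Db: "\<bar>D k i t\<bar> \<le> M * (K * (t + 1)) ^ k / fact k" if "i < n" "t \<in> {-1..1}" for k i t
    using that
  proof (induction k arbitrary: i t)
    case 0 thus ?case using dM by (simp add: D0)
  next
    case (Suc k)
    let ?g = "\<lambda>s. K * (M * (K * (s + 1)) ^ k / fact k)"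
    have cg: "continuous_on {-1..1} ?g" by (intro continuous_intros) auto
    have "\<bar>J (\<lambda>s. \<Sum>j<n. A i j * D k j s) t\<bar> \<le> J ?g t"
    proof (rule J_mono_bound)
      show "sq_int (\<lambda>s. \<Sum>j<n. A i j * D k j s)" by (intro sq_int_sum sq_int_cmult Dsq) auto
      show "sq_int ?g" by (rule sq_int_cont[OF cg])
      fix s assume s: "s \<in> {-1..t}"
      hence s1: "s \<in> {-1..1}" using Suc.prems by auto
      let ?b = "M * (K * (s + 1)) ^ k / fact k"
      have b: "0 \<le> ?b" using M K s by (intro divide_nonneg_nonneg mult_nonneg_nonneg zero_le_power) auto
      have "\<bar>\<Sum>j<n. A i j * D k j s\<bar> \<le> (\<Sum>j<n. \<bar>A i j\<bar> * ?b)"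
      proof (rule order_trans[OF sum_abs sum_mono])
        fix j assume "j \<in> {..<n}"
        thus "\<bar>A i j * D k j s\<bar> \<le> \<bar>A i j\<bar> * ?b"
          unfolding abs_mult using Suc.IH[of j s] s1 by (intro mult_left_mono) auto
      qed
      also have "\<dots> = (\<Sum>j<n. \<bar>A i j\<bar>) * ?b" by (rule sum_distrib_right[symmetric])
      also have "\<dots> \<le> K * ?b"
        by (rule mult_right_mono[OF _ b]) (use matrix_row_bound[OF Suc.prems(1)] in \<open>simp add: K_def\<close>)
      finally show "\<bar>\<Sum>j<n. A i j * D k j s\<bar> \<le> ?g s" .
    qed fact
    also have "J ?g t = M * (K * (t + 1)) ^ Suc k / fact (Suc k) - M * (K * (-1 + 1)) ^ Suc k / fact (Suc k)"
    proof (rule J_FTC)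
      fix t :: real
      have "((\<lambda>t. M * (K * (t + 1)) ^ Suc k / fact (Suc k)) has_real_derivative
         M * (real (Suc k) * (K * (t + 1)) ^ k * K) / fact (Suc k)) (at t within {-1..1})"
      proof -
        have "((\<lambda>t. K * (t + 1)) has_real_derivative K) (at t within {-1..1})"
          by (auto intro!: derivative_eq_intros)
        from DERIV_cdivide[OF DERIV_cmult[OF DERIV_power[OF this, of "Suc k"], of M], of "fact (Suc k)"]
        show ?thesis by (simp only: diff_Suc_1 One_nat_def[symmetric] mult.assoc mult.commute[of K "_ ^ k"])
      qed
      moreover have "M * (real (Suc k) * (K * (t + 1)) ^ k * K) / fact (Suc k) = ?g t"
        unfolding fact_Suc by (simp add: divide_simps del: of_nat_Suc)
      ultimately show "((\<lambda>t. M * (K * (t + 1)) ^ Suc k / fact (Suc k)) has_real_derivative ?g t) (at t within {-1..1})" by (simp only:)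
    qed fact
    finally show ?case by (simp add: DS)
  qed
  define x where "x i t = (\<Sum>k. D k i t)" for i t
  let ?m = "\<lambda>k. M * ((2 * K) ^ k /\<^sub>R fact k)"
  have sm: "summable ?m" by (intro summable_mult summable_exp_generic)
  have Db2: "norm (D k i t) \<le> ?m k" if "i < n" "t \<in> {-1..1}" for k i t
  proof -
    have "\<bar>D k i t\<bar> \<le> M * (K * (t + 1)) ^ k / fact k" by (rule Db[OF that])
    also have "\<dots> \<le> M * (K * 2) ^ k / fact k"
      using that K M by (intro divide_right_mono mult_left_mono power_mono) auto
    finally show ?thesis by (simp add: ac_simps divide_inverse)
  qed
  have ul: "uniform_limit {-1..1} (\<lambda>N t. \<Sum>k<N. D k i t) (x i) sequentially" if "i < n" for i
    unfolding x_def [abs_def] by (rule Weierstrass_m_test[OF Db2[OF that] sm])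
  have xc: "continuous_on {-1..1} (x i)" if "i < n" for i
    by (rule uniform_limit_theorem[OF _ ul[OF that]])
       (auto intro!: always_eventually continuous_intros Dc that)
  have xsq: "sq_int (x i)" if "i < n" for i by (intro sq_int_cont xc that)
  show ?thesis
  proof (rule that)
    fix i t assume i: "i < n" and t: "t \<in> {-1..1::real}"
    have S: "(\<Sum>k<Suc N. D k i t) = d i t + J (\<lambda>s. \<Sum>j<n. A i j * (\<Sum>k<N. D k j s)) t" for N
    proof -
      have "(\<Sum>k<Suc N. D k i t) = d i t + (\<Sum>k<N. D (Suc k) i t)"
        by (simp add: sum.lessThan_Suc_shift D0 del: sum.lessThan_Suc)
      also have "(\<Sum>k<N. D (Suc k) i t) = J (\<lambda>s. \<Sum>k<N. \<Sum>j<n. A i j * D k j s) t"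
        unfolding DS by (rule J_sum[symmetric]) (use t in \<open>auto intro!: sq_int_sum sq_int_cmult Dsq\<close>)
      also have "(\<lambda>s. \<Sum>k<N. \<Sum>j<n. A i j * D k j s) = (\<lambda>s. \<Sum>j<n. A i j * (\<Sum>k<N. D k j s))"
        by (subst sum.swap) (simp add: sum_distrib_left)
      finally show ?thesis .
    qed
    have sq: "sq_int (\<lambda>s. \<Sum>k<N. D k j s)" if "j < n" for j N by (intro sq_int_sum Dsq that)
    have "(\<lambda>N. d i t + (\<Sum>j<n. A i j * J (\<lambda>s. \<Sum>k<N. D k j s) t)) \<longlonglongrightarrow> d i t + (\<Sum>j<n. A i j * J (x j) t)"
      by (intro tendsto_intros J_uniform_limit[OF ul] sq xsq t) auto
    moreover have "(\<Sum>j<n. A i j * J (\<lambda>s. \<Sum>k<N. D k j s) t) = J (\<lambda>s. \<Sum>j<n. A i j * (\<Sum>k<N. D k j s)) t" for N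
      by (rule J_lin_sum[symmetric]) (use t sq in auto)
    moreover have "(\<Sum>j<n. A i j * J (x j) t) = J (\<lambda>s. \<Sum>j<n. A i j * x j s) t"
      by (rule J_lin_sum[symmetric]) (use t xsq in auto)
    ultimately have "(\<lambda>N. \<Sum>k<Suc N. D k i t) \<longlonglongrightarrow> d i t + J (\<lambda>s. \<Sum>j<n. A i j * x j s) t"
      unfolding S by simp
    moreover have "(\<lambda>N. \<Sum>k<Suc N. D k i t) \<longlonglongrightarrow> x i t"
      using tendsto_uniform_limitI[OF ul[OF i] t] by (rule LIMSEQ_Suc)
    ultimately show "x i t = d i t + J (\<lambda>s. \<Sum>j<n. A i j * x j s) t" by (rule LIMSEQ_unique[rotated])
    have "norm (x i t) \<le> (\<Sum>k. ?m k)"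
      unfolding x_def by (rule norm_suminf_le[OF Db2[OF i t] sm])
    also have "\<dots> = M * exp (2 * K)" unfolding exp_def by (rule suminf_mult[OF summable_exp_generic])
    finally show "\<bar>x i t\<bar> \<le> M * exp (2 * K)" by simp
  qed (rule xc)
qed

text \<open>The uniqueness principle behind all invariance arguments.\<close>

lemma flat_zero:
  fixes h :: "nat \<Rightarrow> real \<Rightarrow> real"
  assumes d: "\<And>k t. t \<in> {a..b} \<Longrightarrow> (h k has_real_derivative h (Suc k) t) (at t within {a..b})"
    and B: "\<And>k t. t \<in> {a..b} \<Longrightarrow> \<bar>h k t\<bar> \<le> M * K ^ k"
    and c: "c \<in> {a..b}" "\<And>k. h k c = 0" and t: "t \<in> {a..b}"
  shows "h 0 t = 0"
proof -
  have "\<bar>h 0 t\<bar> \<le> M * K * \<bar>t - c\<bar> * ((K * \<bar>t - c\<bar>) ^ N /\<^sub>R fact N)" for N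
  proof -
    \<comment> \<open>All Taylor coefficients at \<open>c\<close> vanish, so the value is pure
      remainder; the geometric bounds on the derivatives make it tend to 0 as \<open>N\<close>
      grows.\<close>
    have "norm (h 0 t - (\<Sum>i\<le>N. h i c * (t - c) ^ i / fact i)) \<le> M * K ^ Suc N * norm (t - c) ^ Suc N / fact N"
    proof (rule field_Taylor[where S = "{a..b}"])
      fix x assume "x \<in> {a..b}"
      thus "norm (h (Suc N) x) \<le> M * K ^ Suc N" using B[of x "Suc N"] by (simp only: real_norm_def)
    qed (use c t d in auto)
    also have "\<dots> = M * K * \<bar>t - c\<bar> * ((K * \<bar>t - c\<bar>) ^ N /\<^sub>R fact N)" by (simp add: power_mult_distrib divide_inverse)
    finally show ?thesis using c(2) by simp
  qed
  moreover have "(\<lambda>N. M * K * \<bar>t - c\<bar> * ((K * \<bar>t - c\<bar>) ^ N /\<^sub>R fact N)) \<longlonglongrightarrow> M * K * \<bar>t - c\<bar> * 0"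
    by (intro tendsto_intros summable_LIMSEQ_zero summable_exp_generic)
  ultimately have "\<bar>h 0 t\<bar> \<le> M * K * \<bar>t - c\<bar> * 0" by (intro LIMSEQ_le_const) auto
  thus ?thesis by simp
qed

text \<open>The row vector \<open>\<xi> A\<close>. Its iterates are the covectors
  \<open>\<xi> A^k\<close> that detect reachability and observability.\<close>

definition vm :: "nat \<Rightarrow> (nat \<Rightarrow> nat \<Rightarrow> real) \<Rightarrow> (nat \<Rightarrow> real) \<Rightarrow> nat \<Rightarrow> real" where
  "vm n A \<xi> j = (\<Sum>i<n. \<xi> i * A i j)"

lemma vm_iter_bound:
  "(\<Sum>j<n. \<bar>(vm n A ^^ k) \<xi> j\<bar>) \<le> (\<Sum>j<n. \<bar>\<xi> j\<bar>) * (\<Sum>i<n. \<Sum>j<n. \<bar>A i j\<bar>) ^ k"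
proof (induction k)
  case (Suc k)
  let ?v = "(vm n A ^^ k) \<xi>" and ?K = "\<Sum>i<n. \<Sum>j<n. \<bar>A i j\<bar>"
  have K: "0 \<le> ?K" by (intro sum_nonneg) auto
  have "(\<Sum>j<n. \<bar>(vm n A ^^ Suc k) \<xi> j\<bar>) \<le> (\<Sum>j<n. \<Sum>i<n. \<bar>?v i\<bar> * \<bar>A i j\<bar>)"
    by (intro sum_mono) (simp add: vm_def sum_abs[THEN order_trans] abs_mult[symmetric])
  also have "\<dots> = (\<Sum>i<n. \<bar>?v i\<bar> * (\<Sum>j<n. \<bar>A i j\<bar>))" by (subst sum.swap) (simp add: sum_distrib_left)
  also have "\<dots> \<le> (\<Sum>i<n. \<bar>?v i\<bar> * ?K)"
    by (intro sum_mono mult_left_mono matrix_row_bound) auto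
  also have "\<dots> = (\<Sum>i<n. \<bar>?v i\<bar>) * ?K" by (simp add: sum_distrib_right)
  also have "\<dots> \<le> (\<Sum>j<n. \<bar>\<xi> j\<bar>) * ?K ^ k * ?K" by (rule mult_right_mono[OF Suc K])
  finally show ?case by (simp add: ac_simps)
qed simp

text \<open>The integrated state equation is meaningful for square-integrable inputs, for which the
  state need not be differentiable everywhere. Initial values are free, and outputs are described
  separately by \<open>out\<close>.\<close>

definition traj :: "nat \<Rightarrow> nat \<Rightarrow> (nat \<Rightarrow> nat \<Rightarrow> real) \<Rightarrow> (nat \<Rightarrow> nat \<Rightarrow> real) \<Rightarrow>
    (nat \<Rightarrow> real \<Rightarrow> real) \<Rightarrow> (nat \<Rightarrow> real \<Rightarrow> real) \<Rightarrow> bool" where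
  "traj n m A B u x \<longleftrightarrow> (\<forall>a<m. sq_int (u a)) \<and> (\<forall>i<n. continuous_on {-1..1} (x i)) \<and>
     (\<forall>i<n. \<forall>t\<in>{-1..1}. x i t = x i (-1) + J (\<lambda>s. (\<Sum>j<n. A i j * x j s) + (\<Sum>a<m. B i a * u a s)) t)"

lemma traj_cont: "traj n m A B u x \<Longrightarrow> i < n \<Longrightarrow> continuous_on {-1..1} (x i)"
  unfolding traj_def by blast

lemma traj_u: "traj n m A B u x \<Longrightarrow> a < m \<Longrightarrow> sq_int (u a)"
  unfolding traj_def by blast

lemma traj_x: "traj n m A B u x \<Longrightarrow> i < n \<Longrightarrow> sq_int (x i)"
  by (intro sq_int_cont traj_cont)

lemma traj_J: "traj n m A B u x \<Longrightarrow> i < n \<Longrightarrow> t \<in> {-1..1} \<Longrightarrow>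
    x i t = x i (-1) + J (\<lambda>s. (\<Sum>j<n. A i j * x j s) + (\<Sum>a<m. B i a * u a s)) t"
  unfolding traj_def by blast

lemma traj_rhs: assumes "traj n m A B u x" shows "sq_int (\<lambda>s. (\<Sum>j<n. A i j * x j s) + (\<Sum>a<m. B i a * u a s))"
  by (intro sq_int_add sq_int_sum sq_int_cmult traj_x[OF assms] traj_u[OF assms]) auto

text \<open>The input term is absorbed into the free term of a Volterra equation. The bound is
  linear in the initial state and the L2 norms of the inputs; this continuity of the input-to-state
  map is what \<open>traj_in_behavior\<close> rests on.\<close>

lemma traj_exists:
  fixes A :: "nat \<Rightarrow> nat \<Rightarrow> real"
  assumes u: "\<And>a. a < m \<Longrightarrow> sq_int (u a)"
  obtains x where "traj n m A B u x" "\<And>i. i < n \<Longrightarrow> x i (-1) = x0 i"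
    "\<And>i t. i < n \<Longrightarrow> t \<in> {-1..1} \<Longrightarrow>
      \<bar>x i t\<bar> \<le> ((\<Sum>i<n. \<bar>x0 i\<bar>) + sqrt 2 * (\<Sum>i<n. \<Sum>a<m. \<bar>B i a\<bar> * nL (u a))) * exp (2 * (\<Sum>i<n. \<Sum>j<n. \<bar>A i j\<bar>))"
proof -
  let ?f = "\<lambda>i s. \<Sum>a<m. B i a * u a s"
  let ?d = "\<lambda>i t. x0 i + J (?f i) t"
  let ?M = "(\<Sum>i<n. \<bar>x0 i\<bar>) + sqrt 2 * (\<Sum>i<n. \<Sum>a<m. \<bar>B i a\<bar> * nL (u a))"
  have f: "sq_int (?f i)" for i by (intro sq_int_sum sq_int_cmult u) auto
  have dM: "\<bar>?d i t\<bar> \<le> ?M" if i: "i < n" and t: "t \<in> {-1..1}" for i t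
  proof -
    have "J (?f i) t = (\<Sum>a<m. B i a * J (u a) t)" by (rule J_lin_sum) (use u t in auto)
    hence "\<bar>J (?f i) t\<bar> \<le> (\<Sum>a<m. \<bar>B i a\<bar> * \<bar>J (u a) t\<bar>)" by (simp add: abs_mult[symmetric] sum_abs)
    also have "\<dots> \<le> (\<Sum>a<m. \<bar>B i a\<bar> * (sqrt 2 * nL (u a)))"
      by (intro sum_mono mult_left_mono J_abs_le u t) auto
    also have "\<dots> = sqrt 2 * (\<Sum>a<m. \<bar>B i a\<bar> * nL (u a))" by (simp add: sum_distrib_left ac_simps)
    also have "\<dots> \<le> sqrt 2 * (\<Sum>i<n. \<Sum>a<m. \<bar>B i a\<bar> * nL (u a))"
      using i by (intro mult_left_mono member_le_sum sum_nonneg) (auto intro: mult_nonneg_nonneg)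
    finally have 1: "\<bar>J (?f i) t\<bar> \<le> \<dots>" .
    have "\<bar>x0 i\<bar> \<le> (\<Sum>i<n. \<bar>x0 i\<bar>)" using i by (intro member_le_sum) auto
    thus ?thesis using 1 by linarith
  qed
  have M: "0 \<le> ?M" by (intro add_nonneg_nonneg mult_nonneg_nonneg sum_nonneg) auto
  obtain x where x: "\<And>i. i < n \<Longrightarrow> continuous_on {-1..1} (x i)"
    "\<And>i t. i < n \<Longrightarrow> t \<in> {-1..1} \<Longrightarrow> x i t = ?d i t + J (\<lambda>s. \<Sum>j<n. A i j * x j s) t"
    "\<And>i t. i < n \<Longrightarrow> t \<in> {-1..1} \<Longrightarrow> \<bar>x i t\<bar> \<le> ?M * exp (2 * (\<Sum>i<n. \<Sum>j<n. \<bar>A i j\<bar>))"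
    by (rule volterra_exists[of n ?d ?M A, OF _ dM M]) (auto intro!: continuous_intros J_cont f)
  have x0: "x i (-1) = x0 i" if "i < n" for i using x(2)[OF that, of "-1"] by simp
  have "traj n m A B u x" unfolding traj_def
  proof (intro conjI allI impI ballI)
    fix i and t :: real assume i: "i < n" and t: "t \<in> {-1..1}"
    have "sq_int (\<lambda>s. \<Sum>j<n. A i j * x j s)" by (intro sq_int_sum sq_int_cmult sq_int_cont x(1)) auto
    hence "J (\<lambda>s. (\<Sum>j<n. A i j * x j s) + ?f i s) t = J (\<lambda>s. \<Sum>j<n. A i j * x j s) t + J (?f i) t"
      by (rule J_add[OF _ f]) (use t in simp)
    thus "x i t = x i (-1) + J (\<lambda>s. (\<Sum>j<n. A i j * x j s) + (\<Sum>a<m. B i a * u a s)) t"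
      unfolding x(2)[OF i t] x0[OF i] by (simp only: ac_simps)
  qed (simp_all add: u x(1))
  thus ?thesis using x0 x(3) by (rule that)
qed

lemma traj_lin:
  assumes x: "traj n m A B u x" and y: "traj n m A B v y"
  shows "traj n m A B (\<lambda>a t. c * u a t + d * v a t) (\<lambda>i t. c * x i t + d * y i t)"
  unfolding traj_def
proof (intro conjI allI impI ballI)
  fix i and t :: real assume i: "i < n" and t: "t \<in> {-1..1}"
  let ?f = "\<lambda>s. (\<Sum>j<n. A i j * x j s) + (\<Sum>a<m. B i a * u a s)"
  let ?g = "\<lambda>s. (\<Sum>j<n. A i j * y j s) + (\<Sum>a<m. B i a * v a s)"
  have "J (\<lambda>s. c * ?f s + d * ?g s) t = c * J ?f t + d * J ?g t"
    using J_add[OF sq_int_cmult[OF traj_rhs[OF x, of i], of c] sq_int_cmult[OF traj_rhs[OF y, of i], of d], of t] t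
    by (simp only: J_cmult) simp
  moreover have "(\<lambda>s. c * ?f s + d * ?g s) = (\<lambda>s. (\<Sum>j<n. A i j * (c * x j s + d * y j s)) + (\<Sum>a<m. B i a * (c * u a s + d * v a s)))"
    by (simp add: algebra_simps sum.distrib sum_distrib_left)
  moreover have "c * x i t + d * y i t = c * x i (-1) + d * y i (-1) + (c * J ?f t + d * J ?g t)"
    using arg_cong[OF traj_J[OF x i t], of "(*) c"] arg_cong[OF traj_J[OF y i t], of "(*) d"]
    unfolding distrib_left by linarith
  ultimately show "c * x i t + d * y i t = c * x i (-1) + d * y i (-1) +
     J (\<lambda>s. (\<Sum>j<n. A i j * (c * x j s + d * y j s)) + (\<Sum>a<m. B i a * (c * u a s + d * v a s))) t" by simp
next
  fix a assume "a < m"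
  thus "sq_int (\<lambda>t. c * u a t + d * v a t)" by (intro sq_int_add sq_int_cmult traj_u[OF x] traj_u[OF y])
next
  fix i assume "i < n"
  thus "continuous_on {-1..1} (\<lambda>t. c * x i t + d * y i t)"
    by (intro continuous_intros traj_cont[OF x] traj_cont[OF y])
qed

lemma traj_diff:
  assumes x: "traj n m A B u x" and y: "traj n m A B v y"
  shows "traj n m A B (\<lambda>a t. u a t - v a t) (\<lambda>i t. x i t - y i t)"
  using traj_lin[OF assms, of 1 "-1"] by simp

text \<open>Pairing the state with a covector that kills the input term removes the rough part of
  the right-hand side. What remains is continuous, so the pairing is differentiable. The subinterval
  \<open>{a..b}\<close> allows for inputs that vanish on part of the interval only.\<close>

lemma covector_derivative:
  assumes x: "traj n m A B u x" and \<eta>: "\<And>t. t \<in> {a..b} \<inter> \<I> \<Longrightarrow> (\<Sum>i<n. \<eta> i * (\<Sum>a<m. B i a * u a t)) = 0"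
    and ab: "-1 \<le> a" "b \<le> 1" and t: "t \<in> {a..b}"
  shows "((\<lambda>t. \<Sum>i<n. \<eta> i * x i t) has_real_derivative (\<Sum>j<n. vm n A \<eta> j * x j t)) (at t within {a..b})"
proof -
  let ?F = "\<lambda>i s. (\<Sum>j<n. A i j * x j s) + (\<Sum>a<m. B i a * u a s)"
  let ?G = "\<lambda>s. \<Sum>j<n. vm n A \<eta> j * x j s"
  let ?H = "\<lambda>s. \<Sum>i<n. \<eta> i * ?F i s"
  have sF: "sq_int (?F i)" for i by (rule traj_rhs[OF x])
  have sH: "sq_int ?H" by (intro sq_int_sum sq_int_cmult sF)
  have sG: "continuous_on {-1..1} ?G" by (intro continuous_intros traj_cont[OF x]) auto
  have HG: "?H s = ?G s" if "s \<in> {a..b} \<inter> \<I>" for s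
  proof -
    have "?H s = (\<Sum>i<n. \<Sum>j<n. \<eta> i * A i j * x j s)"
      using \<eta>[OF that] by (simp add: distrib_left sum.distrib sum_distrib_left mult.assoc)
    also have "\<dots> = ?G s" by (subst sum.swap) (simp add: vm_def sum_distrib_right)
    finally show ?thesis .
  qed
  have e: "(\<Sum>i<n. \<eta> i * x i s) = (\<Sum>i<n. \<eta> i * x i (-1)) + J ?H s" if "s \<in> {-1..1}" for s
  proof -
    have "(\<Sum>i<n. \<eta> i * x i s) = (\<Sum>i<n. \<eta> i * (x i (-1) + J (?F i) s))"
      by (rule sum.cong) (use traj_J[OF x _ that] in auto)
    also have "\<dots> = (\<Sum>i<n. \<eta> i * x i (-1)) + (\<Sum>i<n. \<eta> i * J (?F i) s)" by (simp add: distrib_left sum.distrib)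
    also have "(\<Sum>i<n. \<eta> i * J (?F i) s) = J ?H s" by (rule J_lin_sum[symmetric]) (use sF that in auto)
    finally show ?thesis .
  qed
  have J1: "J ?H s = J ?H a + integral {a..s} ?G" if s: "s \<in> {a..b}" for s
  proof -
    have "J ?H s = J ?H a + integral {a..s} ?H"
      unfolding J_def by (rule Henstock_Kurzweil_Integration.integral_combine[symmetric])
         (use s ab sq_int_J_int(1)[OF sH, of "-1" s] in auto)
    also have "integral {a..s} ?H = integral {a..s} ?G"
      by (rule integral_spike[of "{-1,1}"]) (use HG s ab in auto)
    finally show ?thesis .
  qed
  have "((\<lambda>s. (\<Sum>i<n. \<eta> i * x i (-1)) + (J ?H a + integral {a..s} ?G)) has_real_derivative 0 + (0 + ?G t)) (at t within {a..b})"
    by (intro derivative_intros DERIV_add DERIV_const integral_has_real_derivative t)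
       (rule continuous_on_subset[OF sG], use ab in auto)
  hence "((\<lambda>s. (\<Sum>i<n. \<eta> i * x i (-1)) + (J ?H a + integral {a..s} ?G)) has_real_derivative ?G t) (at t within {a..b})" by simp
  thus ?thesis
  proof (rule DERIV_within_transform[OF _ t])
    fix s assume s: "s \<in> {a..b}"
    hence "s \<in> {-1..1}" using ab by auto
    from e[OF this] J1[OF s] show "(\<Sum>i<n. \<eta> i * x i (-1)) + (J ?H a + integral {a..s} ?G) = (\<Sum>i<n. \<eta> i * x i s)" by linarith
  qed
qed

text \<open>The pairings with the covectors \<open>\<xi> A^k\<close> are successive derivatives of
  each other and grow at most geometrically in \<open>k\<close>, so \<open>flat_zero\<close>
  applies. The base point \<open>c\<close> may be any point of \<open>{a..b}\<close>, which permits
  conclusions backwards in time.\<close>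

lemma annihilator_invariant:
  assumes x: "traj n m A B u x"
    and \<xi>: "\<And>k t. t \<in> {a..b} \<inter> \<I> \<Longrightarrow> (\<Sum>i<n. (vm n A ^^ k) \<xi> i * (\<Sum>a<m. B i a * u a t)) = 0"
    and ab: "-1 \<le> a" "b \<le> 1"
    and c: "c \<in> {a..b}" "\<And>k. (\<Sum>i<n. (vm n A ^^ k) \<xi> i * x i c) = 0" and t: "t \<in> {a..b}"
  shows "(\<Sum>i<n. \<xi> i * x i t) = 0"
proof -
  let ?h = "\<lambda>k t. \<Sum>i<n. (vm n A ^^ k) \<xi> i * x i t"
  have "\<forall>i<n. \<exists>C. \<forall>t\<in>{-1..1}. \<bar>x i t\<bar> \<le> C"
  proof (intro allI impI)
    fix i assume "i < n"
    thus "\<exists>C. \<forall>t\<in>{-1..1}. \<bar>x i t\<bar> \<le> C"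
      using compact_imp_bounded[OF compact_continuous_image[OF traj_cont[OF x] compact_Icc]]
      unfolding bounded_iff by (metis image_eqI real_norm_def)
  qed
  then obtain C where C: "\<And>i t. i < n \<Longrightarrow> t \<in> {-1..1} \<Longrightarrow> \<bar>x i t\<bar> \<le> C i" by metis
  let ?C = "\<Sum>i<n. \<bar>C i\<bar>"
  have C': "\<bar>x i t\<bar> \<le> ?C" if "i < n" "t \<in> {-1..1}" for i t
    using C[OF that] member_le_sum[of i "{..<n}" "\<lambda>i. \<bar>C i\<bar>"] that(1) by fastforce
  let ?K = "\<Sum>i<n. \<Sum>j<n. \<bar>A i j\<bar>"
  have "?h 0 t = 0"
  proof (rule flat_zero[of a b ?h "(\<Sum>j<n. \<bar>\<xi> j\<bar>) * ?C" ?K c t])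
    fix k t assume t: "t \<in> {a..b}"
    show "(?h k has_real_derivative ?h (Suc k) t) (at t within {a..b})"
      using covector_derivative[OF x \<xi> ab t] by simp
    have "\<bar>?h k t\<bar> \<le> (\<Sum>i<n. \<bar>(vm n A ^^ k) \<xi> i\<bar> * \<bar>x i t\<bar>)"
      unfolding abs_mult[symmetric] by (rule sum_abs)
    also have "\<dots> \<le> (\<Sum>i<n. \<bar>(vm n A ^^ k) \<xi> i\<bar> * ?C)"
      by (intro sum_mono mult_left_mono C') (use t ab in auto)
    also have "\<dots> = (\<Sum>i<n. \<bar>(vm n A ^^ k) \<xi> i\<bar>) * ?C" by (simp add: sum_distrib_right)
    also have "\<dots> \<le> (\<Sum>j<n. \<bar>\<xi> j\<bar>) * ?K ^ k * ?C"
      by (intro mult_right_mono vm_iter_bound sum_nonneg) auto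
    finally show "\<bar>?h k t\<bar> \<le> (\<Sum>j<n. \<bar>\<xi> j\<bar>) * ?C * ?K ^ k" by (simp add: ac_simps)
  qed (use c t in auto)
  thus ?thesis by simp
qed

lemma traj_derivative:
  assumes x: "traj n m A B u x" and u: "\<And>a. a < m \<Longrightarrow> continuous_on {-1..1} (u a)" and i: "i < n" and t: "t \<in> {-1..1}"
  shows "(x i has_real_derivative (\<Sum>j<n. A i j * x j t) + (\<Sum>a<m. B i a * u a t)) (at t within {-1..1})"
proof -
  let ?F = "\<lambda>s. (\<Sum>j<n. A i j * x j s) + (\<Sum>a<m. B i a * u a s)"
  have "continuous_on {-1..1} ?F" by (intro continuous_intros traj_cont[OF x] u) auto
  from J_deriv[OF this t] have "((\<lambda>t. x i (-1) + J ?F t) has_real_derivative 0 + ?F t) (at t within {-1..1})"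
    by (intro DERIV_add DERIV_const)
  hence "((\<lambda>t. x i (-1) + J ?F t) has_real_derivative ?F t) (at t within {-1..1})" by simp
  thus ?thesis
    by (rule DERIV_within_transform[OF _ t]) (rule traj_J[OF x i, symmetric])
qed

text \<open>By the state equation, smooth functions plus linear combinations of the states form a
  class closed under differentiation.\<close>

lemma traj_smooth:
  assumes x: "traj n m A B u x" and u: "\<And>a. a < m \<Longrightarrow> smooth_on {-1..1} (u a)" and i: "i < n"
  shows "smooth_on {-1..1} (x i)"
proof -
  let ?K = "{h. \<exists>v c. smooth_on {-1..1} v \<and> h = (\<lambda>t. v t + (\<Sum>j<n. c j * x j t))}"
  show ?thesis
  proof (rule smooth_on_class[of _ ?K])
    have "x i t = 0 + (\<Sum>j<n. (if j = i then 1 else 0) * x j t)" for t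
      using i by (simp add: if_distrib[of "\<lambda>c. c * _"] cong: if_cong)
    thus "x i \<in> ?K" by (auto intro!: exI[of _ "\<lambda>_. 0"] exI[of _ "\<lambda>j. if j = i then 1 else 0"] smooth_on_const)
    fix h assume "h \<in> ?K"
    then obtain v c where v: "smooth_on {-1..1} v" and h: "h = (\<lambda>t. v t + (\<Sum>j<n. c j * x j t))" by blast
    obtain v' where v': "smooth_on {-1..1} v'" "\<And>t. t \<in> {-1..1} \<Longrightarrow> (v has_real_derivative v' t) (at t within {-1..1})"
      using smooth_on_derivE[OF v] by blast
    let ?v = "\<lambda>t. v' t + (\<Sum>j<n. c j * (\<Sum>a<m. B j a * u a t))"
    let ?h = "\<lambda>t. ?v t + (\<Sum>j<n. vm n A c j * x j t)"
    have "smooth_on {-1..1} ?v" by (intro smooth_on_add v' smooth_on_sum smooth_on_cmult u) auto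
    hence hK: "?h \<in> ?K" by blast
    have hd: "(h has_real_derivative ?h t) (at t within {-1..1})" if t: "t \<in> {-1..1}" for t
    proof -
      have "(h has_real_derivative v' t + (\<Sum>j<n. c j * ((\<Sum>l<n. A j l * x l t) + (\<Sum>a<m. B j a * u a t)))) (at t within {-1..1})"
        unfolding h by (intro DERIV_add v'(2) t DERIV_sum DERIV_cmult traj_derivative[OF x] smooth_on_continuous u) auto
      also have "v' t + (\<Sum>j<n. c j * ((\<Sum>l<n. A j l * x l t) + (\<Sum>a<m. B j a * u a t))) = ?h t"
      proof -
        have "(\<Sum>j<n. c j * (\<Sum>l<n. A j l * x l t)) = (\<Sum>l<n. vm n A c l * x l t)"
          unfolding sum_distrib_left vm_def sum_distrib_right by (subst sum.swap) (simp add: mult.assoc)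
        thus ?thesis by (simp add: distrib_left sum.distrib)
      qed
      finally show ?thesis .
    qed
    show "\<exists>h'\<in>?K. \<forall>t\<in>{-1..1}. (h has_real_derivative h' t) (at t within {-1..1})"
      by (rule bexI[OF _ hK], rule ballI, rule hd)
  qed
qed

lemma trajI_deriv:
  assumes "\<And>a. a < m \<Longrightarrow> sq_int (u a)" "\<And>i. i < n \<Longrightarrow> continuous_on {-1..1} (x i)"
    "\<And>a. a < m \<Longrightarrow> continuous_on {-1..1} (u a)"
    "\<And>i t. i < n \<Longrightarrow> t \<in> \<I> \<Longrightarrow> (x i has_real_derivative (\<Sum>j<n. A i j * x j t) + (\<Sum>a<m. B i a * u a t)) (at t)"
  shows "traj n m A B u x"
  unfolding traj_def
proof (intro conjI allI impI ballI)
  fix i and t :: real assume i: "i < n" and t: "t \<in> {-1..1}"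
  let ?F = "\<lambda>s. (\<Sum>j<n. A i j * x j s) + (\<Sum>a<m. B i a * u a s)"
  have "(?F has_integral x i t - x i (-1)) {-1..t}"
    by (rule fundamental_theorem_of_calculus_interior)
       (use t assms(4)[OF i] in \<open>auto simp: has_real_derivative_iff_has_vector_derivative[symmetric] intro: continuous_on_subset[OF assms(2)[OF i]]\<close>)
  thus "x i t = x i (-1) + J ?F t" unfolding J_def by (simp add: integral_unique)
qed (use assms in auto)

section \<open>Behaviors in terms of components\<close>

lemma L2_iff: "w \<in> L2 d \<longleftrightarrow> (\<forall>t\<in>\<I>. w t \<in> carrier_vec d) \<and> (\<forall>i<d. sq_int (\<lambda>t. w t $ i))"
  by (auto simp: L2_def sq_int_def)

lemma tf_vec_test_function:
  assumes "\<And>i. i < d \<Longrightarrow> tf (\<psi> i)"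
  shows "(\<lambda>t. vec d (\<lambda>i. \<psi> i t)) \<in> test_functions d"
proof -
  have "\<forall>i<d. \<exists>a. 0 < a \<and> a < 1 \<and> (\<forall>t. a \<le> \<bar>t\<bar> \<longrightarrow> \<psi> i t = 0)"
    using assms unfolding tf_def by blast
  then obtain a where a: "\<And>i. i < d \<Longrightarrow> 0 < a i \<and> a i < 1 \<and> (\<forall>t. a i \<le> \<bar>t\<bar> \<longrightarrow> \<psi> i t = 0)" by metis
  \<comment> \<open>The inserted value \<open>1/2\<close> keeps the maximum defined when
    \<open>d = 0\<close>.\<close>
  define b where "b = Max (insert (1/2) (a ` {..<d}))"
  have b: "b < 1" "0 < b" unfolding b_def using a by (auto simp: Max_gr_iff)
  have ab: "a i \<le> b" if "i < d" for i unfolding b_def using that by (intro Max_ge) auto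
  let ?S = "{t. vec d (\<lambda>i. \<psi> i t) \<noteq> 0\<^sub>v d}"
  have "?S \<subseteq> {-b..b}"
  proof
    fix t assume "t \<in> ?S"
    then obtain i where i: "i < d" "\<psi> i t \<noteq> 0" by (auto simp: vec_eq_iff)
    hence "\<bar>t\<bar> < a i" using a[OF i(1)] by (meson not_le)
    thus "t \<in> {-b..b}" using ab[OF i(1)] by auto
  qed
  hence c: "closure ?S \<subseteq> {-b..b}" by (rule closure_minimal) simp
  hence "compact (closure ?S)" by (meson bounded_closed_interval bounded_subset closed_closure compact_eq_bounded_closed)
  moreover have "closure ?S \<subseteq> \<I>" using c b by auto
  moreover have "smooth_on UNIV (\<lambda>t. vec d (\<lambda>i. \<psi> i t) $ i)" if "i < d" for i
    using tf_smooth[OF assms[OF that]] that by simp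
  ultimately show ?thesis by (simp add: test_functions_def)
qed

text \<open>A compact support inside the open interval has a largest absolute value
  \<open>b < 1\<close>, and the radius \<open>(b + 1) / 2\<close> lies in the gap.\<close>

lemma test_function_tf: assumes "\<phi> \<in> test_functions d" "i < d" shows "tf (\<lambda>t. \<phi> t $ i)"
proof -
  let ?S = "closure {t. \<phi> t \<noteq> 0\<^sub>v d}"
  have S: "compact ?S" "?S \<subseteq> \<I>" and s: "smooth_on UNIV (\<lambda>t. \<phi> t $ i)" using assms by (auto simp: test_functions_def)
  have "\<exists>a. 0 < a \<and> a < 1 \<and> ?S \<subseteq> {-a<..<a}"
  proof (cases "?S = {}")
    case False
    have "compact (abs ` ?S)" by (intro compact_continuous_image continuous_intros S)
    then obtain b where b: "b \<in> abs ` ?S" "\<And>x. x \<in> abs ` ?S \<Longrightarrow> x \<le> b"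
      using compact_attains_sup[of "abs ` ?S"] False by auto
    have b1: "0 \<le> b" "b < 1"
    proof -
      obtain x where "x \<in> ?S" "b = \<bar>x\<bar>" using b(1) by blast
      moreover have "x \<in> \<I>" using S(2) calculation(1) by blast
      ultimately show "0 \<le> b" "b < 1" by auto
    qed
    have "?S \<subseteq> {-((b+1)/2)<..<(b+1)/2}"
    proof
      fix t assume "t \<in> ?S"
      hence "\<bar>t\<bar> \<le> b" using b(2) by blast
      hence "\<bar>t\<bar> < (b + 1) / 2" using b1 by (simp add: field_simps)
      thus "t \<in> {-((b+1)/2)<..<(b+1)/2}" unfolding abs_less_iff greaterThanLessThan_iff by linarith
    qed
    thus ?thesis using b1 by (intro exI[of _ "(b+1)/2"]) auto
  qed (auto intro: exI[of _ "1/2"])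
  then obtain a where a: "0 < a" "a < 1" "?S \<subseteq> {-a<..<a}" by blast
  have "\<phi> t $ i = 0" if "a \<le> \<bar>t\<bar>" for t
  proof -
    have "t \<notin> {-a<..<a}" using that by auto
    hence "t \<notin> {t. \<phi> t \<noteq> 0\<^sub>v d}"
      using subset_trans[OF closure_subset a(3)] by (rule contra_subsetD[rotated])
    thus ?thesis using assms(2) by simp
  qed
  thus ?thesis unfolding tf_def using s a by blast
qed

lemma vderiv_vec:
  assumes "\<phi> \<in> test_functions d"
  shows "vderiv j \<phi> t = vec d (\<lambda>i. (deriv ^^ j) (\<lambda>\<tau>. \<phi> \<tau> $ i) t)"
proof -
  have "\<phi> t \<in> carrier_vec d" using assms by (auto simp: test_functions_def)
  thus ?thesis by (simp add: vderiv_def)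
qed

text \<open>Component form of the weak equations, with the polynomials acting on the test functions;
  the first index of \<open>\<rho>\<close> counts equations, the second signal components.
  Components of \<open>w\<close> with index \<open>q\<close> or above do not enter.\<close>

definition weak_kernel :: "nat \<Rightarrow> nat \<Rightarrow> (nat \<Rightarrow> nat \<Rightarrow> real poly) \<Rightarrow> (nat \<Rightarrow> real \<Rightarrow> real) \<Rightarrow> bool" where
  "weak_kernel g q \<rho> w \<longleftrightarrow> (\<forall>a<q. sq_int (w a)) \<and>
     (\<forall>\<phi>. (\<forall>b<g. tf (\<phi> b)) \<longrightarrow> (\<Sum>a<q. \<Sum>b<g. LI (\<lambda>t. w a t * diff_op (\<rho> b a) (\<phi> b) t)) = 0)"

text \<open>The signs of the formal adjoint are moved into the coefficients: \<open>kernel_poly r R\<close> is \<open>R(-s)\<close>.\<close>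

definition kernel_poly :: "nat \<Rightarrow> (nat \<Rightarrow> real mat) \<Rightarrow> nat \<Rightarrow> nat \<Rightarrow> real poly" where
  "kernel_poly r R b a = (\<Sum>i\<le>r. monom ((-1) ^ i * R i $$ (b, a)) i)"

lemma sq_int_LI_mult: "sq_int f \<Longrightarrow> tf \<psi> \<Longrightarrow> integrable MI (\<lambda>t. f t * \<psi> t)"
  by (rule sq_int_mult[OF _ tf_sq_int])

lemma LI_sum2:
  assumes "\<And>a b. a < q \<Longrightarrow> b < g \<Longrightarrow> integrable MI (F a b)"
  shows "LI (\<lambda>t. \<Sum>a<q. \<Sum>b<g. c a b * F a b t) = (\<Sum>a<q. \<Sum>b<g. c a b * LI (F a b))"
proof -
  have "LI (\<lambda>t. \<Sum>a<q. \<Sum>b<g. c a b * F a b t) = (\<Sum>a<q. LI (\<lambda>t. \<Sum>b<g. c a b * F a b t))"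
    by (rule Bochner_Integration.integral_sum) (auto intro!: assms)
  also have "\<dots> = (\<Sum>a<q. \<Sum>b<g. LI (\<lambda>t. c a b * F a b t))"
    by (intro sum.cong refl Bochner_Integration.integral_sum) (auto intro!: assms)
  finally show ?thesis by simp
qed

lemma kernel_behavior_iff_weak_kernel:
  assumes R: "\<And>i. i \<le> r \<Longrightarrow> R i \<in> carrier_mat g q"
  shows "w \<in> kernel_behavior g q r R \<longleftrightarrow>
    (\<forall>t\<in>\<I>. w t \<in> carrier_vec q) \<and> weak_kernel g q (kernel_poly r R) (\<lambda>a t. w t $ a)"
proof (cases "w \<in> L2 q")
  case False
  thus ?thesis by (auto simp: kernel_behavior_def weak_kernel_def L2_iff)
next
  case True
  hence w: "\<And>t. t \<in> \<I> \<Longrightarrow> w t \<in> carrier_vec q" "\<And>a. a < q \<Longrightarrow> sq_int (\<lambda>t. w t $ a)"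
    by (auto simp: L2_iff)
  let ?F = "\<lambda>\<phi>. \<Sum>i\<le>r. (-1) ^ i * (LINT t|lebesgue_on \<I>. w t \<bullet> (transpose_mat (R i) *\<^sub>v vderiv i \<phi> t))"
  let ?G = "\<lambda>\<phi>. \<Sum>a<q. \<Sum>b<g. LI (\<lambda>t. w t $ a * diff_op (kernel_poly r R b a) (\<phi> b) t)"
  have eq: "?F \<phi> = ?G (\<lambda>b t. \<phi> t $ b)" if \<phi>: "\<phi> \<in> test_functions g" for \<phi>
  proof -
    note tf = test_function_tf[OF \<phi>]
    have int: "integrable MI (\<lambda>t. w t $ a * (deriv ^^ i) (\<lambda>\<tau>. \<phi> \<tau> $ b) t)" if "a < q" "b < g" for a b i
      by (intro sq_int_LI_mult w tf_deriv_iter tf that)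
    have 1: "(LINT t|lebesgue_on \<I>. w t \<bullet> (transpose_mat (R i) *\<^sub>v vderiv i \<phi> t)) =
       (\<Sum>a<q. \<Sum>b<g. R i $$ (b, a) * LI (\<lambda>t. w t $ a * (deriv ^^ i) (\<lambda>\<tau>. \<phi> \<tau> $ b) t))" if i: "i \<le> r" for i
    proof -
      have "w t \<bullet> (transpose_mat (R i) *\<^sub>v vderiv i \<phi> t) =
          (\<Sum>a<q. \<Sum>b<g. R i $$ (b, a) * (w t $ a * (deriv ^^ i) (\<lambda>\<tau>. \<phi> \<tau> $ b) t))" for t
      proof -
        have "(transpose_mat (R i) *\<^sub>v vderiv i \<phi> t) $ a = (\<Sum>b<g. R i $$ (b, a) * (deriv ^^ i) (\<lambda>\<tau>. \<phi> \<tau> $ b) t)"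
          if "a < q" for a
          using R[OF i] that by (simp add: vderiv_vec[OF \<phi>] scalar_prod_def atLeast0LessThan)
        thus ?thesis using R[OF i] by (simp add: scalar_prod_def sum_distrib_left atLeast0LessThan mult.left_commute)
      qed
      thus ?thesis using LI_sum2[OF int] by simp
    qed
    have "?F \<phi> = (\<Sum>i\<le>r. \<Sum>a<q. \<Sum>b<g. (-1) ^ i * R i $$ (b, a) * LI (\<lambda>t. w t $ a * (deriv ^^ i) (\<lambda>\<tau>. \<phi> \<tau> $ b) t))"
      by (simp add: 1 sum_distrib_left mult.assoc)
    also have "\<dots> = (\<Sum>a<q. \<Sum>b<g. \<Sum>i\<le>r. (-1) ^ i * R i $$ (b, a) * LI (\<lambda>t. w t $ a * (deriv ^^ i) (\<lambda>\<tau>. \<phi> \<tau> $ b) t))"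
      by (rule trans[OF sum.swap sum.cong[OF refl sum.swap]])
    also have "\<dots> = ?G (\<lambda>b t. \<phi> t $ b)"
    proof (intro sum.cong refl)
      fix a b assume ab: "a \<in> {..<q}" "b \<in> {..<g}"
      have "w t $ a * diff_op (kernel_poly r R b a) (\<lambda>\<tau>. \<phi> \<tau> $ b) t =
        (\<Sum>i\<le>r. (-1) ^ i * R i $$ (b, a) * (w t $ a * (deriv ^^ i) (\<lambda>\<tau>. \<phi> \<tau> $ b) t))" for t
        by (simp add: kernel_poly_def diff_op_poly_sum diff_op_monom sum_distrib_left ac_simps)
      thus "(\<Sum>i\<le>r. (-1) ^ i * R i $$ (b, a) * LI (\<lambda>t. w t $ a * (deriv ^^ i) (\<lambda>\<tau>. \<phi> \<tau> $ b) t)) =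
         LI (\<lambda>t. w t $ a * diff_op (kernel_poly r R b a) (\<lambda>\<tau>. \<phi> \<tau> $ b) t)"
        using int ab by simp
    qed
    finally show ?thesis .
  qed
  have "(\<forall>\<phi>\<in>test_functions g. ?F \<phi> = 0) \<longleftrightarrow> (\<forall>\<phi>. (\<forall>b<g. tf (\<phi> b)) \<longrightarrow> ?G \<phi> = 0)"
  proof (intro iffI allI impI ballI)
    fix \<phi> assume a: "\<forall>\<phi>\<in>test_functions g. ?F \<phi> = 0" and \<phi>: "\<forall>b<g. tf (\<phi> b)"
    let ?\<phi> = "\<lambda>t. vec g (\<lambda>b. \<phi> b t)"
    have t: "?\<phi> \<in> test_functions g" using \<phi> by (intro tf_vec_test_function) auto
    have "?G (\<lambda>b t. ?\<phi> t $ b) = 0" by (rule trans[OF eq[OF t, symmetric] bspec[OF a t]])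
    thus "?G \<phi> = 0" by simp
  next
    fix \<phi> assume a: "\<forall>\<phi>. (\<forall>b<g. tf (\<phi> b)) \<longrightarrow> ?G \<phi> = 0" and \<phi>: "\<phi> \<in> test_functions g"
    have "?G (\<lambda>b t. \<phi> t $ b) = 0" by (rule a[rule_format]) (rule test_function_tf[OF \<phi>])
    thus "?F \<phi> = 0" using eq[OF \<phi>] by simp
  qed
  thus ?thesis using True w by (auto simp: kernel_behavior_def weak_kernel_def)
qed

lemma weak_kernel_sq_int: "weak_kernel g q \<rho> w \<Longrightarrow> a < q \<Longrightarrow> sq_int (w a)" by (simp add: weak_kernel_def)

lemma weak_kernel_lin:
  assumes v: "weak_kernel g q \<rho> v" and w: "weak_kernel g q \<rho> w"
  shows "weak_kernel g q \<rho> (\<lambda>a t. c * v a t + d * w a t)"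
  unfolding weak_kernel_def
proof (intro conjI allI impI)
  fix a assume "a < q"
  thus "sq_int (\<lambda>t. c * v a t + d * w a t)" by (intro sq_int_add sq_int_cmult weak_kernel_sq_int[OF v] weak_kernel_sq_int[OF w])
next
  fix \<phi> assume \<phi>: "\<forall>b<g. tf (\<phi> b)"
  have "LI (\<lambda>t. (c * v a t + d * w a t) * diff_op (\<rho> b a) (\<phi> b) t) =
     c * LI (\<lambda>t. v a t * diff_op (\<rho> b a) (\<phi> b) t) + d * LI (\<lambda>t. w a t * diff_op (\<rho> b a) (\<phi> b) t)" if "a < q" "b < g" for a b
  proof -
    have "integrable MI (\<lambda>t. v a t * diff_op (\<rho> b a) (\<phi> b) t)" "integrable MI (\<lambda>t. w a t * diff_op (\<rho> b a) (\<phi> b) t)"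
      using that \<phi> by (auto intro!: sq_int_LI_mult tf_diff_op weak_kernel_sq_int[OF v] weak_kernel_sq_int[OF w])
    thus ?thesis by (simp add: distrib_right mult.assoc)
  qed
  hence "(\<Sum>a<q. \<Sum>b<g. LI (\<lambda>t. (c * v a t + d * w a t) * diff_op (\<rho> b a) (\<phi> b) t)) =
    c * (\<Sum>a<q. \<Sum>b<g. LI (\<lambda>t. v a t * diff_op (\<rho> b a) (\<phi> b) t)) + d * (\<Sum>a<q. \<Sum>b<g. LI (\<lambda>t. w a t * diff_op (\<rho> b a) (\<phi> b) t))"
    by (simp add: sum.distrib sum_distrib_left)
  also have "\<dots> = 0" using v w \<phi> by (simp add: weak_kernel_def)
  finally show "(\<Sum>a<q. \<Sum>b<g. LI (\<lambda>t. (c * v a t + d * w a t) * diff_op (\<rho> b a) (\<phi> b) t)) = 0" .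
qed

lemma weak_kernel_cong_AE:
  assumes v: "weak_kernel g q \<rho> v" and w: "\<And>a. a < q \<Longrightarrow> sq_int (w a)" "\<And>a. a < q \<Longrightarrow> AE t in MI. v a t = w a t"
  shows "weak_kernel g q \<rho> w"
  unfolding weak_kernel_def
proof (intro conjI allI impI)
  fix \<phi> assume \<phi>: "\<forall>b<g. tf (\<phi> b)"
  have "(\<Sum>a<q. \<Sum>b<g. LI (\<lambda>t. w a t * diff_op (\<rho> b a) (\<phi> b) t)) = (\<Sum>a<q. \<Sum>b<g. LI (\<lambda>t. v a t * diff_op (\<rho> b a) (\<phi> b) t))"
    by (intro sum.cong refl LI_cong_AE[symmetric] w weak_kernel_sq_int[OF v] tf_sq_int tf_diff_op) (use \<phi> in auto)
  thus "(\<Sum>a<q. \<Sum>b<g. LI (\<lambda>t. w a t * diff_op (\<rho> b a) (\<phi> b) t)) = 0" using v \<phi> by (simp add: weak_kernel_def)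
qed (rule w)

text \<open>Every summand of the weak equations is an L2 inner product with a fixed test function,
  so the equations survive L2 limits.\<close>

lemma weak_kernel_limit:
  assumes w: "\<And>a. a < q \<Longrightarrow> sq_int (w a)"
    and lim: "\<And>e. 0 < e \<Longrightarrow> \<exists>v. weak_kernel g q \<rho> v \<and> (\<forall>a<q. nL (\<lambda>t. w a t - v a t) \<le> K * e)"
  shows "weak_kernel g q \<rho> w"
  unfolding weak_kernel_def
proof (intro conjI allI impI)
  fix \<phi> assume \<phi>: "\<forall>b<g. tf (\<phi> b)"
  let ?p = "\<lambda>a b. diff_op (\<rho> b a) (\<phi> b)"
  let ?C = "\<Sum>a<q. \<Sum>b<g. K * nL (?p a b)"
  show "(\<Sum>a<q. \<Sum>b<g. LI (\<lambda>t. w a t * ?p a b t)) = 0"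
  proof (rule LI_tendsto_eqI[where K = "?C"])
    fix e :: real assume "0 < e"
    then obtain v where v: "weak_kernel g q \<rho> v" "\<And>a. a < q \<Longrightarrow> nL (\<lambda>t. w a t - v a t) \<le> K * e" using lim by blast
    have p: "tf (?p a b)" if "b < g" for a b using \<phi> that by (intro tf_diff_op) auto
    have "(\<Sum>a<q. \<Sum>b<g. LI (\<lambda>t. w a t * ?p a b t)) = (\<Sum>a<q. \<Sum>b<g. LI (\<lambda>t. w a t * ?p a b t)) - (\<Sum>a<q. \<Sum>b<g. LI (\<lambda>t. v a t * ?p a b t))"
      using v(1) \<phi> by (simp add: weak_kernel_def)
    also have "\<dots> = (\<Sum>a<q. \<Sum>b<g. LI (\<lambda>t. (w a t - v a t) * ?p a b t))"
      unfolding sum_subtractf[symmetric] 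
    proof (intro sum.cong refl)
      fix a b assume "a \<in> {..<q}" "b \<in> {..<g}"
      hence "integrable MI (\<lambda>t. v a t * ?p a b t)" "integrable MI (\<lambda>t. w a t * ?p a b t)"
        by (auto intro!: sq_int_LI_mult p weak_kernel_sq_int[OF v(1)] w)
      thus "LI (\<lambda>t. w a t * ?p a b t) - LI (\<lambda>t. v a t * ?p a b t) = LI (\<lambda>t. (w a t - v a t) * ?p a b t)"
        by (simp add: left_diff_distrib)
    qed
    finally have "\<bar>(\<Sum>a<q. \<Sum>b<g. LI (\<lambda>t. w a t * ?p a b t))\<bar> \<le> (\<Sum>a<q. \<Sum>b<g. \<bar>LI (\<lambda>t. (w a t - v a t) * ?p a b t)\<bar>)"
      by (simp add: order_trans[OF sum_abs sum_mono[OF sum_abs]])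
    also have "\<dots> \<le> (\<Sum>a<q. \<Sum>b<g. K * e * nL (?p a b))"
    proof (intro sum_mono)
      fix a b assume ab: "a \<in> {..<q}" "b \<in> {..<g}"
      have "\<bar>LI (\<lambda>t. (w a t - v a t) * ?p a b t)\<bar> \<le> nL (\<lambda>t. w a t - v a t) * nL (?p a b)"
        using ab by (intro Cauchy_Schwarz_LI sq_int_diff w weak_kernel_sq_int[OF v(1)] tf_sq_int p) auto
      also have "\<dots> \<le> K * e * nL (?p a b)" using v(2) ab by (intro mult_right_mono) auto
      finally show "\<bar>LI (\<lambda>t. (w a t - v a t) * ?p a b t)\<bar> \<le> K * e * nL (?p a b)" .
    qed
    also have "\<dots> = ?C * e" by (simp add: sum_distrib_right sum_distrib_left ac_simps)
    finally show "\<bar>(\<Sum>a<q. \<Sum>b<g. LI (\<lambda>t. w a t * ?p a b t)) - 0\<bar> \<le> ?C * e" by simp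
  qed
qed (rule w)

section \<open>Input-state-output systems and their square-integrable trajectories\<close>

definition stack :: "nat \<Rightarrow> (nat \<Rightarrow> real \<Rightarrow> real) \<Rightarrow> (nat \<Rightarrow> real \<Rightarrow> real) \<Rightarrow> nat \<Rightarrow> real \<Rightarrow> real" where
  "stack m u y a = (if a < m then u a else y (a - m))"

definition out :: "nat \<Rightarrow> nat \<Rightarrow> (nat \<Rightarrow> nat \<Rightarrow> real) \<Rightarrow> (nat \<Rightarrow> nat \<Rightarrow> real) \<Rightarrow>
    (nat \<Rightarrow> real \<Rightarrow> real) \<Rightarrow> (nat \<Rightarrow> real \<Rightarrow> real) \<Rightarrow> nat \<Rightarrow> real \<Rightarrow> real" where
  "out n m C D u x b t = (\<Sum>j<n. C b j * x j t) + (\<Sum>a<m. D b a * u a t)"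

lemma sum_stack: "(\<Sum>a<m + p. F a (stack m u y a)) = (\<Sum>a<m. F a (u a)) + (\<Sum>b<p. F (m + b) (y b))" for F :: "_ \<Rightarrow> _ \<Rightarrow> real"
proof -
  have "(\<Sum>a<m + p. F a (stack m u y a)) = (\<Sum>a<m. F a (stack m u y a)) + (\<Sum>b<p. F (m + b) (stack m u y (m + b)))"
    by (induction p) (simp_all add: add.assoc)
  thus ?thesis by (simp add: stack_def)
qed

lemma out_lin: "out n m C D (\<lambda>a t. c * u a t + d * v a t) (\<lambda>i t. c * x i t + d * z i t) b t =
    c * out n m C D u x b t + d * out n m C D v z b t"
  by (simp add: out_def algebra_simps sum.distrib sum_distrib_left)

lemma out_sq_int: assumes "traj n m A B u x" shows "sq_int (out n m C D u x b)"
  unfolding out_def [abs_def] by (intro sq_int_add sq_int_sum sq_int_cmult traj_x[OF assms] traj_u[OF assms]) auto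

lemma nL_cmult: "nL (\<lambda>t. c * f t) = \<bar>c\<bar> * nL f"
  by (simp add: nL_def power_mult_distrib real_sqrt_mult)

lemma nL_lin_sum: "finite S \<Longrightarrow> (\<And>j. j \<in> S \<Longrightarrow> sq_int (f j)) \<Longrightarrow> nL (\<lambda>t. \<Sum>j\<in>S. c j * f j t) \<le> (\<Sum>j\<in>S. \<bar>c j\<bar> * nL (f j))"
proof (induction S rule: finite_induct)
  case empty thus ?case by (simp add: nL_def)
next
  case (insert x F)
  have "nL (\<lambda>t. c x * f x t + (\<Sum>j\<in>F. c j * f j t)) \<le> nL (\<lambda>t. c x * f x t) + nL (\<lambda>t. \<Sum>j\<in>F. c j * f j t)"
    by (rule nL_triangle) (use insert in \<open>auto intro!: sq_int_cmult sq_int_sum\<close>)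
  also have "\<dots> \<le> \<bar>c x\<bar> * nL (f x) + (\<Sum>j\<in>F. \<bar>c j\<bar> * nL (f j))" using insert by (simp add: nL_cmult)
  finally show ?case using insert by simp
qed

text \<open>Component form of an input-state-output representation of the kernel of
  \<open>\<rho>\<close>. Its assumption concerns smooth trajectories;
  \<open>traj_in_behavior\<close> and \<open>state_exists\<close> carry the two directions over to
  square-integrable ones.\<close>

locale iso_system =
  fixes m p g n :: nat and \<rho> :: "nat \<Rightarrow> nat \<Rightarrow> real poly" and A B C D :: "nat \<Rightarrow> nat \<Rightarrow> real"
  assumes iso: "\<And>u y. (\<And>a. a < m \<Longrightarrow> smooth_on {-1..1} (u a)) \<Longrightarrow> (\<And>b. b < p \<Longrightarrow> smooth_on {-1..1} (y b)) \<Longrightarrow>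
     weak_kernel g (m + p) \<rho> (stack m u y) \<longleftrightarrow>
     (\<exists>x. (\<forall>i<n. smooth_on {-1..1} (x i)) \<and> (\<forall>t\<in>\<I>.
        (\<forall>i<n. (x i has_real_derivative (\<Sum>j<n. A i j * x j t) + (\<Sum>a<m. B i a * u a t)) (at t)) \<and>
        (\<forall>b<p. y b t = out n m C D u x b t)))"
begin

abbreviation "KB \<equiv> weak_kernel g (m + p) \<rho>"

definition smooth_solution :: "(nat \<Rightarrow> real \<Rightarrow> real) \<Rightarrow> (nat \<Rightarrow> real \<Rightarrow> real) \<Rightarrow> (nat \<Rightarrow> real \<Rightarrow> real) \<Rightarrow> bool" where
  "smooth_solution u y x \<longleftrightarrow> (\<forall>i<n. smooth_on {-1..1} (x i)) \<and> (\<forall>t\<in>\<I>.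
        (\<forall>i<n. (x i has_real_derivative (\<Sum>j<n. A i j * x j t) + (\<Sum>a<m. B i a * u a t)) (at t)) \<and>
        (\<forall>b<p. y b t = out n m C D u x b t))"

lemma iso':
  assumes "\<And>a. a < m \<Longrightarrow> smooth_on {-1..1} (u a)" "\<And>b. b < p \<Longrightarrow> smooth_on {-1..1} (y b)"
  shows "KB (stack m u y) \<longleftrightarrow> (\<exists>x. smooth_solution u y x)"
  unfolding smooth_solution_def by (rule iso) (simp_all add: assms)

lemma smooth_traj_in_behavior:
  assumes x: "traj n m A B u x" and u: "\<And>a. a < m \<Longrightarrow> smooth_on {-1..1} (u a)"
  shows "KB (stack m u (out n m C D u x))"
proof -
  have sx: "smooth_on {-1..1} (x i)" if "i < n" for i by (rule traj_smooth[OF x u that])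
  have so: "smooth_on {-1..1} (out n m C D u x b)" for b
    unfolding out_def [abs_def] by (intro smooth_on_add smooth_on_sum smooth_on_cmult sx u) auto
  have "(x i has_real_derivative (\<Sum>j<n. A i j * x j t) + (\<Sum>a<m. B i a * u a t)) (at t)" if "i < n" "t \<in> \<I>" for i t
  proof -
    have "at t within {-1..1} = at t" using that by (intro at_within_interior) auto
    thus ?thesis using traj_derivative[OF x smooth_on_continuous[OF u] that(1), of t] that(2) by simp
  qed
  hence "smooth_solution u (out n m C D u x) x" using sx unfolding smooth_solution_def by simp
  hence "\<exists>z. smooth_solution u (out n m C D u x) z" by blast
  thus ?thesis by (subst iso') (simp_all add: u so)
qed

lemma smooth_behavior_traj:
  assumes "KB (stack m u y)" and u: "\<And>a. a < m \<Longrightarrow> smooth_on {-1..1} (u a)" and y: "\<And>b. b < p \<Longrightarrow> smooth_on {-1..1} (y b)"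
  obtains x where "traj n m A B u x" "\<And>b t. b < p \<Longrightarrow> t \<in> \<I> \<Longrightarrow> y b t = out n m C D u x b t"
proof -
  have "\<exists>x. smooth_solution u y x" using assms(1) by (subst (asm) iso') (simp_all add: u y)
  then obtain x where "smooth_solution u y x" by (rule exE)
  hence x: "\<And>i. i < n \<Longrightarrow> smooth_on {-1..1} (x i)"
    "\<And>i t. i < n \<Longrightarrow> t \<in> \<I> \<Longrightarrow> (x i has_real_derivative (\<Sum>j<n. A i j * x j t) + (\<Sum>a<m. B i a * u a t)) (at t)"
    "\<And>b t. b < p \<Longrightarrow> t \<in> \<I> \<Longrightarrow> y b t = out n m C D u x b t"
    unfolding smooth_solution_def by blast+
  have "traj n m A B u x"
    by (rule trajI_deriv) (simp_all add: sq_int_cont smooth_on_continuous u x)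
  thus ?thesis using x(3) by (rule that)
qed

text \<open>With polynomial inputs the trajectory is smooth and the representation applies. The L2
  error of the input controls the state error uniformly, and the weak equations pass to the
  limit.\<close>

lemma traj_in_behavior:
  assumes x: "traj n m A B u x" shows "KB (stack m u (out n m C D u x))"
proof -
  \<comment> \<open>\<open>?L\<close> is the gain from the input error to the state in the sup norm,
    \<open>?K1 b\<close> the gain to output \<open>b\<close> in the L2 norm; the summand 1 of
    \<open>?K\<close> covers the inputs themselves.\<close>
  let ?L = "sqrt 2 * (\<Sum>i<n. \<Sum>a<m. \<bar>B i a\<bar> * 1) * exp (2 * (\<Sum>i<n. \<Sum>j<n. \<bar>A i j\<bar>))"
  let ?K1 = "\<lambda>b. (\<Sum>j<n. \<bar>C b j\<bar> * (sqrt 2 * ?L)) + (\<Sum>a<m. \<bar>D b a\<bar>)"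
  let ?K = "1 + (\<Sum>b<p. ?K1 b)"
  have L: "0 \<le> ?L" by (intro mult_nonneg_nonneg sum_nonneg) auto
  have K1: "0 \<le> ?K1 b" for b using L by (intro add_nonneg_nonneg sum_nonneg mult_nonneg_nonneg) auto
  show ?thesis
  proof (rule weak_kernel_limit[where K = ?K])
    fix a assume "a < m + p"
    thus "sq_int (stack m u (out n m C D u x) a)" by (auto simp: stack_def traj_u[OF x] out_sq_int[OF x])
  next
    fix e :: real assume e: "0 < e"
    have "\<forall>a<m. \<exists>q. nL (\<lambda>t. u a t - poly q t) < e" using poly_dense[OF traj_u[OF x] e] by blast
    then obtain q where q: "\<And>a. a < m \<Longrightarrow> nL (\<lambda>t. u a t - poly (q a) t) < e" by metis
    let ?d = "\<lambda>a t. u a t - poly (q a) t"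
    have d: "sq_int (?d a)" if "a < m" for a by (intro sq_int_diff traj_u[OF x that] sq_int_poly')
    obtain z where z: "traj n m A B ?d z" "\<And>i. i < n \<Longrightarrow> z i (-1) = 0"
      "\<And>i t. i < n \<Longrightarrow> t \<in> {-1..1} \<Longrightarrow>
      \<bar>z i t\<bar> \<le> ((\<Sum>i<n. \<bar>0\<bar>) + sqrt 2 * (\<Sum>i<n. \<Sum>a<m. \<bar>B i a\<bar> * nL (?d a))) * exp (2 * (\<Sum>i<n. \<Sum>j<n. \<bar>A i j\<bar>))"
      using traj_exists[of m ?d n A B "\<lambda>_. 0", OF d] by blast
    have zb: "\<bar>z i t\<bar> \<le> ?L * e" if "i < n" "t \<in> {-1..1}" for i t
    proof -
      have "(\<Sum>i<n. \<Sum>a<m. \<bar>B i a\<bar> * nL (?d a)) \<le> (\<Sum>i<n. \<Sum>a<m. \<bar>B i a\<bar> * 1 * e)"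
        using less_imp_le[OF q] by (intro sum_mono) (auto intro!: mult_left_mono)
      also have "\<dots> = (\<Sum>i<n. \<Sum>a<m. \<bar>B i a\<bar> * 1) * e" by (simp add: sum_distrib_right)
      finally have "sqrt 2 * (\<Sum>i<n. \<Sum>a<m. \<bar>B i a\<bar> * nL (?d a)) * exp (2 * (\<Sum>i<n. \<Sum>j<n. \<bar>A i j\<bar>))
          \<le> sqrt 2 * ((\<Sum>i<n. \<Sum>a<m. \<bar>B i a\<bar> * 1) * e) * exp (2 * (\<Sum>i<n. \<Sum>j<n. \<bar>A i j\<bar>))"
        by (intro mult_right_mono mult_left_mono) auto
      moreover have "\<bar>z i t\<bar> \<le> sqrt 2 * (\<Sum>i<n. \<Sum>a<m. \<bar>B i a\<bar> * nL (?d a)) * exp (2 * (\<Sum>i<n. \<Sum>j<n. \<bar>A i j\<bar>))"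
        using z(3)[OF that] by (simp only: abs_zero sum.neutral_const add_0)
      ultimately have "\<bar>z i t\<bar> \<le> sqrt 2 * ((\<Sum>i<n. \<Sum>a<m. \<bar>B i a\<bar> * 1) * e) * exp (2 * (\<Sum>i<n. \<Sum>j<n. \<bar>A i j\<bar>))"
        by (rule order_trans[rotated])
      thus ?thesis by (simp only: ac_simps)
    qed
    \<comment> \<open>Subtracting the response \<open>z\<close> to the input error leaves a state
      driven by the polynomials \<open>q a\<close>.\<close>
    define x' where "x' i t = x i t - z i t" for i t
    let ?u = "\<lambda>a t. u a t - ?d a t"
    have x': "traj n m A B ?u x'" unfolding x'_def [abs_def] by (rule traj_diff[OF x z(1)])
    have "KB (stack m ?u (out n m C D ?u x'))"
      by (rule smooth_traj_in_behavior[OF x']) (simp add: smooth_on_poly)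
    moreover have "nL (\<lambda>t. stack m u (out n m C D u x) a t - stack m ?u (out n m C D ?u x') a t) \<le> ?K * e" if a: "a < m + p" for a
    proof (cases "a < m")
      case True
      have "nL (\<lambda>t. u a t - ?u a t) \<le> 1 * e" using q[OF True] by simp
      also have "\<dots> \<le> ?K * e" using e K1 by (intro mult_right_mono) (auto intro!: sum_nonneg)
      finally show ?thesis using True by (simp add: stack_def)
    next
      case False
      define b where "b = a - m"
      have b: "b < p" using False a by (simp add: b_def)
      have nz: "nL (z j) \<le> sqrt 2 * ?L * e" if "j < n" for j
      proof -
        have "nL (z j) \<le> sqrt 2 * \<bar>?L * e\<bar>"
          by (rule nL_le_sup) (use zb[OF that] traj_x[OF z(1) that] in auto)
        moreover have "\<bar>?L * e\<bar> = ?L * e" by (rule abs_of_nonneg, rule mult_nonneg_nonneg[OF L], rule less_imp_le[OF e])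
        ultimately show ?thesis by (simp only: mult.assoc)
      qed
      have "out n m C D u x b t - out n m C D ?u x' b t = (\<Sum>j<n. C b j * z j t) + (\<Sum>a<m. D b a * ?d a t)" for t
        by (simp add: out_def x'_def algebra_simps sum_subtractf sum.distrib)
      hence "nL (\<lambda>t. out n m C D u x b t - out n m C D ?u x' b t) = nL (\<lambda>t. (\<Sum>j<n. C b j * z j t) + (\<Sum>a<m. D b a * ?d a t))"
        by simp
      also have "\<dots> \<le> nL (\<lambda>t. \<Sum>j<n. C b j * z j t) + nL (\<lambda>t. \<Sum>a<m. D b a * ?d a t)"
        by (intro nL_triangle sq_int_sum sq_int_cmult traj_x[OF z(1)] d) auto
      also have "\<dots> \<le> (\<Sum>j<n. \<bar>C b j\<bar> * nL (z j)) + (\<Sum>a<m. \<bar>D b a\<bar> * nL (?d a))"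
        by (intro add_mono nL_lin_sum traj_x[OF z(1)] d) auto
      also have "\<dots> \<le> (\<Sum>j<n. \<bar>C b j\<bar> * (sqrt 2 * ?L * e)) + (\<Sum>a<m. \<bar>D b a\<bar> * e)"
        using nz less_imp_le[OF q] by (intro add_mono sum_mono mult_left_mono) auto
      also have "\<dots> = ?K1 b * e" by (simp add: distrib_right sum_distrib_right mult.assoc)
      also have "\<dots> \<le> ?K * e"
      proof (intro mult_right_mono)
        have "?K1 b \<le> (\<Sum>b<p. ?K1 b)" by (rule member_le_sum[of b "{..<p}" ?K1]) (use b K1 in auto)
        thus "?K1 b \<le> ?K" by linarith
      qed (use e in simp)
      finally show ?thesis using False by (simp add: stack_def b_def)
    qed
    ultimately show "\<exists>v. KB v \<and> (\<forall>a<m + p. nL (\<lambda>t. stack m u (out n m C D u x) a t - v a t) \<le> ?K * e)" by blast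
  qed
qed

end

section \<open>Square-integrable trajectories have states\<close>

lemma ex_traj:
  assumes "\<And>a. a < m \<Longrightarrow> sq_int (u a)"
  shows "\<exists>x. traj n m A B u x \<and> (\<forall>i<n. x i (-1) = x0 i)"
  by (rule traj_exists[of m u n A B x0]) (simp add: assms, intro exI conjI allI impI)

text \<open>Exponentials are eigenfunctions: each derivative moved off \<open>\<psi>\<close> becomes
  multiplication by \<open>- l\<close>, so the symbol is evaluated at \<open>- l\<close>.\<close>

lemma diff_op_exp_weak:
  assumes "tf \<psi>"
  shows "LI (\<lambda>t. exp (l * t) * diff_op q \<psi> t) = poly q (- l) * LI (\<lambda>t. exp (l * t) * \<psi> t)"
proof -
  have ch: "chain k (\<lambda>j t. l ^ j * exp (l * t))" for k
    by (rule chain_deriv) (auto intro!: derivative_eq_intros continuous_intros)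
  have e: "LI (\<lambda>t. exp (l * t) * (deriv ^^ j) \<psi> t) = (- l) ^ j * LI (\<lambda>t. exp (l * t) * \<psi> t)" for j
    using chain_weak[OF ch[of j] order_refl assms] by (simp add: mult.assoc power_minus[of l])
  have s: "sq_int (\<lambda>t. exp (l * t))" by (intro sq_int_cont continuous_intros)
  have "LI (\<lambda>t. exp (l * t) * diff_op q \<psi> t) = LI (\<lambda>t. \<Sum>j\<le>degree q. coeff q j * (exp (l * t) * (deriv ^^ j) \<psi> t))"
    by (simp add: diff_op_def sum_distrib_left mult.left_commute)
  also have "\<dots> = (\<Sum>j\<le>degree q. coeff q j * LI (\<lambda>t. exp (l * t) * (deriv ^^ j) \<psi> t))"
    using sq_int_LI_mult[OF s tf_deriv_iter[OF assms]] by simp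
  also have "\<dots> = poly q (- l) * LI (\<lambda>t. exp (l * t) * \<psi> t)"
    by (simp add: e poly_altdef sum_distrib_right mult.assoc)
  finally show ?thesis .
qed

lemma const_le_geometric:
  fixes c M K l :: real
  assumes "\<And>k::nat. l ^ k * c \<le> M * K ^ k" "0 \<le> K" "K < l" shows "c \<le> 0"
proof -
  have l: "0 < l" using assms by linarith
  have "c \<le> M * (K / l) ^ k" for k
    using assms(1)[of k] l by (simp add: power_divide field_simps)
  moreover have "(\<lambda>k. M * (K / l) ^ k) \<longlonglongrightarrow> M * 0"
    using assms l by (intro tendsto_intros LIMSEQ_realpow_zero) (auto simp: field_simps)
  ultimately have "c \<le> M * 0" by (intro LIMSEQ_le_const) auto
  thus ?thesis by simp
qed

text \<open>The quadratic form of the Gram matrix at \<open>v\<close> is the sum of the squared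
  components of \<open>M v\<close>, so injectivity of \<open>M\<close> makes it definite. This turns
  rank conditions on non-square matrices into invertibility: once for the output symbol, once for
  the controllability matrix.\<close>

lemma gram_det_nonzero:
  fixes M :: "'b \<Rightarrow> nat \<Rightarrow> real"
  assumes S: "finite S" and M: "\<And>c. (\<And>b. b \<in> S \<Longrightarrow> (\<Sum>a<p. M b a * c a) = 0) \<Longrightarrow> \<forall>a<p. c a = 0"
  shows "det (mat p p (\<lambda>(c, a). \<Sum>b\<in>S. M b c * M b a)) \<noteq> 0"
proof
  let ?G = "mat p p (\<lambda>(c, a). \<Sum>b\<in>S. M b c * M b a)"
  have G: "?G \<in> carrier_mat p p" by simp
  assume "det ?G = 0"
  then obtain v where v: "v \<in> carrier_vec p" "v \<noteq> 0\<^sub>v p" "?G *\<^sub>v v = 0\<^sub>v p"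
    using det_0_iff_vec_prod_zero_field[OF G] by blast
  have "(\<Sum>b\<in>S. (\<Sum>a<p. M b a * v $ a)\<^sup>2) = (\<Sum>c<p. v $ c * (?G *\<^sub>v v) $ c)"
  proof -
    have "(?G *\<^sub>v v) $ c = (\<Sum>a<p. (\<Sum>b\<in>S. M b c * M b a) * v $ a)" if "c < p" for c
      using v(1) that by (simp add: scalar_prod_def atLeast0LessThan)
    hence "(\<Sum>c<p. v $ c * (?G *\<^sub>v v) $ c) = (\<Sum>c<p. \<Sum>a<p. \<Sum>b\<in>S. v $ c * (M b c * M b a * v $ a))"
      by (simp add: sum_distrib_left sum_distrib_right)
    also have "\<dots> = (\<Sum>c<p. \<Sum>b\<in>S. \<Sum>a<p. v $ c * (M b c * M b a * v $ a))"
      by (intro sum.cong refl sum.swap)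
    also have "\<dots> = (\<Sum>b\<in>S. \<Sum>c<p. \<Sum>a<p. v $ c * (M b c * M b a * v $ a))" by (rule sum.swap)
    also have "\<dots> = (\<Sum>b\<in>S. (\<Sum>a<p. M b a * v $ a)\<^sup>2)"
      by (simp add: power2_eq_square sum_product ac_simps)
    finally show ?thesis by simp
  qed
  also have "\<dots> = 0" using v(3) by simp
  finally have "\<forall>b\<in>S. (\<Sum>a<p. M b a * v $ a)\<^sup>2 = 0" using S by (subst (asm) sum_nonneg_eq_0_iff) auto
  hence "\<forall>a<p. v $ a = 0" by (intro M) auto
  hence "v = 0\<^sub>v p" using v(1) by auto
  thus False using v(2) by simp
qed

lemma comm_ring_hom_poly_eval: "comm_ring_hom (\<lambda>q::real poly. poly q x)"
  by unfold_locales auto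

context iso_system
begin

text \<open>Exponential trajectories with zero input are outputs of \<open>x' = Ax\<close>, hence of exponential growth at most
  the norm of \<open>A\<close>.\<close>

lemma output_symbol_injective:
  "\<exists>l. \<forall>c. (\<forall>b<g. (\<Sum>a<p. poly (\<rho> b (m + a)) (- l) * c a) = 0) \<longrightarrow> (\<forall>a<p. c a = 0)"
proof (intro exI allI impI)
  let ?K = "\<Sum>i<n. \<Sum>j<n. \<bar>A i j\<bar>"
  \<comment> \<open>Strictly above the growth bound \<open>?K\<close> of the solutions of
    \<open>x' = A x\<close>.\<close>
  let ?l = "?K + 1"
  have K: "0 \<le> ?K" by (intro sum_nonneg) auto
  fix c a assume c: "\<forall>b<g. (\<Sum>a<p. poly (\<rho> b (m + a)) (- ?l) * c a) = 0" and a: "a < p"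
  let ?u = "\<lambda>(_::nat) (_::real). 0 :: real"
  let ?y = "\<lambda>a t. c a * exp (?l * t)"
  have sexp: "smooth_on {-1..1} (\<lambda>t. exp (?l * t))"
  proof (rule smooth_on_class[where F = "range (\<lambda>d t. d * exp (?l * t))"])
    show "(\<lambda>t. exp (?l * t)) \<in> range (\<lambda>d t. d * exp (?l * t))" by (rule range_eqI[of _ _ 1]) simp
    fix h assume "h \<in> range (\<lambda>d t. d * exp (?l * t))"
    then obtain d where h: "h = (\<lambda>t. d * exp (?l * t))" by blast
    show "\<exists>h'\<in>range (\<lambda>d t. d * exp (?l * t)). \<forall>t\<in>{-1..1}. (h has_real_derivative h' t) (at t within {-1..1})"
      unfolding h by (rule bexI[of _ "\<lambda>t. (d * ?l) * exp (?l * t)"]) (auto intro!: derivative_eq_intros)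
  qed
  have "KB (stack m ?u ?y)"
    unfolding weak_kernel_def
  proof (intro conjI allI impI)
    fix b assume "b < m + p"
    show "sq_int (stack m ?u ?y b)" by (auto simp: stack_def intro!: sq_int_cmult sq_int_cont continuous_intros)
  next
    fix \<phi> assume \<phi>: "\<forall>b<g. tf (\<phi> b)"
    let ?F = "\<lambda>a w. \<Sum>b<g. LI (\<lambda>t. w t * diff_op (\<rho> b a) (\<phi> b) t)"
    have "(\<Sum>a<m + p. ?F a (stack m ?u ?y a)) = (\<Sum>a<m. ?F a (?u a)) + (\<Sum>a<p. ?F (m + a) (?y a))"
      by (rule sum_stack)
    also have "\<dots> = (\<Sum>a<p. \<Sum>b<g. poly (\<rho> b (m + a)) (- ?l) * c a * LI (\<lambda>t. exp (?l * t) * \<phi> b t))"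
    proof -
      have "LI (\<lambda>t. ?y a t * diff_op (\<rho> b (m + a)) (\<phi> b) t) = poly (\<rho> b (m + a)) (- ?l) * c a * LI (\<lambda>t. exp (?l * t) * \<phi> b t)"
        if "b < g" for a b using diff_op_exp_weak[of "\<phi> b" ?l "\<rho> b (m + a)"] \<phi> that by (simp add: mult.assoc)
      thus ?thesis by simp
    qed
    also have "\<dots> = (\<Sum>b<g. (\<Sum>a<p. poly (\<rho> b (m + a)) (- ?l) * c a) * LI (\<lambda>t. exp (?l * t) * \<phi> b t))"
      by (subst sum.swap) (simp add: sum_distrib_right)
    also have "\<dots> = 0" using c by simp
    finally show "(\<Sum>a<m + p. ?F a (stack m ?u ?y a)) = 0" .
  qed
  moreover have "smooth_on {-1..1} (?u i)" for i by (rule smooth_on_const)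
  moreover have "smooth_on {-1..1} (?y b)" for b by (rule smooth_on_cmult[OF sexp])
  ultimately obtain x where x: "traj n m A B ?u x" "\<And>b t. b < p \<Longrightarrow> t \<in> \<I> \<Longrightarrow> ?y b t = out n m C D ?u x b t"
    using smooth_behavior_traj[of ?u ?y] by blast
  let ?\<eta> = "\<lambda>k. (vm n A ^^ k) (C a)"
  \<comment> \<open>\<open>?h k\<close> is the \<open>k\<close>-th derivative of output
    \<open>a\<close>. For the exponential output it is \<open>?l ^ k * ?y a\<close>, while the state
    bounds it at 0 by a multiple of \<open>?K ^ k\<close>; this is compatible only with
    \<open>c a = 0\<close>.\<close>
  let ?h = "\<lambda>k t. \<Sum>i<n. ?\<eta> k i * x i t"
  have dh: "(?h k has_real_derivative ?h (Suc k) t) (at t)" if "t \<in> \<I>" for k t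
  proof -
    have "(?h k has_real_derivative ?h (Suc k) t) (at t within {-1..1})"
      using covector_derivative[OF x(1), of "-1" 1 "?\<eta> k" t] that by simp
    moreover have "at t within {-1..1} = at t" using that by (intro at_within_interior) auto
    ultimately show ?thesis by simp
  qed
  have h: "\<forall>t\<in>\<I>. ?h k t = ?l ^ k * ?y a t" for k
  proof (induction k)
    case 0 show ?case using x(2)[OF a] by (simp add: out_def)
  next
    case (Suc k)
    show ?case
    proof
      fix t assume t: "t \<in> \<I>"
      have "((\<lambda>t. ?l ^ k * ?y a t) has_real_derivative ?l ^ Suc k * ?y a t) (at t)"
        by (auto intro!: derivative_eq_intros)
      hence "(?h k has_real_derivative ?l ^ Suc k * ?y a t) (at t)"
        by (rule has_field_derivative_transform_within_open[of _ _ _ "\<I>"]) (use t Suc in auto)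
      thus "?h (Suc k) t = ?l ^ Suc k * ?y a t" using DERIV_unique[OF dh[OF t]] by blast
    qed
  qed
  let ?X = "\<Sum>i<n. \<bar>x i 0\<bar>"
  have "?l ^ k * \<bar>c a\<bar> \<le> (\<Sum>j<n. \<bar>C a j\<bar>) * ?X * ?K ^ k" for k
  proof -
    have "?l ^ k * \<bar>c a\<bar> = \<bar>?h k 0\<bar>" using h[of k] K by (simp add: abs_mult)
    also have "\<dots> \<le> (\<Sum>i<n. \<bar>?\<eta> k i\<bar> * \<bar>x i 0\<bar>)" unfolding abs_mult[symmetric] by (rule sum_abs)
    also have "\<dots> \<le> (\<Sum>i<n. \<bar>?\<eta> k i\<bar> * ?X)"
      by (intro sum_mono mult_left_mono member_le_sum) auto
    also have "\<dots> = (\<Sum>i<n. \<bar>?\<eta> k i\<bar>) * ?X" by (simp add: sum_distrib_right)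
    also have "\<dots> \<le> (\<Sum>j<n. \<bar>C a j\<bar>) * ?K ^ k * ?X" by (intro mult_right_mono vm_iter_bound sum_nonneg) auto
    finally show ?thesis by (simp only: ac_simps)
  qed
  hence "\<bar>c a\<bar> \<le> 0" using K by (intro const_le_geometric[of ?l "\<bar>c a\<bar>" _ ?K]) auto
  thus "c a = 0" by simp
qed

text \<open>With zero input every component of a weak output solves a scalar equation, obtained from the adjugate.\<close>

lemma zero_input_output_smooth:
  assumes v: "KB (stack m (\<lambda>_ _. 0) v)" and a': "a' < p"
  obtains f where "smooth_on {-1..1} f" "AE t in MI. v a' t = f t"
proof -
  obtain l where l: "\<And>c. (\<And>b. b < g \<Longrightarrow> (\<Sum>a<p. poly (\<rho> b (m + a)) (- l) * c a) = 0) \<Longrightarrow> \<forall>a<p. c a = 0"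
    using output_symbol_injective by blast
  let ?M = "\<lambda>b a. poly (\<rho> b (m + a)) (- l)"
  \<comment> \<open>The output symbol need not be square. Multiplying it by the transpose of the
    constant matrix \<open>?M\<close>, its own value at \<open>- l\<close>, gives a square matrix
    that is a Gram matrix at \<open>- l\<close>; hence its determinant is a nonzero
    polynomial.\<close>
  define P where "P = mat p p (\<lambda>(c, a). \<Sum>b<g. smult (?M b c) (\<rho> b (m + a)))"
  have P: "P \<in> carrier_mat p p" by (simp add: P_def)
  interpret hom: comm_ring_hom "\<lambda>q::real poly. poly q (- l)" by (rule comm_ring_hom_poly_eval)
  have "poly (det P) (- l) = det (map_mat (\<lambda>q. poly q (- l)) P)" by simp
  also have "map_mat (\<lambda>q. poly q (- l)) P = mat p p (\<lambda>(c, a). \<Sum>b<g. ?M b c * ?M b a)"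
    by (rule eq_matI) (auto simp: P_def poly_sum)
  also have "det \<dots> \<noteq> 0" by (rule gram_det_nonzero[OF finite_lessThan]) (rule l, simp)
  finally have D0: "det P \<noteq> 0" by auto
  let ?adj = "adj_mat P"
  have adj: "(\<Sum>c<p. ?adj $$ (a', c) * P $$ (c, a)) = (if a = a' then det P else 0)" if a: "a < p" for a
  proof -
    have "(?adj * P) $$ (a', a) = (det P \<cdot>\<^sub>m 1\<^sub>m p) $$ (a', a)" using adj_mat(3)[OF P] by simp
    thus ?thesis using P adj_mat(1)[OF P] a a' by (auto simp: scalar_prod_def atLeast0LessThan)
  qed
  have sv: "sq_int (v a)" if "a < p" for a
    using weak_kernel_sq_int[OF v, of "m + a"] that by (simp add: stack_def)
  show ?thesis
  proof (rule weak_ode_smooth[OF sv[OF a'] D0])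
    fix \<psi> assume \<psi>: "tf \<psi>"
    have s\<psi>: "smooth_on UNIV \<psi>" by (rule tf_smooth[OF \<psi>])
    \<comment> \<open>Row \<open>a'\<close> of the adjugate combined with \<open>?M\<close>: testing
      with this vector puts row \<open>a'\<close> of \<open>adj_mat P * P\<close> in front of the
      outputs, that is \<open>det P\<close> at position \<open>a'\<close> and 0 elsewhere.\<close>
    let ?\<phi> = "\<lambda>b t. \<Sum>c<p. ?M b c * diff_op (?adj $$ (a', c)) \<psi> t"
    have \<phi>: "\<forall>b<g. tf (?\<phi> b)" by (intro allI impI tf_sum tf_cmult tf_diff_op \<psi>)
    let ?F = "\<lambda>a w. \<Sum>b<g. LI (\<lambda>t. w t * diff_op (\<rho> b a) (?\<phi> b) t)"
    have "0 = (\<Sum>a<m + p. ?F a (stack m (\<lambda>_ _. 0) v a))" using v \<phi> by (simp add: weak_kernel_def)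
    also have "\<dots> = (\<Sum>a<m. ?F a (\<lambda>_. 0)) + (\<Sum>a<p. ?F (m + a) (v a))" by (rule sum_stack)
    also have "\<dots> = (\<Sum>a<p. ?F (m + a) (v a))" by simp
    also have "\<dots> = (\<Sum>a<p. if a = a' then LI (\<lambda>t. v a t * diff_op (det P) \<psi> t) else 0)"
    proof (rule sum.cong[OF refl])
      fix a assume "a \<in> {..<p}" hence a: "a < p" by simp
      have "?F (m + a) (v a) = LI (\<lambda>t. \<Sum>b<g. v a t * diff_op (\<rho> b (m + a)) (?\<phi> b) t)"
        by (rule Bochner_Integration.integral_sum[symmetric])
           (use \<phi> in \<open>auto intro!: sq_int_LI_mult sv a tf_diff_op\<close>)
      also have "(\<lambda>t. \<Sum>b<g. v a t * diff_op (\<rho> b (m + a)) (?\<phi> b) t) = (\<lambda>t. v a t * diff_op (if a = a' then det P else 0) \<psi> t)"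
      proof
        fix t
        have "(\<Sum>b<g. diff_op (\<rho> b (m + a)) (?\<phi> b) t) = (\<Sum>b<g. \<Sum>c<p. ?M b c * diff_op (\<rho> b (m + a) * ?adj $$ (a', c)) \<psi> t)"
          by (subst diff_op_fun_sum) (auto intro!: smooth_diff_op s\<psi> simp: diff_op_mult[OF s\<psi>])
        also have "\<dots> = (\<Sum>c<p. \<Sum>b<g. ?M b c * diff_op (\<rho> b (m + a) * ?adj $$ (a', c)) \<psi> t)" by (rule sum.swap)
        also have "\<dots> = diff_op (\<Sum>c<p. \<Sum>b<g. smult (?M b c) (\<rho> b (m + a) * ?adj $$ (a', c))) \<psi> t"
          by (simp add: diff_op_poly_sum diff_op_smult)
        also have "(\<Sum>c<p. \<Sum>b<g. smult (?M b c) (\<rho> b (m + a) * ?adj $$ (a', c))) = (\<Sum>c<p. ?adj $$ (a', c) * P $$ (c, a))"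
        proof (rule sum.cong[OF refl])
          fix c assume c: "c \<in> {..<p}"
          have "P $$ (c, a) = (\<Sum>b<g. smult (?M b c) (\<rho> b (m + a)))" using a c by (simp add: P_def)
          thus "(\<Sum>b<g. smult (?M b c) (\<rho> b (m + a) * ?adj $$ (a', c))) = ?adj $$ (a', c) * P $$ (c, a)"
            by (simp only: sum_distrib_left mult_smult_right mult.commute)
        qed
        finally show "(\<Sum>b<g. v a t * diff_op (\<rho> b (m + a)) (?\<phi> b) t) = v a t * diff_op (if a = a' then det P else 0) \<psi> t"
          by (simp add: adj[OF a] flip: sum_distrib_left)
      qed
      finally show "?F (m + a) (v a) = (if a = a' then LI (\<lambda>t. v a t * diff_op (det P) \<psi> t) else 0)" by simp
    qed
    also have "\<dots> = LI (\<lambda>t. v a' t * diff_op (det P) \<psi> t)" using a' by simp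
    finally show "LI (\<lambda>t. v a' t * diff_op (det P) \<psi> t) = 0" by simp
  qed (rule that)
qed

lemma state_exists:
  assumes w: "KB (stack m u y)"
  obtains x where "traj n m A B u x" "\<And>b. b < p \<Longrightarrow> AE t in MI. y b t = out n m C D u x b t"
proof -
  have u: "sq_int (u a)" if "a < m" for a using weak_kernel_sq_int[OF w, of a] that by (simp add: stack_def)
  have y: "sq_int (y b)" if "b < p" for b using weak_kernel_sq_int[OF w, of "m + b"] that by (simp add: stack_def)
  obtain x1 where x1: "traj n m A B u x1" using ex_traj[of m u n A B "\<lambda>_. 0"] u by auto
  let ?z = "\<lambda>(_::nat) (_::real). 0 :: real"
  let ?v = "\<lambda>b t. y b t - out n m C D u x1 b t"
  have "KB (\<lambda>a t. 1 * stack m u y a t + (-1) * stack m u (out n m C D u x1) a t)"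
    by (rule weak_kernel_lin[OF w traj_in_behavior[OF x1]])
  also have "(\<lambda>a t. 1 * stack m u y a t + (-1) * stack m u (out n m C D u x1) a t) = stack m ?z ?v"
    by (auto simp: stack_def fun_eq_iff)
  finally have v: "KB (stack m ?z ?v)" .
  have "\<forall>b<p. \<exists>f. smooth_on {-1..1} f \<and> (AE t in MI. ?v b t = f t)"
    using zero_input_output_smooth[OF v] by metis
  then obtain f where f: "\<And>b. b < p \<Longrightarrow> smooth_on {-1..1} (f b)" "\<And>b. b < p \<Longrightarrow> AE t in MI. ?v b t = f b t" by metis
  \<comment> \<open>The weak equations ignore null sets, so they hold for the smooth
    representatives, to which the representation applies.\<close>
  have "KB (stack m ?z f)"
  proof (rule weak_kernel_cong_AE[OF v])
    fix a assume a: "a < m + p"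
    thus "sq_int (stack m ?z f a)" by (auto simp: stack_def intro!: sq_int_cont smooth_on_continuous f)
    show "AE t in MI. stack m ?z ?v a t = stack m ?z f a t"
      using f(2)[of "a - m"] a by (cases "a < m") (auto simp: stack_def)
  qed
  then obtain x2 where x2: "traj n m A B ?z x2" "\<And>b t. b < p \<Longrightarrow> t \<in> \<I> \<Longrightarrow> f b t = out n m C D ?z x2 b t"
    using smooth_behavior_traj[of ?z f] f(1) smooth_on_const by blast
  let ?x = "\<lambda>i t. 1 * x1 i t + 1 * x2 i t"
  have "traj n m A B (\<lambda>a t. 1 * u a t + 1 * ?z a t) ?x" by (rule traj_lin[OF x1 x2(1)])
  hence "traj n m A B u ?x" by simp
  moreover have "AE t in MI. y b t = out n m C D u ?x b t" if "b < p" for b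
  proof -
    have "out n m C D u ?x b t = out n m C D u x1 b t + out n m C D ?z x2 b t" for t
      using out_lin[of n m C D 1 u 1 ?z x1 x2 b t] by simp
    note split = this
    have "AE t in MI. f b t = out n m C D ?z x2 b t" by (rule AE_MI_I) (rule x2(2)[OF that])
    with f(2)[OF that] show ?thesis by eventually_elim (simp add: split[simplified])
  qed
  ultimately show ?thesis by (rule that)
qed

end

section \<open>Controllability and minimality\<close>

definition mv :: "nat \<Rightarrow> (nat \<Rightarrow> nat \<Rightarrow> real) \<Rightarrow> (nat \<Rightarrow> real) \<Rightarrow> nat \<Rightarrow> real" where
  "mv n A v i = (\<Sum>j<n. A i j * v j)"

lemma vm_mv_adjoint: "(\<Sum>i<n. vm n A \<eta> i * v i) = (\<Sum>i<n. \<eta> i * mv n A v i)"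
  unfolding vm_def mv_def sum_distrib_left sum_distrib_right by (subst sum.swap) (simp add: mult.assoc)

lemma vm_mv_iter_adjoint: "(\<Sum>i<n. (vm n A ^^ k) \<eta> i * v i) = (\<Sum>i<n. \<eta> i * (mv n A ^^ k) v i)"
proof (induction k arbitrary: v)
  case (Suc k)
  have "(\<Sum>i<n. (vm n A ^^ Suc k) \<eta> i * v i) = (\<Sum>i<n. (vm n A ^^ k) \<eta> i * mv n A v i)"
    by (simp add: vm_mv_adjoint)
  also have "\<dots> = (\<Sum>i<n. \<eta> i * (mv n A ^^ k) (mv n A v) i)" by (rule Suc)
  finally show ?case by (simp add: funpow_swap1)
qed simp

lemma AE_lebesgue_on_negligible:
  assumes "AE t in lebesgue_on S. P t" "S \<in> sets lebesgue"
  obtains N where "negligible N" "\<And>t. t \<in> S - N \<Longrightarrow> P t"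
proof -
  have "AE t in lebesgue. t \<in> S \<longrightarrow> P t"
    using assms AE_restrict_space_iff[of S lebesgue P] by simp
  hence "negligible {t. \<not> (t \<in> S \<longrightarrow> P t)}"
    using eventually_ae_filter_negligible by (metis (mono_tags, lifting) mem_Collect_eq negligible_subset subsetI)
  thus ?thesis by (rule that) auto
qed

text \<open>The complement of a null set is dense in the interval, since a nonempty open set is
  never negligible; continuity does the rest.\<close>

lemma cont_zero_off_negligible:
  fixes f :: "real \<Rightarrow> real"
  assumes f: "continuous_on {a..b} f" and ab: "a < b" and N: "negligible N"
    and z: "\<And>t. t \<in> {a<..<b} - N \<Longrightarrow> f t = 0" and t: "t \<in> {a..b}"
  shows "f t = 0"
proof -
  have sub: "{a..b} \<subseteq> closure ({a<..<b} - N)"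
  proof
    fix x assume x: "x \<in> {a..b}"
    show "x \<in> closure ({a<..<b} - N)"
    proof (rule ccontr)
      assume "x \<notin> closure ({a<..<b} - N)"
      then obtain e where e: "0 < e" "\<And>y. y \<in> {a<..<b} - N \<Longrightarrow> \<not> dist y x < e"
        unfolding closure_approachable by blast
      let ?S = "{max a (x - e)<..<min b (x + e)}"
      have "?S \<subseteq> N"
      proof
        fix y assume y: "y \<in> ?S"
        hence "dist y x < e" by (auto simp: dist_real_def abs_if)
        thus "y \<in> N" using e(2)[of y] y by auto
      qed
      hence "negligible ?S" using N negligible_subset by blast
      moreover have "?S \<noteq> {}" using x ab e(1) by auto
      ultimately show False using open_not_negligible[of ?S] by auto
    qed
  qed
  have cl: "closure ({a<..<b} - N) = {a..b}"
  proof
    show "closure ({a<..<b} - N) \<subseteq> {a..b}" by (rule closure_minimal) auto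
  qed (rule sub)
  show ?thesis
    by (rule continuous_constant_on_closure[of "{a<..<b} - N" f 0 t]) (use f z t in \<open>simp_all add: cl\<close>)
qed

lemma zero_derivative_unique:
  assumes "((\<lambda>t. 0) has_real_derivative D) (at t within {a..b})" "a < b" "t \<in> {a..b}"
  shows "D = 0"
  using vector_derivative_unique_within_closed_interval[of a b t "\<lambda>t. 0" D 0] assms
  by (simp add: has_real_derivative_iff_has_vector_derivative)

lemma traj_cong_AE:
  assumes x: "traj n m A B u x" and v: "\<And>a. a < m \<Longrightarrow> sq_int (v a)" "\<And>a. a < m \<Longrightarrow> AE t in MI. u a t = v a t"
  shows "traj n m A B v x"
  unfolding traj_def
proof (intro conjI allI impI ballI)
  fix i and t :: real assume i: "i < n" and t: "t \<in> {-1..1}"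
  have "AE t in MI. \<forall>a\<in>{..<m}. u a t = v a t" by (rule AE_finite_allI) (use v in auto)
  hence "AE s in MI. (\<Sum>j<n. A i j * x j s) + (\<Sum>a<m. B i a * u a s) = (\<Sum>j<n. A i j * x j s) + (\<Sum>a<m. B i a * v a s)"
    by eventually_elim simp
  from J_cong_AE[OF this, of t] t traj_J[OF x i t]
  show "x i t = x i (-1) + J (\<lambda>s. (\<Sum>j<n. A i j * x j s) + (\<Sum>a<m. B i a * v a s)) t" by simp
qed (use v traj_cont[OF x] in simp_all)

lemma sq_int_indicator_mult: assumes "sq_int f" "S \<in> sets lebesgue" "S \<subseteq> \<I>"
  shows "sq_int (\<lambda>t. indicator S t * f t)"
  unfolding sq_int_def
proof
  have [measurable]: "f \<in> borel_measurable MI" by (rule sq_int_measurable[OF assms(1)])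
  have [measurable]: "S \<in> sets MI" using assms by (simp add: sets_restrict_space_iff)
  show "(\<lambda>t. indicator S t * f t) \<in> borel_measurable MI" by measurable
  show "integrable MI (\<lambda>t. (indicator S t * f t)\<^sup>2)"
    by (rule Bochner_Integration.integrable_bound[OF sq_int_sq[OF assms(1)]]) (auto simp: indicator_def)
qed

section \<open>Orthonormal families and subspaces\<close>

definition orthonormal :: "nat \<Rightarrow> nat \<Rightarrow> (nat \<Rightarrow> nat \<Rightarrow> real) \<Rightarrow> bool" where
  "orthonormal n r T \<longleftrightarrow> (\<forall>j<r. \<forall>k<r. (\<Sum>i<n. T j i * T k i) = (if j = k then 1 else 0))"

text \<open>Padding the rows of \<open>T\<close> with zeros gives a square matrix \<open>M\<close>
  with \<open>M M^T = 1\<close>, hence \<open>M^T M = 1\<close>. For \<open>r > n\<close> a padded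
  column contradicts this, which bounds \<open>r\<close>; for \<open>r = n\<close> it is the
  completeness relation.\<close>

lemma orthonormal_square:
  assumes "orthonormal n r T" "r \<ge> n" "i < r" "l < r"
  shows "(\<Sum>j<r. (if i < n then T j i else 0) * (if l < n then T j l else 0)) = (if i = l then 1 else 0)"
proof -
  let ?M = "mat r r (\<lambda>(j, i). if i < n then T j i else 0) :: real mat"
  have M: "?M \<in> carrier_mat r r" "transpose_mat ?M \<in> carrier_mat r r" by simp_all
  have "?M * transpose_mat ?M = 1\<^sub>m r"
  proof (rule eq_matI)
    fix j k assume "j < dim_row (1\<^sub>m r :: real mat)" "k < dim_col (1\<^sub>m r :: real mat)"
    hence jk: "j < r" "k < r" by simp_all
    have "(?M * transpose_mat ?M) $$ (j, k) = (\<Sum>i<r. (if i < n then T j i else 0) * (if i < n then T k i else 0))"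
      using jk by (simp add: scalar_prod_def atLeast0LessThan)
    also have "\<dots> = (\<Sum>i<n. T j i * T k i)"
      using assms(2) by (intro sum.mono_neutral_cong_right) auto
    finally show "(?M * transpose_mat ?M) $$ (j, k) = 1\<^sub>m r $$ (j, k)"
      using assms(1) jk by (simp add: orthonormal_def)
  qed simp_all
  hence "transpose_mat ?M * ?M = 1\<^sub>m r" by (rule mat_mult_left_right_inverse[OF M])
  hence "(transpose_mat ?M * ?M) $$ (i, l) = (if i = l then 1 else 0)" using assms by simp
  thus ?thesis using assms by (simp add: scalar_prod_def atLeast0LessThan)
qed

lemma orthonormal_le: assumes "orthonormal n r T" shows "r \<le> n"
proof (rule ccontr)
  assume "\<not> r \<le> n"
  thus False using orthonormal_square[OF assms, of n n] by simp
qed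

lemma orthonormal_full: assumes "orthonormal n n T" "i < n" "l < n"
  shows "(\<Sum>j<n. T j i * T j l) = (if i = l then 1 else 0)"
  using orthonormal_square[OF assms(1), of i l] assms by simp

text \<open>Vectors are functions of which the first \<open>n\<close> values count, and subspaces
  are predicates. A longest orthonormal family inside \<open>V\<close> exists by
  \<open>orthonormal_le\<close>; it spans \<open>V\<close>, because the residual \<open>e\<close> of
  an expansion could otherwise be normalised and appended.\<close>

lemma subspace_orthonormal_basis:
  fixes V :: "(nat \<Rightarrow> real) \<Rightarrow> bool"
  assumes lin: "\<forall>v w c d. V v \<longrightarrow> V w \<longrightarrow> V (\<lambda>i. c * v i + d * w i)" and V0: "V (\<lambda>_. 0)"
  obtains r T where "orthonormal n r T" "\<And>j. j < r \<Longrightarrow> V (T j)"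
    "\<And>v i. V v \<Longrightarrow> i < n \<Longrightarrow> v i = (\<Sum>j<r. (\<Sum>l<n. T j l * v l) * T j i)"
proof -
  note V = lin[rule_format]
  let ?Q = "\<lambda>r. \<exists>T. orthonormal n r T \<and> (\<forall>j<r. V (T j))"
  have "?Q 0" by (simp add: orthonormal_def)
  moreover have "\<forall>r. ?Q r \<longrightarrow> r \<le> n" using orthonormal_le by blast
  ultimately obtain r where r: "?Q r" "\<And>r'. ?Q r' \<Longrightarrow> r' \<le> r"
    using GreatestI_nat[of ?Q 0 n] Greatest_le_nat[of ?Q _ n] by blast
  obtain T where T: "orthonormal n r T" "\<And>j. j < r \<Longrightarrow> V (T j)" using r(1) by blast
  have Vsum: "V (\<lambda>i. \<Sum>j<k. c j * T j i)" if "k \<le> r" for k c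
    using that
  proof (induction k)
    case (Suc k)
    thus ?case using V[of "\<lambda>i. \<Sum>j<k. c j * T j i" "T k" 1 "c k"] T(2)[of k] by simp
  qed (simp add: V0)
  show ?thesis
  proof (rule that[OF T])
    fix v i assume v: "V v" and i: "i < n"
    let ?c = "\<lambda>j. \<Sum>l<n. T j l * v l"
    define e where "e l = v l - (\<Sum>j<r. ?c j * T j l)" for l
    have eT: "(\<Sum>l<n. T k l * e l) = 0" if k: "k < r" for k
    proof -
      have "(\<Sum>l<n. T k l * e l) = ?c k - (\<Sum>l<n. \<Sum>j<r. ?c j * (T k l * T j l))"
        by (simp add: e_def right_diff_distrib sum_subtractf sum_distrib_left mult.left_commute)
      also have "(\<Sum>l<n. \<Sum>j<r. ?c j * (T k l * T j l)) = (\<Sum>j<r. ?c j * (\<Sum>l<n. T k l * T j l))"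
        by (subst sum.swap) (simp add: sum_distrib_left)
      also have "\<dots> = (\<Sum>j<r. ?c j * (if k = j then 1 else 0))"
        using T(1) k by (intro sum.cong refl) (simp add: orthonormal_def)
      also have "\<dots> = ?c k" using k by (simp add: if_distrib[of "\<lambda>x. _ * x"] cong: if_cong)
      finally show ?thesis by simp
    qed
    have Ve: "V e" using V[OF v Vsum[OF order_refl, of ?c], of 1 "-1"] by (simp add: e_def [abs_def])
    have "(\<Sum>l<n. (e l)\<^sup>2) = 0"
    proof (rule ccontr)
      assume ne: "(\<Sum>l<n. (e l)\<^sup>2) \<noteq> 0"
      let ?s = "sqrt (\<Sum>l<n. (e l)\<^sup>2)"
      have s: "?s \<noteq> 0" "?s * ?s = (\<Sum>l<n. (e l)\<^sup>2)" using ne by (auto simp: sum_nonneg)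
      \<comment> \<open>The summand \<open>0 * e l\<close> gives the new vector the shape
        \<open>c * v + d * w\<close> of the closure hypothesis.\<close>
      define T' where "T' j = (if j < r then T j else (\<lambda>l. (1 / ?s) * e l + 0 * e l))" for j
      have "orthonormal n (Suc r) T'"
        unfolding orthonormal_def
      proof (intro allI impI)
        fix j k assume jk: "j < Suc r" "k < Suc r"
        consider "j < r" "k < r" | "j < r" "k = r" | "j = r" "k < r" | "j = r" "k = r" using jk by linarith
        thus "(\<Sum>i<n. T' j i * T' k i) = (if j = k then 1 else 0)"
        proof cases
          case 1 thus ?thesis using T(1) by (simp add: T'_def orthonormal_def)
        next
          case 2
          have "(\<Sum>i<n. T' j i * T' k i) = (1 / ?s) * (\<Sum>i<n. T j i * e i)"
            using 2 by (simp add: T'_def sum_distrib_left)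
          thus ?thesis using eT 2 by simp
        next
          case 3
          have "(\<Sum>i<n. T' j i * T' k i) = (1 / ?s) * (\<Sum>i<n. T k i * e i)"
            using 3 by (simp add: T'_def sum_divide_distrib mult.commute)
          thus ?thesis using eT 3 by simp
        next
          case 4
          have "(\<Sum>i<n. T' j i * T' k i) = (\<Sum>i<n. (e i)\<^sup>2) / (?s * ?s)"
            using 4 by (simp add: T'_def sum_divide_distrib power2_eq_square)
          thus ?thesis using 4 s ne by simp
        qed
      qed
      moreover have "\<forall>j<Suc r. V (T' j)" using T(2) V[OF Ve Ve, of "1 / ?s" 0] by (simp add: T'_def)
      ultimately have "Suc r \<le> r" using r(2) by blast
      thus False by simp
    qed
    hence "\<forall>l\<in>{..<n}. (e l)\<^sup>2 = 0" by (subst (asm) sum_nonneg_eq_0_iff) auto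
    thus "v i = (\<Sum>j<r. ?c j * T j i)" using i by (simp add: e_def)
  qed
qed

lemma vm_iter_sum: "i < n \<Longrightarrow> (\<And>i. i < n \<Longrightarrow> \<eta> i = (\<Sum>j<N. c j * \<xi> j i)) \<Longrightarrow>
   (vm n A ^^ k) \<eta> i = (\<Sum>j<N. c j * (vm n A ^^ k) (\<xi> j) i)"
proof (induction k arbitrary: i)
  case (Suc k)
  have "(vm n A ^^ Suc k) \<eta> i = (\<Sum>l<n. (vm n A ^^ k) \<eta> l * A l i)" by (simp add: vm_def)
  also have "\<dots> = (\<Sum>l<n. (\<Sum>j<N. c j * (vm n A ^^ k) (\<xi> j) l) * A l i)"
    by (intro sum.cong refl arg_cong2[of _ _ _ _ "(*)"] Suc.IH Suc.prems(2)) auto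
  also have "\<dots> = (\<Sum>j<N. c j * (vm n A ^^ Suc k) (\<xi> j) i)"
    unfolding sum_distrib_right by (subst sum.swap) (simp add: vm_def sum_distrib_left mult.assoc)
  finally show ?case .
qed simp

text \<open>Among \<open>n + 1\<close> covectors \<open>\<xi> A\<^sup>k\<close> one depends on its predecessors, so powers below \<open>n\<close> suffice.\<close>

lemma krylov_annihilator:
  assumes "\<And>k. k < n \<Longrightarrow> (\<Sum>i<n. (vm n A ^^ k) \<xi> i * v i) = 0"
  shows "(\<Sum>i<n. (vm n A ^^ k) \<xi> i * v i) = 0"
proof -
  \<comment> \<open>The \<open>n + 1\<close> covectors have only \<open>n\<close> coordinates; a
    zero row makes the matrix of columns square and visibly singular, so its kernel contains a
    linear relation.\<close>
  let ?M = "mat (Suc n) (Suc n) (\<lambda>(i, k). if i < n then (vm n A ^^ k) \<xi> i else 0) :: real mat"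
  have M: "?M \<in> carrier_mat (Suc n) (Suc n)" "transpose_mat ?M \<in> carrier_mat (Suc n) (Suc n)" by simp_all
  have "transpose_mat ?M *\<^sub>v unit_vec (Suc n) n = 0\<^sub>v (Suc n)"
    by (rule eq_vecI) (auto simp: scalar_prod_def unit_vec_def intro!: sum.neutral)
  moreover have "unit_vec (Suc n) n \<noteq> (0\<^sub>v (Suc n) :: real vec)" by simp
  ultimately have "det (transpose_mat ?M) = 0"
    using det_0_iff_vec_prod_zero_field[OF M(2)] unit_vec_carrier[of "Suc n" n] by blast
  hence "det ?M = 0" using det_transpose[OF M(1)] by simp
  then obtain c where c: "c \<in> carrier_vec (Suc n)" "c \<noteq> 0\<^sub>v (Suc n)" "?M *\<^sub>v c = 0\<^sub>v (Suc n)"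
    using det_0_iff_vec_prod_zero_field[OF M(1)] by blast
  have dep: "(\<Sum>k<Suc n. (vm n A ^^ k) \<xi> i * c $ k) = 0" if "i < n" for i
  proof -
    have "(?M *\<^sub>v c) $ i = (\<Sum>k<Suc n. (vm n A ^^ k) \<xi> i * c $ k)"
      using that c(1) by (simp add: scalar_prod_def atLeast0LessThan del: sum.lessThan_Suc)
    thus ?thesis using c(3) that by simp
  qed
  let ?K = "{k. k < Suc n \<and> c $ k \<noteq> 0}"
  have "?K \<noteq> {}" using c(1,2) by (auto simp: vec_eq_iff)
  \<comment> \<open>The last covector with a nonzero coefficient depends on its predecessors;
    applying powers of \<open>A\<close> then expresses all higher ones by lower ones.\<close>
  define j0 where "j0 = Max ?K"
  have j0: "j0 < Suc n" "c $ j0 \<noteq> 0" using Max_in[of ?K] \<open>?K \<noteq> {}\<close> by (auto simp: j0_def)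
  have top: "c $ k = 0" if "j0 < k" "k < Suc n" for k
  proof (rule ccontr)
    assume "c $ k \<noteq> 0"
    hence "k \<le> Max ?K" using that(2) by (intro Max_ge) auto
    thus False using that(1) by (simp add: j0_def)
  qed
  define d where "d k = - (c $ k) / c $ j0" for k
  have rel: "(vm n A ^^ j0) \<xi> i = (\<Sum>k<j0. d k * (vm n A ^^ k) \<xi> i)" if "i < n" for i
  proof -
    have "0 = (\<Sum>k<Suc j0. (vm n A ^^ k) \<xi> i * c $ k)"
      using dep[OF that] top j0(1) sum.mono_neutral_right[of "{..<Suc n}" "{..<Suc j0}" "\<lambda>k. (vm n A ^^ k) \<xi> i * c $ k"]
      by (force simp del: sum.lessThan_Suc)
    hence "c $ j0 * (vm n A ^^ j0) \<xi> i = - (\<Sum>k<j0. c $ k * (vm n A ^^ k) \<xi> i)" by (simp add: mult.commute)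
    hence "(vm n A ^^ j0) \<xi> i = - (\<Sum>k<j0. c $ k * (vm n A ^^ k) \<xi> i) / c $ j0" using j0(2) by (simp add: field_simps)
    thus ?thesis by (simp add: d_def sum_divide_distrib sum_negf)
  qed
  show ?thesis
  proof (induction k rule: less_induct)
    case (less k)
    show ?case
    proof (cases "k < j0")
      case True thus ?thesis using assms j0(1) by simp
    next
      case False
      have "(vm n A ^^ k) \<xi> i = (\<Sum>j<j0. d j * (vm n A ^^ (k - j0)) ((vm n A ^^ j) \<xi>) i)" if "i < n" for i
        using vm_iter_sum[OF that, where \<eta> = "(vm n A ^^ j0) \<xi>" and N = j0 and c = d and \<xi> = "\<lambda>j. (vm n A ^^ j) \<xi>" and A = A and k = "k - j0"] rel False
        by (simp flip: funpow_add[THEN fun_cong, unfolded o_def])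
      hence "(\<Sum>i<n. (vm n A ^^ k) \<xi> i * v i) = (\<Sum>i<n. \<Sum>j<j0. d j * ((vm n A ^^ (k - j0 + j)) \<xi> i * v i))"
        by (simp add: sum_distrib_right mult.assoc funpow_add)
      also have "\<dots> = (\<Sum>j<j0. d j * (\<Sum>i<n. (vm n A ^^ (k - j0 + j)) \<xi> i * v i))"
        by (subst sum.swap) (simp add: sum_distrib_left)
      also have "\<dots> = 0" using less False by (intro sum.neutral) auto
      finally show ?thesis .
    qed
  qed
qed

section \<open>Reachable and unobservable states\<close>

definition behavior_controllable :: "((nat \<Rightarrow> real \<Rightarrow> real) \<Rightarrow> bool) \<Rightarrow> nat \<Rightarrow> bool" where
  "behavior_controllable \<K> q \<longleftrightarrow> (\<forall>w0 w1. \<K> w0 \<longrightarrow> \<K> w1 \<longrightarrow> (\<exists>t1\<in>{0<..<1}. \<exists>w. \<K> w \<and>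
     (\<forall>a<q. AE t in lebesgue_on {-1<..0}. w a t = w0 a t) \<and>
     (\<forall>a<q. AE t in lebesgue_on {t1..<1}. w a t = w1 a (t - t1))))"

context iso_system
begin

text \<open>The annihilator of the controllable subspace, the span of the columns of all
  \<open>A^k B\<close>.\<close>

definition reachable_annih :: "(nat \<Rightarrow> real) \<Rightarrow> bool" where
  "reachable_annih \<xi> \<longleftrightarrow> (\<forall>k. \<forall>a<m. (\<Sum>i<n. (vm n A ^^ k) \<xi> i * B i a) = 0)"

text \<open>A double annihilator in place of a span: membership becomes a family of linear
  equations, which \<open>annihilator_invariant\<close> transports along trajectories.\<close>

definition reachable :: "(nat \<Rightarrow> real) \<Rightarrow> bool" where
  "reachable v \<longleftrightarrow> (\<forall>\<xi>. reachable_annih \<xi> \<longrightarrow> (\<Sum>i<n. \<xi> i * v i) = 0)"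

definition unobservable :: "(nat \<Rightarrow> real) \<Rightarrow> bool" where
  "unobservable v \<longleftrightarrow> (\<forall>k. \<forall>b<p. (\<Sum>i<n. (vm n A ^^ k) (C b) i * v i) = 0)"

lemma reachable_annih_vm: "reachable_annih \<xi> \<Longrightarrow> reachable_annih ((vm n A ^^ k) \<xi>)"
  unfolding reachable_annih_def by (metis funpow_add comp_apply)

lemma reachable_annih_input: assumes "reachable_annih \<xi>" shows "(\<Sum>i<n. (vm n A ^^ k) \<xi> i * (\<Sum>a<m. B i a * u a)) = 0"
proof -
  have "(\<Sum>i<n. (vm n A ^^ k) \<xi> i * (\<Sum>a<m. B i a * u a)) = (\<Sum>a<m. (\<Sum>i<n. (vm n A ^^ k) \<xi> i * B i a) * u a)"
    unfolding sum_distrib_left sum_distrib_right by (subst sum.swap) (simp add: mult.assoc)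
  thus ?thesis using assms by (simp add: reachable_annih_def)
qed

lemma reachable_mv: assumes "reachable v" shows "reachable (mv n A v)"
  unfolding reachable_def
proof (intro allI impI)
  fix \<xi> assume "reachable_annih \<xi>"
  hence "reachable_annih (vm n A \<xi>)" using reachable_annih_vm[of \<xi> 1] by simp
  thus "(\<Sum>i<n. \<xi> i * mv n A v i) = 0" using assms unfolding vm_mv_adjoint[symmetric] reachable_def by blast
qed

lemma reachable_input: "reachable (\<lambda>i. \<Sum>a<m. B i a * u a)"
  unfolding reachable_def using reachable_annih_input[of _ 0] by simp

lemma reachable_lin: "reachable v \<Longrightarrow> reachable w \<Longrightarrow> reachable (\<lambda>i. c * v i + d * w i)"
proof -
  assume vw: "reachable v" "reachable w"
  have "(\<Sum>i<n. \<xi> i * (c * v i + d * w i)) = c * (\<Sum>i<n. \<xi> i * v i) + d * (\<Sum>i<n. \<xi> i * w i)" for \<xi>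
    by (simp add: distrib_left sum.distrib sum_distrib_left mult.left_commute)
  thus ?thesis using vw by (simp add: reachable_def)
qed

lemma unobservable_mv: assumes "unobservable v" shows "unobservable (mv n A v)"
  unfolding unobservable_def
proof (intro allI impI)
  fix k b assume "b < p"
  hence "(\<Sum>i<n. (vm n A ^^ Suc k) (C b) i * v i) = 0" using assms unfolding unobservable_def by blast
  thus "(\<Sum>i<n. (vm n A ^^ k) (C b) i * mv n A v i) = 0" by (simp add: vm_mv_adjoint)
qed

lemma unobservable_mv_iter: "unobservable v \<Longrightarrow> unobservable ((mv n A ^^ k) v)" by (induction k) (auto intro: unobservable_mv)

lemma reachable_mv_iter: "reachable v \<Longrightarrow> reachable ((mv n A ^^ k) v)" by (induction k) (auto intro: reachable_mv)

text \<open>Steer from zero to the zero-input response of an arbitrary state \<open>x0\<close>: the connecting state starts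
  unobservable, ends at \<open>x0\<close> modulo unobservable states, and never leaves reachable plus unobservable.\<close>

lemma reachable_plus_unobservable_total:
  assumes ctrl: "behavior_controllable KB (m + p)"
    and \<eta>r: "\<And>v. reachable v \<Longrightarrow> (\<Sum>i<n. \<eta> i * v i) = 0"
    and \<eta>u: "\<And>v. unobservable v \<Longrightarrow> (\<Sum>i<n. \<eta> i * v i) = 0"
  shows "(\<Sum>i<n. \<eta> i * x0 i) = 0"
proof -
  let ?z = "\<lambda>(_::nat) (_::real). 0 :: real"
  let ?\<eta> = "\<lambda>k. (vm n A ^^ k) \<eta>"
  have \<eta>u': "(\<Sum>i<n. ?\<eta> k i * v i) = 0" if "unobservable v" for k v
    unfolding vm_mv_iter_adjoint by (rule \<eta>u[OF unobservable_mv_iter[OF that]])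
  have "(\<Sum>i<n. ?\<eta> k i * B i a) = 0" if "a < m" for k a
  proof -
    have "reachable (\<lambda>i. B i a)" using reachable_input[of "\<lambda>a'. if a' = a then 1 else 0"] that
      by (simp add: if_distrib[of "\<lambda>x. _ * x"] cong: if_cong)
    thus ?thesis unfolding vm_mv_iter_adjoint by (intro \<eta>r reachable_mv_iter)
  qed
  hence \<eta>a: "reachable_annih \<eta>" by (simp add: reachable_annih_def)
  obtain x1 where x1: "traj n m A B ?z x1" "\<And>i. i < n \<Longrightarrow> x1 i (-1) = x0 i"
    using ex_traj[of m ?z n A B x0] by auto
  let ?w1 = "stack m ?z (out n m C D ?z x1)"
  have w1: "KB ?w1" by (rule traj_in_behavior[OF x1(1)])
  have w0: "KB ?z" using weak_kernel_lin[OF w1 w1, of 0 0] by simp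
  from ctrl w0 w1 obtain t1 w where t1: "t1 \<in> {0<..<1}" and w: "KB w"
    and wl: "\<And>a. a < m + p \<Longrightarrow> AE t in lebesgue_on {-1<..0}. w a t = ?z a t"
    and wr: "\<And>a. a < m + p \<Longrightarrow> AE t in lebesgue_on {t1..<1}. w a t = ?w1 a (t - t1)"
    unfolding behavior_controllable_def by blast
  let ?y = "\<lambda>b. w (m + b)"
  have "stack m w ?y = w" by (auto simp: stack_def fun_eq_iff)
  hence "KB (stack m w ?y)" using w by simp
  then obtain xt where xt: "traj n m A B w xt" and yt: "\<And>b. b < p \<Longrightarrow> AE t in MI. ?y b t = out n m C D w xt b t"
    by (rule state_exists) (rule that, simp_all)
  have "\<exists>N. negligible N \<and> (\<forall>t\<in>{-1<..0} - N. w a t = 0)" if "a < m + p" for a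
    by (rule AE_lebesgue_on_negligible[OF wl[OF that]]) auto
  then obtain Nl where Nl: "\<And>a. a < m + p \<Longrightarrow> negligible (Nl a)" "\<And>a t. a < m + p \<Longrightarrow> t \<in> {-1<..0} - Nl a \<Longrightarrow> w a t = 0"
    by metis
  have "\<exists>N. negligible N \<and> (\<forall>t\<in>{t1..<1} - N. w a t = ?w1 a (t - t1))" if "a < m + p" for a
    by (rule AE_lebesgue_on_negligible[OF wr[OF that]]) auto
  then obtain Nr where Nr: "\<And>a. a < m + p \<Longrightarrow> negligible (Nr a)" "\<And>a t. a < m + p \<Longrightarrow> t \<in> {t1..<1} - Nr a \<Longrightarrow> w a t = ?w1 a (t - t1)"
    by metis
  have "\<exists>N. negligible N \<and> (\<forall>t\<in>{-1..1} - N. ?y b t = out n m C D w xt b t)" if "b < p" for b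
    by (rule AE_MI_neg[OF yt[OF that]]) auto
  then obtain Ny where Ny: "\<And>b. b < p \<Longrightarrow> negligible (Ny b)" "\<And>b t. b < p \<Longrightarrow> t \<in> {-1..1} - Ny b \<Longrightarrow> ?y b t = out n m C D w xt b t"
    by metis
  \<comment> \<open>Outside \<open>{0<..<t1}\<close> the input of \<open>w\<close> vanishes only
    almost everywhere. The representative \<open>v\<close> vanishes there exactly, as
    \<open>covector_derivative\<close> demands.\<close>
  define v where "v a t = indicator {0<..<t1} t * w a t" for a t
  have vz: "v a t = 0" if "t \<le> 0 \<or> t1 \<le> t" for a t using that by (auto simp: v_def)
  have vsq: "sq_int (v a)" if "a < m" for a unfolding v_def [abs_def]
    by (rule sq_int_indicator_mult) (use traj_u[OF xt that] t1 in auto)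
  have wv: "w a t = v a t" if at: "a < m" "t \<in> \<I> - (Nl a \<union> Nr a)" for a t
  proof -
    consider "t \<in> {-1<..0}" | "t \<in> {t1..<1}" | "t \<in> {0<..<t1}" using at(2) t1 by force
    thus ?thesis
      using Nl(2)[of a t] Nr(2)[of a t] at by cases (auto simp: v_def stack_def indicator_def)
  qed
  have "AE t in MI. w a t = v a t" if a: "a < m" for a
  proof -
    have "negligible (Nl a \<union> Nr a)" using Nl(1)[of a] Nr(1)[of a] a by auto
    hence "AE t in lebesgue. t \<notin> Nl a \<union> Nr a"
      by (metis (mono_tags, lifting) AE_iff_null_sets eventually_mono negligible_iff_null_sets null_setsD2)
    thus ?thesis unfolding AE_MI by eventually_elim (use wv[OF a] in blast)
  qed
  hence xv: "traj n m A B v xt" by (intro traj_cong_AE[OF xt vsq])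
  have xc: "continuous_on S (\<lambda>t. \<Sum>i<n. \<xi> i * xt i t)" if "S \<subseteq> {-1..1}" for \<xi> S
    by (intro continuous_intros continuous_on_subset[OF traj_cont[OF xt] that]) auto
  have x1c: "continuous_on {-1..1} (\<lambda>t. \<Sum>i<n. \<xi> i * x1 i t)" for \<xi>
    by (intro continuous_intros traj_cont[OF x1(1)]) auto

  \<comment> \<open>On \<open>{-1..0}\<close> input and output vanish, hence all derivatives of the
    output do: the initial state is unobservable.\<close>
  let ?h = "\<lambda>b k t. \<Sum>i<n. (vm n A ^^ k) (C b) i * xt i t"
  have dl: "(?h b k has_real_derivative ?h b (Suc k) t) (at t within {-1..0})" if "t \<in> {-1..0}" for b k t
    using covector_derivative[OF xv, of "-1" 0 "(vm n A ^^ k) (C b)" t] that by (simp add: vz)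
  have hl: "\<forall>t\<in>{-1..0}. ?h b k t = 0" if b: "b < p" for b k
  proof (induction k)
    case 0
    have neg: "negligible (Ny b \<union> Nl (m + b) \<union> (\<Union>a\<in>{..<m}. Nl a))"
      using Ny(1)[OF b] Nl(1) b by (intro negligible_Un negligible_Union) auto
    have "(\<Sum>i<n. C b i * xt i t) = 0" if "t \<in> {-1<..<0} - (Ny b \<union> Nl (m + b) \<union> (\<Union>a\<in>{..<m}. Nl a))" for t
    proof -
      have "w a t = 0" if "a < m" for a using Nl(2)[of a t] \<open>t \<in> _\<close> that by force
      moreover have "w (m + b) t = 0" using Nl(2)[of "m + b" t] that b by force
      ultimately show ?thesis using Ny(2)[OF b, of t] that by (force simp: out_def)
    qed
    thus ?case using cont_zero_off_negligible[OF xc[of "{-1..0}"] _ neg] by simp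
  next
    case (Suc k)
    show ?case
    proof
      fix t :: real assume t: "t \<in> {-1..0}"
      have "((\<lambda>t. 0) has_real_derivative ?h b (Suc k) t) (at t within {-1..0})"
        by (rule DERIV_within_transform[OF dl[OF t] t]) (use Suc in auto)
      thus "?h b (Suc k) t = 0" by (rule zero_derivative_unique) (use t in auto)
    qed
  qed
  have u0: "unobservable (\<lambda>i. xt i (-1))" using hl by (simp add: unobservable_def)
  \<comment> \<open>All covectors \<open>\<eta> A^k\<close> kill the unobservable initial state and
    the input term, so they kill the state at all times.\<close>
  have \<eta>x: "(\<Sum>i<n. ?\<eta> k i * xt i t) = 0" if "t \<in> {-1..1}" for k t
  proof (rule annihilator_invariant[OF xt _ _ _ _ _ that])
    show "(-1::real) \<in> {-1..1}" by simp
    show "(\<Sum>i<n. (vm n A ^^ l) (?\<eta> k) i * (\<Sum>a<m. B i a * w a t)) = 0" for l t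
      by (rule reachable_annih_input[OF reachable_annih_vm[OF \<eta>a]])
    show "(\<Sum>i<n. (vm n A ^^ l) (?\<eta> k) i * xt i (-1)) = 0" for l
      using \<eta>u'[OF u0, of "l + k"] by (simp add: funpow_add)
  qed auto

  \<comment> \<open>On \<open>{t1..1}\<close> the output agrees with that of \<open>x1\<close>
    delayed by \<open>t1\<close>, so at time \<open>t1\<close> the two states differ by an
    unobservable one.\<close>
  let ?H = "\<lambda>b k t. ?h b k t - (\<Sum>i<n. (vm n A ^^ k) (C b) i * x1 i (t - t1))"
  have dr: "(?H b k has_real_derivative ?H b (Suc k) t) (at t within {t1..1})" if t: "t \<in> {t1..1}" for b k t
  proof -
    have 1: "(?h b k has_real_derivative ?h b (Suc k) t) (at t within {t1..1})"
      using covector_derivative[OF xv, of t1 1 "(vm n A ^^ k) (C b)" t] t t1 by (simp add: vz)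
    let ?g = "\<lambda>k t. \<Sum>i<n. (vm n A ^^ k) (C b) i * x1 i t"
    have "(?g k has_real_derivative ?g (Suc k) (t - t1)) (at (t - t1) within {0..1-t1})"
      using covector_derivative[OF x1(1), of 0 "1-t1" "(vm n A ^^ k) (C b)" "t - t1"] t t1 by simp
    moreover have "(\<lambda>t. t - t1) ` {t1..1} = {0..1-t1}" by (simp add: image_diff_atLeastAtMost)
    ultimately have "((\<lambda>t. ?g k (t - t1)) has_real_derivative ?g (Suc k) (t - t1) * 1) (at t within {t1..1})"
      by (intro DERIV_image_chain[unfolded o_def]) (auto intro!: derivative_eq_intros)
    thus ?thesis using DERIV_diff[OF 1, of "\<lambda>t. ?g k (t - t1)" "?g (Suc k) (t - t1)"] by simp
  qed
  have hr: "\<forall>t\<in>{t1..1}. ?H b k t = 0" if b: "b < p" for b k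
  proof (induction k)
    case 0
    have neg: "negligible (Ny b \<union> Nr (m + b) \<union> (\<Union>a\<in>{..<m}. Nr a))"
      using Ny(1)[OF b] Nr(1) b by (intro negligible_Un negligible_Union) auto
    have "?H b 0 t = 0" if "t \<in> {t1<..<1} - (Ny b \<union> Nr (m + b) \<union> (\<Union>a\<in>{..<m}. Nr a))" for t
    proof -
      have "w a t = 0" if "a < m" for a using Nr(2)[of a t] \<open>t \<in> _\<close> that by (force simp: stack_def)
      moreover have "w (m + b) t = out n m C D ?z x1 b (t - t1)" using Nr(2)[of "m + b" t] that b by (force simp: stack_def)
      moreover have "t \<in> {-1..1} - Ny b" using that t1 by auto
      ultimately show ?thesis using Ny(2)[OF b, of t] by (simp add: out_def)
    qed
    moreover have "continuous_on {t1..1} (?H b 0)"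
    proof (intro continuous_on_diff xc)
      show "continuous_on {t1..1} (\<lambda>t. \<Sum>i<n. (vm n A ^^ 0) (C b) i * x1 i (t - t1))"
        by (rule continuous_on_compose2[OF x1c]) (use t1 in \<open>auto intro!: continuous_intros\<close>)
    qed (use t1 in auto)
    ultimately show ?case using cont_zero_off_negligible[of t1 1 "?H b 0", OF _ _ neg] t1 by auto
  next
    case (Suc k)
    show ?case
    proof
      fix t :: real assume t: "t \<in> {t1..1}"
      have "((\<lambda>t. 0) has_real_derivative ?H b (Suc k) t) (at t within {t1..1})"
        by (rule DERIV_within_transform[OF dr[OF t] t]) (use Suc in auto)
      thus "?H b (Suc k) t = 0" by (rule zero_derivative_unique) (use t t1 in auto)
    qed
  qed
  have "unobservable (\<lambda>i. xt i t1 - x1 i 0)"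
    unfolding unobservable_def
  proof (intro allI impI)
    fix k b assume "b < p"
    from hr[OF this, of k] have "?H b k t1 = 0" using t1 by auto
    thus "(\<Sum>i<n. (vm n A ^^ k) (C b) i * (xt i t1 - x1 i 0)) = 0" by (simp add: right_diff_distrib sum_subtractf)
  qed
  hence "(\<Sum>i<n. ?\<eta> k i * (xt i t1 - x1 i 0)) = 0" for k by (rule \<eta>u')
  hence x10: "(\<Sum>i<n. ?\<eta> k i * x1 i 0) = 0" for k
    using \<eta>x[of t1 k] t1 by (simp add: right_diff_distrib sum_subtractf)
  \<comment> \<open>The delay makes time \<open>t1\<close> correspond to time 0 of
    \<open>x1\<close>. Zero-input invariance leads from there back to the prescribed state
    \<open>x0\<close> at \<open>-1\<close>.\<close>
  have "(\<Sum>i<n. \<eta> i * x1 i (-1)) = 0"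
    by (rule annihilator_invariant[OF x1(1), of "-1" 1 \<eta> 0]) (use x10 in auto)
  thus ?thesis using x1(2) by simp
qed

end

text \<open>\<open>\<eta>\<close> is the residual of an orthonormal expansion. Orthogonality refers
  to the first \<open>n\<close> coordinates, whereas the splitting of \<open>x\<close> holds at
  every index.\<close>

lemma subspace_orthogonal_decomposition:
  fixes V :: "(nat \<Rightarrow> real) \<Rightarrow> bool" and x :: "nat \<Rightarrow> real"
  assumes lin: "\<forall>v w c d. V v \<longrightarrow> V w \<longrightarrow> V (\<lambda>i. c * v i + d * w i)" and V0: "V (\<lambda>_. 0)"
  obtains v \<eta> where "V v" "\<And>w. V w \<Longrightarrow> (\<Sum>i<n. \<eta> i * w i) = 0" "\<And>i. x i = v i + \<eta> i"
proof -
  note V = lin[rule_format]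
  obtain r T where T: "orthonormal n r T" "\<And>j. j < r \<Longrightarrow> V (T j)"
    "\<And>v i. V v \<Longrightarrow> i < n \<Longrightarrow> v i = (\<Sum>j<r. (\<Sum>l<n. T j l * v l) * T j i)"
    using subspace_orthonormal_basis[of V n, OF lin V0] by blast
  let ?c = "\<lambda>j. \<Sum>l<n. T j l * x l"
  define v where "v i = (\<Sum>j<r. ?c j * T j i)" for i
  have Vsum: "V (\<lambda>i. \<Sum>j<k. c j * T j i)" if "k \<le> r" for k c
    using that
  proof (induction k)
    case (Suc k)
    thus ?case using V[of "\<lambda>i. \<Sum>j<k. c j * T j i" "T k" 1 "c k"] T(2)[of k] by simp
  qed (simp add: V0)
  show ?thesis
  proof (rule that[of v "\<lambda>i. x i - v i"])
    show "V v" unfolding v_def [abs_def] by (rule Vsum) simp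
    have vT: "(\<Sum>i<n. T k i * v i) = ?c k" if k: "k < r" for k
    proof -
      have "(\<Sum>i<n. T k i * v i) = (\<Sum>j<r. ?c j * (\<Sum>i<n. T k i * T j i))"
        unfolding v_def sum_distrib_left by (subst sum.swap) (simp add: mult.left_commute)
      also have "\<dots> = (\<Sum>j<r. ?c j * (if k = j then 1 else 0))"
        using T(1) k by (intro sum.cong refl) (simp add: orthonormal_def)
      finally show ?thesis using k by (simp add: if_distrib[of "\<lambda>x. _ * x"] cong: if_cong)
    qed
    fix w assume w: "V w"
    have "(\<Sum>i<n. (x i - v i) * w i) = (\<Sum>i<n. (x i - v i) * (\<Sum>j<r. (\<Sum>l<n. T j l * w l) * T j i))"
      by (intro sum.cong refl arg_cong2[of _ _ _ _ "(*)"] T(3)[OF w]) simp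
    also have "\<dots> = (\<Sum>j<r. (\<Sum>l<n. T j l * w l) * (\<Sum>i<n. T j i * (x i - v i)))"
      unfolding sum_distrib_left[of "x _ - v _"] by (subst sum.swap) (simp add: sum_distrib_left ac_simps)
    also have "\<dots> = 0"
      using vT by (intro sum.neutral) (simp add: right_diff_distrib sum_subtractf)
    finally show "(\<Sum>i<n. (x i - v i) * w i) = 0" .
  qed simp
qed

context iso_system
begin

lemma unobservable_lin: "unobservable v \<Longrightarrow> unobservable w \<Longrightarrow> unobservable (\<lambda>i. c * v i + d * w i)"
proof -
  assume vw: "unobservable v" "unobservable w"
  have "(\<Sum>i<n. \<xi> i * (c * v i + d * w i)) = c * (\<Sum>i<n. \<xi> i * v i) + d * (\<Sum>i<n. \<xi> i * w i)" for \<xi>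
    by (simp add: distrib_left sum.distrib sum_distrib_left mult.left_commute)
  thus ?thesis using vw by (simp add: unobservable_def)
qed

lemma reachable_0: "reachable (\<lambda>_. 0)" and unobservable_0: "unobservable (\<lambda>_. 0)"
  by (simp_all add: reachable_def unobservable_def)

text \<open>The component of \<open>x\<close> orthogonal to reachable plus unobservable states
  annihilates both kinds. By \<open>reachable_plus_unobservable_total\<close> it then annihilates
  every vector, in particular itself.\<close>

lemma reachable_unobservable_decomposition:
  assumes ctrl: "behavior_controllable KB (m + p)"
  obtains \<sigma> \<nu> where "reachable \<sigma>" "unobservable \<nu>" "\<And>i. i < n \<Longrightarrow> x i = \<sigma> i + \<nu> i"
proof -
  let ?V = "\<lambda>v. \<exists>\<sigma> \<nu>. reachable \<sigma> \<and> unobservable \<nu> \<and> v = (\<lambda>i. \<sigma> i + \<nu> i)"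
  have Vr: "?V v" if "reachable v" for v using that unobservable_0 by (intro exI[of _ v] exI[of _ "\<lambda>_. 0"]) auto
  have Vu: "?V v" if "unobservable v" for v using that reachable_0 by (intro exI[of _ v] exI[of _ "\<lambda>_. 0"]) auto
  obtain v \<eta> where v: "?V v" and \<eta>: "\<And>w. ?V w \<Longrightarrow> (\<Sum>i<n. \<eta> i * w i) = 0" and x: "\<And>i. x i = v i + \<eta> i"
  proof (rule subspace_orthogonal_decomposition[of ?V n x], intro allI impI)
    fix v w :: "nat \<Rightarrow> real" and c d
    assume "?V v" "?V w"
    then obtain \<sigma> \<nu> \<sigma>' \<nu>' where s: "reachable \<sigma>" "unobservable \<nu>" "v = (\<lambda>i. \<sigma> i + \<nu> i)" "reachable \<sigma>'" "unobservable \<nu>'" "w = (\<lambda>i. \<sigma>' i + \<nu>' i)"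
      by blast
    show "?V (\<lambda>i. c * v i + d * w i)"
      by (rule exI[of _ "\<lambda>i. c * \<sigma> i + d * \<sigma>' i"], rule exI[of _ "\<lambda>i. c * \<nu> i + d * \<nu>' i"])
         (use s reachable_lin[OF s(1,4)] unobservable_lin[OF s(2,5)] in \<open>auto simp: algebra_simps\<close>)
  next
    show "?V (\<lambda>_. 0)" by (rule Vr[OF reachable_0])
  qed (rule that, simp_all)
  have "(\<Sum>i<n. \<eta> i * \<eta> i) = 0"
    by (rule reachable_plus_unobservable_total[OF ctrl]) (use \<eta> Vr Vu in auto)
  hence "\<forall>i\<in>{..<n}. \<eta> i * \<eta> i = 0" by (subst (asm) sum_nonneg_eq_0_iff) auto
  hence \<eta>0: "\<eta> i = 0" if "i < n" for i using that by simp
  obtain \<sigma> \<nu> where s: "reachable \<sigma>" "unobservable \<nu>" "v = (\<lambda>i. \<sigma> i + \<nu> i)" using v by blast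
  show ?thesis by (rule that[OF s(1,2)]) (use x \<eta>0 s(3) in simp)
qed

text \<open>The zero-input response of the unobservable part of the initial state contributes
  nothing to the output, so it can be subtracted. The rest starts in the reachable subspace and
  stays there.\<close>

lemma reachable_state_exists:
  assumes ctrl: "behavior_controllable KB (m + p)" and x: "traj n m A B u x"
  obtains z where "traj n m A B u z" "\<And>t. t \<in> {-1..1} \<Longrightarrow> reachable (\<lambda>i. z i t)"
    "\<And>b t. b < p \<Longrightarrow> t \<in> {-1..1} \<Longrightarrow> out n m C D u z b t = out n m C D u x b t"
proof -
  obtain \<sigma> \<nu> where s: "reachable \<sigma>" "unobservable \<nu>" "\<And>i. i < n \<Longrightarrow> x i (-1) = \<sigma> i + \<nu> i"
    using reachable_unobservable_decomposition[OF ctrl, of "\<lambda>i. x i (-1)"] by blast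
  obtain z0 where z0: "traj n m A B (\<lambda>_ _. 0) z0" "\<And>i. i < n \<Longrightarrow> z0 i (-1) = \<nu> i"
    using ex_traj[of m "\<lambda>_ _. 0" n A B \<nu>] by auto
  let ?z = "\<lambda>i t. x i t - z0 i t"
  have z: "traj n m A B u ?z" using traj_diff[OF x z0(1)] by simp
  have Cz0: "(\<Sum>i<n. C b i * z0 i t) = 0" if b: "b < p" and t: "t \<in> {-1..1}" for b t
    by (rule annihilator_invariant[OF z0(1), of "-1" 1 "C b" "-1"]) (use s(2) z0(2) b t in \<open>auto simp: unobservable_def\<close>)
  show ?thesis
  proof (rule that[OF z])
    fix t :: real assume t: "t \<in> {-1..1}"
    show "reachable (\<lambda>i. ?z i t)"
      unfolding reachable_def
    proof (intro allI impI)
      fix \<xi> assume \<xi>: "reachable_annih \<xi>"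
      show "(\<Sum>i<n. \<xi> i * ?z i t) = 0"
      proof (rule annihilator_invariant[OF z _ _ _ _ _ t, where c = "-1"])
        fix k
        have "(\<Sum>i<n. (vm n A ^^ k) \<xi> i * ?z i (-1)) = (\<Sum>i<n. (vm n A ^^ k) \<xi> i * \<sigma> i)"
          by (rule sum.cong) (use s(3) z0(2) in auto)
        thus "(\<Sum>i<n. (vm n A ^^ k) \<xi> i * ?z i (-1)) = 0"
          using s(1) reachable_annih_vm[OF \<xi>] by (simp add: reachable_def)
      qed (use reachable_annih_input[OF \<xi>] in simp_all)
    qed
    fix b assume b: "b < p"
    show "out n m C D u ?z b t = out n m C D u x b t"
      using Cz0[OF b t] by (simp add: out_def right_diff_distrib sum_subtractf)
  qed
qed

text \<open>In coordinates of an orthonormal basis \<open>T\<close> of the reachable subspace the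
  matrices become \<open>T A T^T\<close>, \<open>T B\<close> and \<open>C T^T\<close>, with the same
  \<open>D\<close>. The subspace is invariant under the dynamics, and
  \<open>reachable_state_exists\<close> supplies for each smooth trajectory a state inside
  it.\<close>

lemma reachable_compression:
  assumes ctrl: "behavior_controllable KB (m + p)"
    and T: "orthonormal n r T" "\<And>j. j < r \<Longrightarrow> reachable (T j)"
    and Tb: "\<And>v i. reachable v \<Longrightarrow> i < n \<Longrightarrow> v i = (\<Sum>j<r. (\<Sum>l<n. T j l * v l) * T j i)"
  shows "iso_system m p g r \<rho> (\<lambda>j k. \<Sum>i<n. T j i * mv n A (T k) i) (\<lambda>j a. \<Sum>i<n. T j i * B i a)
     (\<lambda>b k. \<Sum>l<n. C b l * T k l) D"
proof
  let ?A = "\<lambda>j k. \<Sum>i<n. T j i * mv n A (T k) i"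
  let ?B = "\<lambda>j a. \<Sum>i<n. T j i * B i a"
  let ?C = "\<lambda>b k. \<Sum>l<n. C b l * T k l"
  have dyn: "(\<Sum>i<n. T k i * ((\<Sum>l<n. A i l * x l) + (\<Sum>a<m. B i a * u a))) = (\<Sum>j<r. ?A k j * z j) + (\<Sum>a<m. ?B k a * u a)"
    if "\<And>l. l < n \<Longrightarrow> x l = (\<Sum>j<r. z j * T j l)" for x z k and u :: "nat \<Rightarrow> real"
  proof -
    have "(\<Sum>l<n. A i l * x l) = (\<Sum>j<r. mv n A (T j) i * z j)" for i
    proof -
      have "(\<Sum>l<n. A i l * x l) = (\<Sum>l<n. A i l * (\<Sum>j<r. z j * T j l))" using that by simp
      also have "\<dots> = (\<Sum>j<r. mv n A (T j) i * z j)"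
        unfolding sum_distrib_left mv_def sum_distrib_right by (subst sum.swap) (simp add: ac_simps)
      finally show ?thesis .
    qed
    hence "(\<Sum>i<n. T k i * (\<Sum>l<n. A i l * x l)) = (\<Sum>j<r. ?A k j * z j)"
      unfolding sum_distrib_right by (simp add: sum_distrib_left, subst sum.swap) (simp add: mult.assoc)
    moreover have "(\<Sum>i<n. T k i * (\<Sum>a<m. B i a * u a)) = (\<Sum>a<m. ?B k a * u a)"
      unfolding sum_distrib_left sum_distrib_right by (subst sum.swap) (simp add: mult.assoc)
    ultimately show ?thesis by (simp add: distrib_left sum.distrib)
  qed
  have outp: "(\<Sum>l<n. C b l * x l) = (\<Sum>k<r. ?C b k * z k)"
    if "\<And>l. l < n \<Longrightarrow> x l = (\<Sum>j<r. z j * T j l)" for x z b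
  proof -
    have "(\<Sum>l<n. C b l * x l) = (\<Sum>l<n. C b l * (\<Sum>j<r. z j * T j l))" using that by simp
    also have "\<dots> = (\<Sum>k<r. ?C b k * z k)"
      unfolding sum_distrib_left sum_distrib_right by (subst sum.swap) (simp add: ac_simps)
    finally show ?thesis .
  qed
  fix u y :: "nat \<Rightarrow> real \<Rightarrow> real"
  assume u: "\<And>a. a < m \<Longrightarrow> smooth_on {-1..1} (u a)" and y: "\<And>b. b < p \<Longrightarrow> smooth_on {-1..1} (y b)"
  show "KB (stack m u y) \<longleftrightarrow>
     (\<exists>z. (\<forall>i<r. smooth_on {-1..1} (z i)) \<and> (\<forall>t\<in>\<I>.
        (\<forall>i<r. (z i has_real_derivative (\<Sum>j<r. ?A i j * z j t) + (\<Sum>a<m. ?B i a * u a t)) (at t)) \<and>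
        (\<forall>b<p. y b t = out r m ?C D u z b t)))" (is "_ \<longleftrightarrow> ?R")
  proof
    assume "KB (stack m u y)"
    then obtain x where x: "traj n m A B u x" "\<And>b t. b < p \<Longrightarrow> t \<in> \<I> \<Longrightarrow> y b t = out n m C D u x b t"
      by (rule smooth_behavior_traj) (rule u y that; simp)+
    obtain w where w: "traj n m A B u w" "\<And>t. t \<in> {-1..1} \<Longrightarrow> reachable (\<lambda>i. w i t)"
      "\<And>b t. b < p \<Longrightarrow> t \<in> {-1..1} \<Longrightarrow> out n m C D u w b t = out n m C D u x b t"
      using reachable_state_exists[OF ctrl x(1)] by blast
    let ?z = "\<lambda>j t. \<Sum>i<n. T j i * w i t"
    have wz: "w l t = (\<Sum>j<r. ?z j t * T j l)" if "l < n" "t \<in> \<I>" for l t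
      using Tb[OF w(2) that(1), of t] that(2) by simp
    show ?R
    proof (intro exI[of _ ?z] conjI allI impI ballI)
      fix j assume "j < r"
      show "smooth_on {-1..1} (?z j)"
        by (intro smooth_on_sum smooth_on_cmult traj_smooth[OF w(1) u]) auto
    next
      fix t k assume t: "t \<in> \<I>" and k: "k < r"
      have at: "at t within {-1..1} = at t" using t by (intro at_within_interior) auto
      have "(?z k has_real_derivative (\<Sum>i<n. T k i * ((\<Sum>l<n. A i l * w l t) + (\<Sum>a<m. B i a * u a t)))) (at t within {-1..1})"
        using t by (intro DERIV_sum DERIV_cmult traj_derivative[OF w(1)] smooth_on_continuous u) auto
      moreover have "(\<Sum>i<n. T k i * ((\<Sum>l<n. A i l * w l t) + (\<Sum>a<m. B i a * u a t))) = (\<Sum>j<r. ?A k j * ?z j t) + (\<Sum>a<m. ?B k a * u a t)"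
        by (rule dyn) (rule wz[OF _ t])
      ultimately show "(?z k has_real_derivative (\<Sum>j<r. ?A k j * ?z j t) + (\<Sum>a<m. ?B k a * u a t)) (at t)"
        by (simp only: at)
    next
      fix t b assume t: "t \<in> \<I>" and b: "b < p"
      have "y b t = out n m C D u w b t" using x(2)[OF b t] w(3)[OF b, of t] t by simp
      thus "y b t = out r m ?C D u ?z b t"
        using outp[of "\<lambda>l. w l t" "\<lambda>j. ?z j t" b, OF wz[OF _ t]] by (simp add: out_def)
    qed
  next
    assume ?R
    then obtain z where z: "\<And>i. i < r \<Longrightarrow> smooth_on {-1..1} (z i)"
      "\<And>i t. i < r \<Longrightarrow> t \<in> \<I> \<Longrightarrow> (z i has_real_derivative (\<Sum>j<r. ?A i j * z j t) + (\<Sum>a<m. ?B i a * u a t)) (at t)"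
      "\<And>b t. b < p \<Longrightarrow> t \<in> \<I> \<Longrightarrow> y b t = out r m ?C D u z b t" by blast
    let ?x = "\<lambda>i t. \<Sum>k<r. z k t * T k i"
    have Rsum: "reachable (\<lambda>i. \<Sum>k<l. c k * T k i)" if "l \<le> r" for l c
      using that
    proof (induction l)
      case (Suc l)
      thus ?case using reachable_lin[of "\<lambda>i. \<Sum>k<l. c k * T k i" "T l" 1 "c l"] T(2)[of l] by simp
    qed (simp add: reachable_0)
    have "smooth_solution u y ?x"
      unfolding smooth_solution_def
    proof (intro conjI allI impI ballI)
      fix i assume "i < n"
      have "smooth_on {-1..1} (\<lambda>t. \<Sum>k<r. T k i * z k t)" by (intro smooth_on_sum smooth_on_cmult z) auto
      thus "smooth_on {-1..1} (?x i)" by (simp add: mult.commute)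
    next
      fix t i assume t: "t \<in> \<I>" and i: "i < n"
      let ?v = "\<lambda>i. (\<Sum>l<n. A i l * ?x l t) + (\<Sum>a<m. B i a * u a t)"
      have "reachable (\<lambda>i. 1 * mv n A (\<lambda>i. ?x i t) i + 1 * (\<Sum>a<m. B i a * u a t))"
        by (intro reachable_lin reachable_mv reachable_input Rsum) simp
      hence "reachable ?v" by (simp add: mv_def)
      hence "?v i = (\<Sum>k<r. (\<Sum>l<n. T k l * ?v l) * T k i)" by (rule Tb[OF _ i])
      also have "\<dots> = (\<Sum>k<r. ((\<Sum>j<r. ?A k j * z j t) + (\<Sum>a<m. ?B k a * u a t)) * T k i)"
        by (subst dyn[of "\<lambda>l. ?x l t" "\<lambda>j. z j t"]) simp_all
      finally show "(?x i has_real_derivative ?v i) (at t)"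
        using t by (simp only:) (intro DERIV_sum DERIV_cmult_right z(2), auto)
    next
      fix t b assume t: "t \<in> \<I>" and b: "b < p"
      show "y b t = out n m C D u ?x b t"
        using z(3)[OF b t] outp[of "\<lambda>l. ?x l t" "\<lambda>j. z j t" b] by (simp add: out_def)
    qed
    hence "\<exists>x. smooth_solution u y x" by blast
    thus "KB (stack m u y)" by (subst iso') (simp_all add: u y)
  qed
qed

text \<open>Minimality applied to the compression forces the reachable subspace to have dimension
  \<open>n\<close>. So no nonzero covector annihilates it, and the controllability matrix
  \<open>[B, A B, ..., A^(n-1) B]\<close> has full row rank. \<open>G\<close> is a right inverse of
  this matrix, cut into blocks.\<close>

lemma minimal_right_inverse:
  assumes ctrl: "behavior_controllable KB (m + p)"
    and minimal: "\<And>r A' B' C' D'. iso_system m p g r \<rho> A' B' C' D' \<Longrightarrow> n \<le> r"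
  obtains G where "\<And>i j. i < n \<Longrightarrow> j < n \<Longrightarrow>
     (\<Sum>k<n. \<Sum>a<m. (mv n A ^^ k) (\<lambda>i. B i a) i * G k a j) = (if i = j then 1 else 0 :: real)"
proof -
  obtain r T where T: "orthonormal n r T" "\<And>j. j < r \<Longrightarrow> reachable (T j)"
    "\<And>v i. reachable v \<Longrightarrow> i < n \<Longrightarrow> v i = (\<Sum>j<r. (\<Sum>l<n. T j l * v l) * T j i)"
    using subspace_orthonormal_basis[of reachable n] reachable_lin reachable_0 by blast
  have "n \<le> r" by (rule minimal[OF reachable_compression[OF ctrl T]])
  hence r: "r = n" using orthonormal_le[OF T(1)] by simp
  have annih0: "\<xi> i = 0" if \<xi>: "reachable_annih \<xi>" and i: "i < n" for \<xi> i
  proof -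
    have "\<xi> i = (\<Sum>l<n. (if i = l then 1 else 0) * \<xi> l)" using i by (simp add: if_distrib[of "\<lambda>x. x * _"] cong: if_cong)
    also have "\<dots> = (\<Sum>l<n. (\<Sum>j<n. T j i * T j l) * \<xi> l)"
      using orthonormal_full[of n T i] T(1) i r by (intro sum.cong refl) simp
    also have "\<dots> = (\<Sum>j<n. T j i * (\<Sum>l<n. \<xi> l * T j l))"
      unfolding sum_distrib_left sum_distrib_right by (subst sum.swap) (simp add: ac_simps)
    also have "\<dots> = 0" using T(2) \<xi> r by (intro sum.neutral) (simp add: reachable_def)
    finally show ?thesis .
  qed
  let ?S = "{..<n} \<times> {..<m}"
  let ?M = "\<lambda>(k, a) i. (mv n A ^^ k) (\<lambda>i. B i a) i"
  define W where "W = mat n n (\<lambda>(c, a). \<Sum>b\<in>?S. ?M b c * ?M b a)"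
  have W: "W \<in> carrier_mat n n" by (simp add: W_def)
  have "det W \<noteq> 0"
    unfolding W_def
  proof (rule gram_det_nonzero)
    show "finite ?S" by simp
    fix c assume c: "\<And>b. b \<in> ?S \<Longrightarrow> (\<Sum>i<n. ?M b i * c i) = 0"
    have "(\<Sum>i<n. (vm n A ^^ k) c i * B i a) = 0" if a: "a < m" for k a
    proof (rule krylov_annihilator)
      fix k assume "k < n"
      thus "(\<Sum>i<n. (vm n A ^^ k) c i * B i a) = 0"
        unfolding vm_mv_iter_adjoint using c[of "(k, a)"] a by (simp add: mult.commute)
    qed
    hence "reachable_annih c" by (simp add: reachable_annih_def)
    thus "\<forall>i<n. c i = 0" using annih0 by blast
  qed
  \<comment> \<open>With \<open>K\<close> the controllability matrix and \<open>W = K K^T\<close>,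
    the witness is \<open>K^T W^(-1)\<close>, the inverse being written with the adjugate.\<close>
  show ?thesis
  proof (rule that[of "\<lambda>k a j. (\<Sum>l<n. ?M (k, a) l * adj_mat W $$ (l, j)) / det W"])
    fix i j assume ij: "i < n" "j < n"
    have "(\<Sum>k<n. \<Sum>a<m. ?M (k, a) i * ((\<Sum>l<n. ?M (k, a) l * adj_mat W $$ (l, j)) / det W))
      = (\<Sum>b\<in>?S. ?M b i * ((\<Sum>l<n. ?M b l * adj_mat W $$ (l, j)) / det W))"
      by (subst sum.cartesian_product) (simp add: case_prod_unfold)
    also have "\<dots> = (\<Sum>b\<in>?S. \<Sum>l<n. ?M b i * ?M b l * adj_mat W $$ (l, j)) / det W"
      by (simp add: sum_distrib_left sum_divide_distrib mult.assoc)
    also have "(\<Sum>b\<in>?S. \<Sum>l<n. ?M b i * ?M b l * adj_mat W $$ (l, j)) = (\<Sum>l<n. W $$ (i, l) * adj_mat W $$ (l, j))"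
      using ij by (subst sum.swap) (simp add: W_def sum_distrib_right)
    also have "\<dots> = (W * adj_mat W) $$ (i, j)"
      using ij W adj_mat(1)[OF W] by (simp add: scalar_prod_def atLeast0LessThan)
    also have "\<dots> = det W * (if i = j then 1 else 0)" using ij adj_mat(2)[OF W] by simp
    finally show "(\<Sum>k<n. \<Sum>a<m. (mv n A ^^ k) (\<lambda>i. B i a) i * ((\<Sum>l<n. ?M (k, a) l * adj_mat W $$ (l, j)) / det W)) = (if i = j then 1 else 0)"
      using \<open>det W \<noteq> 0\<close> by simp
  qed
qed

end

section \<open>Polynomial approximation\<close>

definition ip :: "real poly \<Rightarrow> real poly \<Rightarrow> real" where
  "ip p q = LI (\<lambda>t. poly p t * poly q t)"

lemma LI_poly_mult: "sq_int f \<Longrightarrow> integrable MI (\<lambda>t. f t * poly p t)"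
  by (rule sq_int_mult[OF _ sq_int_poly'])

lemma ip_commute: "ip p q = ip q p" by (simp add: ip_def mult.commute)

lemma ip_add_left: "ip (p + q) r = ip p r + ip q r"
  using LI_poly_mult[OF sq_int_poly', of p r] LI_poly_mult[OF sq_int_poly', of q r]
  by (simp add: ip_def distrib_right)

lemma ip_smult_left: "ip (smult c p) r = c * ip p r"
  by (simp add: ip_def mult.assoc)

lemma ip_0_left [simp]: "ip 0 r = 0" by (simp add: ip_def)

lemma ip_diff_left: "ip (p - q) r = ip p r - ip q r"
  using ip_add_left[of p "smult (-1) q" r] ip_smult_left[of "-1" q r] by simp

lemma ip_sum_left: "ip (\<Sum>i\<in>S. f i) r = (\<Sum>i\<in>S. ip (f i) r)"
  by (induction S rule: infinite_finite_induct) (auto simp: ip_add_left)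

lemma ip_eq_0: assumes "ip p p = 0" shows "p = 0"
proof -
  have "LI (\<lambda>t. (poly p t)\<^sup>2) = 0" using assms by (simp add: ip_def power2_eq_square)
  hence "AE t in MI. (poly p t)\<^sup>2 = 0"
    by (subst integral_nonneg_eq_0_iff_AE[symmetric]) (use sq_int_sq[OF sq_int_poly[of p]] in auto)
  hence "AE t in MI. poly p t = 0" by simp
  then obtain N where N: "negligible N" "\<And>t. t \<in> {-1..1} - N \<Longrightarrow> poly p t = 0"
    using AE_MI_neg[of "\<lambda>t. poly p t = 0"] by blast
  have "{-1..1} \<subseteq> {t. poly p t = 0}"
  proof
    fix t :: real assume "t \<in> {-1..1}"
    thus "t \<in> {t. poly p t = 0}"
      using cont_zero_off_negligible[of "-1" 1 "poly p" N t] N continuous_on_poly[OF continuous_on_id, of "{-1..1}" p] by auto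
  qed
  moreover have "infinite {-1..1::real}" by (rule infinite_Icc) simp
  ultimately have "infinite {t. poly p t = 0}" by (rule infinite_super)
  thus "p = 0" using poly_roots_finite by blast
qed

lemma ip_nonneg: "0 \<le> ip p p" unfolding ip_def by (rule integral_nonneg_AE) simp

text \<open>Gram-Schmidt applied to the monomials: the Legendre polynomials, normalised in L2. The
  argument works with orthonormality and the eigenvalue equation instead of a closed
  formula.\<close>

fun legendre :: "nat \<Rightarrow> real poly" where
  "legendre n = (let p = monom 1 n - (\<Sum>i<n. smult (ip (monom 1 n) (legendre i)) (legendre i)) in smult (1 / sqrt (ip p p)) p)"

declare legendre.simps [simp del]

lemma degree_sum_less_or_0:
  assumes "\<And>i. i < n \<Longrightarrow> degree (f i) \<le> i"
  shows "(\<Sum>i<n. f i) = 0 \<or> degree (\<Sum>i<n. f i) < n"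
proof (cases "n = 0")
  case False
  have "degree (\<Sum>i<n. f i) \<le> n - 1"
    by (rule degree_sum_le) (use assms in force)+
  thus ?thesis using False by linarith
qed simp

lemma legendre_props: "degree (legendre n) = n \<and> legendre n \<noteq> 0 \<and> (\<forall>i<n. ip (legendre n) (legendre i) = 0) \<and> ip (legendre n) (legendre n) = 1"
proof (induction n rule: less_induct)
  case (less n)
  define s where "s = (\<Sum>i<n. smult (ip (monom 1 n) (legendre i)) (legendre i))"
  define p where "p = monom 1 n - s"
  have legendre: "legendre n = smult (1 / sqrt (ip p p)) p" by (subst legendre.simps) (simp add: p_def s_def Let_def)
  have "s = 0 \<or> degree s < n" unfolding s_def
    by (rule degree_sum_less_or_0) (use less in \<open>auto intro: order_trans[OF degree_smult_le]\<close>)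
  hence "coeff s n = 0" by (auto simp: coeff_eq_0)
  hence cn: "coeff p n = 1" by (simp add: p_def)
  hence p0: "p \<noteq> 0" by auto
  have "degree p \<le> n" unfolding p_def using \<open>s = 0 \<or> degree s < n\<close>
    by (intro degree_diff_le) (auto simp: degree_monom_eq)
  hence dp: "degree p = n" using cn le_degree[of p n] by simp
  have pos: "0 < ip p p" using ip_nonneg[of p] ip_eq_0[of p] p0 by linarith
  have orth: "ip p (legendre j) = 0" if j: "j < n" for j
  proof -
    have "ip s (legendre j) = (\<Sum>i<n. ip (monom 1 n) (legendre i) * ip (legendre i) (legendre j))"
      by (simp add: s_def ip_sum_left ip_smult_left)
    also have "\<dots> = (\<Sum>i<n. if i = j then ip (monom 1 n) (legendre i) else 0)"
    proof (rule sum.cong[OF refl])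
      fix i assume "i \<in> {..<n}"
      thus "ip (monom 1 n) (legendre i) * ip (legendre i) (legendre j) = (if i = j then ip (monom 1 n) (legendre i) else 0)"
        using less[of i] less[of j] j ip_commute[of "legendre i" "legendre j"] by (cases i j rule: linorder_cases) auto
    qed
    finally show ?thesis using j by (simp add: p_def ip_diff_left)
  qed
  have "ip (legendre n) (legendre i) = 0" if "i < n" for i using orth[OF that] by (simp add: legendre ip_smult_left)
  moreover have "ip (legendre n) (legendre n) = 1"
    using pos by (simp add: legendre ip_smult_left ip_commute[of p "smult _ p"] flip: real_sqrt_mult)
  moreover have "degree (legendre n) = n" "legendre n \<noteq> 0" using pos dp p0 by (simp_all add: legendre)
  ultimately show ?case by blast
qed

lemma ip_legendre: "ip (legendre i) (legendre j) = (if i = j then 1 else 0)"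
  using legendre_props[of i] legendre_props[of j] ip_commute[of "legendre i" "legendre j"] by (cases i j rule: linorder_cases) auto

lemma legendre_span: "q = 0 \<or> degree q < n \<Longrightarrow> \<exists>c. q = (\<Sum>i<n. smult (c i) (legendre i))"
proof (induction n arbitrary: q)
  case 0 thus ?case by auto
next
  case (Suc n)
  let ?a = "coeff q n / coeff (legendre n) n"
  let ?r = "q - smult ?a (legendre n)"
  have l: "coeff (legendre n) n \<noteq> 0" using legendre_props[of n] by (metis leading_coeff_0_iff)
  have "degree q \<le> n" using Suc.prems by auto
  hence "degree ?r \<le> n" using legendre_props[of n] by (intro degree_diff_le) (auto intro: order_trans[OF degree_smult_le])
  moreover have "coeff ?r n = 0" using l by simp
  ultimately have "?r = 0 \<or> degree ?r < n" by (metis le_neq_implies_less leading_coeff_0_iff)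
  then obtain c where "?r = (\<Sum>i<n. smult (c i) (legendre i))" using Suc.IH by blast
  hence q: "q = (\<Sum>i<n. smult (c i) (legendre i)) + smult ?a (legendre n)" by (metis diff_add_cancel)
  have "(\<Sum>i<Suc n. smult ((c(n := ?a)) i) (legendre i)) = (\<Sum>i<n. smult (c i) (legendre i)) + smult ?a (legendre n)" by simp
  thus ?case using q by metis
qed

lemma legendre_orth: assumes "q = 0 \<or> degree q < n" shows "ip (legendre n) q = 0"
proof -
  obtain c where c: "q = (\<Sum>i<n. smult (c i) (legendre i))" using legendre_span[OF assms] by blast
  show ?thesis unfolding ip_commute[of "legendre n"] c by (simp add: ip_sum_left ip_smult_left ip_legendre)
qed

text \<open>The Legendre differential operator. The weight \<open>1 - t^2\<close> vanishes at both
  end points, which makes it symmetric for \<open>ip\<close> without boundary terms.\<close>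

definition legendre_op :: "real poly \<Rightarrow> real poly" where
  "legendre_op p = - pderiv ([:1, 0, -1:] * pderiv p)"

lemma coeff_legendre_op: "coeff (legendre_op p) k = real k * (real k + 1) * coeff p k - (real k + 1) * (real k + 2) * coeff p (k + 2)"
proof -
  have "[:1, 0, -1:] * pderiv p = pderiv p - pCons 0 (pCons 0 (pderiv p))" by simp
  thus ?thesis by (cases k) (simp_all add: legendre_op_def coeff_pderiv algebra_simps)
qed

lemma degree_legendre_op: "degree (legendre_op p) \<le> degree p"
  by (rule degree_le) (auto simp: coeff_legendre_op coeff_eq_0)

text \<open>Integration by parts with one factor merely in H1; the weight removes the boundary
  terms. Besides symmetry this gives the pairing with a non-polynomial function in
  \<open>jackson_step\<close>.\<close>

lemma LI_legendre_op:
  assumes "sq_int f"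
  shows "LI (\<lambda>t. (c + J f t) * poly (legendre_op p) t) = LI (\<lambda>t. f t * ((1 - t\<^sup>2) * poly (pderiv p) t))"
proof -
  let ?\<pi> = "[:1, 0, -1:] * pderiv p"
  have "LI (\<lambda>t. (c + J f t) * poly (pderiv ?\<pi>) t) =
      (c + J f 1) * poly ?\<pi> 1 - c * poly ?\<pi> (-1) - LI (\<lambda>t. f t * poly ?\<pi> t)"
    by (rule int_by_parts[OF assms]) (rule has_field_derivative_at_within[OF poly_DERIV], intro continuous_intros)
  also have "poly ?\<pi> 1 = 0" by simp
  also have "poly ?\<pi> (-1) = 0" by simp
  finally have "LI (\<lambda>t. (c + J f t) * poly (pderiv ?\<pi>) t) = - LI (\<lambda>t. f t * poly ?\<pi> t)" by simp
  moreover have "poly ?\<pi> t = (1 - t\<^sup>2) * poly (pderiv p) t" for t by (simp add: power2_eq_square algebra_simps)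
  ultimately show ?thesis by (simp add: legendre_op_def)
qed

lemma ip_legendre_op: "ip q (legendre_op p) = LI (\<lambda>t. poly (pderiv q) t * ((1 - t\<^sup>2) * poly (pderiv p) t))"
proof -
  have "ip q (legendre_op p) = LI (\<lambda>t. (poly q (-1) + J (poly (pderiv q)) t) * poly (legendre_op p) t)"
    unfolding ip_def
  proof (rule Bochner_Integration.integral_cong[OF refl])
    fix t assume "t \<in> space MI"
    hence "t \<in> {-1..1}" by auto
    hence "J (poly (pderiv q)) t = poly q t - poly q (-1)"
      by (intro J_FTC has_field_derivative_at_within[OF poly_DERIV])
    thus "poly q t * poly (legendre_op p) t = (poly q (-1) + J (poly (pderiv q)) t) * poly (legendre_op p) t" by simp
  qed
  thus ?thesis using LI_legendre_op[OF sq_int_poly] by simp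
qed

lemma ip_legendre_op_sym: "ip q (legendre_op p) = ip (legendre_op q) p"
  unfolding ip_commute[of "legendre_op q"] ip_legendre_op by (simp add: ac_simps)

text \<open>The coefficient formula shows that the difference \<open>d\<close> of the two sides has
  degree below \<open>n\<close>. By symmetry, \<open>ip d d\<close> involves only inner products of
  \<open>legendre n\<close> with polynomials of degree below \<open>n\<close>, so it
  vanishes.\<close>

lemma legendre_op_legendre: "legendre_op (legendre n) = smult (real n * (real n + 1)) (legendre n)"
proof -
  let ?d = "legendre_op (legendre n) - smult (real n * (real n + 1)) (legendre n)"
  have "degree (legendre n) = n" using legendre_props by blast
  hence "coeff ?d n = 0" by (simp add: coeff_legendre_op coeff_eq_0)
  moreover have "degree ?d \<le> n" using degree_legendre_op[of "legendre n"] \<open>degree (legendre n) = n\<close>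
    by (intro degree_diff_le) (auto intro: order_trans[OF degree_smult_le])
  ultimately have d: "?d = 0 \<or> degree ?d < n" by (metis le_neq_implies_less leading_coeff_0_iff)
  have Ld: "legendre_op ?d = 0 \<or> degree (legendre_op ?d) < n"
  proof (cases "?d = 0")
    case True thus ?thesis by (simp add: legendre_op_def)
  qed (use d degree_legendre_op[of ?d] in linarith)
  have "ip ?d ?d = ip (legendre n) (legendre_op ?d) - (real n * (real n + 1)) * ip (legendre n) ?d"
    by (simp only: ip_diff_left ip_smult_left ip_legendre_op_sym)
  also have "\<dots> = 0" using legendre_orth[OF d] legendre_orth[OF Ld] by simp
  finally have "?d = 0" by (rule ip_eq_0)
  thus ?thesis by simp
qed

lemma legendre_op_add: "legendre_op (p + q) = legendre_op p + legendre_op q" 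
  by (rule poly_eqI) (simp add: coeff_legendre_op algebra_simps)

lemma legendre_op_smult: "legendre_op (smult c p) = smult c (legendre_op p)"
  by (rule poly_eqI) (simp add: coeff_legendre_op algebra_simps)

lemma legendre_op_sum: "legendre_op (\<Sum>i\<in>S. f i) = (\<Sum>i\<in>S. legendre_op (f i))"
  by (induction S rule: infinite_finite_induct) (auto simp: legendre_op_add, simp_all add: legendre_op_def)

text \<open>Bessel's inequality for the derivatives of the Legendre polynomials, which are orthogonal for the
  weight \<open>1 - t\<^sup>2\<close>, bounds the tail of the Legendre expansion.\<close>

lemma jackson_step:
  assumes G: "chain 1 G"
  obtains q where "degree q \<le> N" "nL (\<lambda>t. G 0 t - poly q t) \<le> nL (G 1) / (real N + 1)"
proof -
  let ?g = "G 0"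
  have g: "sq_int ?g" and g': "sq_int (G 1)" using chain_sq_int[OF G] by auto
  have gJ: "?g t = ?g (-1) + J (G 1) t" if "t \<in> {-1..1}" for t using chain_J[OF G, of 0 t] that by simp
  define c where "c n = LI (\<lambda>t. ?g t * poly (legendre n) t)" for n
  define Q where "Q M = (\<Sum>n<M. smult (c n) (legendre n))" for M
  let ?l = "\<lambda>n. real n * (real n + 1)"
  have LQ: "legendre_op (Q M) = (\<Sum>n<M. smult (?l n * c n) (legendre n))" for M
    by (simp add: Q_def legendre_op_sum legendre_op_smult legendre_op_legendre mult.commute)
  have LIg: "LI (\<lambda>t. ?g t * poly (\<Sum>n<M. smult (d n) (legendre n)) t) = (\<Sum>n<M. d n * c n)" for M d
  proof -
    have "LI (\<lambda>t. ?g t * poly (\<Sum>n<M. smult (d n) (legendre n)) t) = LI (\<lambda>t. \<Sum>n<M. d n * (?g t * poly (legendre n) t))"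
      by (simp add: poly_sum sum_distrib_left mult.left_commute)
    thus ?thesis using LI_poly_mult[OF g] by (simp add: c_def)
  qed
  have ipQ: "ip (\<Sum>n<M. smult (d n) (legendre n)) (\<Sum>n<M. smult (e n) (legendre n)) = (\<Sum>n<M. d n * e n)" for M d e
  proof -
    have "ip (\<Sum>n<M. smult (d n) (legendre n)) (\<Sum>n<M. smult (e n) (legendre n)) = (\<Sum>n<M. d n * (\<Sum>k<M. e k * ip (legendre k) (legendre n)))"
      by (simp add: ip_sum_left ip_smult_left ip_commute[of "legendre _" "\<Sum>n<M. _ n"])
    also have "\<dots> = (\<Sum>n<M. d n * e n)" by (rule sum.cong) (auto simp: ip_legendre if_distrib[of "\<lambda>x. _ * x"] cong: if_cong)
    finally show ?thesis .
  qed
  have best: "(nL (\<lambda>t. ?g t - poly (\<Sum>n<M. smult (d n) (legendre n)) t))\<^sup>2 = LI (\<lambda>t. (?g t)\<^sup>2) - 2 * (\<Sum>n<M. d n * c n) + (\<Sum>n<M. d n * d n)" for M d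
  proof -
    let ?p = "\<Sum>n<M. smult (d n) (legendre n)"
    have "(nL (\<lambda>t. ?g t - poly ?p t))\<^sup>2 = LI (\<lambda>t. (?g t)\<^sup>2 - 2 * (?g t * poly ?p t) + poly ?p t * poly ?p t)"
      unfolding nL_sq by (simp add: power2_diff power2_eq_square algebra_simps)
    also have "\<dots> = LI (\<lambda>t. (?g t)\<^sup>2) - 2 * LI (\<lambda>t. ?g t * poly ?p t) + ip ?p ?p"
      unfolding ip_def using sq_int_sq[OF g] LI_poly_mult[OF g, of ?p] LI_poly_mult[OF sq_int_poly', of ?p ?p] by simp
    finally show ?thesis unfolding LIg ipQ .
  qed
  have pyth: "(nL (\<lambda>t. ?g t - poly (Q M) t))\<^sup>2 = LI (\<lambda>t. (?g t)\<^sup>2) - (\<Sum>n<M. c n * c n)" for M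
    unfolding Q_def best by simp
  have bestQ: "(nL (\<lambda>t. ?g t - poly (Q M) t))\<^sup>2 \<le> (nL (\<lambda>t. ?g t - poly p t))\<^sup>2" if pM: "p = 0 \<or> degree p < M" for M p
  proof -
    obtain d where d: "p = (\<Sum>n<M. smult (d n) (legendre n))" using legendre_span[OF pM] by blast
    have "0 \<le> (\<Sum>n<M. (c n - d n)\<^sup>2)" by (intro sum_nonneg) simp
    also have "\<dots> = (\<Sum>n<M. c n * c n) - 2 * (\<Sum>n<M. d n * c n) + (\<Sum>n<M. d n * d n)"
      by (simp add: power2_eq_square algebra_simps sum.distrib sum_subtractf sum_distrib_left)
    finally show ?thesis unfolding pyth d best by simp
  qed
  \<comment> \<open>Expand the nonnegative integral of \<open>(1 - t^2) (G 1 - Q')^2\<close>. The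
    Legendre equation turns both the mixed and the quadratic term into the sum on the left.\<close>
  have bessel: "(\<Sum>n<M. ?l n * (c n * c n)) \<le> (nL (G 1))\<^sup>2" for M
  proof -
    let ?S = "\<lambda>t. poly (pderiv (Q M)) t"
    let ?w = "\<lambda>t::real. 1 - t\<^sup>2"
    have wc: "continuous_on {-1..1} (\<lambda>t. ?w t * ?S t)" by (intro continuous_intros)
    have i1: "integrable MI (\<lambda>t. ?w t * (G 1 t)\<^sup>2)"
    proof (rule Bochner_Integration.integrable_bound[OF sq_int_sq[OF g']])
      have [measurable]: "G 1 \<in> borel_measurable MI" by (rule sq_int_measurable[OF g'])
      have [measurable]: "?w \<in> borel_measurable MI"
        by (rule sq_int_measurable[OF sq_int_cont]) (intro continuous_intros)
      show "(\<lambda>t. ?w t * (G 1 t)\<^sup>2) \<in> borel_measurable MI" by measurable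
      show "AE t in MI. norm (?w t * (G 1 t)\<^sup>2) \<le> norm ((G 1 t)\<^sup>2)"
      proof (rule AE_MI_I)
        fix t assume "t \<in> \<I>"
        hence "t\<^sup>2 \<le> 1" by (auto simp: abs_square_le_1)
        hence "\<bar>?w t\<bar> \<le> 1" by simp
        thus "norm (?w t * (G 1 t)\<^sup>2) \<le> norm ((G 1 t)\<^sup>2)" by (simp add: abs_mult mult_left_le_one_le)
      qed
    qed
    have i2: "integrable MI (\<lambda>t. G 1 t * (?w t * ?S t))" by (rule sq_int_mult[OF g' sq_int_cont[OF wc]])
    have i3: "integrable MI (\<lambda>t. ?S t * (?w t * ?S t))" by (rule sq_int_mult[OF sq_int_poly' sq_int_cont[OF wc]])
    have e2: "LI (\<lambda>t. G 1 t * (?w t * ?S t)) = (\<Sum>n<M. ?l n * (c n * c n))"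
    proof -
      have "LI (\<lambda>t. G 1 t * (?w t * ?S t)) = LI (\<lambda>t. (?g (-1) + J (G 1) t) * poly (legendre_op (Q M)) t)"
        using LI_legendre_op[OF g'] by simp
      also have "\<dots> = LI (\<lambda>t. ?g t * poly (legendre_op (Q M)) t)"
      proof (rule Bochner_Integration.integral_cong[OF refl])
        fix t assume "t \<in> space MI"
        hence "?g t = ?g (-1) + J (G 1) t" by (intro gJ) auto
        thus "(?g (-1) + J (G 1) t) * poly (legendre_op (Q M)) t = ?g t * poly (legendre_op (Q M)) t" by metis
      qed
      finally show ?thesis unfolding LQ LIg by (simp add: mult.assoc)
    qed
    have e3: "LI (\<lambda>t. ?S t * (?w t * ?S t)) = (\<Sum>n<M. ?l n * (c n * c n))"
    proof -
      have "LI (\<lambda>t. ?S t * (?w t * ?S t)) = ip (Q M) (legendre_op (Q M))" by (simp add: ip_legendre_op)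
      also have "\<dots> = (\<Sum>n<M. c n * (?l n * c n))" unfolding LQ unfolding Q_def ipQ ..
      finally show ?thesis by (simp add: ac_simps)
    qed
    have "0 \<le> LI (\<lambda>t. ?w t * (G 1 t - ?S t)\<^sup>2)"
    proof (rule integral_nonneg_AE, rule AE_MI_I)
      fix t assume "t \<in> \<I>"
      hence "t\<^sup>2 \<le> 1" by (auto simp: abs_square_le_1)
      thus "0 \<le> ?w t * (G 1 t - ?S t)\<^sup>2" by simp
    qed
    also have "(\<lambda>t. ?w t * (G 1 t - ?S t)\<^sup>2) = (\<lambda>t. ?w t * (G 1 t)\<^sup>2 - 2 * (G 1 t * (?w t * ?S t)) + ?S t * (?w t * ?S t))"
      by (rule ext) (simp add: power2_eq_square algebra_simps)
    also have "LI \<dots> = LI (\<lambda>t. ?w t * (G 1 t)\<^sup>2) - 2 * (\<Sum>n<M. ?l n * (c n * c n)) + (\<Sum>n<M. ?l n * (c n * c n))"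
      using i1 i2 i3 e2 e3 by simp
    finally have "(\<Sum>n<M. ?l n * (c n * c n)) \<le> LI (\<lambda>t. ?w t * (G 1 t)\<^sup>2)" by simp
    also have "\<dots> \<le> LI (\<lambda>t. (G 1 t)\<^sup>2)"
    proof (rule integral_mono[OF i1 sq_int_sq[OF g']])
      fix t assume "t \<in> space MI"
      show "?w t * (G 1 t)\<^sup>2 \<le> (G 1 t)\<^sup>2" by (rule mult_left_le_one_le[of _ "?w t"]) (use \<open>t \<in> space MI\<close> in \<open>auto simp: abs_square_le_1\<close>)
    qed
    finally show ?thesis by (simp add: nL_sq)
  qed
  \<comment> \<open>The terms with \<open>N < n < M\<close> carry
    \<open>n (n + 1) \<ge> (N + 1)^2\<close> in Bessel's inequality; this is the source of the
    factor \<open>1 / (N + 1)\<close>.\<close>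
  have tail: "(nL (\<lambda>t. ?g t - poly (Q (Suc N)) t))\<^sup>2 \<le> (nL (G 1) / (real N + 1))\<^sup>2 + (nL (\<lambda>t. ?g t - poly (Q M) t))\<^sup>2"
    if M: "Suc N \<le> M" for M
  proof -
    have split: "(\<Sum>n<M. f n) = (\<Sum>n<Suc N. f n) + (\<Sum>n=Suc N..<M. f n)" for f :: "nat \<Rightarrow> real"
      unfolding lessThan_atLeast0 by (rule sum.atLeastLessThan_concat[symmetric]) (use M in auto)
    have "(real N + 1)\<^sup>2 * (\<Sum>n=Suc N..<M. c n * c n) \<le> (\<Sum>n=Suc N..<M. ?l n * (c n * c n))"
      unfolding sum_distrib_left
    proof (rule sum_mono)
      fix n assume "n \<in> {Suc N..<M}"
      hence "real N + 1 \<le> real n" by auto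
      hence "(real N + 1) * (real N + 1) \<le> real n * (real n + 1)" by (intro mult_mono) auto
      thus "(real N + 1)\<^sup>2 * (c n * c n) \<le> ?l n * (c n * c n)"
        by (intro mult_right_mono) (auto simp: power2_eq_square)
    qed
    also have "\<dots> \<le> (\<Sum>n<M. ?l n * (c n * c n))"
      unfolding split[of "\<lambda>n. ?l n * (c n * c n)"] by (simp add: sum_nonneg del: sum.lessThan_Suc)
    also have "\<dots> \<le> (nL (G 1))\<^sup>2" by (rule bessel)
    finally have "(\<Sum>n=Suc N..<M. c n * c n) \<le> (nL (G 1) / (real N + 1))\<^sup>2"
      by (simp add: power_divide field_simps)
    thus ?thesis unfolding pyth split[of "\<lambda>n. c n * c n"] by linarith
  qed
  have "(nL (\<lambda>t. ?g t - poly (Q (Suc N)) t))\<^sup>2 \<le> (nL (G 1) / (real N + 1))\<^sup>2"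
  proof (rule field_le_epsilon)
    fix e :: real assume e: "0 < e"
    obtain p where p: "nL (\<lambda>t. ?g t - poly p t) < sqrt e" using poly_dense[OF g, of "sqrt e"] e by auto
    \<comment> \<open>Large enough for \<open>p\<close> to compete with the partial sum
      \<open>Q ?M\<close>, whose error is therefore at most \<open>sqrt e\<close>: the Legendre
      system is complete.\<close>
    let ?M = "max (Suc N) (Suc (degree p))"
    have "(nL (\<lambda>t. ?g t - poly (Q ?M) t))\<^sup>2 \<le> (nL (\<lambda>t. ?g t - poly p t))\<^sup>2" by (rule bestQ) auto
    also have "\<dots> \<le> (sqrt e)\<^sup>2" using p by (intro power_mono) auto
    also have "\<dots> = e" using e by simp
    finally show "(nL (\<lambda>t. ?g t - poly (Q (Suc N)) t))\<^sup>2 \<le> (nL (G 1) / (real N + 1))\<^sup>2 + e" using tail[of ?M] by linarith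
  qed
  hence "nL (\<lambda>t. ?g t - poly (Q (Suc N)) t) \<le> nL (G 1) / (real N + 1)" by (rule power2_le_imp_le) simp
  moreover have "degree (Q (Suc N)) \<le> N"
    unfolding Q_def using legendre_props by (intro degree_sum_le) (auto intro: order_trans[OF degree_smult_le])
  ultimately show ?thesis using that by blast
qed

section \<open>Rates for functions and their derivatives\<close>

lemma poly_antiderivative:
  fixes q :: "real poly"
  obtains P where "pderiv P = q" "poly P x0 = a" "degree P \<le> Suc (degree q)"
proof -
  define P0 where "P0 = (\<Sum>i\<le>degree q. monom (coeff q i / (real i + 1)) (Suc i))"
  have "pderiv P0 = (\<Sum>i\<le>degree q. monom (coeff q i) i)"
  proof -
    have "pderiv (\<Sum>i\<in>S. f i) = (\<Sum>i\<in>S. pderiv (f i))" for S :: "nat set" and f :: "nat \<Rightarrow> real poly"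
      by (induction S rule: infinite_finite_induct) (simp_all add: pderiv_add)
    thus ?thesis unfolding P0_def by (auto simp: pderiv_monom add.commute intro!: sum.cong)
  qed
  hence P0: "pderiv P0 = q" by (simp add: poly_as_sum_of_monoms)
  show ?thesis
  proof (rule that[of "P0 + [:a - poly P0 x0:]"])
    show d: "pderiv (P0 + [:a - poly P0 x0:]) = q" by (simp add: pderiv_add P0 pderiv_pCons)
    show "degree (P0 + [:a - poly P0 x0:]) \<le> Suc (degree q)"
      using degree_pderiv[of "P0 + [:a - poly P0 x0:]"] unfolding d by linarith
  qed simp
qed

text \<open>Approximate the derivative \<open>F 1\<close>, integrate the approximant to a polynomial
  \<open>P\<close>, and apply \<open>jackson_step\<close> to \<open>F 0 - P\<close>, whose
  derivative is already small. Each round gains a factor \<open>1 / (N + 1)\<close>.\<close>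

lemma jackson:
  assumes "chain k F"
  shows "\<exists>C\<ge>0. \<forall>N. \<exists>q. degree q \<le> N \<and> nL (\<lambda>t. F 0 t - poly q t) \<le> C / (real N + 1) ^ k"
  using assms
proof (induction k arbitrary: F)
  case 0
  show ?case by (rule exI[of _ "nL (F 0)"]) (auto intro!: exI[of _ 0])
next
  case (Suc k)
  obtain C where C: "0 \<le> C" "\<And>N. \<exists>q. degree q \<le> N \<and> nL (\<lambda>t. F 1 t - poly q t) \<le> C / (real N + 1) ^ k"
    using Suc.IH[OF chain_Suc_shift[OF Suc.prems]] by auto
  \<comment> \<open>\<open>2 ^ k\<close> pays for replacing \<open>N' + 1\<close> by
    \<open>N + 1 \<le> 2 (N' + 1)\<close>, where \<open>N' = N - 1\<close> leaves room for the
    degree of the primitive. The norm of \<open>F 0\<close> covers \<open>N = 0\<close> with the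
    zero polynomial.\<close>
  let ?D = "C * 2 ^ k + nL (F 0)"
  have "\<exists>q. degree q \<le> N \<and> nL (\<lambda>t. F 0 t - poly q t) \<le> ?D / (real N + 1) ^ Suc k" for N
  proof (cases N)
    case 0
    thus ?thesis using C(1) by (intro exI[of _ 0]) simp
  next
    case (Suc N')
    obtain q' where q': "degree q' \<le> N'" "nL (\<lambda>t. F 1 t - poly q' t) \<le> C / (real N' + 1) ^ k"
      using C(2) by blast
    obtain P where P: "pderiv P = q'" "degree P \<le> Suc (degree q')" by (rule poly_antiderivative[of q' 0 0]) (rule that)
    have "chain 1 (\<lambda>j t. 1 * F j t + (-1) * poly ((pderiv ^^ j) P) t)"
      by (rule chain_lin[OF chain_mono[OF Suc.prems] chain_poly]) simp
    from jackson_step[OF this, of N] obtain r where r: "degree r \<le> N"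
      "nL (\<lambda>t. 1 * F 0 t + (-1) * poly ((pderiv ^^ 0) P) t - poly r t) \<le> nL (\<lambda>t. 1 * F 1 t + (-1) * poly ((pderiv ^^ 1) P) t) / (real N + 1)"
      by blast
    have "nL (\<lambda>t. F 0 t - poly (P + r) t) \<le> nL (\<lambda>t. F 1 t - poly q' t) / (real N + 1)"
      using r(2) by (simp add: P(1) diff_diff_eq)
    also have "\<dots> \<le> C / (real N' + 1) ^ k / (real N + 1)" using q'(2) by (intro divide_right_mono) auto
    also have "\<dots> \<le> (C * 2 ^ k / (real N + 1) ^ k) / (real N + 1)"
    proof (intro divide_right_mono)
      have "(real N + 1) ^ k \<le> (2 * (real N' + 1)) ^ k" using Suc by (intro power_mono) auto
      hence "C * (real N + 1) ^ k \<le> C * (2 ^ k * (real N' + 1) ^ k)"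
        using C(1) unfolding power_mult_distrib by (rule mult_left_mono)
      thus "C / (real N' + 1) ^ k \<le> C * 2 ^ k / (real N + 1) ^ k" by (simp add: divide_simps ac_simps)
    qed simp
    also have "\<dots> = C * 2 ^ k / (real N + 1) ^ Suc k" by (simp add: mult.commute)
    also have "\<dots> \<le> ?D / (real N + 1) ^ Suc k" by (intro divide_right_mono) auto
    finally have "nL (\<lambda>t. F 0 t - poly (P + r) t) \<le> ?D / (real N + 1) ^ Suc k" .
    moreover have "degree (P + r) \<le> N" using P(2) q'(1) r(1) Suc by (intro degree_add_le) auto
    ultimately show ?thesis by blast
  qed
  moreover have "0 \<le> ?D" using C(1) by simp
  ultimately show ?case by blast
qed

text \<open>Approximating the highest derivative and integrating back keeps the initial values exact.\<close>

lemma simultaneous_approximation: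
  assumes "chain (r + k) F"
  shows "\<exists>C\<ge>0. \<forall>N>r. \<exists>P. degree P < N \<and> (\<forall>j<r. poly ((pderiv ^^ j) P) (-1) = F j (-1)) \<and>
    (\<forall>j\<le>r. nL (\<lambda>t. F j t - poly ((pderiv ^^ j) P) t) \<le> C / real (N - r) ^ k) \<and>
    (\<forall>j<r. \<forall>t\<in>{-1..1}. \<bar>F j t - poly ((pderiv ^^ j) P) t\<bar> \<le> C / real (N - r) ^ k)"
  using assms
proof (induction r arbitrary: F)
  case 0
  obtain C where C: "0 \<le> C" "\<And>N. \<exists>q. degree q \<le> N \<and> nL (\<lambda>t. F 0 t - poly q t) \<le> C / (real N + 1) ^ k"
    using jackson[of k F] 0 by auto
  show ?case
  proof (intro exI[of _ C] conjI allI impI)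
    fix N :: nat assume N: "0 < N"
    obtain q where "degree q \<le> N - 1" "nL (\<lambda>t. F 0 t - poly q t) \<le> C / (real (N - 1) + 1) ^ k" using C(2) by blast
    moreover have "real (N - 1) + 1 = real N" using N by simp
    ultimately show "\<exists>P. degree P < N \<and> (\<forall>j<0. poly ((pderiv ^^ j) P) (-1) = F j (-1)) \<and>
      (\<forall>j\<le>0. nL (\<lambda>t. F j t - poly ((pderiv ^^ j) P) t) \<le> C / real (N - 0) ^ k) \<and>
      (\<forall>j<0. \<forall>t\<in>{-1..1}. \<bar>F j t - poly ((pderiv ^^ j) P) t\<bar> \<le> C / real (N - 0) ^ k)"
      using N by (intro exI[of _ q]) auto
  qed (rule C)
next
  case (Suc r)
  have "chain (r + k) (\<lambda>j. F (Suc j))" using Suc.prems chain_Suc_shift by simp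
  from Suc.IH[OF this] obtain C where C: "0 \<le> C" and CP: "\<And>N. r < N \<Longrightarrow> \<exists>P. degree P < N \<and> (\<forall>j<r. poly ((pderiv ^^ j) P) (-1) = F (Suc j) (-1)) \<and>
    (\<forall>j\<le>r. nL (\<lambda>t. F (Suc j) t - poly ((pderiv ^^ j) P) t) \<le> C / real (N - r) ^ k) \<and>
    (\<forall>j<r. \<forall>t\<in>{-1..1}. \<bar>F (Suc j) t - poly ((pderiv ^^ j) P) t\<bar> \<le> C / real (N - r) ^ k)" by blast
  \<comment> \<open>The factor 2 is \<open>sqrt 2 * sqrt 2\<close>: one for bounding a primitive
    uniformly by the L2 norm of its derivative, one for returning to the L2 norm.\<close>
  show ?case
  proof (intro exI[of _ "2 * C"] conjI allI impI)
    show "0 \<le> 2 * C" using C by simp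
    fix N assume N: "Suc r < N"
    hence "r < N - 1" by simp
    from CP[OF this] obtain P' where P': "degree P' < N - 1" "\<And>j. j < r \<Longrightarrow> poly ((pderiv ^^ j) P') (-1) = F (Suc j) (-1)"
      "\<And>j. j \<le> r \<Longrightarrow> nL (\<lambda>t. F (Suc j) t - poly ((pderiv ^^ j) P') t) \<le> C / real (N - 1 - r) ^ k"
      "\<And>j t. j < r \<Longrightarrow> t \<in> {-1..1} \<Longrightarrow> \<bar>F (Suc j) t - poly ((pderiv ^^ j) P') t\<bar> \<le> C / real (N - 1 - r) ^ k" by blast
    obtain P where P: "pderiv P = P'" "poly P (-1) = F 0 (-1)" "degree P \<le> Suc (degree P')" by (rule poly_antiderivative)
    have Pj: "(pderiv ^^ Suc j) P = (pderiv ^^ j) P'" for j using P(1) by (simp add: funpow_swap1)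
    let ?b = "C / real (N - Suc r) ^ k"
    have b: "0 \<le> ?b" using C by simp
    have Nr: "N - 1 - r = N - Suc r" by simp
    have n0: "nL (\<lambda>t. F 1 t - poly P' t) \<le> ?b" using P'(3)[of 0] by (simp add: Nr)
    have s1: "sq_int (\<lambda>t. F 1 t - poly P' t)" using chain_sq_int[OF Suc.prems, of 1] by (intro sq_int_diff sq_int_poly') auto
    have s0: "sq_int (\<lambda>t. F 0 t - poly P t)" using chain_sq_int[OF Suc.prems, of 0] by (intro sq_int_diff sq_int_poly') auto
    have r2: "sqrt 2 * sqrt 2 = (2::real)" "sqrt 2 \<le> (2::real)" by (simp, rule real_le_lsqrt) auto
    have sup: "\<bar>F 0 t - poly P t\<bar> \<le> sqrt 2 * ?b" if t: "t \<in> {-1..1}" for t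
    proof -
      have "J (poly P') t = poly P t - poly P (-1)"
        unfolding P(1)[symmetric] by (intro J_FTC has_field_derivative_at_within[OF poly_DERIV] t)
      moreover have "F 0 t = F 0 (-1) + J (F 1) t" using chain_J[OF Suc.prems, of 0 t] t by simp
      moreover have "J (\<lambda>t. F 1 t - poly P' t) t = J (F 1) t - J (poly P') t"
        using t chain_sq_int[OF Suc.prems, of 1] by (intro J_diff) auto
      ultimately have "F 0 t - poly P t = J (\<lambda>t. F 1 t - poly P' t) t" using P(2) by linarith
      also have "\<bar>\<dots>\<bar> \<le> sqrt 2 * nL (\<lambda>t. F 1 t - poly P' t)" by (rule J_abs_le[OF s1 t])
      also have "\<dots> \<le> sqrt 2 * ?b" using n0 by (intro mult_left_mono) auto
      finally show ?thesis .
    qed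
    have sup2: "\<bar>F 0 t - poly P t\<bar> \<le> 2 * ?b" if "t \<in> {-1..1}" for t
      using sup[OF that] mult_right_mono[OF r2(2) b] by linarith
    have nl: "nL (\<lambda>t. F 0 t - poly P t) \<le> 2 * ?b"
    proof -
      have "nL (\<lambda>t. F 0 t - poly P t) \<le> sqrt 2 * \<bar>sqrt 2 * ?b\<bar>" by (rule nL_le_sup[OF _ s0]) (rule sup, auto)
      also have "\<bar>sqrt 2 * ?b\<bar> = sqrt 2 * ?b" using b by (simp only: abs_mult abs_of_nonneg real_sqrt_ge_zero zero_le_numeral)
      finally show ?thesis by (simp only: mult.assoc[symmetric] r2(1))
    qed
    have e2: "2 * ?b = 2 * C / real (N - Suc r) ^ k" by simp
    have b2: "?b \<le> 2 * C / real (N - Suc r) ^ k" using b e2 by linarith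
    show "\<exists>P. degree P < N \<and> (\<forall>j<Suc r. poly ((pderiv ^^ j) P) (-1) = F j (-1)) \<and>
      (\<forall>j\<le>Suc r. nL (\<lambda>t. F j t - poly ((pderiv ^^ j) P) t) \<le> 2 * C / real (N - Suc r) ^ k) \<and>
      (\<forall>j<Suc r. \<forall>t\<in>{-1..1}. \<bar>F j t - poly ((pderiv ^^ j) P) t\<bar> \<le> 2 * C / real (N - Suc r) ^ k)"
    proof (intro exI[of _ P] conjI allI impI ballI)
      show "degree P < N" using P(3) P'(1) by linarith
      fix j assume "j < Suc r"
      thus "poly ((pderiv ^^ j) P) (-1) = F j (-1)"
        using P(2) P'(2) Pj by (cases j) (simp_all del: funpow.simps(2))
    next
      fix j assume j: "j \<le> Suc r"
      show "nL (\<lambda>t. F j t - poly ((pderiv ^^ j) P) t) \<le> 2 * C / real (N - Suc r) ^ k"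
      proof (cases j)
        case 0 thus ?thesis using nl e2 by simp
      next
        case (Suc i)
        thus ?thesis using order_trans[OF P'(3)[of i, unfolded Nr] b2] j by (simp only: Pj Suc_le_mono)
      qed
    next
      fix j and t :: real assume j: "j < Suc r" and t: "t \<in> {-1..1}"
      show "\<bar>F j t - poly ((pderiv ^^ j) P) t\<bar> \<le> 2 * C / real (N - Suc r) ^ k"
      proof (cases j)
        case 0 thus ?thesis using sup2[OF t] e2 by simp
      next
        case (Suc i)
        thus ?thesis using order_trans[OF P'(4)[of i t, unfolded Nr] b2] j t by (simp only: Pj Suc_less_eq)
      qed
    qed
  qed
qed

text \<open>For \<open>N > r\<close> one has \<open>N \<le> (r + 1) (N - r)\<close>, so the rate in
  \<open>N - r\<close> becomes a rate in \<open>N\<close> at the cost of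
  \<open>(r + 1) ^ k\<close>.\<close>

corollary polynomial_approximation:
  assumes "chain (r + k) F"
  shows "\<exists>C\<ge>0. \<forall>N>r. \<exists>P. (P = 0 \<or> degree P < N) \<and> (\<forall>j<r. poly ((pderiv ^^ j) P) (-1) = F j (-1)) \<and>
    (\<forall>j<r. \<forall>t\<in>{-1..1}. \<bar>F j t - poly ((pderiv ^^ j) P) t\<bar> \<le> C / real N ^ k)"
proof -
  obtain C where C: "0 \<le> C" and P: "\<forall>N>r. \<exists>P. degree P < N \<and> (\<forall>j<r. poly ((pderiv ^^ j) P) (-1) = F j (-1)) \<and>
    (\<forall>j\<le>r. nL (\<lambda>t. F j t - poly ((pderiv ^^ j) P) t) \<le> C / real (N - r) ^ k) \<and>
    (\<forall>j<r. \<forall>t\<in>{-1..1}. \<bar>F j t - poly ((pderiv ^^ j) P) t\<bar> \<le> C / real (N - r) ^ k)"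
    using simultaneous_approximation[OF assms] by (elim exE conjE) (rule that)
  show ?thesis
  proof (intro exI[of _ "C * (real r + 1) ^ k"] conjI allI impI)
    show "0 \<le> C * (real r + 1) ^ k" using C by simp
    fix N assume N: "r < N"
    obtain d where d: "N = Suc (r + d)" using less_imp_Suc_add[OF N] by auto
    have "real N \<le> (real r + 1) * real (N - r)" by (simp add: d algebra_simps)
    hence "real N ^ k \<le> ((real r + 1) * real (N - r)) ^ k" by (intro power_mono) auto
    hence "C * real N ^ k \<le> C * ((real r + 1) ^ k * real (N - r) ^ k)"
      using C by (intro mult_left_mono) (auto simp: power_mult_distrib)
    moreover have "0 < real N ^ k" "0 < real (N - r) ^ k" using N by auto
    ultimately have le: "C / real (N - r) ^ k \<le> C * (real r + 1) ^ k / real N ^ k"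
      by (simp add: divide_simps ac_simps)
    show "\<exists>P. (P = 0 \<or> degree P < N) \<and> (\<forall>j<r. poly ((pderiv ^^ j) P) (-1) = F j (-1)) \<and>
      (\<forall>j<r. \<forall>t\<in>{-1..1}. \<bar>F j t - poly ((pderiv ^^ j) P) t\<bar> \<le> C * (real r + 1) ^ k / real N ^ k)"
    proof -
      obtain Q where Q: "degree Q < N" "\<forall>j<r. poly ((pderiv ^^ j) Q) (-1) = F j (-1)"
        and Q3: "\<forall>j<r. \<forall>t\<in>{-1..1}. \<bar>F j t - poly ((pderiv ^^ j) Q) t\<bar> \<le> C / real (N - r) ^ k"
        using P[rule_format, OF N] by (elim exE conjE) (rule that; assumption)
      show ?thesis
      proof (intro exI[of _ Q] conjI allI impI ballI disjI2)
        fix j and t :: real assume j: "j < r" "t \<in> {-1..1}"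
        have "\<bar>F j t - poly ((pderiv ^^ j) Q) t\<bar> \<le> C / real (N - r) ^ k" using Q3 j by blast
        thus "\<bar>F j t - poly ((pderiv ^^ j) Q) t\<bar> \<le> C * (real r + 1) ^ k / real N ^ k" using le by (rule order_trans)
      next
        fix j assume "j < r" thus "poly ((pderiv ^^ j) Q) (-1) = F j (-1)" using Q(2) by blast
      qed (rule Q(1))
    qed
  qed
qed

text \<open>Exact agreement at \<open>-1\<close> and uniform approximation are bundled because both
  pass through linear combinations and derivatives. With \<open>F = 0\<close> it describes small
  polynomials with vanishing jet, such as residuals and corrections.\<close>

definition jet_approx :: "nat \<Rightarrow> nat \<Rightarrow> nat \<Rightarrow> (nat \<Rightarrow> real \<Rightarrow> real) \<Rightarrow> (nat \<Rightarrow> real poly) \<Rightarrow> bool" where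
  "jet_approx N0 k r F q \<longleftrightarrow> (\<exists>K\<ge>0. \<forall>N>N0. \<forall>j<r. F j (-1) = poly ((pderiv ^^ j) (q N)) (-1) \<and>
     (\<forall>t\<in>{-1..1}. \<bar>F j t - poly ((pderiv ^^ j) (q N)) t\<bar> \<le> K / real N ^ k))"

lemma appI:
  assumes "0 \<le> K" "\<And>N j. N0 < N \<Longrightarrow> j < r \<Longrightarrow> F j (-1) = poly ((pderiv ^^ j) (q N)) (-1)"
    "\<And>N j t. N0 < N \<Longrightarrow> j < r \<Longrightarrow> t \<in> {-1..1} \<Longrightarrow> \<bar>F j t - poly ((pderiv ^^ j) (q N)) t\<bar> \<le> K / real N ^ k"
  shows "jet_approx N0 k r F q"
  unfolding jet_approx_def using assms by blast

lemma appE: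
  assumes "jet_approx N0 k r F q"
  obtains K where "0 \<le> K" "\<And>N j. N0 < N \<Longrightarrow> j < r \<Longrightarrow> F j (-1) = poly ((pderiv ^^ j) (q N)) (-1)"
    "\<And>N j t. N0 < N \<Longrightarrow> j < r \<Longrightarrow> t \<in> {-1..1} \<Longrightarrow> \<bar>F j t - poly ((pderiv ^^ j) (q N)) t\<bar> \<le> K / real N ^ k"
  using assms unfolding jet_approx_def by blast

lemma pderiv_iter_lin: "(pderiv ^^ j) (smult a p + smult b (q :: real poly)) = smult a ((pderiv ^^ j) p) + smult b ((pderiv ^^ j) q)"
  by (induction j) (simp_all add: pderiv_add pderiv_smult)

lemma jet_approx_lin:
  assumes "jet_approx N0 k r F p" "jet_approx N0 k r G q"
  shows "jet_approx N0 k r (\<lambda>j t. a * F j t + b * G j t) (\<lambda>N. smult a (p N) + smult b (q N))"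
proof -
  obtain K where K: "0 \<le> K" "\<And>N j. N0 < N \<Longrightarrow> j < r \<Longrightarrow> F j (-1) = poly ((pderiv ^^ j) (p N)) (-1)"
    "\<And>N j t. N0 < N \<Longrightarrow> j < r \<Longrightarrow> t \<in> {-1..1} \<Longrightarrow> \<bar>F j t - poly ((pderiv ^^ j) (p N)) t\<bar> \<le> K / real N ^ k"
    using appE[OF assms(1)] by blast
  obtain L where L: "0 \<le> L" "\<And>N j. N0 < N \<Longrightarrow> j < r \<Longrightarrow> G j (-1) = poly ((pderiv ^^ j) (q N)) (-1)"
    "\<And>N j t. N0 < N \<Longrightarrow> j < r \<Longrightarrow> t \<in> {-1..1} \<Longrightarrow> \<bar>G j t - poly ((pderiv ^^ j) (q N)) t\<bar> \<le> L / real N ^ k"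
    using appE[OF assms(2)] by blast
  show ?thesis
  proof (rule appI[of "\<bar>a\<bar> * K + \<bar>b\<bar> * L"])
    fix N j and t :: real assume j: "N0 < N" "j < r" "t \<in> {-1..1}"
    let ?x = "F j t - poly ((pderiv ^^ j) (p N)) t" and ?y = "G j t - poly ((pderiv ^^ j) (q N)) t"
    have "a * F j t + b * G j t - poly ((pderiv ^^ j) (smult a (p N) + smult b (q N))) t = a * ?x + b * ?y"
      by (simp add: pderiv_iter_lin algebra_simps)
    also have "\<bar>\<dots>\<bar> \<le> \<bar>a\<bar> * \<bar>?x\<bar> + \<bar>b\<bar> * \<bar>?y\<bar>" unfolding abs_mult[symmetric] by (rule abs_triangle_ineq)
    also have "\<dots> \<le> \<bar>a\<bar> * (K / real N ^ k) + \<bar>b\<bar> * (L / real N ^ k)"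
      by (intro add_mono mult_left_mono K(3) L(3) j) auto
    finally show "\<bar>a * F j t + b * G j t - poly ((pderiv ^^ j) (smult a (p N) + smult b (q N))) t\<bar> \<le> (\<bar>a\<bar> * K + \<bar>b\<bar> * L) / real N ^ k"
      by (simp add: add_divide_distrib)
  next
    fix N j assume "N0 < N" "j < r"
    thus "a * F j (-1) + b * G j (-1) = poly ((pderiv ^^ j) (smult a (p N) + smult b (q N))) (-1)"
      using K(2)[of N j] L(2)[of N j] by (simp add: pderiv_iter_lin)
  qed (use K(1) L(1) in auto)
qed

lemma jet_approx_0: "jet_approx N0 k r (\<lambda>_ _. 0) (\<lambda>_. 0)"
  by (rule appI[of 0]) auto

lemma jet_approx_cong: "jet_approx N0 k r F p \<Longrightarrow> (\<And>j t. j < r \<Longrightarrow> t \<in> {-1..1} \<Longrightarrow> F j t = G j t) \<Longrightarrow> jet_approx N0 k r G p"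
  by (erule appE, erule appI) auto

lemma jet_approx_sum:
  "finite S \<Longrightarrow> (\<And>i. i \<in> S \<Longrightarrow> jet_approx N0 k r (F i) (p i)) \<Longrightarrow>
   jet_approx N0 k r (\<lambda>j t. \<Sum>i\<in>S. c i * F i j t) (\<lambda>N. \<Sum>i\<in>S. smult (c i) (p i N))"
proof (induction S rule: finite_induct)
  case (insert x S)
  thus ?case using jet_approx_lin[of N0 k r "F x" "p x" "\<lambda>j t. \<Sum>i\<in>S. c i * F i j t" "\<lambda>N. \<Sum>i\<in>S. smult (c i) (p i N)" "c x" 1] by simp
qed (simp add: jet_approx_0)

lemma jet_approx_sum0:
  "finite S \<Longrightarrow> (\<And>i. i \<in> S \<Longrightarrow> jet_approx N0 k r (\<lambda>_ _. 0) (p i)) \<Longrightarrow>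
   jet_approx N0 k r (\<lambda>_ _. 0) (\<lambda>N. \<Sum>i\<in>S. p i N)"
  using jet_approx_sum[of S N0 k r "\<lambda>_ _ _. 0" p "\<lambda>_. 1"] by simp

lemma jet_approx_mono: "jet_approx N0 k r F p \<Longrightarrow> r' \<le> r \<Longrightarrow> jet_approx N0 k r' F p"
  by (erule appE, erule appI) auto

lemma jet_approx_pderiv: "jet_approx N0 k (Suc r) F p \<Longrightarrow> jet_approx N0 k r (\<lambda>j. F (Suc j)) (\<lambda>N. pderiv (p N))"
proof (erule appE, erule appI)
  fix K N j assume "\<And>N j. N0 < N \<Longrightarrow> j < Suc r \<Longrightarrow> F j (-1) = poly ((pderiv ^^ j) (p N)) (-1)" "N0 < N" "j < r"
  from this(1)[OF this(2), of "Suc j"] this(3)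
  show "F (Suc j) (-1) = poly ((pderiv ^^ j) (pderiv (p N))) (-1)" by (simp add: funpow_swap1)
next
  fix K N j and t :: real assume "\<And>N j t. N0 < N \<Longrightarrow> j < Suc r \<Longrightarrow> t \<in> {-1..1} \<Longrightarrow> \<bar>F j t - poly ((pderiv ^^ j) (p N)) t\<bar> \<le> K / real N ^ k"
    "N0 < N" "j < r" "t \<in> {-1..1}"
  from this(1)[OF this(2), of "Suc j" t] this(3,4)
  show "\<bar>F (Suc j) t - poly ((pderiv ^^ j) (pderiv (p N))) t\<bar> \<le> K / real N ^ k" by (simp add: funpow_swap1)
qed

lemma jet_approx_pderiv_iter0: "jet_approx N0 k (r + l) (\<lambda>_ _. 0) p \<Longrightarrow> jet_approx N0 k r (\<lambda>_ _. 0) (\<lambda>N. (pderiv ^^ l) (p N))"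
proof (induction l arbitrary: p)
  case (Suc l)
  have "jet_approx N0 k (r + l) (\<lambda>_ _. 0) (\<lambda>N. pderiv (p N))" using jet_approx_pderiv[of N0 k "r + l" "\<lambda>_ _. 0" p] Suc.prems by simp
  from Suc.IH[OF this] show ?case by (simp add: funpow_swap1)
qed simp

definition deg_lt :: "nat \<Rightarrow> real poly \<Rightarrow> bool" where
  "deg_lt N p \<longleftrightarrow> p = 0 \<or> degree p < N"

lemma deg_lt_iff: "deg_lt N p \<longleftrightarrow> (\<forall>i\<ge>N. coeff p i = 0)"
proof
  assume "\<forall>i\<ge>N. coeff p i = 0"
  thus "deg_lt N p" unfolding deg_lt_def by (metis leading_coeff_0_iff not_le)
qed (auto simp: deg_lt_def coeff_eq_0)

lemma deg_lt_0: "deg_lt N 0" by (simp add: deg_lt_def)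
lemma deg_lt_add: "deg_lt N p \<Longrightarrow> deg_lt N q \<Longrightarrow> deg_lt N (p + q)" by (simp add: deg_lt_iff)
lemma deg_lt_diff: "deg_lt N p \<Longrightarrow> deg_lt N q \<Longrightarrow> deg_lt N (p - q)" by (simp add: deg_lt_iff)
lemma deg_lt_smult: "deg_lt N p \<Longrightarrow> deg_lt N (smult c p)" by (simp add: deg_lt_iff)
lemma deg_lt_pderiv: "deg_lt N p \<Longrightarrow> deg_lt N (pderiv p)" by (simp add: deg_lt_iff coeff_pderiv)
lemma deg_lt_pderiv_iter: "deg_lt N p \<Longrightarrow> deg_lt N ((pderiv ^^ j) p)" by (induction j) (auto intro: deg_lt_pderiv)
lemma deg_lt_sum: "(\<And>i. i \<in> S \<Longrightarrow> deg_lt N (f i)) \<Longrightarrow> deg_lt N (\<Sum>i\<in>S. f i)"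
  by (induction S rule: infinite_finite_induct) (auto intro: deg_lt_0 deg_lt_add)

lemma chain_jet_approx:
  assumes "chain (r + k) F"
  obtains q where "jet_approx r k r F q" "\<And>N. r < N \<Longrightarrow> deg_lt N (q N)"
proof -
  obtain C where C: "0 \<le> C" and P: "\<forall>N>r. \<exists>P. (P = 0 \<or> degree P < N) \<and> (\<forall>j<r. poly ((pderiv ^^ j) P) (-1) = F j (-1)) \<and>
    (\<forall>j<r. \<forall>t\<in>{-1..1}. \<bar>F j t - poly ((pderiv ^^ j) P) t\<bar> \<le> C / real N ^ k)"
    using polynomial_approximation[OF assms] by (elim exE conjE) (rule that)
  then obtain q where q: "\<forall>N>r. (q N = 0 \<or> degree (q N) < N) \<and> (\<forall>j<r. poly ((pderiv ^^ j) (q N)) (-1) = F j (-1)) \<and>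
    (\<forall>j<r. \<forall>t\<in>{-1..1}. \<bar>F j t - poly ((pderiv ^^ j) (q N)) t\<bar> \<le> C / real N ^ k)" by metis
  show ?thesis
    by (rule that[of q], rule appI[OF C]) (use q in \<open>auto simp: deg_lt_def\<close>)
qed

section \<open>Polynomial trajectories\<close>

text \<open>With \<open>V j = A^j b\<close> this is the sum of \<open>A^(k-1-j) b\<close> times the
  \<open>j\<close>-th derivative of \<open>h\<close> over \<open>j < k\<close>: the quotient of
  \<open>s^k - A^k\<close> by \<open>s - A\<close>, with \<open>s\<close> acting as differentiation,
  applied to \<open>b h\<close>.\<close>

primrec krylov_poly :: "(nat \<Rightarrow> nat \<Rightarrow> real) \<Rightarrow> nat \<Rightarrow> real poly \<Rightarrow> nat \<Rightarrow> real poly" where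
  "krylov_poly V 0 h i = 0"
| "krylov_poly V (Suc k) h i = smult (V k i) h + krylov_poly V k (pderiv h) i"

text \<open>The telescoping identity \<open>(s - A) (s^(k-1) + ... + A^(k-1)) = s^k - A^k\<close>,
  with \<open>s\<close> read as differentiation.\<close>

lemma krylov_poly_residual:
  assumes V: "\<And>k i. V (Suc k) i = (\<Sum>j<n. A i j * V k j)"
  shows "pderiv (krylov_poly V k h i) - (\<Sum>j<n. smult (A i j) (krylov_poly V k h j)) =
    smult (V 0 i) ((pderiv ^^ k) h) - smult (V k i) h"
proof (induction k arbitrary: h)
  case (Suc k)
  have "(\<Sum>j<n. smult (A i j) (krylov_poly V (Suc k) h j)) =
      smult (V (Suc k) i) h + (\<Sum>j<n. smult (A i j) (krylov_poly V k (pderiv h) j))"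
    by (simp add: V smult_add_right sum.distrib smult_sum)
  thus ?case using Suc[of "pderiv h"] by (simp add: pderiv_add pderiv_smult funpow_swap1 algebra_simps)
qed simp

text \<open>Only derivatives of \<open>h\<close> of order below \<open>k\<close> occur, so
  \<open>k\<close> additional orders suffice.\<close>

lemma krylov_poly_jet_approx:
  "jet_approx N0 l (r + k) (\<lambda>_ _. 0) h \<Longrightarrow> jet_approx N0 l r (\<lambda>_ _. 0) (\<lambda>N. krylov_poly V k (h N) i)"
proof (induction k arbitrary: h)
  case (Suc k)
  have "jet_approx N0 l (r + k) (\<lambda>_ _. 0) (\<lambda>N. pderiv (h N))" using jet_approx_pderiv[of N0 l "r + k" "\<lambda>_ _. 0" h] Suc.prems by simp
  from jet_approx_lin[OF jet_approx_mono[OF Suc.prems, of r] Suc.IH[OF this], of "V k i" 1] show ?case by simp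
qed (simp add: jet_approx_0)

lemma krylov_poly_deg: "deg_lt N h \<Longrightarrow> deg_lt N (krylov_poly V k h i)"
  by (induction k arbitrary: h) (auto intro: deg_lt_0 deg_lt_add deg_lt_smult deg_lt_pderiv)

text \<open>The residual of approximate polynomial trajectories is removed by the right inverse of \<open>[sI - A, -B]\<close>
  read off from \<open>\<Sum> A\<^sup>k B G\<^sub>k = I\<close>; it involves derivatives of the residual of order below \<open>n\<close> only.\<close>

lemma polynomial_trajectory_correction:
  fixes m n :: nat
  assumes G: "\<And>i j. i < n \<Longrightarrow> j < n \<Longrightarrow>
     (\<Sum>k<n. \<Sum>a<m. (mv n A ^^ k) (\<lambda>i. B i a) i * G k a j) = (if i = j then 1 else 0 :: real)"
    and X: "\<And>i. i < n \<Longrightarrow> jet_approx N0 l (n + s) (X i) (px i)" and U: "\<And>a. a < m \<Longrightarrow> jet_approx N0 l (n + s) (U a) (pu a)"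
    and dyn: "\<And>i j t. i < n \<Longrightarrow> t \<in> {-1..1} \<Longrightarrow> X i (Suc j) t = (\<Sum>c<n. A i c * X c j t) + (\<Sum>a<m. B i a * U a j t)"
    and dx: "\<And>i N. i < n \<Longrightarrow> N0 < N \<Longrightarrow> deg_lt N (px i N)" and du: "\<And>a N. a < m \<Longrightarrow> N0 < N \<Longrightarrow> deg_lt N (pu a N)"
  obtains qx qu where
    "\<And>i N. i < n \<Longrightarrow> pderiv (qx i N) = (\<Sum>j<n. smult (A i j) (qx j N)) + (\<Sum>a<m. smult (B i a) (qu a N))"
    "\<And>i. i < n \<Longrightarrow> jet_approx N0 l s (X i) (qx i)" "\<And>a. a < m \<Longrightarrow> jet_approx N0 l s (U a) (qu a)"
    "\<And>i N. i < n \<Longrightarrow> N0 < N \<Longrightarrow> deg_lt N (qx i N)" "\<And>a N. a < m \<Longrightarrow> N0 < N \<Longrightarrow> deg_lt N (qu a N)"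
proof -
  define e where "e i N = pderiv (px i N) - ((\<Sum>j<n. smult (A i j) (px j N)) + (\<Sum>a<m. smult (B i a) (pu a N)))" for i N
  define h where "h k a N = (\<Sum>j<n. smult (G k a j) (e j N))" for k a N
  define V where "V a k = (mv n A ^^ k) (\<lambda>i. B i a)" for a k
  \<comment> \<open>By \<open>krylov_poly_residual\<close> the pair satisfies
    \<open>\<delta>x' - A \<delta>x = B \<delta>u - e\<close>, because the sum of
    \<open>A^k B G_k e\<close> over \<open>k < n\<close> is \<open>e\<close>; adding it cancels the
    residual.\<close>
  define \<delta>u where "\<delta>u a N = (\<Sum>k<n. (pderiv ^^ k) (h k a N))" for a N
  define \<delta>x where "\<delta>x i N = (\<Sum>k<n. \<Sum>a<m. krylov_poly (V a) k (h k a N) i)" for i N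
  have VS: "V a (Suc k) i = (\<Sum>j<n. A i j * V a k j)" and V0: "V a 0 i = B i a" for a k i by (simp_all add: V_def mv_def)
  \<comment> \<open>The residual contains the derivative of \<open>px i\<close>, so one of the
    \<open>n + s\<close> approximated derivatives is lost. Its jet at \<open>-1\<close> vanishes
    because the exact jets satisfy \<open>dyn\<close>.\<close>
  have e0: "jet_approx N0 l (n + s - 1) (\<lambda>_ _. 0) (e i)" if i: "i < n" for i
  proof -
    have 1: "jet_approx N0 l (n + s - 1) (\<lambda>j. X i (Suc j)) (\<lambda>N. pderiv (px i N))"
      by (rule jet_approx_pderiv) (use X[OF i] i in simp)
    have 2: "jet_approx N0 l (n + s - 1) (\<lambda>j t. 1 * (\<Sum>c<n. A i c * X c j t) + 1 * (\<Sum>a<m. B i a * U a j t))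
       (\<lambda>N. smult 1 (\<Sum>c<n. smult (A i c) (px c N)) + smult 1 (\<Sum>a<m. smult (B i a) (pu a N)))"
      by (intro jet_approx_lin jet_approx_sum jet_approx_mono[OF X] jet_approx_mono[OF U]) auto
    have "jet_approx N0 l (n + s - 1) (\<lambda>_ _. 0) (\<lambda>N. smult 1 (pderiv (px i N)) + smult (-1) (smult 1 (\<Sum>c<n. smult (A i c) (px c N)) + smult 1 (\<Sum>a<m. smult (B i a) (pu a N))))"
      by (rule jet_approx_cong[OF jet_approx_lin[OF 1 2, of 1 "-1"]]) (simp add: dyn[OF i])
    thus ?thesis by (simp add: e_def [abs_def] algebra_simps)
  qed
  have de: "deg_lt N (e i N)" if "i < n" "N0 < N" for i N
    unfolding e_def by (intro deg_lt_diff deg_lt_add deg_lt_sum deg_lt_smult deg_lt_pderiv dx du) (use that in auto)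
  have h0: "jet_approx N0 l (n + s - 1) (\<lambda>_ _. 0) (h k a)" for k a
    using jet_approx_sum[of "{..<n}" N0 l "n + s - 1" "\<lambda>_ _ _. 0" e "G k a"] e0 by (simp add: h_def [abs_def])
  have dh: "deg_lt N (h k a N)" if "N0 < N" for k a N
    unfolding h_def by (intro deg_lt_sum deg_lt_smult de that) auto
  \<comment> \<open>For \<open>k < n\<close> at most \<open>n - 1\<close> of the
    \<open>n + s - 1\<close> orders are consumed, which leaves the \<open>s\<close> required
    ones.\<close>
  have h1: "jet_approx N0 l (s + k) (\<lambda>_ _. 0) (h k a)" if "k < n" for k a
    by (rule jet_approx_mono[OF h0]) (use that in auto)
  have du0: "jet_approx N0 l s (\<lambda>_ _. 0) (\<delta>u a)" for a
    unfolding \<delta>u_def [abs_def] by (intro jet_approx_sum0 jet_approx_pderiv_iter0 h1) auto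
  have dx0: "jet_approx N0 l s (\<lambda>_ _. 0) (\<delta>x i)" for i
    unfolding \<delta>x_def [abs_def] by (intro jet_approx_sum0 krylov_poly_jet_approx h1) auto
  have corr: "pderiv (\<delta>x i N) - (\<Sum>j<n. smult (A i j) (\<delta>x j N)) = (\<Sum>a<m. smult (B i a) (\<delta>u a N)) - e i N" if i: "i < n" for i N
  proof -
    have pds: "pderiv (\<Sum>i\<in>S. f i) = (\<Sum>i\<in>S. pderiv (f i))" for S :: "nat set" and f :: "nat \<Rightarrow> real poly"
      by (induction S rule: infinite_finite_induct) (simp_all add: pderiv_add)
    have sms: "smult c (\<Sum>i\<in>S. f i) = (\<Sum>i\<in>S. smult c (f i))" for S :: "nat set" and f :: "nat \<Rightarrow> real poly" and c
      by (induction S rule: infinite_finite_induct) (simp_all add: smult_add_right)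
    have ssm: "smult (\<Sum>i\<in>S. f i) p = (\<Sum>i\<in>S. smult (f i) p)" for S :: "nat set" and f and p :: "real poly"
      by (induction S rule: infinite_finite_induct) (simp_all add: smult_add_left)
    have sw: "(\<Sum>j<n. smult (A i j) (\<delta>x j N)) = (\<Sum>k<n. \<Sum>a<m. \<Sum>j<n. smult (A i j) (krylov_poly (V a) k (h k a N) j))"
      unfolding \<delta>x_def sms by (rule trans[OF sum.swap sum.cong[OF refl sum.swap]])
    have "pderiv (\<delta>x i N) - (\<Sum>j<n. smult (A i j) (\<delta>x j N)) =
      (\<Sum>k<n. \<Sum>a<m. pderiv (krylov_poly (V a) k (h k a N) i) - (\<Sum>j<n. smult (A i j) (krylov_poly (V a) k (h k a N) j)))"
      unfolding sw sum_subtractf by (simp add: \<delta>x_def pds)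
    also have "\<dots> = (\<Sum>k<n. \<Sum>a<m. smult (B i a) ((pderiv ^^ k) (h k a N)) - smult (V a k i) (h k a N))"
      by (simp add: krylov_poly_residual[of "V _", OF VS] V0)
    also have "\<dots> = (\<Sum>k<n. \<Sum>a<m. smult (B i a) ((pderiv ^^ k) (h k a N))) - (\<Sum>k<n. \<Sum>a<m. smult (V a k i) (h k a N))"
      by (simp add: sum_subtractf)
    also have "(\<Sum>k<n. \<Sum>a<m. smult (B i a) ((pderiv ^^ k) (h k a N))) = (\<Sum>a<m. smult (B i a) (\<delta>u a N))"
      unfolding \<delta>u_def sms by (rule sum.swap)
    also have "(\<Sum>k<n. \<Sum>a<m. smult (V a k i) (h k a N)) = (\<Sum>k<n. \<Sum>a<m. \<Sum>j<n. smult (V a k i * G k a j) (e j N))"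
      by (simp add: h_def sms)
    also have "\<dots> = (\<Sum>k<n. \<Sum>j<n. \<Sum>a<m. smult (V a k i * G k a j) (e j N))"
      by (intro sum.cong refl sum.swap)
    also have "\<dots> = (\<Sum>j<n. \<Sum>k<n. \<Sum>a<m. smult (V a k i * G k a j) (e j N))" by (rule sum.swap)
    also have "\<dots> = (\<Sum>j<n. smult (\<Sum>k<n. \<Sum>a<m. V a k i * G k a j) (e j N))" by (simp add: ssm)
    also have "\<dots> = (\<Sum>j<n. smult (if i = j then 1 else 0) (e j N))"
      using G[OF i] by (intro sum.cong refl) (simp add: V_def)
    also have "\<dots> = (\<Sum>j<n. if i = j then e j N else 0)" by (rule sum.cong) auto
    also have "\<dots> = e i N" using i by simp
    finally show ?thesis .
  qed
  show ?thesis
  proof (rule that[of "\<lambda>i N. px i N + \<delta>x i N" "\<lambda>a N. pu a N + \<delta>u a N"])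
    fix i N assume i: "i < n"
    show "pderiv (px i N + \<delta>x i N) = (\<Sum>j<n. smult (A i j) (px j N + \<delta>x j N)) + (\<Sum>a<m. smult (B i a) (pu a N + \<delta>u a N))"
      using corr[OF i, of N] by (simp add: e_def pderiv_add smult_add_right sum.distrib algebra_simps)
  next
    fix i assume i: "i < n"
    show "jet_approx N0 l s (X i) (\<lambda>N. px i N + \<delta>x i N)"
      using jet_approx_lin[OF jet_approx_mono[OF X[OF i], of s] dx0[of i], of 1 1] by simp
  next
    fix a assume a: "a < m"
    show "jet_approx N0 l s (U a) (\<lambda>N. pu a N + \<delta>u a N)"
      using jet_approx_lin[OF jet_approx_mono[OF U[OF a], of s] du0[of a], of 1 1] by simp
  next
    fix i N assume "i < n" "N0 < N"
    thus "deg_lt N (px i N + \<delta>x i N)"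
      unfolding \<delta>x_def by (intro deg_lt_add dx deg_lt_sum krylov_poly_deg dh)
  next
    fix a N assume "a < m" "N0 < N"
    thus "deg_lt N (pu a N + \<delta>u a N)"
      unfolding \<delta>u_def by (intro deg_lt_add du deg_lt_sum deg_lt_pderiv_iter dh)
  qed
qed

section \<open>Translation to vector-valued signals\<close>

lemma deriv_iter_0: "(deriv ^^ j) (\<lambda>_. 0 :: real) = (\<lambda>_. 0)"
  by (induction j) simp_all

text \<open>Vector test functions with a single nonzero component separate the components.\<close>

lemma is_weak_deriv_iff:
  assumes f: "\<And>i. i < d \<Longrightarrow> sq_int (\<lambda>t. f t $ i)"
  shows "is_weak_deriv d j f h \<longleftrightarrow> h \<in> L2 d \<and>
    (\<forall>i<d. \<forall>\<psi>. tf \<psi> \<longrightarrow> LI (\<lambda>t. f t $ i * (deriv ^^ j) \<psi> t) = (-1) ^ j * LI (\<lambda>t. h t $ i * \<psi> t))"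
proof (cases "h \<in> L2 d")
  case h: True
  hence hs: "sq_int (\<lambda>t. h t $ i)" if "i < d" for i using that by (auto simp: L2_iff)
  let ?l = "\<lambda>\<phi>. LINT t|lebesgue_on \<I>. f t \<bullet> vderiv j \<phi> t" and ?r = "\<lambda>\<phi>. LINT t|lebesgue_on \<I>. h t \<bullet> \<phi> t"
  have l: "?l \<phi> = (\<Sum>i<d. LI (\<lambda>t. f t $ i * (deriv ^^ j) (\<lambda>\<tau>. \<phi> \<tau> $ i) t))"
    and r: "?r \<phi> = (\<Sum>i<d. LI (\<lambda>t. h t $ i * \<phi> t $ i))" if \<phi>: "\<phi> \<in> test_functions d" for \<phi>
  proof -
    note tf = test_function_tf[OF \<phi>]
    have "f t \<bullet> vderiv j \<phi> t = (\<Sum>i<d. f t $ i * (deriv ^^ j) (\<lambda>\<tau>. \<phi> \<tau> $ i) t)" for t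
      by (simp add: vderiv_vec[OF \<phi>] scalar_prod_def atLeast0LessThan)
    moreover have "integrable MI (\<lambda>t. f t $ i * (deriv ^^ j) (\<lambda>\<tau>. \<phi> \<tau> $ i) t)" if "i < d" for i
      by (intro sq_int_LI_mult f tf_deriv_iter tf that)
    ultimately show "?l \<phi> = (\<Sum>i<d. LI (\<lambda>t. f t $ i * (deriv ^^ j) (\<lambda>\<tau>. \<phi> \<tau> $ i) t))" by simp
    have "\<phi> t \<in> carrier_vec d" for t using \<phi> by (simp add: test_functions_def)
    from carrier_vecD[OF this] have "h t \<bullet> \<phi> t = (\<Sum>i<d. h t $ i * \<phi> t $ i)" for t
      by (simp add: scalar_prod_def atLeast0LessThan)
    moreover have "integrable MI (\<lambda>t. h t $ i * \<phi> t $ i)" if "i < d" for i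
      by (intro sq_int_LI_mult hs tf that)
    ultimately show "?r \<phi> = (\<Sum>i<d. LI (\<lambda>t. h t $ i * \<phi> t $ i))" by simp
  qed
  have "(\<forall>\<phi>\<in>test_functions d. ?l \<phi> = (-1) ^ j * ?r \<phi>) \<longleftrightarrow>
    (\<forall>i<d. \<forall>\<psi>. tf \<psi> \<longrightarrow> LI (\<lambda>t. f t $ i * (deriv ^^ j) \<psi> t) = (-1) ^ j * LI (\<lambda>t. h t $ i * \<psi> t))"
  proof (intro iffI allI impI ballI)
    fix i \<psi> assume a: "\<forall>\<phi>\<in>test_functions d. ?l \<phi> = (-1) ^ j * ?r \<phi>" and i: "i < d" and \<psi>: "tf \<psi>"
    let ?\<psi> = "\<lambda>i'. if i' = i then \<psi> else (\<lambda>_. 0)"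
    let ?\<phi> = "\<lambda>t. vec d (\<lambda>i'. ?\<psi> i' t)"
    have \<phi>: "?\<phi> \<in> test_functions d" by (rule tf_vec_test_function) (use \<psi> tf_zero in auto)
    have c: "(\<lambda>\<tau>. ?\<phi> \<tau> $ i') = ?\<psi> i'" if "i' < d" for i' using that by auto
    have "?l ?\<phi> = (\<Sum>i'<d. if i' = i then LI (\<lambda>t. f t $ i * (deriv ^^ j) \<psi> t) else 0)"
      unfolding l[OF \<phi>] by (rule sum.cong) (auto simp: c deriv_iter_0)
    moreover have "?r ?\<phi> = (\<Sum>i'<d. if i' = i then LI (\<lambda>t. h t $ i * \<psi> t) else 0)"
      unfolding r[OF \<phi>] by (rule sum.cong) auto
    ultimately show "LI (\<lambda>t. f t $ i * (deriv ^^ j) \<psi> t) = (-1) ^ j * LI (\<lambda>t. h t $ i * \<psi> t)"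
      using bspec[OF a \<phi>] i by simp
  next
    fix \<phi> assume a: "\<forall>i<d. \<forall>\<psi>. tf \<psi> \<longrightarrow> LI (\<lambda>t. f t $ i * (deriv ^^ j) \<psi> t) = (-1) ^ j * LI (\<lambda>t. h t $ i * \<psi> t)"
      and \<phi>: "\<phi> \<in> test_functions d"
    show "?l \<phi> = (-1) ^ j * ?r \<phi>"
      unfolding l[OF \<phi>] r[OF \<phi>] sum_distrib_left
      by (rule sum.cong[OF refl]) (use a test_function_tf[OF \<phi>] in auto)
  qed
  thus ?thesis using h by (simp add: is_weak_deriv_def)
qed (simp add: is_weak_deriv_def)

text \<open>Pins down the choice made by \<open>weak_deriv\<close>: the chain supplies one weak
  derivative, and two of them differ by a function that all test functions annihilate.\<close>

lemma weak_deriv_AE: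
  assumes f: "\<And>i. i < d \<Longrightarrow> sq_int (\<lambda>t. f t $ i)"
    and E: "\<And>i. i < d \<Longrightarrow> chain l (E i)" "\<And>i. i < d \<Longrightarrow> AE t in MI. f t $ i = E i 0 t" and j: "j \<le> l"
  shows "weak_deriv d j f \<in> L2 d" "AE t in MI. weak_deriv d j f t = vec d (\<lambda>i. E i j t)"
proof -
  let ?e = "\<lambda>t. vec d (\<lambda>i. E i j t)"
  have Ej: "sq_int (E i j)" if "i < d" for i using chain_sq_int[OF E(1)[OF that] j] .
  have iff: "is_weak_deriv d j f h \<longleftrightarrow> h \<in> L2 d \<and>
    (\<forall>i<d. \<forall>\<psi>. tf \<psi> \<longrightarrow> LI (\<lambda>t. f t $ i * (deriv ^^ j) \<psi> t) = (-1) ^ j * LI (\<lambda>t. h t $ i * \<psi> t))" for h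
    by (rule is_weak_deriv_iff) (rule f)
  have "is_weak_deriv d j f ?e"
    unfolding iff
  proof (intro conjI allI impI)
    show "?e \<in> L2 d" unfolding L2_iff using Ej by simp
    fix i \<psi> assume i: "i < d" and \<psi>: "tf \<psi>"
    have "LI (\<lambda>t. f t $ i * (deriv ^^ j) \<psi> t) = LI (\<lambda>t. E i 0 t * (deriv ^^ j) \<psi> t)"
      by (rule LI_cong_AE[OF f[OF i] E(2)[OF i] chain_sq_int[OF E(1)[OF i]] tf_sq_int[OF tf_deriv_iter[OF \<psi>]]]) simp
    also have "\<dots> = (-1) ^ j * LI (\<lambda>t. E i j t * \<psi> t)" by (rule chain_weak[OF E(1)[OF i] j \<psi>])
    finally show "LI (\<lambda>t. f t $ i * (deriv ^^ j) \<psi> t) = (-1) ^ j * LI (\<lambda>t. ?e t $ i * \<psi> t)" using i by simp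
  qed
  note e = this
  have "is_weak_deriv d j f (weak_deriv d j f)"
    unfolding weak_deriv_def by (rule someI[of "is_weak_deriv d j f", OF e])
  note w = this e
  let ?h = "weak_deriv d j f"
  show h: "?h \<in> L2 d" using w(1) by (simp add: is_weak_deriv_def)
  have "AE t in MI. ?h t $ i = E i j t" if i: "i < d" for i
  proof -
    have hi: "sq_int (\<lambda>t. ?h t $ i)" using h i by (auto simp: L2_iff)
    have "AE t in MI. ?h t $ i - E i j t = 0"
    proof (rule weak_zero)
      show "sq_int (\<lambda>t. ?h t $ i - E i j t)" by (rule sq_int_diff[OF hi Ej[OF i]])
      fix \<psi> assume \<psi>: "tf \<psi>"
      have "(-1) ^ j * LI (\<lambda>t. ?h t $ i * \<psi> t) = (-1) ^ j * LI (\<lambda>t. ?e t $ i * \<psi> t)"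
        using w[unfolded iff] i \<psi> by simp
      hence "LI (\<lambda>t. ?h t $ i * \<psi> t) = LI (\<lambda>t. E i j t * \<psi> t)" using i by simp
      thus "LI (\<lambda>t. (?h t $ i - E i j t) * \<psi> t) = 0"
        using sq_int_LI_mult[OF hi \<psi>] sq_int_LI_mult[OF Ej[OF i] \<psi>] by (simp add: left_diff_distrib)
    qed
    thus ?thesis by simp
  qed
  hence "AE t in MI. \<forall>i\<in>{..<d}. ?h t $ i = E i j t" by (intro AE_finite_allI) auto
  moreover have "AE t in MI. ?h t \<in> carrier_vec d" by (rule AE_MI_I) (use h in \<open>auto simp: L2_iff\<close>)
  ultimately show "AE t in MI. ?h t = ?e t"
    by eventually_elim (auto intro!: eq_vecI)
qed

text \<open>Blocks of length \<open>d\<close> are stacked, so entry \<open>c\<close> is component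
  \<open>c mod d\<close> of the derivative of order \<open>c div d\<close>.\<close>

lemma Lam_AE:
  assumes f: "\<And>i. i < d \<Longrightarrow> sq_int (\<lambda>t. f t $ i)"
    and E: "\<And>i. i < d \<Longrightarrow> chain l (E i)" "\<And>i. i < d \<Longrightarrow> AE t in MI. f t $ i = E i 0 t" and s: "s \<le> Suc l"
  shows "AE t in MI. Lam d s f t = vec (s * d) (\<lambda>c. E (c mod d) (c div d) t)"
  using s
proof (induction s)
  case 0
  show ?case by (rule AE_MI_I) auto
next
  case (Suc s)
  have "AE t in MI. Lam d s f t = vec (s * d) (\<lambda>c. E (c mod d) (c div d) t)" using Suc by simp
  moreover have "AE t in MI. weak_deriv d s f t = vec d (\<lambda>i. E i s t)"
    by (rule weak_deriv_AE(2)[OF f E]) (use Suc.prems in auto)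
  ultimately show ?case
  proof eventually_elim
    case (elim t)
    show ?case unfolding Lam.simps elim
    proof (rule eq_vecI)
      fix c assume "c < dim_vec (vec (Suc s * d) (\<lambda>c. E (c mod d) (c div d) t))"
      hence c: "c < s * d + d" by simp
      show "(vec (s * d) (\<lambda>c. E (c mod d) (c div d) t) @\<^sub>v vec d (\<lambda>i. E i s t)) $ c = vec (Suc s * d) (\<lambda>c. E (c mod d) (c div d) t) $ c"
      proof (cases "c < s * d")
        case False
        then obtain i where i: "c = s * d + i" "i < d" using c by (metis le_add_diff_inverse linorder_not_less nat_add_left_cancel_less)
        thus ?thesis using c by simp
      qed (use c in simp)
    qed simp
  qed
qed

text \<open>Only derivatives of order below \<open>s \<le> l\<close> are stacked; in a chain of
  length \<open>l\<close> these are continuous and provide the representative whose value at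
  \<open>-1\<close> is meant.\<close>

lemma Lam_has_value_0:
  assumes f: "\<And>i. i < d \<Longrightarrow> sq_int (\<lambda>t. f t $ i)"
    and E: "\<And>i. i < d \<Longrightarrow> chain l (E i)" "\<And>i. i < d \<Longrightarrow> AE t in MI. f t $ i = E i 0 t" and s: "s \<le> l"
    and z: "\<And>i j. i < d \<Longrightarrow> j < s \<Longrightarrow> E i j (-1) = 0"
  shows "has_value_at (s * d) (Lam d s f) (-1) (0\<^sub>v (s * d))"
  unfolding has_value_at_def
proof (intro exI conjI)
  have Lam: "AE t in MI. Lam d s f t = vec (s * d) (\<lambda>c. E (c mod d) (c div d) t)"
    by (rule Lam_AE[where l = l], rule f, assumption, rule E(1), assumption, rule E(2), assumption, use s in simp)
  let ?g = "\<lambda>t. vec (s * d) (\<lambda>c. E (c mod d) (c div d) t)"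
  have cd: "c mod d < d \<and> c div d < s" if "c < s * d" for c
    using that by (metis less_mult_imp_div_less mod_less_divisor mult_is_0 not_gr0 not_less_zero)
  show "\<forall>t\<in>{-1..1}. ?g t \<in> carrier_vec (s * d)" by simp
  show "\<forall>i<s * d. continuous_on {-1..1} (\<lambda>t. ?g t $ i)"
  proof (intro allI impI)
    fix c assume c: "c < s * d"
    have "continuous_on {-1..1} (E (c mod d) (c div d))"
      by (rule chain_cont[OF E(1)]) (use cd[OF c] s in auto)
    thus "continuous_on {-1..1} (\<lambda>t. ?g t $ c)" using c by simp
  qed
  show "AE t in lebesgue_on \<I>. ?g t = Lam d s f t"
    using Lam by (rule eventually_mono) simp
  show "?g (-1) = 0\<^sub>v (s * d)" using cd z by (intro eq_vecI) auto
qed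

text \<open>Under the root, 2 is the length of the interval and \<open>s * d\<close> the number of
  stacked entries.\<close>

lemma Sobolev_norm_bound:
  assumes f: "\<And>i. i < d \<Longrightarrow> sq_int (\<lambda>t. f t $ i)"
    and E: "\<And>i. i < d \<Longrightarrow> chain l (E i)" "\<And>i. i < d \<Longrightarrow> AE t in MI. f t $ i = E i 0 t" and s: "s \<le> l" "s \<noteq> 0"
    and b: "\<And>i j t. i < d \<Longrightarrow> j < s \<Longrightarrow> t \<in> \<I> \<Longrightarrow> \<bar>E i j t\<bar> \<le> e"
  shows "\<bar>Sobolev_norm d (s - 1) f\<bar> \<le> sqrt (2 * real (s * d)) * \<bar>e\<bar>"
proof -
  let ?F = "\<lambda>t. Lam d s f t \<bullet> Lam d s f t"
  let ?g = "\<lambda>t. vec (s * d) (\<lambda>c. E (c mod d) (c div d) t)"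
  have nn: "0 \<le> ?F t" for t by (simp add: scalar_prod_def sum_nonneg)
  have cd: "c mod d < d \<and> c div d < s" if "c < s * d" for c
    using that by (metis less_mult_imp_div_less mod_less_divisor mult_is_0 not_gr0 not_less_zero)
  have "AE t in MI. t \<in> \<I>" by (rule AE_MI_I) simp
  moreover have "AE t in MI. Lam d s f t = ?g t"
    by (rule Lam_AE[where l = l], rule f, assumption, rule E(1), assumption, rule E(2), assumption, use s in simp)
  ultimately have ae: "AE t in MI. ?F t \<le> real (s * d) * e\<^sup>2"
  proof eventually_elim
    case (elim t)
    have "?g t \<bullet> ?g t = (\<Sum>c<s * d. (E (c mod d) (c div d) t)\<^sup>2)"
      by (simp add: scalar_prod_def atLeast0LessThan power2_eq_square)
    also have "\<dots> \<le> (\<Sum>c<s * d. e\<^sup>2)"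
    proof (rule sum_mono)
      fix c assume "c \<in> {..<s * d}"
      hence "\<bar>E (c mod d) (c div d) t\<bar> \<le> e" using cd[of c] b[of "c mod d" "c div d" t] elim(1) by simp
      from power_mono[OF this, of 2] show "(E (c mod d) (c div d) t)\<^sup>2 \<le> e\<^sup>2" by simp
    qed
    finally show ?case unfolding elim(2) by simp
  qed
  have i0: "0 \<le> LI ?F" by (rule integral_nonneg_AE) (simp add: nn)
  have "LI ?F \<le> LI (\<lambda>t. real (s * d) * e\<^sup>2)"
  proof (cases "integrable MI ?F")
    case True thus ?thesis by (rule integral_mono_AE) (use ae in auto)
  next
    \<comment> \<open>By convention the integral is 0 in this case.\<close>
    case False thus ?thesis by (simp add: not_integrable_integral_eq)
  qed
  hence "LI ?F \<le> (2 * real (s * d)) * e\<^sup>2" by simp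
  hence "sqrt (LI ?F) \<le> sqrt ((2 * real (s * d)) * e\<^sup>2)" by (rule real_sqrt_le_mono)
  moreover have "Sobolev_norm d (s - 1) f = sqrt (LI ?F)" using s(2) by (simp add: Sobolev_norm_def L2_norm_def)
  ultimately show ?thesis using i0 by (simp add: real_sqrt_mult)
qed

section \<open>Dictionary between vector-valued signals and components\<close>

lemma weak_kernel_cong:
  assumes "\<And>a t. a < q \<Longrightarrow> t \<in> \<I> \<Longrightarrow> v a t = w a t" "weak_kernel g q \<rho> v"
  shows "weak_kernel g q \<rho> w"
proof (rule weak_kernel_cong_AE[OF assms(2)])
  fix a assume a: "a < q"
  show ae: "AE t in MI. v a t = w a t" by (rule AE_MI_I) (rule assms(1)[OF a])
  have "w a \<in> borel_measurable MI \<longleftrightarrow> v a \<in> borel_measurable MI"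
    by (rule measurable_cong) (use assms(1)[OF a] in auto)
  thus "sq_int (w a)" using sq_int_cong_AE[OF weak_kernel_sq_int[OF assms(2) a] ae] sq_int_measurable[OF weak_kernel_sq_int[OF assms(2) a]] by blast
qed

lemma kernel_behavior_append:
  assumes R: "\<And>i. i \<le> r \<Longrightarrow> R i \<in> carrier_mat g (m + p)"
    and uy: "\<And>t. t \<in> \<I> \<Longrightarrow> u t \<in> carrier_vec m" "\<And>t. t \<in> \<I> \<Longrightarrow> y t \<in> carrier_vec p"
  shows "(\<lambda>t. u t @\<^sub>v y t) \<in> kernel_behavior g (m + p) r R \<longleftrightarrow>
    weak_kernel g (m + p) (kernel_poly r R) (stack m (\<lambda>a t. u t $ a) (\<lambda>b t. y t $ b))"
proof -
  have c: "(u t @\<^sub>v y t) $ a = stack m (\<lambda>a t. u t $ a) (\<lambda>b t. y t $ b) a t" if "a < m + p" "t \<in> \<I>" for a t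
    using uy[OF that(2)] that(1) by (auto simp: stack_def)
  have "weak_kernel g (m + p) (kernel_poly r R) (\<lambda>a t. (u t @\<^sub>v y t) $ a) \<longleftrightarrow>
      weak_kernel g (m + p) (kernel_poly r R) (stack m (\<lambda>a t. u t $ a) (\<lambda>b t. y t $ b))"
    by (rule iffI; rule weak_kernel_cong[rotated], assumption) (simp_all only: c)
  moreover have "\<forall>t\<in>\<I>. u t @\<^sub>v y t \<in> carrier_vec (m + p)" using uy by auto
  ultimately show ?thesis using kernel_behavior_iff_weak_kernel[OF R] by simp
qed

lemma signal_in_kernel_behavior:
  assumes R: "\<And>i. i \<le> r \<Longrightarrow> R i \<in> carrier_mat g q"
  shows "(\<lambda>t. vec q (\<lambda>a. w a t)) \<in> kernel_behavior g q r R \<longleftrightarrow> weak_kernel g q (kernel_poly r R) w"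
proof -
  have "weak_kernel g q (kernel_poly r R) (\<lambda>a t. vec q (\<lambda>a. w a t) $ a) \<longleftrightarrow> weak_kernel g q (kernel_poly r R) w"
    using weak_kernel_cong[of q w "\<lambda>a t. vec q (\<lambda>a. w a t) $ a"] weak_kernel_cong[of q "\<lambda>a t. vec q (\<lambda>a. w a t) $ a" w] by auto
  moreover have "(\<lambda>t. vec q (\<lambda>a. w a t)) \<in> kernel_behavior g q r R \<longleftrightarrow>
      (\<forall>t\<in>\<I>. vec q (\<lambda>a. w a t) \<in> carrier_vec q) \<and> weak_kernel g q (kernel_poly r R) (\<lambda>a t. vec q (\<lambda>a. w a t) $ a)"
    by (rule kernel_behavior_iff_weak_kernel) (rule R)
  ultimately show ?thesis by simp
qed

lemma smooth_closed_vec: "(\<And>i. i < d \<Longrightarrow> smooth_on {-1..1} (f i)) \<Longrightarrow> (\<lambda>t. vec d (\<lambda>i. f i t)) \<in> smooth_closed d"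
  by (simp add: smooth_closed_def)

lemma smooth_closedD: "f \<in> smooth_closed d \<Longrightarrow> i < d \<Longrightarrow> smooth_on {-1..1} (\<lambda>t. f t $ i)"
  "f \<in> smooth_closed d \<Longrightarrow> t \<in> {-1..1} \<Longrightarrow> f t \<in> carrier_vec d"
  by (auto simp: smooth_closed_def)

lemma mult_mat_vec_index: "M \<in> carrier_mat nr nc \<Longrightarrow> v \<in> carrier_vec nc \<Longrightarrow> i < nr \<Longrightarrow> (M *\<^sub>v v) $ i = (\<Sum>j<nc. M $$ (i, j) * v $ j)"
  by (simp add: scalar_prod_def atLeast0LessThan)

lemma state_equation_signal_iff:
  assumes A: "A \<in> carrier_mat n n" "B \<in> carrier_mat n m" "C \<in> carrier_mat p n" "D \<in> carrier_mat p m"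
    and u: "u \<in> smooth_closed m" and y: "y \<in> smooth_closed p"
  shows "(\<exists>x\<in>smooth_closed n. \<forall>t\<in>\<I>.
           (\<forall>i<n. ((\<lambda>\<tau>. x \<tau> $ i) has_real_derivative (A *\<^sub>v x t + B *\<^sub>v u t) $ i) (at t)) \<and>
           y t = C *\<^sub>v x t + D *\<^sub>v u t) \<longleftrightarrow>
    (\<exists>x. (\<forall>i<n. smooth_on {-1..1} (x i)) \<and> (\<forall>t\<in>\<I>.
        (\<forall>i<n. (x i has_real_derivative (\<Sum>j<n. A $$ (i, j) * x j t) + (\<Sum>a<m. B $$ (i, a) * u t $ a)) (at t)) \<and>
        (\<forall>b<p. y t $ b = out n m (\<lambda>b j. C $$ (b, j)) (\<lambda>b a. D $$ (b, a)) (\<lambda>a t. u t $ a) x b t)))" (is "?L \<longleftrightarrow> ?R")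
proof -
  have rhs: "(A *\<^sub>v v + B *\<^sub>v u t) $ i = (\<Sum>j<n. A $$ (i, j) * v $ j) + (\<Sum>a<m. B $$ (i, a) * u t $ a)"
    if "v \<in> carrier_vec n" "t \<in> \<I>" "i < n" for v t i
  proof -
    have "u t \<in> carrier_vec m" using smooth_closedD(2)[OF u, of t] that(2) by simp
    thus ?thesis using mult_mat_vec_index[OF A(1) that(1,3)] mult_mat_vec_index[OF A(2) _ that(3), of "u t"] A that(3) by simp
  qed
  have outp: "y t = C *\<^sub>v v + D *\<^sub>v u t \<longleftrightarrow> (\<forall>b<p. y t $ b = (\<Sum>j<n. C $$ (b, j) * v $ j) + (\<Sum>a<m. D $$ (b, a) * u t $ a))"
    if "v \<in> carrier_vec n" "t \<in> \<I>" for v t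
  proof -
    have ut: "u t \<in> carrier_vec m" and yt: "y t \<in> carrier_vec p"
      using smooth_closedD(2)[OF u, of t] smooth_closedD(2)[OF y, of t] that(2) by simp_all
    have "(C *\<^sub>v v + D *\<^sub>v u t) $ b = (\<Sum>j<n. C $$ (b, j) * v $ j) + (\<Sum>a<m. D $$ (b, a) * u t $ a)" if "b < p" for b
      using mult_mat_vec_index[OF A(3) \<open>v \<in> _\<close> that] mult_mat_vec_index[OF A(4) ut that] A that by simp
    thus ?thesis using yt A by (auto simp: vec_eq_iff)
  qed
  show ?thesis
  proof
    assume ?L
    then obtain x where x: "x \<in> smooth_closed n"
      "\<And>t i. t \<in> \<I> \<Longrightarrow> i < n \<Longrightarrow> ((\<lambda>\<tau>. x \<tau> $ i) has_real_derivative (A *\<^sub>v x t + B *\<^sub>v u t) $ i) (at t)"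
      "\<And>t. t \<in> \<I> \<Longrightarrow> y t = C *\<^sub>v x t + D *\<^sub>v u t" by blast
    have xt: "x t \<in> carrier_vec n" if "t \<in> \<I>" for t using smooth_closedD(2)[OF x(1), of t] that by simp
    show ?R
    proof (intro exI[of _ "\<lambda>i t. x t $ i"] conjI allI impI ballI)
      fix i t assume "t \<in> \<I>" "i < n"
      thus "((\<lambda>t. x t $ i) has_real_derivative (\<Sum>j<n. A $$ (i, j) * x t $ j) + (\<Sum>a<m. B $$ (i, a) * u t $ a)) (at t)"
        using x(2)[of t i] rhs[OF xt, of t t i] by simp
    next
      fix b t assume "t \<in> \<I>" "b < p"
      thus "y t $ b = out n m (\<lambda>b j. C $$ (b, j)) (\<lambda>b a. D $$ (b, a)) (\<lambda>a t. u t $ a) (\<lambda>i t. x t $ i) b t"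
        using x(3)[of t] outp[OF xt, of t t] by (simp add: out_def)
    qed (rule smooth_closedD(1)[OF x(1)])
  next
    assume ?R
    then obtain x where x: "\<And>i. i < n \<Longrightarrow> smooth_on {-1..1} (x i)"
      "\<And>t i. t \<in> \<I> \<Longrightarrow> i < n \<Longrightarrow> (x i has_real_derivative (\<Sum>j<n. A $$ (i, j) * x j t) + (\<Sum>a<m. B $$ (i, a) * u t $ a)) (at t)"
      "\<And>t b. t \<in> \<I> \<Longrightarrow> b < p \<Longrightarrow> y t $ b = out n m (\<lambda>b j. C $$ (b, j)) (\<lambda>b a. D $$ (b, a)) (\<lambda>a t. u t $ a) x b t" by blast
    show ?L
    proof (rule bexI[OF _ smooth_closed_vec[OF x(1)]], intro ballI conjI allI impI)
      fix t i assume "t \<in> \<I>" "i < n"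
      thus "((\<lambda>\<tau>. vec n (\<lambda>i. x i \<tau>) $ i) has_real_derivative (A *\<^sub>v vec n (\<lambda>i. x i t) + B *\<^sub>v u t) $ i) (at t)"
        using x(2)[of t i] rhs[of "vec n (\<lambda>i. x i t)" t i] by simp
    next
      fix t assume "t \<in> \<I>"
      thus "y t = C *\<^sub>v vec n (\<lambda>i. x i t) + D *\<^sub>v u t"
        using x(3)[of t] outp[of "vec n (\<lambda>i. x i t)" t] by (simp add: out_def)
    qed
  qed
qed

text \<open>Left to right it opens the given representation to the component theory; right to left
  it turns systems found there into competitors for the McMillan degree.\<close>

lemma iso_representation_iff_system:
  assumes R: "\<And>i. i \<le> r \<Longrightarrow> R i \<in> carrier_mat g (m + p)"
    and A: "A \<in> carrier_mat n n" "B \<in> carrier_mat n m" "C \<in> carrier_mat p n" "D \<in> carrier_mat p m"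
  shows "is_iso_representation m p (kernel_behavior g (m + p) r R) n A B C D \<longleftrightarrow>
    iso_system m p g n (kernel_poly r R) (\<lambda>i j. A $$ (i, j)) (\<lambda>i a. B $$ (i, a)) (\<lambda>b j. C $$ (b, j)) (\<lambda>b a. D $$ (b, a))"
proof
  assume I: "is_iso_representation m p (kernel_behavior g (m + p) r R) n A B C D"
  show "iso_system m p g n (kernel_poly r R) (\<lambda>i j. A $$ (i, j)) (\<lambda>i a. B $$ (i, a)) (\<lambda>b j. C $$ (b, j)) (\<lambda>b a. D $$ (b, a))"
  proof
    fix u y :: "nat \<Rightarrow> real \<Rightarrow> real"
    assume u: "\<And>a. a < m \<Longrightarrow> smooth_on {-1..1} (u a)" and y: "\<And>b. b < p \<Longrightarrow> smooth_on {-1..1} (y b)"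
    let ?U = "\<lambda>t. vec m (\<lambda>a. u a t)" and ?Y = "\<lambda>t. vec p (\<lambda>b. y b t)"
    have U: "?U \<in> smooth_closed m" "?Y \<in> smooth_closed p" by (rule smooth_closed_vec, rule u y, assumption)+
    have "weak_kernel g (m + p) (kernel_poly r R) (stack m u y) \<longleftrightarrow>
        weak_kernel g (m + p) (kernel_poly r R) (stack m (\<lambda>a t. ?U t $ a) (\<lambda>b t. ?Y t $ b))"
      by (rule iffI; rule weak_kernel_cong[rotated], assumption) (auto simp: stack_def)
    also have "\<dots> \<longleftrightarrow> (\<lambda>t. ?U t @\<^sub>v ?Y t) \<in> kernel_behavior g (m + p) r R"
      by (rule kernel_behavior_append[OF R, symmetric]) auto
    also have "\<dots> \<longleftrightarrow> (\<exists>x\<in>smooth_closed n. \<forall>t\<in>\<I>.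
           (\<forall>i<n. ((\<lambda>\<tau>. x \<tau> $ i) has_real_derivative (A *\<^sub>v x t + B *\<^sub>v ?U t) $ i) (at t)) \<and>
           ?Y t = C *\<^sub>v x t + D *\<^sub>v ?U t)"
      by (rule I[unfolded is_iso_representation_def, THEN conjunct2, THEN conjunct2, THEN conjunct2, THEN conjunct2,
            THEN bspec, OF U(1), THEN bspec, OF U(2)])
    also note state_equation_signal_iff[OF A U]
    finally show "weak_kernel g (m + p) (kernel_poly r R) (stack m u y) \<longleftrightarrow>
      (\<exists>x. (\<forall>i<n. smooth_on {-1..1} (x i)) \<and> (\<forall>t\<in>\<I>.
        (\<forall>i<n. (x i has_real_derivative (\<Sum>j<n. A $$ (i, j) * x j t) + (\<Sum>a<m. B $$ (i, a) * u a t)) (at t)) \<and>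
        (\<forall>b<p. y b t = out n m (\<lambda>b j. C $$ (b, j)) (\<lambda>b a. D $$ (b, a)) u x b t)))"
      by (simp add: out_def)
  qed
next
  assume "iso_system m p g n (kernel_poly r R) (\<lambda>i j. A $$ (i, j)) (\<lambda>i a. B $$ (i, a)) (\<lambda>b j. C $$ (b, j)) (\<lambda>b a. D $$ (b, a))"
  then interpret iso_system m p g n "kernel_poly r R" "\<lambda>i j. A $$ (i, j)" "\<lambda>i a. B $$ (i, a)" "\<lambda>b j. C $$ (b, j)" "\<lambda>b a. D $$ (b, a)" .
  show "is_iso_representation m p (kernel_behavior g (m + p) r R) n A B C D"
    unfolding is_iso_representation_def
  proof (intro conjI A ballI)
    fix u y assume u: "u \<in> smooth_closed m" and y: "y \<in> smooth_closed p"
    have "(\<lambda>t. u t @\<^sub>v y t) \<in> kernel_behavior g (m + p) r R \<longleftrightarrow> KB (stack m (\<lambda>a t. u t $ a) (\<lambda>b t. y t $ b))"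
      by (rule kernel_behavior_append[OF R]) (use smooth_closedD(2)[OF u] smooth_closedD(2)[OF y] in auto)
    also note iso[OF smooth_closedD(1)[OF u] smooth_closedD(1)[OF y]]
    also note state_equation_signal_iff[OF A u y, symmetric]
    finally show "(\<lambda>t. u t @\<^sub>v y t) \<in> kernel_behavior g (m + p) r R \<longleftrightarrow> (\<exists>x\<in>smooth_closed n. \<forall>t\<in>\<I>.
           (\<forall>i<n. ((\<lambda>\<tau>. x \<tau> $ i) has_real_derivative (A *\<^sub>v x t + B *\<^sub>v u t) $ i) (at t)) \<and>
           y t = C *\<^sub>v x t + D *\<^sub>v u t)" .
  qed
qed

lemma controllable_components:
  assumes R: "\<And>i. i \<le> r \<Longrightarrow> R i \<in> carrier_mat g q" and c: "controllable (kernel_behavior g q r R)"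
  shows "behavior_controllable (weak_kernel g q (kernel_poly r R)) q"
  unfolding behavior_controllable_def
proof (intro allI impI)
  fix w0 w1 assume w: "weak_kernel g q (kernel_poly r R) w0" "weak_kernel g q (kernel_poly r R) w1"
  let ?W = "\<lambda>w t. vec q (\<lambda>a. w a t)"
  have W: "?W w0 \<in> kernel_behavior g q r R" "?W w1 \<in> kernel_behavior g q r R"
    using w signal_in_kernel_behavior[OF R] by simp_all
  obtain t1 v where t1: "t1 \<in> {0<..<1}" and v: "v \<in> kernel_behavior g q r R"
    and l: "AE t in lebesgue_on {-1<..0}. v t = ?W w0 t" and rr: "AE t in lebesgue_on {t1..<1}. v t = ?W w1 (t - t1)"
    using bspec[OF bspec[OF c[unfolded controllable_def] W(1)] W(2)] by (elim bexE conjE)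
  show "\<exists>t1\<in>{0<..<1}. \<exists>w. weak_kernel g q (kernel_poly r R) w \<and>
     (\<forall>a<q. AE t in lebesgue_on {-1<..0}. w a t = w0 a t) \<and>
     (\<forall>a<q. AE t in lebesgue_on {t1..<1}. w a t = w1 a (t - t1))"
  proof (intro bexI[OF _ t1] exI[of _ "\<lambda>a t. v t $ a"] conjI allI impI)
    show "weak_kernel g q (kernel_poly r R) (\<lambda>a t. v t $ a)" using v kernel_behavior_iff_weak_kernel[of r R g q v] R by simp
    fix a assume a: "a < q"
    show "AE t in lebesgue_on {-1<..0}. v t $ a = w0 a t" using l by eventually_elim (use a in simp)
    show "AE t in lebesgue_on {t1..<1}. v t $ a = w1 a (t - t1)" using rr by eventually_elim (use a in simp)
  qed
qed

section \<open>Derivatives of the state\<close>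

lemma chain_Suc:
  assumes "sq_int (F 0)" "\<And>t. t \<in> {-1..1} \<Longrightarrow> F 0 t = F 0 (-1) + J (F (Suc 0)) t" "chain l (\<lambda>j. F (Suc j))"
  shows "chain (Suc l) F"
proof (rule chainI)
  fix j assume "j \<le> Suc l"
  thus "sq_int (F j)" using assms(1) chain_sq_int[OF assms(3), of "j - 1"] by (cases j) auto
next
  fix j and t :: real assume "j < Suc l" "t \<in> {-1..1}"
  thus "F j t = F j (-1) + J (F (Suc j)) t"
    using assms(2)[of t] chain_J[OF assms(3), of "j - 1" t] by (cases j) simp_all
qed

text \<open>Derivatives of the state generated by differentiating the state equation,
  \<open>U a j\<close> being the \<open>j\<close>-th derivative of input \<open>a\<close>. The
  relation between consecutive orders then holds by definition at every point, as required for the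
  correction.\<close>

fun state_chain where
  "state_chain n m A B U x 0 = x"
| "state_chain n m A B U x (Suc j) = (\<lambda>i t. (\<Sum>c<n. A i c * state_chain n m A B U x j c t) + (\<Sum>a<m. B i a * U a j t))"

lemma state_chain_chain:
  fixes A B :: "nat \<Rightarrow> nat \<Rightarrow> real"
  assumes x: "traj n m A B (\<lambda>a. U a 0) x" and U: "\<And>a. a < m \<Longrightarrow> chain l (U a)" and i: "i < n"
  shows "chain l (\<lambda>j. state_chain n m A B U x j i)"
  using U i
proof (induction l arbitrary: i)
  case 0
  show ?case by (rule chainI) (use traj_x[OF x 0(2)] in auto)
next
  case (Suc l)
  show ?case
  proof (rule chain_Suc)
    show "sq_int (state_chain n m A B U x 0 i)" using traj_x[OF x Suc.prems(2)] by simp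
    fix t :: real assume "t \<in> {-1..1}"
    from traj_J[OF x Suc.prems(2) this]
    show "state_chain n m A B U x 0 i t = state_chain n m A B U x 0 i (-1) + J (state_chain n m A B U x (Suc 0) i) t" by simp
  next
    have "chain l (\<lambda>j t. 1 * (\<Sum>c<n. A i c * state_chain n m A B U x j c t) + 1 * (\<Sum>a<m. B i a * U a j t))"
    proof (intro chain_lin chain_sum)
      fix c assume "c \<in> {..<n}"
      thus "chain l (\<lambda>j. state_chain n m A B U x j c)" by (intro Suc.IH chain_mono[OF Suc.prems(1)]) auto
    next
      fix a assume "a \<in> {..<m}"
      thus "chain l (U a)" by (intro chain_mono[OF Suc.prems(1)]) auto
    qed
    thus "chain l (\<lambda>j. state_chain n m A B U x (Suc j) i)" by simp
  qed
qed

section \<open>The approximating trajectories and their error\<close>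

theorem proposition10:
  fixes m p s k :: nat
    and \<B> :: "signal set"
    and w :: signal
  assumes "linear_differential_behavior m p \<B>"
    and "controllable \<B>"
    and "s \<noteq> 0"
    and "w \<in> \<B> \<inter> Sobolev (m + p) (McMillan_degree m p \<B> + s + k)"
  shows "\<exists>wN :: nat \<Rightarrow> signal.
           (\<forall>N\<ge>McMillan_degree m p \<B> + s + 1.
              wN N \<in> \<B> \<inter> im_P (m + p) N \<and>
              has_value_at (s * (m + p)) (Lam (m + p) s (\<lambda>t. wN N t - w t)) (-1) (0\<^sub>v (s * (m + p)))) \<and>
           (\<lambda>N. Sobolev_norm (m + p) (s - 1) (\<lambda>t. w t - wN N t)) \<in> O(\<lambda>N. 1 / real N ^ k)"
proof -
  let ?n = "McMillan_degree m p \<B>"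
  obtain g r R where R: "\<And>i. i \<le> r \<Longrightarrow> R i \<in> carrier_mat g (m + p)" and \<B>: "\<B> = kernel_behavior g (m + p) r R"
    using assms(1) unfolding linear_differential_behavior_def by blast
  have "\<exists>n A B C D. is_iso_representation m p \<B> n A B C D"
    using assms(1) unfolding linear_differential_behavior_def by blast
  hence "\<exists>A B C D. is_iso_representation m p \<B> ?n A B C D"
    unfolding McMillan_degree_def by (rule LeastI_ex)
  then obtain A B C D where rep: "is_iso_representation m p \<B> ?n A B C D" by blast
  have system: "iso_system m p g n (kernel_poly r R) (\<lambda>i j. A $$ (i, j)) (\<lambda>i j. B $$ (i, j)) (\<lambda>i j. C $$ (i, j)) (\<lambda>i j. D $$ (i, j))"
    if "is_iso_representation m p \<B> n A B C D" for n A B C D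
  proof -
    have "A \<in> carrier_mat n n" "B \<in> carrier_mat n m" "C \<in> carrier_mat p n" "D \<in> carrier_mat p m"
      using that unfolding is_iso_representation_def by blast+
    from iffD1[OF iso_representation_iff_system[OF R this] that[unfolded \<B>]] show ?thesis .
  qed
  let ?A = "\<lambda>i j. A $$ (i, j)" and ?B = "\<lambda>i j. B $$ (i, j)" and ?C = "\<lambda>i j. C $$ (i, j)" and ?D = "\<lambda>i j. D $$ (i, j)"
  interpret iso_system m p g ?n "kernel_poly r R" ?A ?B ?C ?D
    by (rule system[OF rep])
  have ctrl: "behavior_controllable KB (m + p)"
    by (rule controllable_components[OF R]) (use assms(2) in \<open>simp_all add: \<B>\<close>)
  have minimal: "?n \<le> n'" if "iso_system m p g n' (kernel_poly r R) A' B' C' D'" for n' A' B' C' D'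
  proof -
    \<comment> \<open>A system has entries at all indices. Cutting them down to matrices leaves its
      equations unchanged and makes it comparable with the McMillan degree.\<close>
    let ?m = "\<lambda>nr nc M. mat nr nc (\<lambda>(i, j). M i j)"
    have "iso_system m p g n' (kernel_poly r R) (\<lambda>i j. ?m n' n' A' $$ (i, j)) (\<lambda>i j. ?m n' m B' $$ (i, j))
        (\<lambda>i j. ?m p n' C' $$ (i, j)) (\<lambda>i j. ?m p m D' $$ (i, j))"
      using that unfolding iso_system_def out_def by (simp cong: conj_cong imp_cong)
    hence "is_iso_representation m p \<B> n' (?m n' n' A') (?m n' m B') (?m p n' C') (?m p m D')"
      unfolding \<B> by (subst iso_representation_iff_system[OF R]) simp_all
    thus ?thesis unfolding McMillan_degree_def by (intro Least_le) blast
  qed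
  obtain G where G: "\<And>i j. i < ?n \<Longrightarrow> j < ?n \<Longrightarrow>
     (\<Sum>k<?n. \<Sum>a<m. (mv ?n ?A ^^ k) (\<lambda>i. ?B i a) i * G k a j) = (if i = j then 1 else 0 :: real)"
    by (rule minimal_right_inverse[OF ctrl]) (rule minimal, assumption, rule that, assumption)

  let ?l = "?n + s + k"
  have wB: "w \<in> kernel_behavior g (m + p) r R" and wS: "w \<in> Sobolev (m + p) ?l" using assms(4) by (simp_all add: \<B>)
  have wkb: "KB (\<lambda>a t. w t $ a)" and wc: "\<And>t. t \<in> \<I> \<Longrightarrow> w t \<in> carrier_vec (m + p)"
    using wB kernel_behavior_iff_weak_kernel[of r R g "m + p" w] R by simp_all
  have wsq: "sq_int (\<lambda>t. w t $ a)" if "a < m + p" for a using weak_kernel_sq_int[OF wkb that] .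
  \<comment> \<open>The weak derivative of highest order determines a chain, in which the lower
    derivatives reappear as primitives.\<close>
  obtain wd where "is_weak_deriv (m + p) ?l w wd" using wS unfolding Sobolev_def by blast
  hence wd: "wd \<in> L2 (m + p)" "\<And>i \<psi>. i < m + p \<Longrightarrow> tf \<psi> \<Longrightarrow>
     LI (\<lambda>t. w t $ i * (deriv ^^ ?l) \<psi> t) = (-1) ^ ?l * LI (\<lambda>t. wd t $ i * \<psi> t)"
    using is_weak_deriv_iff[of "m + p" w ?l wd, OF wsq] by simp_all
  have "\<exists>F. chain ?l F \<and> (AE t in MI. w t $ a = F 0 t)" if a: "a < m" for a
  proof -
    have a': "a < m + p" using a by simp
    have "sq_int (\<lambda>t. wd t $ a)" using wd(1) a' by (simp add: L2_iff)
    from weak_deriv_chain[OF wsq[OF a'] this wd(2)[OF a']] obtain F where "chain ?l F" "AE t in MI. w t $ a = F 0 t" .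
    thus ?thesis by blast
  qed
  then obtain U where U: "\<And>a. a < m \<Longrightarrow> chain ?l (U a)" "\<And>a. a < m \<Longrightarrow> AE t in MI. w t $ a = U a 0 t" by metis

  have "stack m (\<lambda>a t. w t $ a) (\<lambda>b t. w t $ (m + b)) = (\<lambda>a t. w t $ a)" by (auto simp: stack_def fun_eq_iff)
  hence "KB (stack m (\<lambda>a t. w t $ a) (\<lambda>b t. w t $ (m + b)))" using wkb by simp
  then obtain x where x0: "traj ?n m ?A ?B (\<lambda>a t. w t $ a) x"
    and yx: "\<And>b. b < p \<Longrightarrow> AE t in MI. w t $ (m + b) = out ?n m ?C ?D (\<lambda>a t. w t $ a) x b t"
    using state_exists by blast
  have Usq: "sq_int (U a j)" if "a < m" "j \<le> ?l" for a j using chain_sq_int[OF U(1)[OF that(1)] that(2)] .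
  have x: "traj ?n m ?A ?B (\<lambda>a. U a 0) x" by (rule traj_cong_AE[OF x0]) (use U(2) Usq in auto)
  let ?X = "\<lambda>i j. state_chain ?n m ?A ?B U x j i"
  have X: "chain ?l (?X i)" if "i < ?n" for i by (rule state_chain_chain[OF x U(1) that])
  \<comment> \<open>Derivatives of \<open>w\<close>: those of the input, and for output components
    those prescribed by \<open>y = C x + D u\<close>. The polynomials \<open>Q\<close> are built by
    the same formula, so approximation carries over.\<close>
  define H where "H c j t = (if c < m then U c j t else (\<Sum>i<?n. ?C (c - m) i * ?X i j t) + (\<Sum>a<m. ?D (c - m) a * U a j t))" for c j t
  have Hch: "chain ?l (H c)" if "c < m + p" for c
  proof (cases "c < m")
    case True
    have "H c = U c" using True by (intro ext) (simp add: H_def)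
    thus ?thesis using U(1)[OF True] by simp
  next
    case False
    have "chain ?l (\<lambda>j t. 1 * (\<Sum>i<?n. ?C (c - m) i * ?X i j t) + 1 * (\<Sum>a<m. ?D (c - m) a * U a j t))"
      by (intro chain_lin chain_sum) (auto intro: X U(1))
    moreover have "H c = (\<lambda>j t. 1 * (\<Sum>i<?n. ?C (c - m) i * ?X i j t) + 1 * (\<Sum>a<m. ?D (c - m) a * U a j t))"
      using False by (intro ext) (simp add: H_def)
    ultimately show ?thesis by simp
  qed
  have wH: "AE t in MI. w t $ c = H c 0 t" if c: "c < m + p" for c
  proof (cases "c < m")
    case True thus ?thesis using U(2)[OF True] by (simp add: H_def)
  next
    case False
    have "AE t in MI. \<forall>a\<in>{..<m}. w t $ a = U a 0 t" by (rule AE_finite_allI) (use U(2) in auto)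
    moreover have "AE t in MI. w t $ (m + (c - m)) = out ?n m ?C ?D (\<lambda>a t. w t $ a) x (c - m) t"
      by (rule yx) (use False c in simp)
    ultimately show ?thesis by eventually_elim (use False in \<open>simp add: H_def out_def\<close>)
  qed

  \<comment> \<open>The regularity \<open>?n + s + k\<close> is split as \<open>r + k\<close> with
    \<open>r = ?n + s\<close>: \<open>r\<close> derivatives are approximated, of which the
    correction leaves \<open>s\<close>, and \<open>k\<close> gives the rate. The threshold
    \<open>N > ?n + s\<close> is that of \<open>chain_jet_approx\<close>.\<close>
  have "\<exists>q. jet_approx (?n + s) k (?n + s) (?X i) q \<and> (\<forall>N>?n + s. deg_lt N (q N))" if "i < ?n" for i
    using chain_jet_approx[OF X[OF that]] by blast
  then obtain px where px: "\<And>i. i < ?n \<Longrightarrow> jet_approx (?n + s) k (?n + s) (?X i) (px i)"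
    "\<And>i N. i < ?n \<Longrightarrow> ?n + s < N \<Longrightarrow> deg_lt N (px i N)" by metis
  have "\<exists>q. jet_approx (?n + s) k (?n + s) (U a) q \<and> (\<forall>N>?n + s. deg_lt N (q N))" if "a < m" for a
    using chain_jet_approx[OF U(1)[OF that]] by blast
  then obtain pu where pu: "\<And>a. a < m \<Longrightarrow> jet_approx (?n + s) k (?n + s) (U a) (pu a)"
    "\<And>a N. a < m \<Longrightarrow> ?n + s < N \<Longrightarrow> deg_lt N (pu a N)" by metis
  obtain qx qu where
    qd: "\<And>i N. i < ?n \<Longrightarrow> pderiv (qx i N) = (\<Sum>j<?n. smult (?A i j) (qx j N)) + (\<Sum>a<m. smult (?B i a) (qu a N))"
    and qa: "\<And>i. i < ?n \<Longrightarrow> jet_approx (?n + s) k s (?X i) (qx i)" "\<And>a. a < m \<Longrightarrow> jet_approx (?n + s) k s (U a) (qu a)"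
    and qdeg: "\<And>i N. i < ?n \<Longrightarrow> ?n + s < N \<Longrightarrow> deg_lt N (qx i N)" "\<And>a N. a < m \<Longrightarrow> ?n + s < N \<Longrightarrow> deg_lt N (qu a N)"
    by (rule polynomial_trajectory_correction[OF G px(1) pu(1) _ px(2) pu(2)]) (auto intro: that)
  define Q where "Q c N = (if c < m then qu c N else (\<Sum>i<?n. smult (?C (c - m) i) (qx i N)) + (\<Sum>a<m. smult (?D (c - m) a) (qu a N)))" for c N
  have Qdeg: "deg_lt N (Q c N)" if "?n + s < N" for c N
    unfolding Q_def using that by (auto intro!: deg_lt_add deg_lt_sum deg_lt_smult qdeg)
  have Qapp: "jet_approx (?n + s) k s (H c) (Q c)" for c
  proof (cases "c < m")
    case True
    have "H c = U c" "Q c = qu c" using True by (auto simp: H_def Q_def fun_eq_iff)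
    thus ?thesis using qa(2)[OF True] by simp
  next
    case False
    have "jet_approx (?n + s) k s (\<lambda>j t. 1 * (\<Sum>i<?n. ?C (c - m) i * ?X i j t) + 1 * (\<Sum>a<m. ?D (c - m) a * U a j t))
      (\<lambda>N. smult 1 (\<Sum>i<?n. smult (?C (c - m) i) (qx i N)) + smult 1 (\<Sum>a<m. smult (?D (c - m) a) (qu a N)))"
      by (intro jet_approx_lin jet_approx_sum qa) auto
    moreover have "H c = (\<lambda>j t. 1 * (\<Sum>i<?n. ?C (c - m) i * ?X i j t) + 1 * (\<Sum>a<m. ?D (c - m) a * U a j t))"
      "Q c = (\<lambda>N. smult 1 (\<Sum>i<?n. smult (?C (c - m) i) (qx i N)) + smult 1 (\<Sum>a<m. smult (?D (c - m) a) (qu a N)))"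
      using False by (auto simp: H_def Q_def fun_eq_iff)
    ultimately show ?thesis by simp
  qed
  have "\<exists>K\<ge>0. \<forall>N>?n + s. \<forall>j<s. H c j (-1) = poly ((pderiv ^^ j) (Q c N)) (-1) \<and>
     (\<forall>t\<in>{-1..1}. \<bar>H c j t - poly ((pderiv ^^ j) (Q c N)) t\<bar> \<le> K / real N ^ k)" for c
    using Qapp[of c] unfolding jet_approx_def .
  then obtain K where K: "\<And>c. 0 \<le> K c" "\<And>c N j. ?n + s < N \<Longrightarrow> j < s \<Longrightarrow> H c j (-1) = poly ((pderiv ^^ j) (Q c N)) (-1)"
     "\<And>c N j t. ?n + s < N \<Longrightarrow> j < s \<Longrightarrow> t \<in> {-1..1} \<Longrightarrow> \<bar>H c j t - poly ((pderiv ^^ j) (Q c N)) t\<bar> \<le> K c / real N ^ k"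
    by metis

  define wN where "wN N t = vec (m + p) (\<lambda>c. poly (Q c N) t)" for N t
  have in\<B>: "wN N \<in> \<B>" for N
  proof -
    let ?u = "\<lambda>a t. poly (qu a N) t" and ?x = "\<lambda>i t. poly (qx i N) t"
    have tr: "traj ?n m ?A ?B ?u ?x"
    proof (rule trajI_deriv)
      fix i t assume i: "i < ?n"
      have "poly (pderiv (qx i N)) t = (\<Sum>j<?n. ?A i j * ?x j t) + (\<Sum>a<m. ?B i a * ?u a t)"
        unfolding qd[OF i] by (simp add: poly_sum)
      thus "(?x i has_real_derivative (\<Sum>j<?n. ?A i j * ?x j t) + (\<Sum>a<m. ?B i a * ?u a t)) (at t)"
        using poly_DERIV[of "qx i N" t] by simp
    qed (auto intro!: continuous_intros)
    have "KB (stack m ?u (out ?n m ?C ?D ?u ?x))" by (rule traj_in_behavior[OF tr])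
    hence "KB (\<lambda>c t. poly (Q c N) t)"
      by (rule weak_kernel_cong[rotated]) (auto simp: stack_def Q_def out_def poly_sum)
    thus ?thesis unfolding \<B> wN_def [abs_def] by (rule iffD2[OF signal_in_kernel_behavior, rotated]) (rule R)
  qed
  have inP: "wN N \<in> im_P (m + p) N" if "?n + s < N" for N
    unfolding im_P_def wN_def [abs_def] using Qdeg[OF that] by (auto simp: deg_lt_def intro!: exI[of _ "\<lambda>c. Q c N"])
  let ?P = "\<lambda>N c j t. poly ((pderiv ^^ j) (Q c N)) t"
  \<comment> \<open>Both signs occur: the initial values concern \<open>wN N - w\<close>, the error
    concerns \<open>w - wN N\<close>. The vectors \<open>w t\<close> have a known dimension on the
    open interval only, so components of differences are computed there.\<close>
  have wNsub: "AE t in MI. (wN N t - w t) $ c = 1 * ?P N c 0 t + (-1) * H c 0 t" "AE t in MI. (w t - wN N t) $ c = 1 * H c 0 t + (-1) * ?P N c 0 t"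
    and wNsq: "sq_int (\<lambda>t. (wN N t - w t) $ c)" "sq_int (\<lambda>t. (w t - wN N t) $ c)" if c: "c < m + p" for N c
  proof -
    have ae: "AE t in MI. t \<in> \<I>" by (rule AE_MI_I) simp
    have e: "(wN N t - w t) $ c = poly (Q c N) t - w t $ c" "(w t - wN N t) $ c = w t $ c - poly (Q c N) t" if "t \<in> \<I>" for t
      using wc[OF that] c by (simp_all add: wN_def)
    show "AE t in MI. (wN N t - w t) $ c = 1 * ?P N c 0 t + (-1) * H c 0 t"
      using ae wH[OF c] by eventually_elim (simp add: e)
    show "AE t in MI. (w t - wN N t) $ c = 1 * H c 0 t + (-1) * ?P N c 0 t"
      using ae wH[OF c] by eventually_elim (simp add: e)
    have mb: "(\<lambda>t. (wN N t - w t) $ c) \<in> borel_measurable MI \<longleftrightarrow> (\<lambda>t. poly (Q c N) t - w t $ c) \<in> borel_measurable MI"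
      "(\<lambda>t. (w t - wN N t) $ c) \<in> borel_measurable MI \<longleftrightarrow> (\<lambda>t. w t $ c - poly (Q c N) t) \<in> borel_measurable MI"
      by (rule measurable_cong, use e in simp)+
    have s1: "sq_int (\<lambda>t. poly (Q c N) t - w t $ c)" "sq_int (\<lambda>t. w t $ c - poly (Q c N) t)"
      by (intro sq_int_diff sq_int_poly' wsq c)+
    show "sq_int (\<lambda>t. (wN N t - w t) $ c)"
      by (rule sq_int_cong_AE[OF s1(1) AE_MI_I iffD2[OF mb(1) sq_int_measurable[OF s1(1)]]]) (rule e(1)[symmetric])
    show "sq_int (\<lambda>t. (w t - wN N t) $ c)"
      by (rule sq_int_cong_AE[OF s1(2) AE_MI_I iffD2[OF mb(2) sq_int_measurable[OF s1(2)]]]) (rule e(2)[symmetric])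
  qed
  have Ech: "chain ?l (\<lambda>j t. 1 * ?P N c j t + (-1) * H c j t)" "chain ?l (\<lambda>j t. 1 * H c j t + (-1) * ?P N c j t)" if "c < m + p" for N c
    by (intro chain_lin chain_poly Hch that)+
  have val: "has_value_at (s * (m + p)) (Lam (m + p) s (\<lambda>t. wN N t - w t)) (-1) (0\<^sub>v (s * (m + p)))" if N: "?n + s < N" for N
    by (rule Lam_has_value_0[OF wNsq(1) Ech(1) wNsub(1)]) (use K(2)[OF N] in auto)
  let ?K = "\<Sum>c<m + p. K c"
  have bound: "\<bar>Sobolev_norm (m + p) (s - 1) (\<lambda>t. w t - wN N t)\<bar> \<le> sqrt (2 * real (s * (m + p))) * \<bar>?K / real N ^ k\<bar>" if N: "?n + s < N" for N
  proof (rule Sobolev_norm_bound[OF wNsq(2) Ech(2) wNsub(2) _ assms(3)])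
    fix c j t assume c: "c < m + p" and j: "j < s" and t: "t \<in> \<I>"
    have "\<bar>H c j t - ?P N c j t\<bar> \<le> K c / real N ^ k" using K(3)[OF N j, of t c] t by auto
    also have "\<dots> \<le> ?K / real N ^ k" using c K(1) by (intro divide_right_mono member_le_sum) auto
    finally show "\<bar>1 * H c j t + (-1) * ?P N c j t\<bar> \<le> ?K / real N ^ k" by simp
  qed simp_all
  show ?thesis
  proof (intro exI[of _ wN] conjI allI impI)
    fix N assume "?n + s + 1 \<le> N"
    hence N: "?n + s < N" by simp
    show "wN N \<in> \<B> \<inter> im_P (m + p) N" using in\<B> inP[OF N] by blast
    show "has_value_at (s * (m + p)) (Lam (m + p) s (\<lambda>t. wN N t - w t)) (-1) (0\<^sub>v (s * (m + p)))" by (rule val[OF N])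
  next
    show "(\<lambda>N. Sobolev_norm (m + p) (s - 1) (\<lambda>t. w t - wN N t)) \<in> O(\<lambda>N. 1 / real N ^ k)"
    proof (rule bigoI[where c = "sqrt (2 * real (s * (m + p))) * ?K"])
      have "0 \<le> ?K" using K(1) by (intro sum_nonneg) auto
      hence eq: "sqrt (2 * real (s * (m + p))) * \<bar>?K / real N ^ k\<bar> = sqrt (2 * real (s * (m + p))) * ?K * \<bar>1 / real N ^ k\<bar>" for N :: nat
        by (simp add: abs_divide)
      show "eventually (\<lambda>N. norm (Sobolev_norm (m + p) (s - 1) (\<lambda>t. w t - wN N t)) \<le>
          sqrt (2 * real (s * (m + p))) * ?K * norm (1 / real N ^ k)) sequentially"
        by (rule eventually_mono[OF eventually_gt_at_top[of "?n + s"]]) (use bound in \<open>simp only: eq real_norm_def\<close>)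
    qed
  qed
qed

end
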